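(* Let $\Bbbk$ be an algebraically closed field of characteristic zero and let $R=\Bbbk[T_{ij},S_k]/(T_0^{l_0}+T_1^{l_1}+T_2^{l_2})$ be the trinomial algebra of Type $2$ given by a single relation, with the action of the torus $\mathbb T$ described in the context. Then any $\mathbb T$-homogeneous locally nilpotent derivation of $R$ is a replica either of $\partial/\partial S_k$ for some $k$, or of one of the derivations $\delta$ of types (a), (b), (c), (d) described in the context (after a permutation of the monomials $T_i^{l_i}$, if necessary). Moreover, for a derivation $\delta$ of type (a)–(d) associated with a tuple $C=(c_0,c_1,c_2)$, the algebra $\ker\delta$ is generated by the $T_{ij}$ with $i=0,1,2$ and $j\neq c_i$, together with the following element: - $T_{1c_1}$ in case (a); - $\lambda\,T_0^{l_0/l_{0c_0}}-T_1^{l_1/l_{0c_0}}$ in case (b); - $\mu\,T_0^{l_0/2}+T_1^{l_1/2}$ in case (c); - $(1-\lambda^2)\,T_0^{l_0/2}-(1+\lambda^2)\mathbf i\,T_1^{l_1/2}+2\lambda\,T_2^{l_2/2}$ in case (d).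
   Context: Setting: integers $d\ge0$, $n_0,n_1,n_2\ge1$, positive integers $l_{ij}$ ($i=0,1,2$, $1\le j\le n_i$), variables $T_{ij}$ and $S_k$ ($1\le k\le d$); $T_i^{l_i}=\prod_{j=1}^{n_i}T_{ij}^{l_{ij}}$, and if $\alpha$ divides $l_{ij}$ for all $j$ then $T_i^{l_i/\alpha}=\prod_jT_{ij}^{l_{ij}/\alpha}$. $\mathbf i$ is a square root of $-1$ in $\Bbbk$. Torus: the torus of dimension $n_0+n_1+n_2+d$ acts by scaling the variables $T_{ij},S_k$; $\mathbb H$ is the subgroup of elements for which $T_0^{l_0},T_1^{l_1},T_2^{l_2}$ are semi-invariant of the same weight, and $\mathbb T$ is its identity component. It acts on $R$, so $R$ is graded by the character lattice of $\mathbb T$; a derivation $\delta$ is $\mathbb T$-homogeneous if there is a degree $e$ with $\delta(R_g)\subseteq R_{g+e}$ for all $g$. A derivation is locally nilpotent (an LND) if every element of $R$ is annihilated by some power of it. A replica of an LND $\partial$ is $h\partial$ with $h\in\ker\partial$. $\partial/\partial S_k$ sends $S_k$ to $1$ and all the other generators to $0$. The derivations: let $C=(c_0,c_1,c_2)$ with $c_i\in\{1,\dots,n_i\}$. In each case below $\delta(S_k)=0$ for all $k$, $\delta(T_{ij})=0$ for those $T_{ij}$ not mentioned, and $\delta$ is extended by the Leibniz rule (it induces a derivation of $R$). (a) Suppose $l_{2c_2}=1$. Let $\delta(T_{0c_0})=\frac{\partial T_2^{l_2}}{\partial T_{2c_2}}$, $\delta(T_{2c_2})=-\frac{\partial T_0^{l_0}}{\partial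 T_{0c_0}}$. (b) Suppose $l_{2c_2}=1$ and $l_{0c_0}\mid l_{ij}$ for $i=0,1$ and all $j$. Take any $\lambda\in\Bbbk^\times$ and let $$\delta(T_{0c_0})=\frac{\partial T_1^{l_1/l_{0c_0}}}{\partial T_{1c_1}}\frac{\partial T_2^{l_2}}{\partial T_{2c_2}},\qquad \delta(T_{1c_1})=\lambda\frac{\partial T_0^{l_0/l_{0c_0}}}{\partial T_{0c_0}}\frac{\partial T_2^{l_2}}{\partial T_{2c_2}},$$ $$\delta(T_{2c_2})=-\left(\frac{\partial T_0^{l_0}}{\partial T_{0c_0}}\frac{\partial T_1^{l_1/l_{0c_0}}}{\partial T_{1c_1}}+\lambda\frac{\partial T_0^{l_0/l_{0c_0}}}{\partial T_{0c_0}}\frac{\partial T_1^{l_1}}{\partial T_{1c_1}}\right).$$ (c) Suppose $l_{0c_0}=l_{1c_1}=2$, $l_{2c_2}\ge2$, and all $l_{ij}$ with $i=0,1$ are even. Take $\mu\in\{\pm\mathbf i\}$ and let $$\delta(T_{0c_0})=\mu\frac{\partial T_1^{l_1/2}}{\partial T_{1c_1}}\frac{\partial T_2^{l_2}}{\partial T_{2c_2}},\qquad \delta(T_{1c_1})=\frac{\partial T_0^{l_0/2}}{\partial T_{0c_0}}\frac{\partial T_2^{l_2}}{\partial T_{2c_2}},$$ $$\delta(T_{2c_2})=-\left(\mu\frac{\partial T_0^{l_0}}{\partial T_{0c_0}}\frac{\partial T_1^{l_1/2}}{\partial T_{1c_1}}+\frac{\partial T_0^{l_0/2}}{\partial T_{0c_0}}\frac{\partial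 T_1^{l_1}}{\partial T_{1c_1}}\right).$$ (d) Suppose $l_{ic_i}=2$ for $i=0,1,2$ and all $l_{ij}$ are even. Take $\lambda\in\Bbbk^\times$ and let $$\delta(T_{0c_0})=\prod_{i\ne0}\frac{\partial T_i^{l_i/2}}{\partial T_{ic_i}}\left(2\lambda T_1^{l_1/2}+(1+\lambda^2)\mathbf i\,T_2^{l_2/2}\right),$$ $$\delta(T_{1c_1})=\prod_{i\ne1}\frac{\partial T_i^{l_i/2}}{\partial T_{ic_i}}\left(-2\lambda T_0^{l_0/2}+(1-\lambda^2)T_2^{l_2/2}\right),$$ $$\delta(T_{2c_2})=\prod_{i\ne2}\frac{\partial T_i^{l_i/2}}{\partial T_{ic_i}}\left(-(1+\lambda^2)\mathbf i\,T_0^{l_0/2}-(1-\lambda^2)T_1^{l_1/2}\right).$$ "After a permutation of the monomials" means that the roles of the indices $0,1,2$ in (a)–(d) may be permuted.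
   Formalization: The zero derivation is excluded from the classification; all S_k are added to the generators of ker δ; in case (b) the kernel claim excludes l_{0c_0}=1, λ=-1, n_2≥2 (indices permuted), where T_{2c_2} is in ker δ but not in the stated algebra. *)

theory Defs
  imports
    "HOL-Analysis.Abstract_Topological_Spaces"
    "HOL-Library.Poly_Mapping"
    "HOL-Computational_Algebra.Polynomial"
    "HOL-Combinatorics.Permutations"
    "HOL-Algebra.QuotRing"
    "HOL-Algebra.Generated_Rings"
begin

section \<open>Polynomials in the variables \<open>T\<^sub>i\<^sub>j\<close> and \<open>S\<^sub>k\<close>\<close>

datatype tvar = TVar nat nat | SVar nat

type_synonym 'k mpol = "(tvar \<Rightarrow>\<^sub>0 nat) \<Rightarrow>\<^sub>0 'k"

text \<open>Throughout, \<open>n i\<close> is \<open>n\<^sub>i\<close> and \<open>l i j\<close> is \<open>l\<^sub>i\<^sub>j\<close>; only the values with \<open>i \<in> {0,1,2}\<close> and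
  \<open>1 \<le> j \<le> n i\<close> matter.\<close>

definition tri_vars :: "(nat \<Rightarrow> nat) \<Rightarrow> nat \<Rightarrow> tvar set" where
  "tri_vars n d = {TVar i j | i j. i \<in> {0,1,2} \<and> j \<in> {1..n i}} \<union> {SVar k | k. k \<in> {1..d}}"

definition Const :: "'k::comm_ring_1 \<Rightarrow> 'k mpol" where
  "Const a = Poly_Mapping.single 0 a"

definition Var :: "tvar \<Rightarrow> ('k::comm_ring_1) mpol" where
  "Var v = Poly_Mapping.single (Poly_Mapping.single v 1) 1"

definition mpol_ring :: "tvar set \<Rightarrow> ('k::comm_ring_1) mpol ring" where
  "mpol_ring V =
     \<lparr>carrier = {q. \<forall>m \<in> Poly_Mapping.keys q. Poly_Mapping.keys m \<subseteq> V}, monoid.mult = (*), one = 1, zero = 0, add = (+)\<rparr>"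

definition monom_at :: "(tvar \<Rightarrow> 'k::comm_ring_1) \<Rightarrow> (tvar \<Rightarrow>\<^sub>0 nat) \<Rightarrow> 'k" where
  "monom_at t m = (\<Prod>v\<in>Poly_Mapping.keys m. t v ^ Poly_Mapping.lookup m v)"

definition eval_at :: "(tvar \<Rightarrow> 'k::comm_ring_1) \<Rightarrow> 'k mpol \<Rightarrow> 'k" where
  "eval_at t q = (\<Sum>m\<in>Poly_Mapping.keys q. Poly_Mapping.lookup q m * monom_at t m)"

definition scale_vars :: "(tvar \<Rightarrow> 'k::comm_ring_1) \<Rightarrow> 'k mpol \<Rightarrow> 'k mpol" where
  \<comment> \<open>substitutes \<open>t v * v\<close> for each variable \<open>v\<close>\<close>
  "scale_vars t q = (\<Sum>m\<in>Poly_Mapping.keys q. Poly_Mapping.single m (Poly_Mapping.lookup q m * monom_at t m))"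

definition pdiff :: "tvar \<Rightarrow> ('k::comm_ring_1) mpol \<Rightarrow> 'k mpol" where
  \<comment> \<open>formal partial derivative; the truncated difference of exponents is harmless, since the
    coefficient vanishes whenever \<open>v\<close> does not occur in \<open>m\<close>\<close>
  "pdiff v q = (\<Sum>m\<in>Poly_Mapping.keys q.
     Poly_Mapping.single (m - Poly_Mapping.single v 1) (of_nat (Poly_Mapping.lookup m v) * Poly_Mapping.lookup q m))"

section \<open>The trinomial algebra\<close>

definition tri_mon ::
    "(nat \<Rightarrow> nat) \<Rightarrow> (nat \<Rightarrow> nat \<Rightarrow> nat) \<Rightarrow> nat \<Rightarrow> nat \<Rightarrow> ('k::comm_ring_1) mpol" where
  \<comment> \<open>\<open>T\<^sub>i\<close> to the exponent vector \<open>l\<^sub>i / \<alpha>\<close>; used only when \<open>\<alpha>\<close> divides all \<open>l\<^sub>i\<^sub>j\<close>\<close>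
  "tri_mon n l i \<alpha> = (\<Prod>j\<in>{1..n i}. Var (TVar i j) ^ (l i j div \<alpha>))"

definition tri_ideal ::
    "(nat \<Rightarrow> nat) \<Rightarrow> (nat \<Rightarrow> nat \<Rightarrow> nat) \<Rightarrow> nat \<Rightarrow> ('k::comm_ring_1) mpol set" where
  "tri_ideal n l d =
     genideal (mpol_ring (tri_vars n d)) {tri_mon n l 0 1 + tri_mon n l 1 1 + tri_mon n l 2 1}"

definition tri_alg ::
    "(nat \<Rightarrow> nat) \<Rightarrow> (nat \<Rightarrow> nat \<Rightarrow> nat) \<Rightarrow> nat \<Rightarrow> ('k::comm_ring_1) mpol set ring" where
  "tri_alg n l d = mpol_ring (tri_vars n d) Quot tri_ideal n l d"

definition cls ::
    "(nat \<Rightarrow> nat) \<Rightarrow> (nat \<Rightarrow> nat \<Rightarrow> nat) \<Rightarrow> nat \<Rightarrow> ('k::comm_ring_1) mpol \<Rightarrow> 'k mpol set" where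
  "cls n l d q = tri_ideal n l d +>\<^bsub>mpol_ring (tri_vars n d)\<^esub> q"

section \<open>The torus action and the grading\<close>

definition big_torus :: "(nat \<Rightarrow> nat) \<Rightarrow> nat \<Rightarrow> (tvar \<Rightarrow> 'k::comm_ring_1) set" where
  "big_torus n d = tri_vars n d \<rightarrow>\<^sub>E (- {0})"

text \<open>The Zariski topology on the big torus, generated by the principal open sets.\<close>

definition zariski_torus :: "(nat \<Rightarrow> nat) \<Rightarrow> nat \<Rightarrow> (tvar \<Rightarrow> 'k::comm_ring_1) topology" where
  "zariski_torus n d = topology_generated_by
     {{t \<in> big_torus n d. eval_at t q \<noteq> 0} | q. q \<in> carrier (mpol_ring (tri_vars n d))}"

definition torus_H ::
    "(nat \<Rightarrow> nat) \<Rightarrow> (nat \<Rightarrow> nat \<Rightarrow> nat) \<Rightarrow> nat \<Rightarrow> (tvar \<Rightarrow> 'k::comm_ring_1) set" where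
  "torus_H n l d = {t \<in> big_torus n d.
     \<exists>w. \<forall>i\<in>{0,1,2}. scale_vars t (tri_mon n l i 1) = Const w * tri_mon n l i 1}"

definition torus_T ::
    "(nat \<Rightarrow> nat) \<Rightarrow> (nat \<Rightarrow> nat \<Rightarrow> nat) \<Rightarrow> nat \<Rightarrow> (tvar \<Rightarrow> 'k::comm_ring_1) set" where
  "torus_T n l d = connected_component_of_set
     (subtopology (zariski_torus n d) (torus_H n l d)) (\<lambda>v\<in>tri_vars n d. 1)"

text \<open>A character of \<open>torus_T\<close> is represented by any function having the right values on
  \<open>torus_T\<close>. It is required to be regular: a regular function on a closed subset of the big torus
  is the restriction of a Laurent polynomial, i.e. of a polynomial \<open>q\<close> divided by a monomial
  \<open>m\<close>.\<close>

definition characters ::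
    "(nat \<Rightarrow> nat) \<Rightarrow> (nat \<Rightarrow> nat \<Rightarrow> nat) \<Rightarrow> nat \<Rightarrow> ((tvar \<Rightarrow> 'k::comm_ring_1) \<Rightarrow> 'k) set" where
  "characters n l d = {\<psi>.
     (\<forall>t\<in>torus_T n l d. \<psi> t \<noteq> 0) \<and>
     (\<forall>s\<in>torus_T n l d. \<forall>t\<in>torus_T n l d. \<psi> (\<lambda>v\<in>tri_vars n d. s v * t v) = \<psi> s * \<psi> t) \<and>
     (\<exists>q m. q \<in> carrier (mpol_ring (tri_vars n d)) \<and> Poly_Mapping.keys m \<subseteq> tri_vars n d \<and>
        (\<forall>t\<in>torus_T n l d. \<psi> t * monom_at t m = eval_at t q))}"

definition graded_part ::
    "(nat \<Rightarrow> nat) \<Rightarrow> (nat \<Rightarrow> nat \<Rightarrow> nat) \<Rightarrow> nat \<Rightarrow> ((tvar \<Rightarrow> 'k::comm_ring_1) \<Rightarrow> 'k) \<Rightarrow>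
     'k mpol set set" where
  \<comment> \<open>\<open>torus_H\<close> preserves the ideal, so the image of a class \<open>r\<close> under \<open>scale_vars t\<close> is
    the class \<open>t \<cdot> r\<close>\<close>
  "graded_part n l d \<psi> = {r \<in> carrier (tri_alg n l d).
     \<forall>t\<in>torus_T n l d. scale_vars t ` r = cls n l d (Const (\<psi> t)) \<otimes>\<^bsub>tri_alg n l d\<^esub> r}"

section \<open>Derivations\<close>

definition is_derivation ::
    "(nat \<Rightarrow> nat) \<Rightarrow> (nat \<Rightarrow> nat \<Rightarrow> nat) \<Rightarrow> nat \<Rightarrow>
     (('k::comm_ring_1) mpol set \<Rightarrow> 'k mpol set) \<Rightarrow> bool" where
  "is_derivation n l d \<delta> \<longleftrightarrow> (let R = tri_alg n l d in
     \<delta> \<in> carrier R \<rightarrow> carrier R \<and>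
     (\<forall>x\<in>carrier R. \<forall>y\<in>carrier R. \<delta> (x \<oplus>\<^bsub>R\<^esub> y) = \<delta> x \<oplus>\<^bsub>R\<^esub> \<delta> y) \<and>
     (\<forall>x\<in>carrier R. \<forall>y\<in>carrier R.
        \<delta> (x \<otimes>\<^bsub>R\<^esub> y) = (\<delta> x \<otimes>\<^bsub>R\<^esub> y) \<oplus>\<^bsub>R\<^esub> (x \<otimes>\<^bsub>R\<^esub> \<delta> y)) \<and>
     (\<forall>a. \<delta> (cls n l d (Const a)) = \<zero>\<^bsub>R\<^esub>))"

definition is_LND ::
    "(nat \<Rightarrow> nat) \<Rightarrow> (nat \<Rightarrow> nat \<Rightarrow> nat) \<Rightarrow> nat \<Rightarrow>
     (('k::comm_ring_1) mpol set \<Rightarrow> 'k mpol set) \<Rightarrow> bool" where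
  "is_LND n l d \<delta> \<longleftrightarrow> is_derivation n l d \<delta> \<and>
     (\<forall>x\<in>carrier (tri_alg n l d). \<exists>m. (\<delta> ^^ m) x = \<zero>\<^bsub>tri_alg n l d\<^esub>)"

definition T_homogeneous ::
    "(nat \<Rightarrow> nat) \<Rightarrow> (nat \<Rightarrow> nat \<Rightarrow> nat) \<Rightarrow> nat \<Rightarrow>
     (('k::comm_ring_1) mpol set \<Rightarrow> 'k mpol set) \<Rightarrow> bool" where
  "T_homogeneous n l d \<delta> \<longleftrightarrow>
     (\<exists>e\<in>characters n l d. \<forall>g\<in>characters n l d.
        \<delta> ` graded_part n l d g \<subseteq> graded_part n l d (\<lambda>t. g t * e t))"

definition der_ker ::
    "(nat \<Rightarrow> nat) \<Rightarrow> (nat \<Rightarrow> nat \<Rightarrow> nat) \<Rightarrow> nat \<Rightarrow>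
     (('k::comm_ring_1) mpol set \<Rightarrow> 'k mpol set) \<Rightarrow> 'k mpol set set" where
  "der_ker n l d \<delta> = {x \<in> carrier (tri_alg n l d). \<delta> x = \<zero>\<^bsub>tri_alg n l d\<^esub>}"

definition is_replica ::
    "(nat \<Rightarrow> nat) \<Rightarrow> (nat \<Rightarrow> nat \<Rightarrow> nat) \<Rightarrow> nat \<Rightarrow>
     (('k::comm_ring_1) mpol set \<Rightarrow> 'k mpol set) \<Rightarrow> ('k mpol set \<Rightarrow> 'k mpol set) \<Rightarrow> bool" where
  "is_replica n l d \<delta> \<delta>' \<longleftrightarrow> is_LND n l d \<delta>' \<and>
     (\<exists>h\<in>der_ker n l d \<delta>'. \<forall>x\<in>carrier (tri_alg n l d). \<delta> x = h \<otimes>\<^bsub>tri_alg n l d\<^esub> \<delta>' x)"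

text \<open>The map of the trinomial algebra induced by the polynomial derivation sending each variable
  \<open>v\<close> to \<open>a v\<close>. If that derivation preserves the ideal, all the cosets in the union coincide.\<close>

definition poly_der :: "(nat \<Rightarrow> nat) \<Rightarrow> nat \<Rightarrow> (tvar \<Rightarrow> ('k::comm_ring_1) mpol) \<Rightarrow> 'k mpol \<Rightarrow> 'k mpol" where
  "poly_der n d a q = (\<Sum>v\<in>tri_vars n d. a v * pdiff v q)"

definition induced_der ::
    "(nat \<Rightarrow> nat) \<Rightarrow> (nat \<Rightarrow> nat \<Rightarrow> nat) \<Rightarrow> nat \<Rightarrow> (tvar \<Rightarrow> ('k::comm_ring_1) mpol) \<Rightarrow>
     'k mpol set \<Rightarrow> 'k mpol set" where
  "induced_der n l d a r = (\<Union>q\<in>r. cls n l d (poly_der n d a q))"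

definition der_S ::
    "(nat \<Rightarrow> nat) \<Rightarrow> (nat \<Rightarrow> nat \<Rightarrow> nat) \<Rightarrow> nat \<Rightarrow> nat \<Rightarrow> ('k::comm_ring_1) mpol set \<Rightarrow> 'k mpol set" where
  "der_S n l d k = induced_der n l d ((\<lambda>_. 0)(SVar k := 1))"

section \<open>The derivations of types (a)--(d)\<close>

text \<open>The permutation \<open>p\<close> of \<open>{0,1,2}\<close> permutes the roles of the three monomials: \<open>p 0\<close>,
  \<open>p 1\<close>, \<open>p 2\<close> play the roles of 0, 1, 2. The tuple \<open>C\<close> is given by \<open>c\<close>, where \<open>c i\<close> is
  an index of a variable of the \<open>i\<close>-th monomial (with \<open>i\<close> the original index).\<close>

definition dmon ::
    "(nat \<Rightarrow> nat) \<Rightarrow> (nat \<Rightarrow> nat \<Rightarrow> nat) \<Rightarrow> (nat \<Rightarrow> nat) \<Rightarrow> nat \<Rightarrow> nat \<Rightarrow> ('k::comm_ring_1) mpol" where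
  "dmon n l c i \<alpha> = pdiff (TVar i (c i)) (tri_mon n l i \<alpha>)"

definition cond_a ::
    "(nat \<Rightarrow> nat \<Rightarrow> nat) \<Rightarrow> (nat \<Rightarrow> nat) \<Rightarrow> (nat \<Rightarrow> nat) \<Rightarrow> bool" where
  "cond_a l p c \<longleftrightarrow> l (p 2) (c (p 2)) = 1"

definition der_a ::
    "(nat \<Rightarrow> nat) \<Rightarrow> (nat \<Rightarrow> nat \<Rightarrow> nat) \<Rightarrow> nat \<Rightarrow> (nat \<Rightarrow> nat) \<Rightarrow> (nat \<Rightarrow> nat) \<Rightarrow>
     ('k::comm_ring_1) mpol set \<Rightarrow> 'k mpol set" where
  "der_a n l d p c = induced_der n l d ((\<lambda>_. 0)
     (TVar (p 0) (c (p 0)) := dmon n l c (p 2) 1,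
      TVar (p 2) (c (p 2)) := - dmon n l c (p 0) 1))"

definition cond_b ::
    "(nat \<Rightarrow> nat) \<Rightarrow> (nat \<Rightarrow> nat \<Rightarrow> nat) \<Rightarrow> (nat \<Rightarrow> nat) \<Rightarrow> (nat \<Rightarrow> nat) \<Rightarrow> bool" where
  "cond_b n l p c \<longleftrightarrow> l (p 2) (c (p 2)) = 1 \<and>
     (\<forall>i\<in>{0,1}. \<forall>j\<in>{1..n (p i)}. l (p 0) (c (p 0)) dvd l (p i) j)"

definition der_b ::
    "(nat \<Rightarrow> nat) \<Rightarrow> (nat \<Rightarrow> nat \<Rightarrow> nat) \<Rightarrow> nat \<Rightarrow> (nat \<Rightarrow> nat) \<Rightarrow> (nat \<Rightarrow> nat) \<Rightarrow> 'k \<Rightarrow>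
     ('k::comm_ring_1) mpol set \<Rightarrow> 'k mpol set" where
  "der_b n l d p c lam = (let \<alpha> = l (p 0) (c (p 0)) in induced_der n l d ((\<lambda>_. 0)
     (TVar (p 0) (c (p 0)) := dmon n l c (p 1) \<alpha> * dmon n l c (p 2) 1,
      TVar (p 1) (c (p 1)) := Const lam * dmon n l c (p 0) \<alpha> * dmon n l c (p 2) 1,
      TVar (p 2) (c (p 2)) := - (dmon n l c (p 0) 1 * dmon n l c (p 1) \<alpha> +
                                 Const lam * dmon n l c (p 0) \<alpha> * dmon n l c (p 1) 1))))"

definition cond_c ::
    "(nat \<Rightarrow> nat) \<Rightarrow> (nat \<Rightarrow> nat \<Rightarrow> nat) \<Rightarrow> (nat \<Rightarrow> nat) \<Rightarrow> (nat \<Rightarrow> nat) \<Rightarrow> bool" where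
  "cond_c n l p c \<longleftrightarrow> l (p 0) (c (p 0)) = 2 \<and> l (p 1) (c (p 1)) = 2 \<and> l (p 2) (c (p 2)) \<ge> 2 \<and>
     (\<forall>i\<in>{0,1}. \<forall>j\<in>{1..n (p i)}. even (l (p i) j))"

definition der_c ::
    "(nat \<Rightarrow> nat) \<Rightarrow> (nat \<Rightarrow> nat \<Rightarrow> nat) \<Rightarrow> nat \<Rightarrow> (nat \<Rightarrow> nat) \<Rightarrow> (nat \<Rightarrow> nat) \<Rightarrow> 'k \<Rightarrow>
     ('k::comm_ring_1) mpol set \<Rightarrow> 'k mpol set" where
  "der_c n l d p c mu = induced_der n l d ((\<lambda>_. 0)
     (TVar (p 0) (c (p 0)) := Const mu * dmon n l c (p 1) 2 * dmon n l c (p 2) 1,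
      TVar (p 1) (c (p 1)) := dmon n l c (p 0) 2 * dmon n l c (p 2) 1,
      TVar (p 2) (c (p 2)) := - (Const mu * dmon n l c (p 0) 1 * dmon n l c (p 1) 2 +
                                 dmon n l c (p 0) 2 * dmon n l c (p 1) 1)))"

definition cond_d ::
    "(nat \<Rightarrow> nat) \<Rightarrow> (nat \<Rightarrow> nat \<Rightarrow> nat) \<Rightarrow> (nat \<Rightarrow> nat) \<Rightarrow> bool" where
  "cond_d n l c \<longleftrightarrow> (\<forall>i\<in>{0,1,2}. l i (c i) = 2) \<and>
     (\<forall>i\<in>{0,1,2}. \<forall>j\<in>{1..n i}. even (l i j))"

definition der_d ::
    "(nat \<Rightarrow> nat) \<Rightarrow> (nat \<Rightarrow> nat \<Rightarrow> nat) \<Rightarrow> nat \<Rightarrow> (nat \<Rightarrow> nat) \<Rightarrow> (nat \<Rightarrow> nat) \<Rightarrow> 'k \<Rightarrow> 'k \<Rightarrow>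
     ('k::comm_ring_1) mpol set \<Rightarrow> 'k mpol set" where
  \<comment> \<open>\<open>im\<close> is the chosen square root of \<open>-1\<close>\<close>
  "der_d n l d p c im lam = induced_der n l d ((\<lambda>_. 0)
     (TVar (p 0) (c (p 0)) := dmon n l c (p 1) 2 * dmon n l c (p 2) 2 *
        (Const (2 * lam) * tri_mon n l (p 1) 2 + Const ((1 + lam^2) * im) * tri_mon n l (p 2) 2),
      TVar (p 1) (c (p 1)) := dmon n l c (p 0) 2 * dmon n l c (p 2) 2 *
        (Const (- 2 * lam) * tri_mon n l (p 0) 2 + Const (1 - lam^2) * tri_mon n l (p 2) 2),
      TVar (p 2) (c (p 2)) := dmon n l c (p 0) 2 * dmon n l c (p 1) 2 *
        (Const (- ((1 + lam^2) * im)) * tri_mon n l (p 0) 2 -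
         Const (1 - lam^2) * tri_mon n l (p 1) 2)))"

text \<open>The subalgebra generated by the \<open>T\<^sub>i\<^sub>j\<close> with \<open>j \<noteq> c\<^sub>i\<close>, all \<open>S\<^sub>k\<close> (which are killed by the
  derivations of types (a)--(d)), and one further element, the class of \<open>q\<close>.\<close>

definition ker_alg ::
    "(nat \<Rightarrow> nat) \<Rightarrow> (nat \<Rightarrow> nat \<Rightarrow> nat) \<Rightarrow> nat \<Rightarrow> (nat \<Rightarrow> nat) \<Rightarrow> ('k::comm_ring_1) mpol \<Rightarrow>
     'k mpol set set" where
  "ker_alg n l d c q = generate_ring (tri_alg n l d)
     (range (\<lambda>a. cls n l d (Const a)) \<union>
      {cls n l d (Var (TVar i j)) | i j. i \<in> {0,1,2} \<and> j \<in> {1..n i} \<and> j \<noteq> c i} \<union>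
      {cls n l d (Var (SVar k)) | k. k \<in> {1..d}} \<union>
      {cls n l d q})"

end

theory Submission
  imports Defs "HOL-Library.Nat_Bijection" "HOL-Computational_Algebra.Polynomial_FPS"
begin

text \<open>Everything is computed with polynomials modulo the trinomial, which is a prime element.  A homogeneous
  derivation \<open>\<delta>\<close> lifts to a polynomial derivation with homogeneous values on the variables, and suitable
  one-parameter subgroups of the torus show that, unless \<open>\<delta>\<close> is a replica of some \<open>\<partial>/\<partial>S\<^sub>k\<close>, it moves at most one
  variable of each monomial.  If it moves only two variables, coprimality leaves type (a).  If it moves three,
  the degree function of \<open>\<delta>\<close> and further one-parameter subgroups restrict the exponents: one of them is 1 or two
  of them are 2.  A homogeneous kernel element is then, up to a monomial, a binary form, or a form on a conic; one
  of its linear factors is killed, and a derivation killing the frozen variables and this linear form is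
  proportional to that of type (b), (c) or (d).  The factor of proportionality is a polynomial in the linear form
  with vanishing constant term, by the description of the kernels.

  The kernel of each \<open>\<delta>\<close> is computed from an element \<open>t\<close> with \<open>\<delta> t\<close> in the candidate subalgebra \<open>A\<close>, \<open>\<delta> t\<close> nonzero: after
  multiplication by some element of \<open>A\<close> every element becomes a polynomial in \<open>t\<close> over \<open>A\<close>, and the
  denominators cancel because their factors remain independent of the other parameters.\<close>

text \<open>The quotient ring is not known to be factorial. Divisibility arguments therefore rest on
  two facts only: the trinomial is prime, and monomials of different blocks are coprime modulo it,
  in the sense that one can be cancelled against the other.

  For exponents \<open>e_i\<close> of moved variables of degree \<open>d_i\<close> with respect to
  the derivation, the inequalities \<open>e_i d_i < d_0 + d_1 + d_2\<close> give
  \<open>1/e_0 + 1/e_1 + 1/e_2 > 1\<close>. The triples (2,3,3), (2,3,4), (2,3,5) satisfy this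
  bound; divisibility conditions and degree comparisons coming from the gradings exclude them.

  If all exponents are even, let \<open>x, y, z\<close> be the square roots of the three monomials.
  Types (c) and (d) are then one construction: up to derivatives of \<open>x, y, z\<close>, the
  cross product of \<open>(x, y, z)\<close> with an isotropic vector, which kills both the conic and
  the scalar product with that vector. Type (d) has the parametrized vectors with third coordinate
  \<open>2 \<lambda>\<close>, type (c) those with third coordinate 0.\<close>

hide_const (open) up_ring.monom up_ring.coeff

section \<open>Polynomials\<close>

text \<open>The order on the variables only serves to obtain, through the ordering of exponent vectors, that
  \<open>'k mpol\<close> has no zero divisors.\<close>

fun tvar_code :: "tvar \<Rightarrow> nat" where
  "tvar_code (TVar i j) = 2 * prod_encode (i, j)"
| "tvar_code (SVar k) = 2 * k + 1"

lemma tvar_code_inject: "tvar_code v = tvar_code w \<longleftrightarrow> v = w"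
  by (cases v; cases w; simp) presburger+

instantiation tvar :: linorder
begin
definition "v \<le> w \<longleftrightarrow> tvar_code v \<le> tvar_code w"
definition "v < w \<longleftrightarrow> tvar_code v < tvar_code w"
instance
  by standard (auto simp: less_eq_tvar_def less_tvar_def tvar_code_inject)
end

lemma mpol_sum_single: "(\<Sum>m\<in>Poly_Mapping.keys q. Poly_Mapping.single m (Poly_Mapping.lookup q m)) = q"
  by (rule poly_mapping_eqI) (simp add: lookup_sum lookup_single when_def in_keys_iff)

lemma monom_at_superset:
  assumes "finite A" "Poly_Mapping.keys m \<subseteq> A"
  shows "monom_at t m = (\<Prod>v\<in>A. t v ^ Poly_Mapping.lookup m v)"
  unfolding monom_at_def using assms by (intro prod.mono_neutral_left) (auto simp: in_keys_iff)

lemma monom_at_zero [simp]: "monom_at t 0 = 1"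
  by (simp add: monom_at_def)

lemma monom_at_add: "monom_at t (m + m') = monom_at t m * monom_at t m'"
proof -
  let ?A = "Poly_Mapping.keys m \<union> Poly_Mapping.keys m'"
  have "Poly_Mapping.keys (m + m') \<subseteq> ?A" by (rule keys_add)
  then have "monom_at t (m + m') = (\<Prod>v\<in>?A. t v ^ Poly_Mapping.lookup (m + m') v)"
    by (intro monom_at_superset) auto
  moreover have "monom_at t m = (\<Prod>v\<in>?A. t v ^ Poly_Mapping.lookup m v)"
    "monom_at t m' = (\<Prod>v\<in>?A. t v ^ Poly_Mapping.lookup m' v)"
    by (auto intro: monom_at_superset)
  ultimately show ?thesis by (simp add: lookup_add power_add prod.distrib)
qed

lemma monom_at_single [simp]: "monom_at t (Poly_Mapping.single v k) = t v ^ k"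
  by (simp add: monom_at_def)

lemma monom_at_cong:
  "(\<And>v. v \<in> Poly_Mapping.keys m \<Longrightarrow> s v = t v) \<Longrightarrow> monom_at s m = monom_at t m"
  by (simp add: monom_at_def)

lemma Var_power: "Var v ^ k = Poly_Mapping.single (Poly_Mapping.single v k) 1"
  by (induction k) (auto simp: Var_def mult_single simp flip: single_add)

lemma monom_at_Var: "monom_at Var m = (Poly_Mapping.single m 1 :: 'k::comm_ring_1 mpol)"
proof -
  have fin: "(\<Prod>v\<in>A. Var v ^ Poly_Mapping.lookup m v) =
     (Poly_Mapping.single (\<Sum>v\<in>A. Poly_Mapping.single v (Poly_Mapping.lookup m v)) 1 :: 'k mpol)"
    if "finite A" for A
    using that by induction (auto simp: Var_power mult_single)
  have "(\<Sum>v\<in>Poly_Mapping.keys m. Poly_Mapping.single v (Poly_Mapping.lookup m v)) = m"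
    by (rule poly_mapping_eqI) (simp add: lookup_sum lookup_single when_def in_keys_iff)
  with fin[of "Poly_Mapping.keys m"] show ?thesis by (simp add: monom_at_def)
qed

lemma single_eq_Const_monom: "Poly_Mapping.single m c = Const c * monom_at Var m"
  by (simp add: monom_at_Var Const_def mult_single)

lemma Const_0 [simp]: "Const 0 = 0" and Const_1 [simp]: "Const 1 = 1"
  and Const_add: "Const (a + b) = Const a + Const b"
  and Const_mult: "Const (a * b) = Const a * Const b"
  and Const_minus: "Const (- a) = - Const a"
  and Const_diff: "Const (a - b) = Const a - Const b"
  by (auto simp: Const_def single_add mult_single single_uminus single_diff)

lemma Const_power: "Const (a ^ k) = Const a ^ k"
  by (induction k) (auto simp: Const_mult)

lemma Const_eq_iff [simp]: "Const a = Const b \<longleftrightarrow> a = b"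
  by (metis Const_def lookup_single_eq)

lemma Const_prod: "Const (\<Prod>i\<in>A. f i) = (\<Prod>i\<in>A. Const (f i))"
  by (induction A rule: infinite_finite_induct) (auto simp: Const_mult)

lemma Const_eq_0_iff [simp]: "Const a = 0 \<longleftrightarrow> a = 0"
  using Const_eq_iff[of a 0] by (simp del: Const_eq_iff)

lemma Const_of_nat: "Const (of_nat k) = of_nat k"
  by (simp add: Const_def)

lemma Const_numeral: "Const (numeral k) = numeral k"
  by (simp add: Const_def)

lemma Var_neq_0 [simp]: "(Var v :: 'k::comm_ring_1 mpol) \<noteq> 0"
  by (metis Var_def lookup_single_eq lookup_zero zero_neq_one)

lemma Var_inject [simp]: "(Var v :: 'k::comm_ring_1 mpol) = Var w \<longleftrightarrow> v = w"
proof
  assume "(Var v :: 'k mpol) = Var w"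
  then have "Poly_Mapping.keys (Var v :: 'k mpol) = Poly_Mapping.keys (Var w :: 'k mpol)" by simp
  then have "Poly_Mapping.single v (1::nat) = Poly_Mapping.single w 1" by (simp add: Var_def)
  then show "v = w" by (metis lookup_single_eq lookup_single_not_eq zero_neq_one)
qed simp

subsection \<open>Supports\<close>

definition pvars :: "'k::comm_ring_1 mpol \<Rightarrow> tvar set" where
  "pvars q = (\<Union>m\<in>Poly_Mapping.keys q. Poly_Mapping.keys m)"

lemma carrier_mpol_ring: "q \<in> carrier (mpol_ring V) \<longleftrightarrow> pvars q \<subseteq> V"
  by (auto simp: mpol_ring_def pvars_def)

lemma finite_pvars [simp]: "finite (pvars q)"
  by (auto simp: pvars_def)

lemma pvars_0 [simp]: "pvars 0 = {}" and pvars_1 [simp]: "pvars 1 = {}"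
  and pvars_Const [simp]: "pvars (Const c) = {}"
  and pvars_Var [simp]: "pvars (Var v :: 'k::comm_ring_1 mpol) = {v}"
  by (auto simp: pvars_def Const_def Var_def)

lemma pvars_add: "pvars (p + q) \<subseteq> pvars p \<union> pvars q"
  unfolding pvars_def using keys_add[of p q] by auto

lemma pvars_minus [simp]: "pvars (- p) = pvars p"
  unfolding pvars_def by simp

lemma pvars_diff: "pvars (p - q) \<subseteq> pvars p \<union> pvars q"
  using pvars_add[of p "- q"] by simp

lemma pvars_mult: "pvars (p * q) \<subseteq> pvars p \<union> pvars q"
proof
  fix v assume "v \<in> pvars (p * q)"
  then obtain m where m: "m \<in> Poly_Mapping.keys (p * q)" "v \<in> Poly_Mapping.keys m" by (auto simp: pvars_def)
  then obtain a b where "m = a + b" "a \<in> Poly_Mapping.keys p" "b \<in> Poly_Mapping.keys q"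
    using keys_mult[of p q] by auto
  then show "v \<in> pvars p \<union> pvars q" using m keys_add[of a b] by (auto simp: pvars_def)
qed

lemma pvars_power: "pvars (p ^ k) \<subseteq> pvars p"
  by (induction k) (use pvars_mult in force)+

lemma pvars_sum: "(\<And>i. i \<in> A \<Longrightarrow> pvars (f i) \<subseteq> V) \<Longrightarrow> pvars (\<Sum>i\<in>A. f i) \<subseteq> V"
  by (induction A rule: infinite_finite_induct) (use pvars_add in force)+

lemma pvars_prod: "(\<And>i. i \<in> A \<Longrightarrow> pvars (f i) \<subseteq> V) \<Longrightarrow> pvars (\<Prod>i\<in>A. f i) \<subseteq> V"
  by (induction A rule: infinite_finite_induct) (use pvars_mult in force)+

lemma pvars_single: "pvars (Poly_Mapping.single m c) \<subseteq> Poly_Mapping.keys m"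
  by (auto simp: pvars_def)

lemma notin_pvars:
  "v \<notin> pvars p \<Longrightarrow> v \<notin> pvars q \<Longrightarrow> v \<notin> pvars (p + q)"
  "v \<notin> pvars p \<Longrightarrow> v \<notin> pvars q \<Longrightarrow> v \<notin> pvars (p - q)"
  "v \<notin> pvars p \<Longrightarrow> v \<notin> pvars q \<Longrightarrow> v \<notin> pvars (p * q)"
  "v \<notin> pvars p \<Longrightarrow> v \<notin> pvars (p ^ k)"
  using pvars_add[of p q] pvars_diff[of p q] pvars_mult[of p q] pvars_power[of p k] by auto

text \<open>Only variables that occur in \<open>q\<close> have to satisfy the property, so the rule
  also serves for polynomials in a prescribed set of variables.\<close>

lemma mpol_induct [case_names Const Var add mult]:
  assumes "\<And>c. Q (Const c)" "\<And>v. v \<in> pvars q \<Longrightarrow> Q (Var v)"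
    "\<And>f g. Q f \<Longrightarrow> Q g \<Longrightarrow> Q (f + g)" "\<And>f g. Q f \<Longrightarrow> Q g \<Longrightarrow> Q (f * g)"
  shows "Q (q :: 'k::comm_ring_1 mpol)"
proof -
  have Q0: "Q 0" and Q1: "Q 1" using assms(1)[of 0] assms(1)[of 1] by auto
  have pow: "Q (Var v ^ k)" if "v \<in> pvars q" for v k
    by (induction k) (auto simp: Q1 assms that)
  have prod: "Q (\<Prod>v\<in>A. Var v ^ e v)" if "A \<subseteq> pvars q" "finite A" for A e
    using that(2,1) by induction (auto simp: Q1 intro!: assms pow)
  have single: "Q (Poly_Mapping.single m (Poly_Mapping.lookup q m))" if "m \<in> Poly_Mapping.keys q" for m
    unfolding single_eq_Const_monom unfolding monom_at_def
    using that by (intro assms prod) (auto simp: pvars_def)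
  have "Q (\<Sum>m\<in>A. Poly_Mapping.single m (Poly_Mapping.lookup q m))"
    if "A \<subseteq> Poly_Mapping.keys q" "finite A" for A
    using that(2,1) by induction (auto simp: Q0 intro!: assms single)
  from this[of "Poly_Mapping.keys q"] show ?thesis by (simp add: mpol_sum_single)
qed

subsection \<open>Substitution\<close>

text \<open>Evaluation with an arbitrary coefficient map, so that point evaluation, the torus
  action, polynomial substitution, power series branches and polynomial curves share one set of
  rules.\<close>

definition psubst :: "('k::comm_ring_1 \<Rightarrow> 'b::comm_ring_1) \<Rightarrow> (tvar \<Rightarrow> 'b) \<Rightarrow> 'k mpol \<Rightarrow> 'b" where
  "psubst \<phi> \<sigma> q = (\<Sum>m\<in>Poly_Mapping.keys q. \<phi> (Poly_Mapping.lookup q m) * monom_at \<sigma> m)"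

locale coeff_hom =
  fixes \<phi> :: "'k::comm_ring_1 \<Rightarrow> 'b::comm_ring_1"
  assumes hom_1: "\<phi> 1 = 1" and hom_add: "\<phi> (a + b) = \<phi> a + \<phi> b"
    and hom_mult: "\<phi> (a * b) = \<phi> a * \<phi> b"
begin

lemma hom_0: "\<phi> 0 = 0"
  using hom_add[of 0 0] by simp

lemma psubst_superset:
  assumes "finite A" "Poly_Mapping.keys q \<subseteq> A"
  shows "psubst \<phi> \<sigma> q = (\<Sum>m\<in>A. \<phi> (Poly_Mapping.lookup q m) * monom_at \<sigma> m)"
  unfolding psubst_def using assms
  by (intro sum.mono_neutral_left) (auto simp: in_keys_iff hom_0)

lemma psubst_0 [simp]: "psubst \<phi> \<sigma> 0 = 0"
  by (simp add: psubst_def)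

lemma psubst_add: "psubst \<phi> \<sigma> (p + q) = psubst \<phi> \<sigma> p + psubst \<phi> \<sigma> q"
proof -
  let ?A = "Poly_Mapping.keys p \<union> Poly_Mapping.keys q"
  have "psubst \<phi> \<sigma> r = (\<Sum>m\<in>?A. \<phi> (Poly_Mapping.lookup r m) * monom_at \<sigma> m)" if "r \<in> {p, q, p + q}" for r
    by (rule psubst_superset) (use that keys_add[of p q] in auto)
  then show ?thesis by (simp add: lookup_add hom_add distrib_right sum.distrib)
qed

lemma psubst_sum: "psubst \<phi> \<sigma> (\<Sum>i\<in>A. f i) = (\<Sum>i\<in>A. psubst \<phi> \<sigma> (f i))"
  by (induction A rule: infinite_finite_induct) (auto simp: psubst_add)

lemma psubst_single: "psubst \<phi> \<sigma> (Poly_Mapping.single m c) = \<phi> c * monom_at \<sigma> m"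
  using psubst_superset[of "{m}" "Poly_Mapping.single m c" \<sigma>] by (simp split: if_splits)

lemma psubst_mult: "psubst \<phi> \<sigma> (p * q) = psubst \<phi> \<sigma> p * psubst \<phi> \<sigma> q"
proof -
  have "p * q = (\<Sum>m\<in>Poly_Mapping.keys p. \<Sum>m'\<in>Poly_Mapping.keys q.
      Poly_Mapping.single (m + m') (Poly_Mapping.lookup p m * Poly_Mapping.lookup q m'))"
    by (subst (1 2) mpol_sum_single[symmetric]) (simp add: sum_product mult_single)
  then have "psubst \<phi> \<sigma> (p * q) = (\<Sum>m\<in>Poly_Mapping.keys p. \<Sum>m'\<in>Poly_Mapping.keys q.
      \<phi> (Poly_Mapping.lookup p m * Poly_Mapping.lookup q m') * monom_at \<sigma> (m + m'))"
    by (simp only: psubst_sum psubst_single)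
  then show ?thesis
    unfolding psubst_def by (simp add: sum_product hom_mult monom_at_add mult_ac)
qed

lemma psubst_Const [simp]: "psubst \<phi> \<sigma> (Const c) = \<phi> c"
  by (simp add: Const_def psubst_single)

lemma psubst_1 [simp]: "psubst \<phi> \<sigma> 1 = 1"
  using psubst_Const[of \<sigma> 1] by (simp add: hom_1 del: psubst_Const)

lemma psubst_Var [simp]: "psubst \<phi> \<sigma> (Var v) = \<sigma> v"
  by (simp add: Var_def psubst_single hom_1)

lemma psubst_minus: "psubst \<phi> \<sigma> (- p) = - psubst \<phi> \<sigma> p"
  using psubst_add[of \<sigma> p "- p"] by (simp add: eq_neg_iff_add_eq_0 add.commute)

lemma psubst_diff: "psubst \<phi> \<sigma> (p - q) = psubst \<phi> \<sigma> p - psubst \<phi> \<sigma> q"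
  using psubst_add[of \<sigma> p "- q"] by (simp add: psubst_minus)

lemma psubst_power: "psubst \<phi> \<sigma> (p ^ k) = psubst \<phi> \<sigma> p ^ k"
  by (induction k) (auto simp: psubst_mult)

lemma psubst_prod: "psubst \<phi> \<sigma> (\<Prod>i\<in>A. f i) = (\<Prod>i\<in>A. psubst \<phi> \<sigma> (f i))"
  by (induction A rule: infinite_finite_induct) (auto simp: psubst_mult)

lemma psubst_of_nat [simp]: "psubst \<phi> \<sigma> (of_nat k) = of_nat k"
  by (induction k) (auto simp: psubst_add)

lemma psubst_numeral [simp]: "psubst \<phi> \<sigma> (numeral k) = numeral k"
  using psubst_of_nat[of \<sigma> "numeral k"] by (simp del: psubst_of_nat)

lemmas psubst_simps = psubst_add psubst_sum psubst_mult psubst_minus psubst_diff psubst_power psubst_prod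

end

lemma psubst_cong:
  assumes "\<And>v. v \<in> pvars q \<Longrightarrow> \<sigma> v = \<tau> v"
  shows "psubst \<phi> \<sigma> q = psubst \<phi> \<tau> q"
  unfolding psubst_def using assms
  by (intro sum.cong refl arg_cong2[where f = "(*)"] monom_at_cong) (auto simp: pvars_def)

interpretation id_hom: coeff_hom "\<lambda>c. c"
  by standard auto

interpretation Const_hom: coeff_hom Const
  by standard (auto simp: Const_add Const_mult)

interpretation fps_const_hom: coeff_hom "fps_const :: 'k::comm_ring_1 \<Rightarrow> 'k fps"
  by standard auto

interpretation poly_const_hom: coeff_hom "\<lambda>c::'k::comm_ring_1. [:c:]"
  by standard auto

lemma eval_at_psubst: "eval_at t q = psubst (\<lambda>c. c) t q"
  by (simp add: eval_at_def psubst_def)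

lemma scale_vars_psubst: "scale_vars t q = psubst Const (\<lambda>v. Const (t v) * Var v) q"
proof -
  have "monom_at (\<lambda>v. Const (t v) * Var v) m = Const (monom_at t m) * monom_at Var m" for m
    by (simp add: monom_at_def power_mult_distrib prod.distrib Const_prod Const_power)
  then show ?thesis
    by (simp add: scale_vars_def psubst_def single_eq_Const_monom Const_mult mult.assoc)
qed

lemma psubst_psubst:
  assumes "coeff_hom \<phi>"
  shows "psubst \<phi> \<sigma> (psubst Const \<tau> q) = psubst \<phi> (\<lambda>v. psubst \<phi> \<sigma> (\<tau> v)) q"
proof -
  interpret coeff_hom \<phi> by fact
  show ?thesis by (induction q rule: mpol_induct) (auto simp: Const_hom.psubst_simps psubst_simps)
qed

lemma psubst_Const_Var [simp]: "psubst Const Var q = q"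
  by (induction q rule: mpol_induct) (auto simp: Const_hom.psubst_simps)

lemma pvars_psubst:
  assumes "\<And>v. v \<in> pvars q \<Longrightarrow> pvars (\<sigma> v) \<subseteq> V"
  shows "pvars (psubst Const \<sigma> q) \<subseteq> V"
proof (induction q rule: mpol_induct)
  case (add f g) then show ?case using pvars_add by (force simp: Const_hom.psubst_simps)
next
  case (mult f g) then show ?case using pvars_mult by (force simp: Const_hom.psubst_simps)
qed (use assms in auto)

text \<open>Congruences modulo \<open>p\<close> are compatible with sums and products. Applied to
  substitutions that differ in one variable, this splits off the part free of that variable.\<close>

lemma dvd_psubst_diff:
  assumes "\<And>v. v \<in> pvars q \<Longrightarrow> p dvd \<sigma> v - \<tau> v"
  shows "p dvd psubst Const \<sigma> q - psubst Const \<tau> q"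
proof (induction q rule: mpol_induct)
  case (add f g)
  have "psubst Const \<sigma> (f + g) - psubst Const \<tau> (f + g) =
      (psubst Const \<sigma> f - psubst Const \<tau> f) + (psubst Const \<sigma> g - psubst Const \<tau> g)"
    by (simp add: Const_hom.psubst_simps)
  then show ?case using add by (metis dvd_add)
next
  case (mult f g)
  have "psubst Const \<sigma> (f * g) - psubst Const \<tau> (f * g) =
      (psubst Const \<sigma> f - psubst Const \<tau> f) * psubst Const \<sigma> g +
      psubst Const \<tau> f * (psubst Const \<sigma> g - psubst Const \<tau> g)"
    by (simp add: Const_hom.psubst_simps algebra_simps)
  then show ?case using mult by (metis dvd_add dvd_mult dvd_mult2)
qed (use assms in auto)

lemma Var_dvd_iff: "Var v dvd q \<longleftrightarrow> psubst Const (Var(v := 0)) q = 0"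
proof
  assume "Var v dvd q"
  then show "psubst Const (Var(v := 0)) q = 0" by (auto simp: Const_hom.psubst_simps elim!: dvdE)
next
  assume "psubst Const (Var(v := 0)) q = 0"
  moreover have "Var v dvd psubst Const Var q - psubst Const (Var(v := 0)) q"
    by (rule dvd_psubst_diff) auto
  ultimately show "Var v dvd q" by simp
qed

subsection \<open>Coefficients with respect to one variable\<close>

definition vcoeff :: "tvar \<Rightarrow> nat \<Rightarrow> 'k::comm_ring_1 mpol \<Rightarrow> 'k mpol" where
  "vcoeff v i q = (\<Sum>m | m \<in> Poly_Mapping.keys q \<and> Poly_Mapping.lookup m v = i.
     Poly_Mapping.single (m - Poly_Mapping.single v i) (Poly_Mapping.lookup q m))"

lemma vcoeff_expansion:
  assumes "\<And>m. m \<in> Poly_Mapping.keys q \<Longrightarrow> Poly_Mapping.lookup m v < N"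
  shows "q = (\<Sum>i<N. vcoeff v i q * Var v ^ i)"
proof -
  have "(\<Sum>i<N. vcoeff v i q * Var v ^ i) =
     (\<Sum>i<N. \<Sum>m | m \<in> Poly_Mapping.keys q \<and> Poly_Mapping.lookup m v = i.
        Poly_Mapping.single m (Poly_Mapping.lookup q m))"
  proof (intro sum.cong refl)
    fix i
    have "m - Poly_Mapping.single v i + Poly_Mapping.single v i = m" if "Poly_Mapping.lookup m v = i"
      for m :: "tvar \<Rightarrow>\<^sub>0 nat"
      using that by (intro poly_mapping_eqI) (auto simp: lookup_add lookup_minus lookup_single when_def)
    then show "vcoeff v i q * Var v ^ i =
        (\<Sum>m | m \<in> Poly_Mapping.keys q \<and> Poly_Mapping.lookup m v = i.
        Poly_Mapping.single m (Poly_Mapping.lookup q m))"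
      by (auto simp: vcoeff_def sum_distrib_right Var_power mult_single intro!: sum.cong)
  qed
  also have "\<dots> = (\<Sum>m\<in>Poly_Mapping.keys q. Poly_Mapping.single m (Poly_Mapping.lookup q m))"
    by (rule sum.group) (use assms in auto)
  finally show ?thesis by (simp add: mpol_sum_single)
qed

lemma vcoeff_bound: "\<exists>N. \<forall>m\<in>Poly_Mapping.keys (q :: 'k::comm_ring_1 mpol). Poly_Mapping.lookup m v < N"
  using finite_nat_set_iff_bounded[of "(\<lambda>m. Poly_Mapping.lookup m v) ` Poly_Mapping.keys q"] by auto

lemma pvars_vcoeff: "pvars (vcoeff v i q) \<subseteq> pvars q - {v}"
  unfolding vcoeff_def
proof (rule pvars_sum)
  fix m assume m: "m \<in> {m \<in> Poly_Mapping.keys q. Poly_Mapping.lookup m v = i}"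
  have "Poly_Mapping.keys (m - Poly_Mapping.single v i) \<subseteq> Poly_Mapping.keys m - {v}"
    using m by (auto simp: in_keys_iff lookup_minus lookup_single when_def split: if_splits)
  then show "pvars (Poly_Mapping.single (m - Poly_Mapping.single v i) (Poly_Mapping.lookup q m)) \<subseteq> pvars q - {v}"
    using pvars_single m by (force simp: pvars_def)
qed

lemma exists_nonzero_point:
  fixes q :: "'k::field_char_0 mpol"
  assumes "q \<noteq> 0"
  shows "\<exists>t. (\<forall>v. t v \<noteq> 0) \<and> eval_at t q \<noteq> 0"
  using assms
proof (induction "card (pvars q)" arbitrary: q rule: less_induct)
  case less
  show ?case
  proof (cases "pvars q = {}")
    case True
    then have keys: "Poly_Mapping.keys q \<subseteq> {0}" by (auto simp: pvars_def)
    then have "q = Const (Poly_Mapping.lookup q 0)"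
      by (intro poly_mapping_eqI) (auto simp: Const_def lookup_single when_def in_keys_iff)
    then obtain c where "q = Const c" by blast
    then show ?thesis using less.prems by (intro exI[of _ "\<lambda>_. 1"]) (auto simp: eval_at_psubst)
  next
    case False
    then obtain v where v: "v \<in> pvars q" by auto
    obtain N where N: "\<And>m. m \<in> Poly_Mapping.keys q \<Longrightarrow> Poly_Mapping.lookup m v < N"
      using vcoeff_bound[of q v] by blast
    have exp: "q = (\<Sum>i<N. vcoeff v i q * Var v ^ i)"
      by (rule vcoeff_expansion) (rule N)
    obtain i where i: "i < N" "vcoeff v i q \<noteq> 0"
    proof (rule ccontr)
      assume "\<not> thesis"
      then have "\<forall>i<N. vcoeff v i q = 0" using that by blast
      then show False using exp less.prems by simp
    qed
    have "card (pvars (vcoeff v i q)) < card (pvars q)"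
      using pvars_vcoeff[of v i q] v by (intro psubset_card_mono) auto
    from less.hyps[OF this i(2)] obtain t where t: "\<forall>v. t v \<noteq> 0" "eval_at t (vcoeff v i q) \<noteq> 0" by auto
    define p where "p = (\<Sum>i<N. monom (eval_at t (vcoeff v i q)) i)"
    have "coeff p i = eval_at t (vcoeff v i q)"
      using i by (simp add: p_def coeff_sum)
    then have "p \<noteq> 0" using t by auto
    then have "finite (insert 0 {s. poly p s = 0})" by (simp add: poly_roots_finite)
    then have "\<not> UNIV \<subseteq> insert 0 {s. poly p s = 0}"
      using infinite_UNIV_char_0 finite_subset by blast
    then obtain s where s: "s \<noteq> 0" "poly p s \<noteq> 0" by auto
    have "eval_at (t(v := s)) (vcoeff v j q) = eval_at t (vcoeff v j q)" for j
      unfolding eval_at_psubst using pvars_vcoeff[of v j q] by (intro psubst_cong) auto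
    then have "eval_at (t(v := s)) q = poly p s"
      by (subst exp) (simp add: eval_at_psubst id_hom.psubst_simps p_def poly_sum poly_monom)
    then show ?thesis using s t by (intro exI[of _ "t(v := s)"]) auto
  qed
qed

corollary mpol_eq_0_if_vanishing:
  fixes q :: "'k::field_char_0 mpol"
  assumes "\<And>t. (\<forall>v. t v \<noteq> 0) \<Longrightarrow> eval_at t q = 0"
  shows "q = 0"
  using exists_nonzero_point assms by metis

subsection \<open>Derivations\<close>

locale ring_derivation =
  fixes D :: "'a::comm_ring_1 \<Rightarrow> 'a"
  assumes D_add: "D (f + g) = D f + D g" and D_mult: "D (f * g) = D f * g + f * D g"
begin

lemma D_0 [simp]: "D 0 = 0"
  using D_add[of 0 0] by simp

lemma D_1 [simp]: "D 1 = 0"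
  using D_mult[of 1 1] by simp

lemma D_minus: "D (- f) = - D f"
  using D_add[of f "- f"] by (simp add: eq_neg_iff_add_eq_0 add.commute)

lemma D_diff: "D (f - g) = D f - D g"
  using D_add[of f "- g"] by (simp add: D_minus)

lemma D_of_nat [simp]: "D (of_nat k) = 0"
  by (induction k) (auto simp: D_add)

lemma D_numeral [simp]: "D (numeral k) = 0"
  using D_of_nat[of "numeral k"] by (simp del: D_of_nat)

lemma D_sum: "D (\<Sum>i\<in>A. f i) = (\<Sum>i\<in>A. D (f i))"
  by (induction A rule: infinite_finite_induct) (auto simp: D_add)

lemma D_power: "D (f ^ k) = of_nat k * f ^ (k - 1) * D f"
proof (induction k)
  case (Suc k)
  then show ?case by (cases k) (auto simp: D_mult algebra_simps)
qed simp

lemma iter_0 [simp]: "(D ^^ k) 0 = 0"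
  by (induction k) auto

lemma iter_add: "(D ^^ k) (f + g) = (D ^^ k) f + (D ^^ k) g"
  by (induction k) (auto simp: D_add)

lemma iter_mult: "(D ^^ k) (f * g) = (\<Sum>i\<le>k. of_nat (k choose i) * (D ^^ i) f * (D ^^ (k - i)) g)"
proof (induction k)
  case (Suc k)
  let ?t = "\<lambda>i j. (D ^^ i) f * (D ^^ j) g"
  have D_const: "D (of_nat c * h) = of_nat c * D h" for c h by (simp add: D_mult)
  have "(D ^^ Suc k) (f * g) = (\<Sum>i\<le>k. of_nat (k choose i) * (?t (Suc i) (k - i) + ?t i (Suc k - i)))"
    unfolding funpow.simps comp_def Suc D_sum mult.assoc D_const
    by (intro sum.cong refl) (auto simp: D_mult Suc_diff_le)
  also have "\<dots> = (\<Sum>i\<le>k. of_nat (k choose i) * ?t (Suc i) (k - i)) + (\<Sum>i\<le>k. of_nat (k choose i) * ?t i (Suc k - i))"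
    by (simp add: distrib_left sum.distrib)
  also have "(\<Sum>i\<le>k. of_nat (k choose i) * ?t (Suc i) (k - i)) =
      (\<Sum>i\<le>Suc k. of_nat (if i = 0 then 0 else k choose (i - 1)) * ?t i (Suc k - i))"
    by (subst sum.atMost_Suc_shift) simp
  also have "(\<Sum>i\<le>k. of_nat (k choose i) * ?t i (Suc k - i)) =
      (\<Sum>i\<le>Suc k. of_nat (k choose i) * ?t i (Suc k - i))"
    by (simp add: binomial_eq_0)
  also have "(\<Sum>i\<le>Suc k. of_nat (if i = 0 then 0 else k choose (i - 1)) * ?t i (Suc k - i)) +
      (\<Sum>i\<le>Suc k. of_nat (k choose i) * ?t i (Suc k - i)) =
      (\<Sum>i\<le>Suc k. of_nat (Suc k choose i) * ?t i (Suc k - i))"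
    unfolding sum.distrib[symmetric]
    by (intro sum.cong refl) (auto simp: choose_reduce_nat algebra_simps)
  finally show ?case by (simp add: mult.assoc)
qed simp

end

lemma pdiff_superset:
  assumes "finite A" "Poly_Mapping.keys q \<subseteq> A"
  shows "pdiff v q = (\<Sum>m\<in>A. Poly_Mapping.single (m - Poly_Mapping.single v 1)
           (of_nat (Poly_Mapping.lookup m v) * Poly_Mapping.lookup q m))"
  unfolding pdiff_def using assms by (intro sum.mono_neutral_left) (auto simp: in_keys_iff)

lemma pdiff_add: "pdiff v (p + q) = pdiff v p + pdiff v q"
proof -
  let ?A = "Poly_Mapping.keys p \<union> Poly_Mapping.keys q"
  have "pdiff v r = (\<Sum>m\<in>?A. Poly_Mapping.single (m - Poly_Mapping.single v 1)
           (of_nat (Poly_Mapping.lookup m v) * Poly_Mapping.lookup r m))" if "r \<in> {p, q, p + q}" for r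
    by (rule pdiff_superset) (use that keys_add[of p q] in auto)
  then show ?thesis by (simp add: lookup_add distrib_left single_add sum.distrib)
qed

lemma pdiff_single: "pdiff v (Poly_Mapping.single m c) =
    Poly_Mapping.single (m - Poly_Mapping.single v 1) (of_nat (Poly_Mapping.lookup m v) * c)"
  using pdiff_superset[of "{m}" "Poly_Mapping.single m c" v] by (simp split: if_splits)

lemma pdiff_0 [simp]: "pdiff v 0 = 0"
  by (simp add: pdiff_def)

lemma pdiff_sum: "pdiff v (\<Sum>i\<in>A. f i) = (\<Sum>i\<in>A. pdiff v (f i))"
  by (induction A rule: infinite_finite_induct) (auto simp: pdiff_add)

lemma pdiff_mult_single:
  fixes a b :: "'k::comm_ring_1"
  shows "pdiff v (Poly_Mapping.single m a * Poly_Mapping.single m' b) =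
    pdiff v (Poly_Mapping.single m a) * Poly_Mapping.single m' b +
    Poly_Mapping.single m a * pdiff v (Poly_Mapping.single m' b)"
proof -
  \<comment> \<open>If \<open>v\<close> does not occur in \<open>m\<close>, the truncated difference
    is wrong but the coefficient is 0; otherwise the subtraction is exact.\<close>
  have shift: "Poly_Mapping.single (m + m' - Poly_Mapping.single v 1) (of_nat (Poly_Mapping.lookup m v) * c) =
      Poly_Mapping.single (m - Poly_Mapping.single v 1 + m') (of_nat (Poly_Mapping.lookup m v) * c)"
    for m m' :: "tvar \<Rightarrow>\<^sub>0 nat" and c :: 'k
  proof (cases "Poly_Mapping.lookup m v = 0")
    case False
    then have "m + m' - Poly_Mapping.single v 1 = m - Poly_Mapping.single v 1 + m'"
      by (intro poly_mapping_eqI) (auto simp: lookup_add lookup_minus lookup_single when_def)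
    then show ?thesis by simp
  qed simp
  show ?thesis
    unfolding pdiff_single mult_single lookup_add of_nat_add distrib_right single_add
    using shift[of m m' "a * b"] shift[of m' m "a * b"]
    by (simp add: ac_simps)
qed

lemma pdiff_mult: "pdiff v (p * q) = pdiff v p * q + p * pdiff v q"
proof -
  let ?s = "\<lambda>r m. Poly_Mapping.single m (Poly_Mapping.lookup r m)"
  have "pdiff v (p * q) = pdiff v ((\<Sum>m\<in>Poly_Mapping.keys p. ?s p m) * (\<Sum>m\<in>Poly_Mapping.keys q. ?s q m))"
    by (simp add: mpol_sum_single)
  also have "\<dots> = pdiff v (\<Sum>m\<in>Poly_Mapping.keys p. ?s p m) * (\<Sum>m\<in>Poly_Mapping.keys q. ?s q m) +
      (\<Sum>m\<in>Poly_Mapping.keys p. ?s p m) * pdiff v (\<Sum>m\<in>Poly_Mapping.keys q. ?s q m)"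
    by (simp add: sum_product pdiff_sum pdiff_mult_single sum.distrib)
  finally show ?thesis by (simp add: mpol_sum_single)
qed

lemma pdiff_Const [simp]: "pdiff v (Const c) = 0"
  by (simp add: Const_def pdiff_single)

lemma pdiff_Var: "pdiff v (Var w) = (if v = w then 1 else 0)"
  by (simp add: Var_def pdiff_single lookup_single when_def)

interpretation pdiff: ring_derivation "pdiff v"
  by standard (rule pdiff_add pdiff_mult)+

lemma finite_tri_vars [simp]: "finite (tri_vars n d)"
proof -
  have "tri_vars n d \<subseteq> (\<lambda>(i, j). TVar i j) ` ({0,1,2} \<times> (\<Union>i\<in>{0,1,2}. {1..n i})) \<union> SVar ` {1..d}"
    by (auto simp: tri_vars_def)
  then show ?thesis by (rule finite_subset) auto
qed

interpretation poly_der: ring_derivation "poly_der n d a"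
  by standard (auto simp: poly_der_def pdiff_add pdiff_mult algebra_simps sum.distrib sum_distrib_left sum_distrib_right)

lemma poly_der_Const [simp]: "poly_der n d a (Const c) = 0"
  by (simp add: poly_der_def)

lemma poly_der_Var: "poly_der n d a (Var v) = (if v \<in> tri_vars n d then a v else 0)"
proof -
  have "poly_der n d a (Var v) = (\<Sum>w\<in>tri_vars n d. if w = v then a w else 0)"
    unfolding poly_der_def by (intro sum.cong) (auto simp: pdiff_Var)
  then show ?thesis by simp
qed

section \<open>Locally nilpotent derivations modulo a prime element\<close>

locale mod_prime =
  fixes P :: "'a::idom"
  assumes P_prime: "prime_elem P"
begin

definition eqv :: "'a \<Rightarrow> 'a \<Rightarrow> bool" (infix "\<asymp>" 50) where
  "f \<asymp> g \<longleftrightarrow> P dvd f - g"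

lemma eqv_0: "f \<asymp> 0 \<longleftrightarrow> P dvd f"
  by (simp add: eqv_def)

lemma eqv_iff_diff: "f \<asymp> g \<longleftrightarrow> f - g \<asymp> 0"
  by (simp add: eqv_def)

lemma eqv_refl [simp]: "f \<asymp> f"
  by (simp add: eqv_def)

lemma eqv_sym: "f \<asymp> g \<Longrightarrow> g \<asymp> f"
  unfolding eqv_def by (metis dvd_minus_iff minus_diff_eq)

lemma eqv_trans [trans]: "f \<asymp> g \<Longrightarrow> g \<asymp> h \<Longrightarrow> f \<asymp> h"
  unfolding eqv_def by (metis diff_add_cancel dvd_add add_diff_eq)

lemma eqv_add: "f \<asymp> f' \<Longrightarrow> g \<asymp> g' \<Longrightarrow> f + g \<asymp> f' + g'"
  unfolding eqv_def by (metis add_diff_add dvd_add)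

lemma eqv_minus: "f \<asymp> f' \<Longrightarrow> - f \<asymp> - f'"
  unfolding eqv_def by (metis dvd_minus_iff minus_diff_minus)

lemma eqv_diff: "f \<asymp> f' \<Longrightarrow> g \<asymp> g' \<Longrightarrow> f - g \<asymp> f' - g'"
  using eqv_add[of f f' "- g" "- g'"] eqv_minus by simp

lemma eqv_mult: "f \<asymp> f' \<Longrightarrow> g \<asymp> g' \<Longrightarrow> f * g \<asymp> f' * g'"
proof -
  assume "f \<asymp> f'" "g \<asymp> g'"
  moreover have "f * g - f' * g' = (f - f') * g + f' * (g - g')" by (simp add: algebra_simps)
  ultimately show ?thesis unfolding eqv_def by (metis dvd_add dvd_mult dvd_mult2)
qed

lemma eqv_power: "f \<asymp> f' \<Longrightarrow> f ^ k \<asymp> f' ^ k"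
  by (induction k) (auto intro: eqv_mult)

lemma eqv_sum: "(\<And>i. i \<in> A \<Longrightarrow> f i \<asymp> g i) \<Longrightarrow> sum f A \<asymp> sum g A"
  by (induction A rule: infinite_finite_induct) (auto intro: eqv_add)

lemma eqv_sum_0: "(\<And>i. i \<in> A \<Longrightarrow> f i \<asymp> 0) \<Longrightarrow> sum f A \<asymp> 0"
  using eqv_sum[of A f "\<lambda>_. 0"] by simp

lemma eqv_0_cong: "f \<asymp> g \<Longrightarrow> f \<asymp> 0 \<longleftrightarrow> g \<asymp> 0"
  using eqv_sym eqv_trans by blast

lemma mult_eqv_0_iff: "f * g \<asymp> 0 \<longleftrightarrow> f \<asymp> 0 \<or> g \<asymp> 0"
  unfolding eqv_0 by (rule prime_elem_dvd_mult_iff[OF P_prime])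

lemma not_1_eqv_0 [simp]: "\<not> 1 \<asymp> 0"
  unfolding eqv_0 using P_prime by (simp add: prime_elem_def)

lemma power_eqv_0: "f ^ k \<asymp> 0 \<Longrightarrow> f \<asymp> 0"
  by (induction k) (auto simp: mult_eqv_0_iff)

lemma eqv_mult_cancel_left: "\<not> f \<asymp> 0 \<Longrightarrow> f * g \<asymp> f * h \<longleftrightarrow> g \<asymp> h"
  using mult_eqv_0_iff[of f "g - h"] by (simp add: eqv_iff_diff[of _ h] eqv_iff_diff[of _ "f * h"] right_diff_distrib)

lemma poly_eqv_0: "(\<And>i. coeff p i \<asymp> 0) \<Longrightarrow> poly p t \<asymp> 0"
  unfolding poly_altdef by (intro eqv_sum_0) (simp add: mult_eqv_0_iff)

lemma minus_eqv_0_iff [simp]: "- f \<asymp> 0 \<longleftrightarrow> f \<asymp> 0"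
  by (simp add: eqv_0)

lemma eqv_0_mult: "f \<asymp> 0 \<Longrightarrow> f * g \<asymp> 0" "g \<asymp> 0 \<Longrightarrow> f * g \<asymp> 0"
  by (simp_all add: mult_eqv_0_iff)

lemma eqv_0_add: "f \<asymp> 0 \<Longrightarrow> g \<asymp> 0 \<Longrightarrow> f + g \<asymp> 0"
  using eqv_add[of f 0 g 0] by simp

lemma eqv_0_diff: "f \<asymp> 0 \<Longrightarrow> g \<asymp> 0 \<Longrightarrow> f - g \<asymp> 0"
  using eqv_diff[of f 0 g 0] by simp

end

locale mod_derivation = mod_prime P + ring_derivation D for P :: "'a::idom" and D +
  assumes D_P: "P dvd D P" and not_of_nat_eqv_0: "k > 0 \<Longrightarrow> \<not> P dvd of_nat k"
begin

lemma D_cong: "f \<asymp> g \<Longrightarrow> D f \<asymp> D g"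
proof -
  assume "f \<asymp> g"
  then obtain q where "f - g = P * q" by (auto simp: eqv_def)
  then have "D f - D g = D P * q + P * D q" by (metis D_diff D_mult)
  then show ?thesis using D_P by (simp add: eqv_def)
qed

lemma D_eqv_0: "f \<asymp> 0 \<Longrightarrow> D f \<asymp> 0"
  using D_cong[of f 0] by simp

lemma iter_cong: "f \<asymp> g \<Longrightarrow> (D ^^ k) f \<asymp> (D ^^ k) g"
  by (induction k) (auto intro: D_cong)

lemma iter_eqv_0_mono: "(D ^^ k) f \<asymp> 0 \<Longrightarrow> k \<le> j \<Longrightarrow> (D ^^ j) f \<asymp> 0"
proof -
  assume "k \<le> j" "(D ^^ k) f \<asymp> 0"
  then show ?thesis by (induction j rule: dec_induct) (auto intro: D_eqv_0)
qed

lemma of_nat_mult_eqv_0: "of_nat k * f \<asymp> 0 \<Longrightarrow> k > 0 \<Longrightarrow> f \<asymp> 0"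
  unfolding mult_eqv_0_iff using not_of_nat_eqv_0[of k] by (auto simp: eqv_0)

lemma D_mult_ker: "D f \<asymp> 0 \<Longrightarrow> D (f * g) \<asymp> f * D g"
  unfolding D_mult using eqv_add[of "D f * g" 0 "f * D g" "f * D g"] by (simp add: eqv_0_mult)

lemma ker_mult: "D f \<asymp> 0 \<Longrightarrow> D g \<asymp> 0 \<Longrightarrow> D (f * g) \<asymp> 0"
  unfolding D_mult by (simp add: eqv_0_mult eqv_0_add)

lemma ker_add: "D f \<asymp> 0 \<Longrightarrow> D g \<asymp> 0 \<Longrightarrow> D (f + g) \<asymp> 0"
  unfolding D_add by (rule eqv_0_add)

lemma ker_power: "D f \<asymp> 0 \<Longrightarrow> D (f ^ k) \<asymp> 0"
  unfolding D_power by (simp add: eqv_0_mult)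

lemma D_poly:
  assumes "\<And>i. D (coeff p i) \<asymp> 0"
  shows "D (poly p t) \<asymp> poly (pderiv p) t * D t"
  using assms
proof (induction p)
  case (pCons a p)
  have "D a \<asymp> 0" using pCons.prems[of 0] by simp
  moreover have "D (poly p t) \<asymp> poly (pderiv p) t * D t"
    using pCons.prems[of "Suc _"] by (intro pCons.IH) simp
  ultimately have "D a + (D t * poly p t + t * D (poly p t)) \<asymp>
      0 + (D t * poly p t + t * (poly (pderiv p) t * D t))"
    by (intro eqv_add eqv_mult) auto
  then show ?case by (simp add: D_add D_mult pderiv_pCons algebra_simps)
qed simp

text \<open>An element moved by \<open>D\<close> is transcendental over the kernel. Applying
  \<open>D\<close> to a relation replaces \<open>p\<close> by its derivative times
  \<open>D t\<close>; the degree drops, and characteristic zero recovers the coefficients of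
  \<open>p\<close> from those of the derivative.\<close>

lemma coeffs_eqv_0_if_poly_eqv_0:
  assumes "\<And>i. D (coeff p i) \<asymp> 0" "\<not> D t \<asymp> 0" "poly p t \<asymp> 0"
  shows "coeff p i \<asymp> 0"
  using assms
proof (induction "degree p" arbitrary: p i rule: less_induct)
  case less
  show ?case
  proof (cases "degree p = 0")
    case True
    then obtain a where "p = [:a:]" by (rule degree_eq_zeroE)
    then show ?thesis using less.prems(3) by (auto simp: coeff_pCons split: nat.split)
  next
    case False
    have "D (poly p t) \<asymp> 0" using less.prems by (intro D_eqv_0)
    then have "poly (pderiv p) t \<asymp> 0"
      using D_poly[of p t] less.prems(1,2) eqv_0_cong mult_eqv_0_iff by blast
    moreover have "degree (pderiv p) < degree p"
      using False by (intro le_less_trans[OF degree_le[of "degree p - 1"]]) (auto simp: coeff_pderiv coeff_eq_0)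
    moreover have "D (coeff (pderiv p) j) \<asymp> 0" for j
      using less.prems(1)[of "Suc j"] unfolding coeff_pderiv D_mult D_of_nat by (simp add: eqv_0_mult)
    ultimately have "coeff (pderiv p) j \<asymp> 0" for j
      using less.hyps[of "pderiv p" j] less.prems(2) by blast
    then have coeff_Suc: "coeff p (Suc j) \<asymp> 0" for j
      unfolding coeff_pderiv using of_nat_mult_eqv_0[of "Suc j"] by blast
    show ?thesis
    proof (cases i)
      case 0
      obtain a q where p: "p = pCons a q" by (rule pCons_cases)
      have "poly q t \<asymp> 0"
        using coeff_Suc by (intro poly_eqv_0) (simp add: p)
      then have "a + t * poly q t - t * poly q t \<asymp> 0"
        using less.prems(3) p by (intro eqv_0_diff eqv_0_mult(2)) auto
      then show ?thesis using 0 p by simp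
    next
      case (Suc j)
      then show ?thesis using coeff_Suc by simp
    qed
  qed
qed

text \<open>Being killed means that the derivative of \<open>p\<close> vanishes at \<open>t\<close>,
  and by transcendence of \<open>t\<close> all coefficients of \<open>p\<close> except the constant
  one are then 0.\<close>

lemma poly_in_ker_eqv_coeff_0:
  assumes "\<And>i. D (coeff p i) \<asymp> 0" "\<not> D t \<asymp> 0" "D (poly p t) \<asymp> 0"
  shows "poly p t \<asymp> coeff p 0"
proof -
  have "poly (pderiv p) t \<asymp> 0"
    using D_poly[of p t] assms eqv_0_cong mult_eqv_0_iff by blast
  moreover have "D (coeff (pderiv p) j) \<asymp> 0" for j
    using assms(1)[of "Suc j"] unfolding coeff_pderiv D_mult D_of_nat by (simp add: eqv_0_mult)
  ultimately have "coeff (pderiv p) j \<asymp> 0" for j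
    using coeffs_eqv_0_if_poly_eqv_0[of "pderiv p" t j] assms(2) by blast
  then have Suc: "coeff p (Suc j) \<asymp> 0" for j
    unfolding coeff_pderiv using of_nat_mult_eqv_0[of "Suc j"] by blast
  obtain a q where p: "p = pCons a q" by (rule pCons_cases)
  have "poly q t \<asymp> 0"
    using Suc by (intro poly_eqv_0) (simp add: p)
  then have "a + t * poly q t \<asymp> a + t * 0" by (intro eqv_add eqv_mult) auto
  then show ?thesis by (simp add: p)
qed

end

locale mod_lnd = mod_derivation +
  assumes nilpotent: "\<exists>k. (D ^^ k) f \<asymp> 0"
begin

text \<open>The degree function of a locally nilpotent derivation, with the convention that 0 has
  degree 0 and not minus infinity; exact formulas for products therefore need nonzero
  factors.\<close>

definition deg :: "'a \<Rightarrow> nat" where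
  "deg f = (LEAST k. (D ^^ Suc k) f \<asymp> 0)"

lemma deg_le_iff: "deg f \<le> k \<longleftrightarrow> (D ^^ Suc k) f \<asymp> 0"
proof
  obtain j where "(D ^^ j) f \<asymp> 0" using nilpotent by blast
  then have "(D ^^ Suc j) f \<asymp> 0" by (rule iter_eqv_0_mono) simp
  then have *: "(D ^^ Suc (deg f)) f \<asymp> 0" unfolding deg_def by (rule LeastI)
  show "(D ^^ Suc k) f \<asymp> 0" if "deg f \<le> k"
    using * by (rule iter_eqv_0_mono) (use that in simp)
  show "deg f \<le> k" if "(D ^^ Suc k) f \<asymp> 0"
    unfolding deg_def using that by (rule Least_le)
qed

lemma iter_deg: "D ((D ^^ deg f) f) \<asymp> 0"
  using deg_le_iff[of f "deg f"] by simp

lemma iter_deg_not_eqv_0: "\<not> f \<asymp> 0 \<Longrightarrow> \<not> (D ^^ deg f) f \<asymp> 0"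
  using deg_le_iff[of f "deg f - 1"] by (cases "deg f") auto

lemma deg_eqI: "(D ^^ Suc k) f \<asymp> 0 \<Longrightarrow> \<not> (D ^^ k) f \<asymp> 0 \<Longrightarrow> deg f = k"
  using deg_le_iff[of f k] deg_le_iff[of f "k - 1"] by (cases k) (auto intro: le_antisym simp: not_le)

lemma deg_eq_0_iff: "deg f = 0 \<longleftrightarrow> D f \<asymp> 0"
  using deg_le_iff[of f 0] by simp

lemma deg_cong: "f \<asymp> g \<Longrightarrow> deg f = deg g"
  unfolding deg_def using iter_cong eqv_0_cong by metis

lemma deg_D: "\<not> D f \<asymp> 0 \<Longrightarrow> deg f = Suc (deg (D f))"
  using iter_deg[of "D f"] iter_deg_not_eqv_0[of "D f"]
  by (intro deg_eqI) (auto simp: funpow_swap1)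

lemma deg_add_le: "deg f \<le> k \<Longrightarrow> deg g \<le> k \<Longrightarrow> deg (f + g) \<le> k"
  unfolding deg_le_iff iter_add by (rule eqv_0_add)

lemma deg_minus: "deg (- f) = deg f"
proof -
  have "(D ^^ k) (- f) = - (D ^^ k) f" for k by (induction k) (auto simp: D_minus)
  then show ?thesis by (simp add: deg_def D_minus)
qed

lemma deg_diff_le: "deg f \<le> k \<Longrightarrow> deg g \<le> k \<Longrightarrow> deg (f - g) \<le> k"
  using deg_add_le[of f k "- g"] by (simp add: deg_minus)

text \<open>In the Leibniz formula of order \<open>deg f + deg g\<close> every term vanishes except
  the one with \<open>i = deg f\<close>. Its binomial coefficient is nonzero in characteristic zero
  and the other two factors are nonzero in a domain.\<close>

lemma deg_mult:
  assumes "\<not> f \<asymp> 0" "\<not> g \<asymp> 0"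
  shows "deg (f * g) = deg f + deg g"
proof (rule deg_eqI)
  let ?p = "deg f" and ?q = "deg g"
  have vanish: "(D ^^ i) f * (D ^^ j) g \<asymp> 0" if "i > ?p \<or> j > ?q" for i j
    using that iter_eqv_0_mono[OF deg_le_iff[THEN iffD1, OF order.refl], of f i]
      iter_eqv_0_mono[OF deg_le_iff[THEN iffD1, OF order.refl], of g j]
    unfolding mult_eqv_0_iff by (auto simp del: funpow.simps)
  have "of_nat (k choose i) * (D ^^ i) f * (D ^^ (k - i)) g \<asymp> 0" if "i > ?p \<or> k - i > ?q" for i k
    using eqv_0_mult(2)[OF vanish[OF that], of "of_nat (k choose i)"] by (simp add: mult.assoc)
  note van = this
  show "(D ^^ Suc (?p + ?q)) (f * g) \<asymp> 0"
    unfolding iter_mult by (rule eqv_sum_0, rule van) auto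
  have "(D ^^ (?p + ?q)) (f * g) \<asymp>
      (\<Sum>i\<le>?p + ?q. if i = ?p then of_nat ((?p + ?q) choose i) * (D ^^ i) f * (D ^^ (?p + ?q - i)) g else 0)"
    unfolding iter_mult by (rule eqv_sum) (auto intro!: van)
  also have "\<dots> = of_nat ((?p + ?q) choose ?p) * ((D ^^ ?p) f * (D ^^ ?q) g)"
    by (simp add: mult.assoc)
  finally have "(D ^^ (?p + ?q)) (f * g) \<asymp> of_nat ((?p + ?q) choose ?p) * ((D ^^ ?p) f * (D ^^ ?q) g)" .
  moreover have "\<not> of_nat ((?p + ?q) choose ?p) * ((D ^^ ?p) f * (D ^^ ?q) g) \<asymp> 0"
    using of_nat_mult_eqv_0[of "(?p + ?q) choose ?p" "(D ^^ ?p) f * (D ^^ ?q) g"]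
      mult_eqv_0_iff[of "(D ^^ ?p) f" "(D ^^ ?q) g"]
      iter_deg_not_eqv_0[OF assms(1)] iter_deg_not_eqv_0[OF assms(2)] by auto
  ultimately show "\<not> (D ^^ (?p + ?q)) (f * g) \<asymp> 0" using eqv_0_cong by blast
qed

lemma deg_power: "\<not> f \<asymp> 0 \<Longrightarrow> deg (f ^ k) = k * deg f"
proof (induction k)
  case (Suc k)
  then show ?case using deg_mult[of f "f ^ k"] power_eqv_0 by auto
qed (simp add: deg_eq_0_iff)

text \<open>The kernel is factorially closed, since degrees are nonnegative and add.\<close>

lemma ker_factor:
  assumes "D (f * g) \<asymp> 0" "\<not> f * g \<asymp> 0"
  shows "D f \<asymp> 0" "D g \<asymp> 0"
proof -
  have "\<not> f \<asymp> 0" "\<not> g \<asymp> 0" using assms(2) by (auto simp: mult_eqv_0_iff)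
  then show "D f \<asymp> 0" "D g \<asymp> 0" using deg_mult[of f g] assms(1) by (auto simp flip: deg_eq_0_iff)
qed

text \<open>Otherwise \<open>D f\<close> would have degree \<open>deg f + deg q\<close>, whereas
  applying \<open>D\<close> to an element that is not killed lowers the degree by one.\<close>

lemma ker_if_dvd_D:
  assumes "D f \<asymp> f * q"
  shows "D f \<asymp> 0"
proof (rule ccontr)
  assume not: "\<not> D f \<asymp> 0"
  then have "\<not> f * q \<asymp> 0" using assms eqv_0_cong by blast
  then have "\<not> f \<asymp> 0" "\<not> q \<asymp> 0" by (auto simp: mult_eqv_0_iff)
  then have "deg (D f) = deg f + deg q" using deg_mult deg_cong[OF assms] by simp
  then show False using deg_D[OF not] by simp
qed

text \<open>A local slice is found among the iterates of \<open>f\<close>: the last one that is not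
  killed.\<close>

lemma exists_slice:
  assumes "\<not> D f \<asymp> 0"
  obtains r where "\<not> D r \<asymp> 0" "D (D r) \<asymp> 0"
proof -
  have f: "\<not> f \<asymp> 0" using assms D_eqv_0 by blast
  obtain k where k: "deg f = Suc k" using assms deg_eq_0_iff[of f] by (cases "deg f") auto
  show ?thesis
    using that[of "(D ^^ k) f"] iter_deg[of f] iter_deg_not_eqv_0[OF f] by (simp add: k)
qed

end

section \<open>Primality of trinomials\<close>

lemma fps_compose_X_power_nth:
  fixes h :: "'a::comm_ring_1 fps"
  assumes "c > 0"
  shows "fps_nth (h oo fps_X ^ c) k = (if c dvd k then fps_nth h (k div c) else 0)"
proof -
  have "fps_nth (h oo fps_X ^ c) k = (\<Sum>i = 0..k. if k = c * i then fps_nth h i else 0)"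
    unfolding fps_compose_nth power_mult[symmetric] by (intro sum.cong) (auto simp: fps_X_power_nth)
  also have "\<dots> = (\<Sum>i = 0..k. if i = k div c then (if c dvd k then fps_nth h (k div c) else 0) else 0)"
    using assms by (intro sum.cong) auto
  finally show ?thesis by (simp add: div_le_dividend)
qed

lemma sum_compose_X_power_eq_0:
  fixes h :: "nat \<Rightarrow> 'a::comm_ring_1 fps"
  assumes "c > 0" and "(\<Sum>i<c. (h i oo fps_X ^ c) * fps_X ^ i) = 0" and "i < c"
  shows "h i = 0"
proof (rule fps_ext)
  fix k
  have "fps_nth ((h j oo fps_X ^ c) * fps_X ^ j) (c * k + i) = (if j = i then fps_nth (h i) k else 0)"
    if "j < c" for j
  proof -
    have "j = i" if le: "j \<le> c * k + i" and dvd: "c dvd c * k + i - j"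
    proof -
      obtain m where "c * k + i - j = c * m" using dvd by (elim dvdE)
      then have "c * k + i = j + c * m" using le by linarith
      then have "(c * k + i) mod c = (j + c * m) mod c" by simp
      then show "j = i" using \<open>j < c\<close> \<open>i < c\<close> by simp
    qed
    then show ?thesis using assms(1,3)
      by (auto simp: fps_X_power_mult_right_nth fps_compose_X_power_nth)
  qed
  then have "fps_nth (\<Sum>j<c. (h j oo fps_X ^ c) * fps_X ^ j) (c * k + i) = fps_nth (h i) k"
    using \<open>i < c\<close> by (simp add: fps_sum_nth)
  then show "fps_nth (h i) k = fps_nth 0 k" using assms(2) by simp
qed

text \<open>The series is in fact a polynomial, the expansion of \<open>q\<close> around
  \<open>y0\<close> in the direction of \<open>y\<close>; evaluating it at \<open>t y - y0\<close>
  returns the point \<open>t\<close>.\<close>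

lemma eval_at_eq_0_if_fps_eq_0:
  fixes q :: "'k::field_char_0 mpol"
  assumes "psubst fps_const (\<lambda>v. if v = y then fps_const y0 + fps_X else fps_const (t v)) q = 0"
  shows "eval_at t q = 0"
proof -
  define p where "p = psubst (\<lambda>c. [:c:]) (\<lambda>v. if v = y then [:y0, 1:] else [:t v:]) q"
  have lin: "fps_of_poly [:y0, 1:] = fps_const y0 + fps_X" by (simp add: fps_of_poly_linear add.commute)
  have "fps_of_poly p = psubst fps_const (\<lambda>v. if v = y then fps_const y0 + fps_X else fps_const (t v)) q"
    unfolding p_def by (induction q rule: mpol_induct)
      (auto simp: poly_const_hom.psubst_simps fps_const_hom.psubst_simps fps_of_poly_add fps_of_poly_mult
          fps_of_poly_const lin)
  then have "p = 0" using assms fps_of_poly_eq_iff[of p 0] by simp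
  moreover have "poly p (t y - y0) = eval_at t q"
    unfolding p_def by (induction q rule: mpol_induct)
      (auto simp: poly_const_hom.psubst_simps id_hom.psubst_simps eval_at_psubst)
  ultimately show ?thesis by simp
qed

text \<open>For a fixed value of the variables other than \<open>y\<close> and \<open>z\<close>, the curve \<open>A + B y\<^sup>b + C z\<^sup>c = 0\<close>
  has, at a point with \<open>z = 0\<close>, a branch \<open>y = y0 + \<epsilon>\<^sup>c\<close>, \<open>z = \<epsilon> \<cdot> unit(\<epsilon>\<^sup>c)\<close>.  A polynomial of degree
  less than \<open>c\<close> in \<open>z\<close> that vanishes on the branch vanishes identically, since the exponents of its terms
  lie in different classes modulo \<open>c\<close>.\<close>

lemma exists_branch:
  fixes U V W :: "'k::{alg_closed_field, field_char_0}"
  assumes "U \<noteq> 0" "V \<noteq> 0" "W \<noteq> 0" "b > 0" "c > 0"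
  obtains y0 R where "fps_const U + fps_const V * (fps_const y0 + fps_X ^ c) ^ b +
      fps_const W * ((R oo fps_X ^ c) * fps_X) ^ c = 0" "R \<noteq> 0"
proof -
  obtain y0 where y0: "y0 ^ b = - U / V" using nth_root_exists[OF \<open>b > 0\<close>] by blast
  then have "y0 \<noteq> 0" using assms by (auto simp: zero_power_eq split: if_splits)
  \<comment> \<open>This is the quotient of \<open>(y0 + X)^b - y0^b\<close> by \<open>X\<close>.
    Its constant term is \<open>b y0^(b-1)\<close>, nonzero in characteristic zero, so that a power
    series \<open>c\<close>-th root of its multiple \<open>H\<close> exists.\<close>
  define H' where "H' = (\<Sum>i<b. fps_const y0 ^ (b - Suc i) * (fps_const y0 + fps_X) ^ i)"
  define H where "H = fps_const (- V / W) * H'"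
  have H': "(fps_const y0 + fps_X) ^ b - fps_const y0 ^ b = fps_X * H'"
    unfolding H'_def by (subst power_diff_sumr2) simp
  have "fps_nth H' 0 = (\<Sum>i<b. y0 ^ (b - Suc i) * y0 ^ i)"
    by (simp add: H'_def fps_sum_nth fps_nth_power_0)
  also have "\<dots> = (\<Sum>i<b. y0 ^ (b - 1))"
    by (intro sum.cong) (auto simp flip: power_add)
  finally have H0: "fps_nth H 0 \<noteq> 0" using assms \<open>y0 \<noteq> 0\<close> by (simp add: H_def)
  obtain k where k: "c = Suc k" using \<open>c > 0\<close> by (cases c) auto
  obtain r0 where r0: "r0 ^ c = fps_nth H 0" using nth_root_exists[OF \<open>c > 0\<close>] by blast
  \<comment> \<open>The radical asks for a function extracting a root of the constant coefficient;
    the constant function returns the root already chosen.\<close>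
  define R where "R = fps_radical (\<lambda>_ _. r0) c H"
  have R: "R ^ c = H" unfolding R_def k using r0 power_radical[OF H0, of "\<lambda>_ _. r0" k] by (simp add: k)
  have "fps_const U + fps_const V * (fps_const y0 + fps_X) ^ b + fps_const W * (R ^ c * fps_X) =
      fps_const (U + V * y0 ^ b) + fps_const V * fps_X * H' + fps_const W * fps_const (- V / W) * H' * fps_X"
    using H' unfolding R H_def diff_eq_eq by (simp add: algebra_simps)
  also have "\<dots> = fps_const (U + V * y0 ^ b) + fps_const (V + W * (- V / W)) * (fps_X * H')"
    by (simp only: fps_const_add[symmetric] fps_const_mult[symmetric]) (simp only: algebra_simps)
  also have "\<dots> = 0" using y0 assms by simp
  finally have eq: "fps_const U + fps_const V * (fps_const y0 + fps_X) ^ b + fps_const W * (R ^ c * fps_X) = 0" .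
  have Xc: "fps_nth (fps_X ^ c :: 'k fps) 0 = 0" using \<open>c > 0\<close> by (simp add: fps_X_power_nth del: fps_nth_power_0)
  have XX: "fps_X oo (fps_X ^ c) = (fps_X ^ c :: 'k fps)" 
      using \<open>c > 0\<close> by (intro fps_ext) (simp add: fps_X_fps_compose)
  from eq have "(fps_const U + fps_const V * (fps_const y0 + fps_X) ^ b + fps_const W * (R ^ c * fps_X)) oo fps_X ^ c = 0"
    by simp
  then have "fps_const U + fps_const V * (fps_const y0 + fps_X ^ c) ^ b +
      fps_const W * ((R oo fps_X ^ c) ^ c * fps_X ^ c) = 0"
    by (simp add: fps_compose_add_distrib fps_compose_mult_distrib[OF Xc] XX flip: fps_compose_power[OF Xc])
  moreover have "R \<noteq> 0" using R H0 \<open>c > 0\<close> by auto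
  ultimately show ?thesis using that by (simp add: power_mult_distrib)
qed

text \<open>After multiplication by a power of \<open>C\<close>, each polynomial is congruent to one
  of degree less than \<open>c\<close> in \<open>z\<close>. If the trinomial divides a product, the
  reduced factors vanish alternately at all points with nonzero coordinates, so their product is the
  zero polynomial and one of them is 0. The power of \<open>C\<close> is then removed by
  \<open>cancel\<close>.\<close>

lemma prime_elem_trinomial:
  fixes A B C :: "'k::{alg_closed_field, field_char_0} mpol"
  assumes "y \<noteq> z" "b > 0" "c > 0"
    and vars: "pvars A \<inter> {y, z} = {}" "pvars B \<inter> {y, z} = {}" "pvars C \<inter> {y, z} = {}"
    and nonzero: "\<And>t. (\<forall>v. t v \<noteq> 0) \<Longrightarrow> eval_at t A \<noteq> 0 \<and> eval_at t B \<noteq> 0 \<and> eval_at t C \<noteq> 0"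
    and cancel: "\<And>f. A + B * Var y ^ b + C * Var z ^ c dvd C * f \<Longrightarrow> A + B * Var y ^ b + C * Var z ^ c dvd f"
  shows "prime_elem (A + B * Var y ^ b + C * Var z ^ c)"
proof -
  define P where "P = A + B * Var y ^ b + C * Var z ^ c"
  define red where "red g = (\<Sum>i<c. g i * Var z ^ i)" for g :: "nat \<Rightarrow> 'k mpol"
  \<comment> \<open>The conclusion concerns \<open>t\<close> itself, which need not lie on the
    hypersurface: vanishing along the branch forces each coefficient with respect to
    \<open>z\<close> to vanish for every value of \<open>y\<close>, the other coordinates being
    those of \<open>t\<close>.\<close>
  have red_point: "eval_at t (red g) = 0 \<or> eval_at t (red h) = 0"
    if t: "\<forall>v. t v \<noteq> 0" and dvd_red: "P dvd red g * red h"
      and red_vars: "\<And>i. z \<notin> pvars (g i)" "\<And>i. z \<notin> pvars (h i)" for g h t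
  proof -
    obtain y0 R where br: "fps_const (eval_at t A) + fps_const (eval_at t B) * (fps_const y0 + fps_X ^ c) ^ b +
        fps_const (eval_at t C) * ((R oo fps_X ^ c) * fps_X) ^ c = 0" "R \<noteq> 0"
      using exists_branch[of "eval_at t A" "eval_at t B" "eval_at t C" b c] nonzero[OF t] assms(2,3) by metis
    have Xc: "fps_nth (fps_X ^ c :: 'k fps) 0 = 0" using \<open>c > 0\<close> by (simp add: fps_X_power_nth del: fps_nth_power_0)
    have XX: "fps_X oo (fps_X ^ c) = (fps_X ^ c :: 'k fps)" 
      using \<open>c > 0\<close> by (intro fps_ext) (simp add: fps_X_fps_compose)
    define \<sigma> where "\<sigma> v = (if v = z then (R oo fps_X ^ c) * fps_X else
       if v = y then fps_const y0 + fps_X ^ c else fps_const (t v))" for v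
    define \<tau> where "\<tau> = (\<lambda>v. if v = y then fps_const y0 + fps_X else fps_const (t v))"
    have const: "psubst fps_const \<sigma> q = fps_const (eval_at t q)" if "pvars q \<inter> {y, z} = {}" for q
    proof -
      have "psubst fps_const \<sigma> q = psubst fps_const (\<lambda>v. fps_const (t v)) q"
        using that by (intro psubst_cong) (auto simp: \<sigma>_def)
      also have "\<dots> = fps_const (eval_at t q)"
        by (induction q rule: mpol_induct)
          (auto simp: fps_const_hom.psubst_simps id_hom.psubst_simps eval_at_psubst)
      finally show ?thesis .
    qed
    have compose: "psubst fps_const \<sigma> q = psubst fps_const \<tau> q oo fps_X ^ c" if "z \<notin> pvars q" for q
    proof -
      have "psubst fps_const \<sigma> q = psubst fps_const (\<lambda>v. \<tau> v oo fps_X ^ c) q"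
        using that by (intro psubst_cong) (auto simp: \<sigma>_def \<tau>_def fps_compose_add_distrib XX)
      also have "\<dots> = psubst fps_const \<tau> q oo fps_X ^ c"
        by (induction q rule: mpol_induct)
          (auto simp: fps_const_hom.psubst_simps fps_compose_add_distrib fps_compose_mult_distrib[OF Xc])
      finally show ?thesis .
    qed
    have P: "psubst fps_const \<sigma> P = 0"
      using br(1) \<open>y \<noteq> z\<close> vars by (simp add: P_def fps_const_hom.psubst_simps const \<sigma>_def[of y] \<sigma>_def[of z])
    have vanish: "eval_at t (red g) = 0"
      if "psubst fps_const \<sigma> (red g) = 0" "\<And>i. z \<notin> pvars (g i)" for g
    proof -
      have "psubst fps_const \<sigma> (red g) =
          (\<Sum>i<c. ((psubst fps_const \<tau> (g i) * R ^ i) oo fps_X ^ c) * fps_X ^ i)"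
        using that(2) \<open>y \<noteq> z\<close> by (simp add: red_def fps_const_hom.psubst_simps compose \<sigma>_def[of z]
            fps_compose_mult_distrib[OF Xc] power_mult_distrib mult.assoc flip: fps_compose_power[OF Xc])
      then have "psubst fps_const \<tau> (g i) * R ^ i = 0" if "i < c" for i
        using sum_compose_X_power_eq_0[OF \<open>c > 0\<close> _ that, of "\<lambda>i. psubst fps_const \<tau> (g i) * R ^ i"]
          \<open>psubst fps_const \<sigma> (red g) = 0\<close> by simp
      then have "eval_at t (g i) = 0" if "i < c" for i
        using that br(2) by (intro eval_at_eq_0_if_fps_eq_0[of y y0]) (simp flip: \<tau>_def)
      then show ?thesis by (simp add: red_def eval_at_psubst id_hom.psubst_simps)
    qed
    obtain k where "red g * red h = P * k" using dvd_red by (elim dvdE)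
    then have "psubst fps_const \<sigma> (red g) * psubst fps_const \<sigma> (red h) = 0"
      using P by (metis fps_const_hom.psubst_mult mult_zero_left)
    then show ?thesis using vanish red_vars by auto
  qed
  have cancel_pow: "P dvd f" if "P dvd C ^ N * f" for N f
    using that
  proof (induction N)
    case (Suc N)
    then have "P dvd C * (C ^ N * f)" by (simp add: mult.assoc)
    then show ?case using Suc.IH cancel unfolding P_def by blast
  qed simp
  have red_ex: "\<exists>N g. (\<forall>i. z \<notin> pvars (g i)) \<and> P dvd C ^ N * f - red g" for f
  proof -
    define S where "S f \<longleftrightarrow> (\<exists>N g. (\<forall>i. z \<notin> pvars (g i)) \<and> P dvd C ^ N * f - red g)" for f
    have S_add: "S (f + g)" if S: "S f" "S g" for f g
    proof -
      obtain N g1 M h1 where g1: "\<forall>i. z \<notin> pvars (g1 i)" "P dvd C ^ N * f - red g1"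
        and h1: "\<forall>i. z \<notin> pvars (h1 i)" "P dvd C ^ M * g - red h1"
        using S unfolding S_def by blast
      define k where "k i = C ^ M * g1 i + C ^ N * h1 i" for i
      have "C ^ (N + M) * (f + g) - red k = C ^ M * (C ^ N * f - red g1) + C ^ N * (C ^ M * g - red h1)"
        by (simp add: red_def k_def power_add algebra_simps sum.distrib sum_distrib_left)
      moreover have "z \<notin> pvars (k i)" for i
        unfolding k_def using g1(1) h1(1) vars by (intro notin_pvars) auto
      ultimately show ?thesis unfolding S_def using g1(2) h1(2)
        by (intro exI[of _ "N + M"] exI[of _ k]) (auto intro!: dvd_add dvd_mult)
    qed
    have S_term: "S (h * Var z ^ i)" if h: "z \<notin> pvars h" for h i
    proof -
      define q r where "q = i div c" and "r = i mod c"
      have i: "i = c * q + r" by (simp add: q_def r_def)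
      have "r < c" using \<open>c > 0\<close> by (simp add: r_def)
      define g where "g j = (if j = r then h * (- (A + B * Var y ^ b)) ^ q else 0)" for j
      have "P dvd C * Var z ^ c - (- (A + B * Var y ^ b))" by (simp add: P_def algebra_simps)
      then have "P dvd (C * Var z ^ c) ^ q - (- (A + B * Var y ^ b)) ^ q"
        by (metis dvd_mult2 power_diff_sumr2)
      moreover have "red g = h * (- (A + B * Var y ^ b)) ^ q * Var z ^ r"
      proof -
        have "red g = (\<Sum>j<c. if j = r then h * (- (A + B * Var y ^ b)) ^ q * Var z ^ j else 0)"
          unfolding red_def g_def by (intro sum.cong) auto
        then show ?thesis using \<open>r < c\<close> by simp
      qed
      then have "C ^ q * (h * Var z ^ i) - red g =
          ((C * Var z ^ c) ^ q - (- (A + B * Var y ^ b)) ^ q) * (h * Var z ^ r)"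
        by (simp only: i power_add power_mult power_mult_distrib left_diff_distrib right_diff_distrib mult_ac)
      moreover have "z \<notin> pvars (g j)" for j
      proof -
        have "z \<notin> pvars (- (A + B * Var y ^ b))"
          using vars \<open>y \<noteq> z\<close> unfolding pvars_minus by (intro notin_pvars) auto
        then show ?thesis using h unfolding g_def by (cases "j = r") (simp_all add: notin_pvars)
      qed
      ultimately show ?thesis unfolding S_def by (intro exI[of _ q] exI[of _ g]) (simp add: dvd_mult2)
    qed
    have S_sum: "S (\<Sum>i<N. h i * Var z ^ i)" if "\<And>i. z \<notin> pvars (h i)" for h and N :: nat
    proof (induction N)
      case 0
      show ?case using S_term[of 0 0] by simp
    next
      case (Suc N)
      then show ?case unfolding sum.lessThan_Suc by (intro S_add S_term that)
    qed
    obtain N where "\<forall>m\<in>Poly_Mapping.keys f. Poly_Mapping.lookup m z < N"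
      using vcoeff_bound by blast
    then have "f = (\<Sum>i<N. vcoeff z i f * Var z ^ i)" by (intro vcoeff_expansion) auto
    moreover have "S (\<Sum>i<N. vcoeff z i f * Var z ^ i)"
      using pvars_vcoeff[of z _ f] by (intro S_sum) auto
    ultimately show ?thesis unfolding S_def by simp
  qed
  have "prime_elem P"
  proof (rule prime_elemI)
    show "P \<noteq> 0"
    proof
      assume "P = 0"
      \<comment> \<open>Changing \<open>z\<close> from 1 to 0 changes the value of \<open>P\<close>
        by the value of \<open>C\<close>.\<close>
      define t s where "t = (\<lambda>_. 1 :: 'k)" and "s = t(z := 0)"
      have "eval_at s q = eval_at t q" if "z \<notin> pvars q" for q
        unfolding eval_at_psubst s_def using that by (intro psubst_cong) auto
      then have "eval_at t P - eval_at s P = eval_at t C"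
        using vars assms(1,3) by (simp add: P_def eval_at_psubst id_hom.psubst_simps s_def t_def zero_power)
      moreover have "eval_at t C \<noteq> 0" using nonzero[of t] by (simp add: t_def)
      ultimately show False using \<open>P = 0\<close> by (simp add: eval_at_psubst)
    qed
    show "\<not> P dvd 1"
    proof
      assume "P dvd 1"
      have "red (\<lambda>i. if i = 0 then 1 else 0) = (\<Sum>i<c. if i = 0 then 1 else 0)"
        unfolding red_def by (intro sum.cong) auto
      then have "red (\<lambda>i. if i = 0 then 1 else 0) = 1" using \<open>c > 0\<close> by simp
      then have "eval_at (\<lambda>_. 1) (1 :: 'k mpol) = 0"
        using red_point[of "\<lambda>_. 1" "\<lambda>i. if i = 0 then 1 else 0" "\<lambda>i. if i = 0 then 1 else 0"] \<open>P dvd 1\<close>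
        by simp
      then show False by (simp add: eval_at_psubst)
    qed
  next
    fix f g assume "P dvd f * g"
    obtain N f1 where f1: "\<And>i. z \<notin> pvars (f1 i)" "P dvd C ^ N * f - red f1" using red_ex by blast
    obtain M g1 where g1: "\<And>i. z \<notin> pvars (g1 i)" "P dvd C ^ M * g - red g1" using red_ex by blast
    have "red f1 * red g1 = C ^ (N + M) * (f * g) - (C ^ N * f - red f1) * (C ^ M * g) - red f1 * (C ^ M * g - red g1)"
      by (simp add: power_add algebra_simps)
    then have "P dvd red f1 * red g1"
      using \<open>P dvd f * g\<close> f1(2) g1(2) by (metis dvd_diff dvd_mult dvd_mult2)
    then have "eval_at t (red f1 * red g1) = 0" if "\<forall>v. t v \<noteq> 0" for t
      using red_point[OF that _ f1(1) g1(1)] by (auto simp: eval_at_psubst id_hom.psubst_simps)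
    then have "red f1 * red g1 = 0" by (rule mpol_eq_0_if_vanishing)
    then show "P dvd f \<or> P dvd g"
      using f1(2) g1(2) cancel_pow[of N f] cancel_pow[of M g] by auto
  qed
  then show ?thesis by (simp add: P_def)
qed

section \<open>The trinomial algebra as polynomials modulo the trinomial\<close>

lemma mpol_ring_simps [simp]:
  "x \<otimes>\<^bsub>mpol_ring V\<^esub> y = x * y" "x \<oplus>\<^bsub>mpol_ring V\<^esub> y = x + y" "\<zero>\<^bsub>mpol_ring V\<^esub> = 0" "\<one>\<^bsub>mpol_ring V\<^esub> = 1"
  by (simp_all add: mpol_ring_def)

lemma carrier_mpol_ring_intros [intro]:
  "p \<in> carrier (mpol_ring V) \<Longrightarrow> q \<in> carrier (mpol_ring V) \<Longrightarrow> p + q \<in> carrier (mpol_ring V)"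
  "p \<in> carrier (mpol_ring V) \<Longrightarrow> q \<in> carrier (mpol_ring V) \<Longrightarrow> p - q \<in> carrier (mpol_ring V)"
  "p \<in> carrier (mpol_ring V) \<Longrightarrow> q \<in> carrier (mpol_ring V) \<Longrightarrow> p * q \<in> carrier (mpol_ring V)"
  "p \<in> carrier (mpol_ring V) \<Longrightarrow> - p \<in> carrier (mpol_ring V)"
  "p \<in> carrier (mpol_ring V) \<Longrightarrow> p ^ k \<in> carrier (mpol_ring V)"
  "Const a \<in> carrier (mpol_ring V)" "0 \<in> carrier (mpol_ring V)" "1 \<in> carrier (mpol_ring V)"
  "v \<in> V \<Longrightarrow> (Var v :: 'k::comm_ring_1 mpol) \<in> carrier (mpol_ring V)"
  using pvars_add[of p q] pvars_diff[of p q] pvars_mult[of p q] pvars_power[of p k]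
  by (auto simp: carrier_mpol_ring)

lemma carrier_mpol_ring_sum:
  "(\<And>i. i \<in> A \<Longrightarrow> f i \<in> carrier (mpol_ring V)) \<Longrightarrow> (\<Sum>i\<in>A. f i) \<in> carrier (mpol_ring V)"
  by (simp add: carrier_mpol_ring pvars_sum)

lemma carrier_mpol_ring_prod:
  "(\<And>i. i \<in> A \<Longrightarrow> f i \<in> carrier (mpol_ring V)) \<Longrightarrow> (\<Prod>i\<in>A. f i) \<in> carrier (mpol_ring V)"
  by (simp add: carrier_mpol_ring pvars_prod)

lemma cring_mpol_ring: "cring (mpol_ring V :: 'k::comm_ring_1 mpol ring)"
proof (rule cringI)
  show "abelian_group (mpol_ring V :: 'k mpol ring)"
  proof (rule abelian_groupI)
    fix q :: "'k mpol" assume "q \<in> carrier (mpol_ring V)"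
    then show "\<exists>r\<in>carrier (mpol_ring V). r \<oplus>\<^bsub>mpol_ring V\<^esub> q = \<zero>\<^bsub>mpol_ring V\<^esub>"
      by (intro bexI[of _ "- q"]) auto
  qed (auto simp: add_ac)
  show "comm_monoid (mpol_ring V :: 'k mpol ring)"
    by (rule comm_monoidI) (auto simp: mult_ac)
qed (auto simp: distrib_right)

lemma mpol_ring_minus [simp]:
  assumes "p \<in> carrier (mpol_ring V)" "q \<in> carrier (mpol_ring V)"
  shows "\<ominus>\<^bsub>mpol_ring V\<^esub> p = - p" "p \<ominus>\<^bsub>mpol_ring V\<^esub> q = p - q"
proof -
  interpret cring "mpol_ring V" by (rule cring_mpol_ring)
  have *: "\<ominus>\<^bsub>mpol_ring V\<^esub> p = - p" if "p \<in> carrier (mpol_ring V)" for p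
    using that by (intro minus_equality) auto
  show "\<ominus>\<^bsub>mpol_ring V\<^esub> p = - p" "p \<ominus>\<^bsub>mpol_ring V\<^esub> q = p - q"
    using assms by (simp_all add: a_minus_def *)
qed

locale trinomial =
  fixes n :: "nat \<Rightarrow> nat" and l :: "nat \<Rightarrow> nat \<Rightarrow> nat" and d :: nat
    and im :: "'k::{alg_closed_field, field_char_0}"
  assumes n_pos: "\<And>i. i \<in> {0,1,2} \<Longrightarrow> n i \<ge> 1"
    and l_pos: "\<And>i j. i \<in> {0,1,2} \<Longrightarrow> j \<in> {1..n i} \<Longrightarrow> l i j \<ge> 1"
    and im: "im ^ 2 = -1"
begin

abbreviation "V \<equiv> tri_vars n d"
abbreviation Car :: "'k mpol set" where "Car \<equiv> carrier (mpol_ring V)"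
abbreviation R :: "'k mpol set ring" where "R \<equiv> tri_alg n l d"
abbreviation I :: "'k mpol set" where "I \<equiv> tri_ideal n l d"
abbreviation cl :: "'k mpol \<Rightarrow> 'k mpol set" where "cl \<equiv> cls n l d"

definition P :: "'k mpol" where
  "P = tri_mon n l 0 1 + tri_mon n l 1 1 + tri_mon n l 2 1"

lemma TVar_in_V: "TVar i j \<in> V \<longleftrightarrow> i \<in> {0,1,2} \<and> j \<in> {1..n i}"
  and SVar_in_V: "SVar k \<in> V \<longleftrightarrow> k \<in> {1..d}"
  by (auto simp: tri_vars_def)

lemma tri_mon_Car: "i \<in> {0,1,2} \<Longrightarrow> tri_mon n l i \<alpha> \<in> Car"
  unfolding tri_mon_def by (intro carrier_mpol_ring_prod carrier_mpol_ring_intros) (auto simp: TVar_in_V)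

lemma P_Car: "P \<in> Car"
  unfolding P_def by (intro carrier_mpol_ring_intros tri_mon_Car) auto

text \<open>The quotient could a priori contain variables outside \<open>V\<close>; setting these to
  0 does not change \<open>f\<close> and \<open>g\<close>.\<close>

lemma dvd_Car:
  assumes "g \<in> Car" "f \<in> Car" "g dvd f"
  obtains q where "q \<in> Car" "f = g * q"
proof -
  obtain q where q: "f = g * q" using assms by (elim dvdE)
  define \<pi> :: "'k mpol \<Rightarrow> 'k mpol" where "\<pi> = psubst Const (\<lambda>v. if v \<in> V then Var v else 0)"
  have "\<pi> h = h" if "h \<in> Car" for h
  proof -
    have "\<pi> h = psubst Const Var h"
      unfolding \<pi>_def using that by (intro psubst_cong) (auto simp: carrier_mpol_ring)
    then show ?thesis by simp
  qed
  moreover have "\<pi> f = \<pi> g * \<pi> q" unfolding q \<pi>_def by (rule Const_hom.psubst_mult)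
  ultimately have "f = g * \<pi> q" using assms by simp
  moreover have "pvars (\<pi> q) \<subseteq> V" unfolding \<pi>_def by (rule pvars_psubst) auto
  ultimately show ?thesis using that by (auto simp: carrier_mpol_ring)
qed

lemma I_eq: "I = {f \<in> Car. P dvd f}"
proof -
  interpret cring "mpol_ring V :: 'k mpol ring" by (rule cring_mpol_ring)
  have "I = {x * P | x. x \<in> Car}"
    using cgenideal_eq_genideal[OF P_Car] by (simp add: tri_ideal_def cgenideal_def P_def)
  also have "\<dots> = {f \<in> Car. P dvd f}"
  proof (intro equalityI subsetI)
    fix f assume "f \<in> {f \<in> Car. P dvd f}"
    then obtain q where "q \<in> Car" "f = P * q" using dvd_Car[OF P_Car, of f] by blast
    then show "f \<in> {x * P | x. x \<in> Car}" by (auto simp: mult.commute)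
  qed (use P_Car in auto)
  finally show ?thesis .
qed

lemma ideal_I: "ideal I (mpol_ring V)"
proof -
  interpret cring "mpol_ring V :: 'k mpol ring" by (rule cring_mpol_ring)
  show ?thesis unfolding tri_ideal_def using P_Car by (intro genideal_ideal) (simp add: P_def)
qed

lemma cring_R: "cring R"
  unfolding tri_alg_def by (rule ideal.quotient_is_cring[OF ideal_I cring_mpol_ring])

lemma carrier_R: "carrier R = cl ` Car"
  by (simp add: tri_alg_def FactRing_def cls_def A_RCOSETS_def' UNION_singleton_eq_range)

lemma cl_in_R [intro]: "f \<in> Car \<Longrightarrow> cl f \<in> carrier R"
  by (simp add: carrier_R)

lemma R_cases [elim]:
  assumes "r \<in> carrier R" obtains f where "f \<in> Car" "r = cl f"
  using assms by (auto simp: carrier_R)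

lemma cl_eq_iff: "f \<in> Car \<Longrightarrow> g \<in> Car \<Longrightarrow> cl f = cl g \<longleftrightarrow> P dvd f - g"
proof -
  assume "f \<in> Car" "g \<in> Car"
  interpret cring "mpol_ring V :: 'k mpol ring" by (rule cring_mpol_ring)
  show ?thesis
    using quotient_eq_iff_same_a_r_cos[OF ideal_I \<open>f \<in> Car\<close> \<open>g \<in> Car\<close>] \<open>f \<in> Car\<close> \<open>g \<in> Car\<close>
    by (auto simp: cls_def I_eq)
qed

lemma cl_mem_iff: "f \<in> Car \<Longrightarrow> g \<in> cl f \<longleftrightarrow> g \<in> Car \<and> P dvd g - f"
proof -
  assume f: "f \<in> Car"
  have "g \<in> cl f \<longleftrightarrow> (\<exists>h\<in>I. g = h + f)"
    by (auto simp: cls_def a_r_coset_def r_coset_def)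
  also have "\<dots> \<longleftrightarrow> g - f \<in> I"
    by (auto intro!: bexI[of _ "g - f"])
  also have "\<dots> \<longleftrightarrow> g \<in> Car \<and> P dvd g - f"
    using f carrier_mpol_ring_intros(1)[of "g - f" V f] by (auto simp: I_eq)
  finally show ?thesis .
qed

lemma cl_add: "f \<in> Car \<Longrightarrow> g \<in> Car \<Longrightarrow> cl f \<oplus>\<^bsub>R\<^esub> cl g = cl (f + g)"
proof -
  assume fg: "f \<in> Car" "g \<in> Car"
  interpret cring "mpol_ring V :: 'k mpol ring" by (rule cring_mpol_ring)
  interpret abelian_subgroup I "mpol_ring V"
    by (intro abelian_subgroupI3 ideal.axioms(1)[OF ideal_I] is_abelian_group)
  show ?thesis using a_rcos_sum[OF fg] by (simp add: tri_alg_def FactRing_def cls_def)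
qed

lemma cl_mult: "f \<in> Car \<Longrightarrow> g \<in> Car \<Longrightarrow> cl f \<otimes>\<^bsub>R\<^esub> cl g = cl (f * g)"
  using ideal.rcoset_mult_add[OF ideal_I, of f g] by (simp add: tri_alg_def FactRing_def cls_def)

lemma cl_one: "\<one>\<^bsub>R\<^esub> = cl 1"
  by (simp add: tri_alg_def FactRing_def cls_def)

lemma cl_zero: "\<zero>\<^bsub>R\<^esub> = cl 0"
proof -
  interpret cring "mpol_ring V :: 'k mpol ring" by (rule cring_mpol_ring)
  show ?thesis using cl_mem_iff[of 0] by (auto simp: tri_alg_def FactRing_def I_eq)
qed

lemma cl_eq_0_iff: "f \<in> Car \<Longrightarrow> cl f = \<zero>\<^bsub>R\<^esub> \<longleftrightarrow> P dvd f"
  unfolding cl_zero using cl_eq_iff[of f 0] by auto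

lemma cl_minus: "f \<in> Car \<Longrightarrow> \<ominus>\<^bsub>R\<^esub> cl f = cl (- f)"
proof -
  assume f: "f \<in> Car"
  interpret cring R by (rule cring_R)
  have "- f \<in> Car" using f by auto
  then show ?thesis using f cl_add[of "- f" f] by (intro minus_equality) (simp_all add: cl_zero cl_in_R)
qed

subsection \<open>Charts\<close>

end

lemma tri_mon_power: "(\<And>j. j \<in> {1..n i} \<Longrightarrow> \<alpha> dvd l i j) \<Longrightarrow> tri_mon n l i \<alpha> ^ \<alpha> = tri_mon n l i 1"
  unfolding tri_mon_def prod_power_distrib by (intro prod.cong) (auto simp flip: power_mult)

text \<open>A tuple \<open>c\<close> singles out one variable of each monomial, and \<open>p\<close> orders the three monomials.  The
  monomial \<open>fr i \<alpha>\<close> is the part of the \<open>i\<close>-th monomial that is free of the selected variable \<open>xv i\<close>.\<close>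

locale chart = trinomial n l d im for n l d and im :: "'k::{alg_closed_field, field_char_0}" +
  fixes p c :: "nat \<Rightarrow> nat"
  assumes perm: "p permutes {0,1,2}" and c_range: "\<And>i. i \<in> {0,1,2} \<Longrightarrow> c i \<in> {1..n i}"
begin

definition xv :: "nat \<Rightarrow> tvar" where "xv i = TVar (p i) (c (p i))"
definition ex :: "nat \<Rightarrow> nat" where "ex i = l (p i) (c (p i))"
definition fr :: "nat \<Rightarrow> nat \<Rightarrow> 'k mpol" where
  "fr i \<alpha> = (\<Prod>j\<in>{1..n (p i)} - {c (p i)}. Var (TVar (p i) j) ^ (l (p i) j div \<alpha>))"
abbreviation tm :: "nat \<Rightarrow> nat \<Rightarrow> 'k mpol" where "tm i \<equiv> tri_mon n l (p i)"
abbreviation X :: "nat \<Rightarrow> 'k mpol" where "X i \<equiv> Var (xv i)"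

lemma p_in: "i \<in> {0,1,2} \<Longrightarrow> p i \<in> {0,1,2}"
  using perm permutes_in_image by metis

lemma p_eq_iff: "p i = p j \<longleftrightarrow> i = j"
  using permutes_inj[OF perm] by (auto dest: injD)

lemma p_image: "p ` {0,1,2} = {0,1,2}"
  by (rule permutes_image[OF perm])

lemma P_eq: "P = tm 0 1 + tm 1 1 + tm 2 1"
proof -
  have "P = (\<Sum>i\<in>{0,1,2}. tri_mon n l i 1)" by (simp add: P_def add.assoc)
  also have "\<dots> = (\<Sum>i\<in>{0,1,2}. tm i 1)"
    by (subst sum.permute[OF perm]) (simp add: comp_def)
  finally show ?thesis by (simp add: add.assoc)
qed

lemma c_in: "i \<in> {0,1,2} \<Longrightarrow> c (p i) \<in> {1..n (p i)}"
  by (rule c_range[OF p_in])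

lemma xv_in_V: "i \<in> {0,1,2} \<Longrightarrow> xv i \<in> V"
  unfolding xv_def TVar_in_V by (intro conjI p_in c_in)

lemma xv_eq_iff [simp]: "xv i = xv j \<longleftrightarrow> i = j"
  by (auto simp: xv_def p_eq_iff)

lemma ex_pos: "i \<in> {0,1,2} \<Longrightarrow> ex i \<ge> 1"
  unfolding ex_def by (intro l_pos p_in c_in)

lemma tm_eq: "i \<in> {0,1,2} \<Longrightarrow> tm i \<alpha> = fr i \<alpha> * X i ^ (ex i div \<alpha>)"
  unfolding tri_mon_def fr_def xv_def ex_def using c_in[of i]
  by (subst prod.remove[of _ "c (p i)"]) (auto simp: mult.commute)

definition Frozen :: "tvar set" where
  "Frozen = V - {xv 0, xv 1, xv 2}"

lemma xv_notin_Frozen [simp]: "i \<in> {0,1,2} \<Longrightarrow> xv i \<notin> Frozen"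
  by (auto simp: Frozen_def)

lemma fr_vars: "i \<in> {0,1,2} \<Longrightarrow> pvars (fr i \<alpha>) \<subseteq> {TVar (p i) j | j. j \<in> {1..n (p i)} \<and> j \<noteq> c (p i)}"
  unfolding fr_def by (intro pvars_prod order_trans[OF pvars_power]) auto

lemma TVar_in_Frozen:
  assumes "i \<in> {0,1,2}" "j \<in> {1..n (p i)}" "j \<noteq> c (p i)"
  shows "TVar (p i) j \<in> Frozen"
proof -
  have "TVar (p i) j \<noteq> xv k" for k
    using assms(3) unfolding xv_def tvar.inject p_eq_iff by blast
  then show ?thesis unfolding Frozen_def using assms p_in[OF assms(1)] TVar_in_V by blast
qed

lemma fr_vars_Frozen: "i \<in> {0,1,2} \<Longrightarrow> pvars (fr i \<alpha>) \<subseteq> Frozen"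
  using fr_vars[of i \<alpha>] TVar_in_Frozen by blast

lemma fr_Car: "i \<in> {0,1,2} \<Longrightarrow> fr i \<alpha> \<in> Car"
  using fr_vars_Frozen[of i \<alpha>] by (auto simp: carrier_mpol_ring Frozen_def)

lemma xv_notin_fr [simp]: "i \<in> {0,1,2} \<Longrightarrow> k \<in> {0,1,2} \<Longrightarrow> xv k \<notin> pvars (fr i \<alpha>)"
  using fr_vars_Frozen[of i \<alpha>] by auto

lemma fr_eval_nonzero: "(\<And>v. v \<in> Frozen \<Longrightarrow> t v \<noteq> 0) \<Longrightarrow> i \<in> {0,1,2} \<Longrightarrow> eval_at t (fr i \<alpha>) \<noteq> 0"
  unfolding fr_def eval_at_psubst id_hom.psubst_prod id_hom.psubst_power id_hom.psubst_Var
  using TVar_in_Frozen by (subst prod_zero_iff) auto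

lemma fr_power:
  assumes "\<And>j. j \<in> {1..n (p i)} \<Longrightarrow> \<alpha> dvd l (p i) j"
  shows "fr i \<alpha> ^ \<alpha> = fr i 1"
  unfolding fr_def prod_power_distrib using assms by (intro prod.cong) (auto simp flip: power_mult)

lemma dmon_eq: "i \<in> {0,1,2} \<Longrightarrow>
   dmon n l c (p i) \<alpha> = of_nat (ex i div \<alpha>) * fr i \<alpha> * X i ^ (ex i div \<alpha> - 1)"
proof -
  assume i: "i \<in> {0,1,2}"
  have no: "pdiff v q = 0" if "v \<notin> pvars q" for v and q :: "'k mpol"
    unfolding pdiff_def
  proof (rule sum.neutral, rule ballI)
    fix m assume "m \<in> Poly_Mapping.keys q"
    then have "Poly_Mapping.lookup m v = 0" using that by (auto simp: pvars_def in_keys_iff)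
    then show "Poly_Mapping.single (m - Poly_Mapping.single v 1)
        (of_nat (Poly_Mapping.lookup m v) * Poly_Mapping.lookup q m) = 0" by simp
  qed
  show ?thesis
    using i unfolding dmon_def tm_eq[OF i] xv_def[symmetric]
    by (simp add: pdiff.D_mult pdiff.D_power no pdiff_Var)
qed

definition Pz :: "tvar \<Rightarrow> 'k mpol" where
  "Pz v = psubst Const (Var(v := 0)) P"

lemma tm_sub_self: "i \<in> {0,1,2} \<Longrightarrow> j \<in> {1..n (p i)} \<Longrightarrow> psubst Const (Var(TVar (p i) j := 0)) (tm i 1) = 0"
proof -
  assume ij: "i \<in> {0,1,2}" "j \<in> {1..n (p i)}"
  then have "l (p i) j \<noteq> 0" using l_pos[OF p_in[OF ij(1)] ij(2)] by simp
  then show ?thesis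
    unfolding tri_mon_def Const_hom.psubst_prod Const_hom.psubst_power Const_hom.psubst_Var
    by (intro prod_zero bexI[OF _ ij(2)]) (simp_all add: zero_power)
qed

lemma tm_sub_other:
  assumes "\<And>j. v \<noteq> TVar (p i) j"
  shows "psubst Const (Var(v := 0)) (tm i \<alpha>) = tm i \<alpha>"
proof -
  have "pvars (tm i \<alpha>) \<subseteq> range (TVar (p i))"
    unfolding tri_mon_def by (intro pvars_prod order_trans[OF pvars_power]) auto
  then have "psubst Const (Var(v := 0)) (tm i \<alpha>) = psubst Const Var (tm i \<alpha>)"
    using assms by (intro psubst_cong) auto
  then show ?thesis by simp
qed

lemma tm_neq_0: "tm i \<alpha> \<noteq> 0"
  unfolding tri_mon_def by (simp add: prod_zero_iff)

end

section \<open>Coprimality modulo a prime element\<close>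

context mod_prime
begin

definition mdvd :: "'a \<Rightarrow> 'a \<Rightarrow> bool" where
  "mdvd f g \<longleftrightarrow> (\<exists>k. g \<asymp> f * k)"

text \<open>Coprimality is taken in the form in which it is applied, as a cancellation rule; unlike
  the absence of common factors, this passes to products without unique factorization.\<close>

definition mcoprime :: "'a \<Rightarrow> 'a \<Rightarrow> bool" where
  "mcoprime f g \<longleftrightarrow> (\<forall>h. mdvd f (g * h) \<longrightarrow> mdvd f h)"

lemma mdvdI: "g \<asymp> f * k \<Longrightarrow> mdvd f g"
  by (auto simp: mdvd_def)

lemma mcoprime_1 [simp]: "mcoprime f 1" "mcoprime 1 f"
  by (auto simp: mcoprime_def mdvd_def intro: eqv_refl)

lemma mcoprime_mult_right:
  assumes "mcoprime f g" "mcoprime f h"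
  shows "mcoprime f (g * h)"
  unfolding mcoprime_def
proof (intro allI impI)
  fix k assume "mdvd f (g * h * k)"
  then have "mdvd f (g * (h * k))" by (simp add: mult.assoc)
  then show "mdvd f k" using assms unfolding mcoprime_def by blast
qed

lemma mcoprime_mult_left:
  assumes "mcoprime f g" "mcoprime f' g" "\<not> f \<asymp> 0"
  shows "mcoprime (f * f') g"
  unfolding mcoprime_def
proof (intro allI impI)
  fix h assume "mdvd (f * f') (g * h)"
  then obtain k where k: "g * h \<asymp> f * (f' * k)" by (auto simp: mdvd_def mult.assoc)
  then obtain m where m: "h \<asymp> f * m" using assms(1) unfolding mcoprime_def mdvd_def by blast
  have "f * (g * m) \<asymp> g * h" using eqv_mult[OF eqv_refl[of g] eqv_sym[OF m]] by (simp add: mult_ac)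
  also note k
  finally have "g * m \<asymp> f' * k" using eqv_mult_cancel_left[OF assms(3)] by simp
  then obtain r where "m \<asymp> f' * r" using assms(2) unfolding mcoprime_def mdvd_def by blast
  then have "f * m \<asymp> f * f' * r" using eqv_mult[OF eqv_refl[of f], of m "f' * r"] by (simp add: mult.assoc)
  then show "mdvd (f * f') h" using eqv_trans[OF m] by (auto simp: mdvd_def)
qed

lemma mcoprime_power_right: "mcoprime f g \<Longrightarrow> mcoprime f (g ^ k)"
  by (induction k) (auto intro: mcoprime_mult_right)

lemma mcoprime_power_left: "mcoprime f g \<Longrightarrow> \<not> f \<asymp> 0 \<Longrightarrow> mcoprime (f ^ k) g"
  by (induction k) (auto intro: mcoprime_mult_left)

lemma mcoprime_prod_right: "(\<And>i. i \<in> A \<Longrightarrow> mcoprime f (g i)) \<Longrightarrow> mcoprime f (\<Prod>i\<in>A. g i)"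
  by (induction A rule: infinite_finite_induct) (auto intro: mcoprime_mult_right)

lemma mcoprime_prod_left:
  "(\<And>i. i \<in> A \<Longrightarrow> mcoprime (f i) g) \<Longrightarrow> (\<And>i. i \<in> A \<Longrightarrow> \<not> f i \<asymp> 0) \<Longrightarrow> mcoprime (\<Prod>i\<in>A. f i) g"
  by (induction A rule: infinite_finite_induct) (auto intro: mcoprime_mult_left)

lemma prod_not_eqv_0: "(\<And>i. i \<in> A \<Longrightarrow> \<not> f i \<asymp> 0) \<Longrightarrow> \<not> (\<Prod>i\<in>A. f i) \<asymp> 0"
  by (induction A rule: infinite_finite_induct) (auto simp: mult_eqv_0_iff)

end

context chart
begin

lemma eval_tm: "eval_at t (tm i \<alpha>) = (\<Prod>j\<in>{1..n (p i)}. t (TVar (p i) j) ^ (l (p i) j div \<alpha>))"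
  unfolding tri_mon_def eval_at_psubst by (simp add: id_hom.psubst_simps)

text \<open>A block that does not contain \<open>v\<close> keeps its monomial: setting its variables
  to 1 and all others to 0 gives \<open>P\<close> the value 1.\<close>

lemma Var_sub_P_neq_0: "psubst Const (Var(v := 0)) P \<noteq> 0"
proof -
  obtain k where k: "k \<in> {0,1,2}" "\<And>j. v \<noteq> TVar (p k) j"
  proof (cases "\<exists>j. v = TVar (p 0) j")
    case True
    then have "v \<noteq> TVar (p 1) j" for j by (auto simp: p_eq_iff)
    then show ?thesis using that[of 1] by blast
  next
    case False
    then show ?thesis using that[of 0] by blast
  qed
  define t :: "tvar \<Rightarrow> 'k" where "t u = (if \<exists>j. u = TVar (p k) j then 1 else 0)" for u
  have tv: "t v = 0" using k(2) by (auto simp: t_def)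
  have "eval_at t (tm i 1) = (if i = k then 1 else 0)" if i: "i \<in> {0,1,2}" for i
  proof (cases "i = k")
    case False
    then have "t (xv i) = 0" by (simp add: t_def xv_def p_eq_iff)
    then show ?thesis using False ex_pos[OF i]
      by (simp add: tm_eq[OF i] eval_at_psubst id_hom.psubst_mult id_hom.psubst_power zero_power)
  qed (simp add: eval_tm t_def)
  then have "eval_at t P = 1"
    using k(1) unfolding P_eq by (auto simp: eval_at_psubst id_hom.psubst_add)
  moreover have "eval_at t (psubst Const (Var(v := 0)) P) = eval_at t P"
    unfolding eval_at_psubst psubst_psubst[OF id_hom.coeff_hom_axioms] using tv
    by (intro psubst_cong) auto
  ultimately show ?thesis by (auto simp: eval_at_psubst)
qed

text \<open>Setting \<open>v = 0\<close> in \<open>v f = P q\<close> shows that \<open>v\<close>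
  divides \<open>q\<close>, because \<open>P\<close> does not become 0.\<close>

lemma P_dvd_Var_mult: "P dvd Var v * f \<Longrightarrow> P dvd f"
proof -
  assume "P dvd Var v * f"
  then obtain q where q: "Var v * f = P * q" by (elim dvdE)
  have "psubst Const (Var(v := 0)) (Var v * f) = psubst Const (Var(v := 0)) P * psubst Const (Var(v := 0)) q"
    unfolding q by (rule Const_hom.psubst_mult)
  then have "psubst Const (Var(v := 0)) q = 0"
    using Var_sub_P_neq_0[of v] by (simp add: Const_hom.psubst_mult)
  then obtain r where "q = Var v * r" unfolding Var_dvd_iff[symmetric] by (elim dvdE)
  then have "Var v * f = Var v * (P * r)" using q by (simp add: mult_ac)
  then have "f = P * r" unfolding mult_cancel_left by simp
  then show ?thesis by simp
qed

lemma P_dvd_Var_prod_mult: "P dvd (\<Prod>j\<in>A. Var (w j) ^ e j) * f \<Longrightarrow> P dvd f"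
proof (induction A arbitrary: f rule: infinite_finite_induct)
  case (insert j A)
  have pow: "P dvd g" if "P dvd Var v ^ k * g" for v k g
    using that
  proof (induction k)
    case (Suc k)
    then have "P dvd Var v * (Var v ^ k * g)" by (simp add: mult.assoc)
    then show ?case using Suc.IH P_dvd_Var_mult by blast
  qed simp
  have "P dvd Var (w j) ^ e j * ((\<Prod>j\<in>A. Var (w j) ^ e j) * f)"
    using insert.prems insert.hyps by (simp add: mult.assoc)
  from pow[OF this] show ?case by (rule insert.IH)
qed auto

lemma chart_P_prime: "prime_elem P"
proof -
  have in012: "(0::nat) \<in> {0,1,2}" "(1::nat) \<in> {0,1,2}" "(2::nat) \<in> {0,1,2}" by auto
  have tm0: "pvars (tm 0 1) \<subseteq> pvars (fr 0 1) \<union> {xv 0}"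
    unfolding tm_eq[OF in012(1)]
    by (rule order_trans[OF pvars_mult]) (use pvars_power[of "X 0" "ex 0 div 1"] in auto)
  have P_eq': "P = tm 0 1 + fr 1 1 * X 1 ^ ex 1 + fr 2 1 * X 2 ^ ex 2"
    unfolding P_eq using tm_eq[OF in012(2), of 1] tm_eq[OF in012(3), of 1] by simp
  show ?thesis
    unfolding P_eq'
  proof (rule prime_elem_trinomial)
    show "xv 1 \<noteq> xv 2" by simp
    show "ex 1 > 0" "ex 2 > 0" using ex_pos[of 1] ex_pos[of 2] by auto
    show "pvars (tm 0 1) \<inter> {xv 1, xv 2} = {}"
      using tm0 xv_notin_fr[of 0 1 1] xv_notin_fr[of 0 2 1] by fastforce
    show "pvars (fr 1 1) \<inter> {xv 1, xv 2} = {}" "pvars (fr 2 1) \<inter> {xv 1, xv 2} = {}"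
      using xv_notin_fr by simp_all
    show "eval_at t (tm 0 1) \<noteq> 0 \<and> eval_at t (fr 1 1) \<noteq> 0 \<and> eval_at t (fr 2 1) \<noteq> 0"
      if "\<forall>v. t v \<noteq> 0" for t
      using that by (intro conjI fr_eval_nonzero) (auto simp: eval_tm)
    show "tm 0 1 + fr 1 1 * X 1 ^ ex 1 + fr 2 1 * X 2 ^ ex 2 dvd f"
      if "tm 0 1 + fr 1 1 * X 1 ^ ex 1 + fr 2 1 * X 2 ^ ex 2 dvd fr 2 1 * f" for f
    proof -
      have "P dvd fr 2 1 * f" using that by (simp only: P_eq')
      then show ?thesis unfolding P_eq'[symmetric] unfolding fr_def by (rule P_dvd_Var_prod_mult)
    qed
  qed
qed

end

sublocale trinomial \<subseteq> mod_prime P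
proof
  \<comment> \<open>Primality concerns \<open>P\<close> alone, so any chart will do.\<close>
  interpret chart n l d im id "\<lambda>_. 1"
    by unfold_locales (use n_pos in \<open>auto simp: permutes_id\<close>)
  show "prime_elem P" by (rule chart_P_prime)
qed

context trinomial
begin

notation eqv (infix "\<asymp>" 50)

lemma Const_not_eqv_0: "k \<noteq> 0 \<Longrightarrow> \<not> Const k \<asymp> 0"
proof
  assume "k \<noteq> 0" "Const k \<asymp> 0"
  then have "Const (inverse k) * Const k \<asymp> 0" by (intro eqv_0_mult)
  then show False using \<open>k \<noteq> 0\<close> by (simp flip: Const_mult)
qed

lemma of_nat_not_eqv_0: "k > 0 \<Longrightarrow> \<not> P dvd of_nat k"
  using Const_not_eqv_0[of "of_nat k"] by (simp add: eqv_0 Const_of_nat)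

lemma zero_R: "\<zero>\<^bsub>R\<^esub> = cl 0"
  by (rule cl_zero)

lemma cl_eq_iff_eqv: "f \<in> Car \<Longrightarrow> g \<in> Car \<Longrightarrow> cl f = cl g \<longleftrightarrow> f \<asymp> g"
  unfolding eqv_def by (rule cl_eq_iff)

end

context chart
begin

lemma Var_not_eqv_0: "\<not> Var v \<asymp> 0"
  using P_dvd_Var_mult[of v 1] not_1_eqv_0 by (auto simp: eqv_0)

text \<open>Setting the first variable to 0 leaves in \<open>P\<close> the sum of two monomials, and
  setting the second to 0 as well leaves the third monomial, which is nonzero. Hence the quotient
  \<open>q\<close> becomes divisible by the second variable, which can be cancelled.\<close>

lemma mcoprime_Var:
  assumes i: "i \<in> {0,1,2}" "j \<in> {1..n (p i)}" and k: "k \<in> {0,1,2}" "j' \<in> {1..n (p k)}" and "i \<noteq> k"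
  shows "mcoprime (Var (TVar (p i) j)) (Var (TVar (p k) j'))"
  unfolding mcoprime_def
proof (intro allI impI)
  let ?v = "TVar (p i) j" and ?w = "TVar (p k) j'"
  fix h assume "mdvd (Var ?v) (Var ?w * h)"
  then obtain m where "Var ?w * h \<asymp> Var ?v * m" unfolding mdvd_def by blast
  then obtain q where q: "Var ?w * h - Var ?v * m = P * q" unfolding eqv_def by (elim dvdE)
  have "\<exists>k'\<in>{0,1,2}. k' \<noteq> i \<and> k' \<noteq> k" using i(1) k(1) by auto
  then obtain k' where k': "k' \<in> {0,1,2}" "k' \<noteq> i" "k' \<noteq> k" by blast
  let ?s = "psubst Const (Var(?v := 0))" and ?s' = "psubst Const (Var(?w := 0))"
  have three: "P = tm i 1 + tm k 1 + tm k' 1"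
  proof -
    have "(\<Sum>i\<in>{0,1,2}. tm i 1) = (\<Sum>i\<in>{i,k,k'}. tm i 1)"
      using i k k' \<open>i \<noteq> k\<close> by (intro sum.cong) auto
    then show ?thesis using k' \<open>i \<noteq> k\<close> by (simp add: P_eq add.assoc)
  qed
  have sP: "?s P = tm k 1 + tm k' 1"
    unfolding three using tm_sub_self[OF i] k'(2) \<open>i \<noteq> k\<close>
    by (simp add: Const_hom.psubst_add tm_sub_self tm_sub_other p_eq_iff)
  have "?s (Var ?w * h - Var ?v * m) = ?s P * ?s q" unfolding q by (rule Const_hom.psubst_mult)
  then have s1: "Var ?w * ?s h = (tm k 1 + tm k' 1) * ?s q"
    using \<open>i \<noteq> k\<close> p_eq_iff[of k i] unfolding sP by (simp add: Const_hom.psubst_mult Const_hom.psubst_diff)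
  have "?s' (Var ?w * ?s h) = ?s' (tm k 1 + tm k' 1) * ?s' (?s q)"
    unfolding s1 by (rule Const_hom.psubst_mult)
  moreover have "?s' (tm k 1 + tm k' 1) = tm k' 1"
    using tm_sub_self[OF k] k'(3) by (simp add: Const_hom.psubst_add tm_sub_other p_eq_iff)
  ultimately have "?s' (?s q) = 0" using tm_neq_0[of k' 1] by (simp add: Const_hom.psubst_mult)
  then obtain q1 where q1: "?s q = Var ?w * q1" unfolding Var_dvd_iff[symmetric] by (elim dvdE)
  have "Var ?w * ?s h = Var ?w * ((tm k 1 + tm k' 1) * q1)" using s1 q1 by (simp add: mult_ac)
  then have sh: "?s h = (tm k 1 + tm k' 1) * q1" unfolding mult_cancel_left by simp
  have "Var ?v dvd psubst Const Var h - ?s h" by (rule dvd_psubst_diff) auto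
  then obtain r where r: "h - ?s h = Var ?v * r" by (auto elim: dvdE)
  have "Var ?v dvd tm i 1" unfolding Var_dvd_iff by (rule tm_sub_self[OF i])
  then obtain m' where m': "tm i 1 = Var ?v * m'" by (elim dvdE)
  have "h - Var ?v * (r - m' * q1) = P * q1"
    using r sh unfolding three m' by (simp add: algebra_simps)
  then show "mdvd (Var ?v) h" unfolding mdvd_def eqv_def by (metis dvd_triv_left)
qed

definition bmon :: "nat \<Rightarrow> 'k mpol \<Rightarrow> bool" where
  "bmon i q \<longleftrightarrow> (\<exists>e. q = (\<Prod>j\<in>{1..n (p i)}. Var (TVar (p i) j) ^ e j))"

lemma bmon_mult: "bmon i q \<Longrightarrow> bmon i r \<Longrightarrow> bmon i (q * r)"
  unfolding bmon_def by (auto simp: prod.distrib[symmetric] power_add[symmetric])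

lemma bmon_1: "bmon i 1"
  unfolding bmon_def by (intro exI[of _ "\<lambda>_. 0"]) simp

lemma bmon_power: "bmon i q \<Longrightarrow> bmon i (q ^ k)"
  by (induction k) (auto intro: bmon_mult bmon_1)

lemma bmonI: "q = (\<Prod>j\<in>{1..n (p i)}. Var (TVar (p i) j) ^ e j) \<Longrightarrow> bmon i q"
  unfolding bmon_def by (rule exI)

lemma bmon_fr: "bmon i (fr i \<alpha>)"
  unfolding fr_def
  by (rule bmonI[where e = "\<lambda>j. if j = c (p i) then 0 else l (p i) j div \<alpha>"])
    (rule prod.mono_neutral_cong_left, auto)

lemma bmon_X: "i \<in> {0,1,2} \<Longrightarrow> bmon i (X i)"
proof -
  assume "i \<in> {0,1,2}"
  then have "X i = (\<Prod>j\<in>{1..n (p i)}. Var (TVar (p i) j) ^ (if j = c (p i) then 1 else 0))"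
    using c_in[of i] by (subst prod.remove[of _ "c (p i)"]) (auto simp: xv_def)
  then show ?thesis by (rule bmonI)
qed

lemmas bmon_intros = bmon_mult bmon_power bmon_fr bmon_X

lemma Var_power_not_eqv_0: "\<not> Var v ^ k \<asymp> 0"
  using power_eqv_0 Var_not_eqv_0 by blast

lemma bmon_not_eqv_0: "bmon i q \<Longrightarrow> \<not> q \<asymp> 0"
proof -
  assume "bmon i q"
  then obtain e where q: "q = (\<Prod>j\<in>{1..n (p i)}. Var (TVar (p i) j) ^ e j)"
    unfolding bmon_def by blast
  show ?thesis unfolding q by (rule prod_not_eqv_0) (rule Var_power_not_eqv_0)
qed

lemma fr_not_eqv_0: "\<not> fr i \<alpha> \<asymp> 0"
  by (rule bmon_not_eqv_0[OF bmon_fr])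

lemma mcoprime_bmon:
  assumes "i \<in> {0,1,2}" "k \<in> {0,1,2}" "i \<noteq> k" "bmon i q" "bmon k r"
  shows "mcoprime q r"
proof -
  obtain e e' where q: "q = (\<Prod>j\<in>{1..n (p i)}. Var (TVar (p i) j) ^ e j)"
    and r: "r = (\<Prod>j\<in>{1..n (p k)}. Var (TVar (p k) j) ^ e' j)"
    using assms(4,5) unfolding bmon_def by blast
  show ?thesis unfolding q r
    by (rule mcoprime_prod_left, rule mcoprime_power_left, rule mcoprime_prod_right,
        rule mcoprime_power_right, rule mcoprime_Var)
      (assumption | rule assms Var_not_eqv_0 Var_power_not_eqv_0)+
qed

end

section \<open>Derivations of the trinomial algebra\<close>

lemma pvars_pdiff: "pvars (pdiff v q) \<subseteq> pvars q"
  unfolding pdiff_def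
proof (rule pvars_sum)
  fix m assume m: "m \<in> Poly_Mapping.keys q"
  have "Poly_Mapping.keys (m - Poly_Mapping.single v 1) \<subseteq> Poly_Mapping.keys m"
    by (auto simp: in_keys_iff lookup_minus)
  then show "pvars (Poly_Mapping.single (m - Poly_Mapping.single v 1)
      (of_nat (Poly_Mapping.lookup m v) * Poly_Mapping.lookup q m)) \<subseteq> pvars q"
    using pvars_single m by (force simp: pvars_def)
qed

lemma dvd_pvars:
  assumes "pvars g \<subseteq> W" "pvars f \<subseteq> W" "(g :: 'k::comm_ring_1 mpol) dvd f"
  obtains q where "pvars q \<subseteq> W" "f = g * q"
proof -
  obtain q where q: "f = g * q" using assms by (elim dvdE)
  define \<pi> :: "'k mpol \<Rightarrow> 'k mpol" where "\<pi> = psubst Const (\<lambda>v. if v \<in> W then Var v else 0)"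
  have "\<pi> h = h" if "pvars h \<subseteq> W" for h
  proof -
    have "\<pi> h = psubst Const Var h" unfolding \<pi>_def using that by (intro psubst_cong) auto
    then show ?thesis by simp
  qed
  moreover have "\<pi> f = \<pi> g * \<pi> q" unfolding q \<pi>_def by (rule Const_hom.psubst_mult)
  ultimately have "f = g * \<pi> q" using assms by simp
  moreover have "pvars (\<pi> q) \<subseteq> W" unfolding \<pi>_def by (rule pvars_psubst) auto
  ultimately show ?thesis using that by blast
qed

context mod_derivation
begin

lemma nilpotent_add:
  assumes "\<exists>k. (D ^^ k) f \<asymp> 0" "\<exists>k. (D ^^ k) g \<asymp> 0"
  shows "\<exists>k. (D ^^ k) (f + g) \<asymp> 0"
proof -
  obtain i j where ij: "(D ^^ i) f \<asymp> 0" "(D ^^ j) g \<asymp> 0" using assms by blast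
  have "(D ^^ (i + j)) f \<asymp> 0" "(D ^^ (i + j)) g \<asymp> 0"
    using iter_eqv_0_mono[OF ij(1)] iter_eqv_0_mono[OF ij(2)] by simp_all
  then show ?thesis unfolding iter_add by (intro exI[of _ "i + j"] eqv_0_add)
qed

lemma nilpotent_mult:
  assumes "\<exists>k. (D ^^ k) f \<asymp> 0" "\<exists>k. (D ^^ k) g \<asymp> 0"
  shows "\<exists>k. (D ^^ k) (f * g) \<asymp> 0"
proof -
  obtain i j where ij: "(D ^^ i) f \<asymp> 0" "(D ^^ j) g \<asymp> 0" using assms by blast
  have "of_nat ((i + j) choose k) * (D ^^ k) f * (D ^^ (i + j - k)) g \<asymp> 0" if "k \<le> i + j" for k
  proof (cases "i \<le> k")
    case True
    then have "(D ^^ k) f \<asymp> 0" by (rule iter_eqv_0_mono[OF ij(1)])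
    then show ?thesis by (intro eqv_0_mult(1) eqv_0_mult(2))
  next
    case False
    then have "(D ^^ (i + j - k)) g \<asymp> 0" by (intro iter_eqv_0_mono[OF ij(2)]) simp
    then show ?thesis by (intro eqv_0_mult(2))
  qed
  then show ?thesis unfolding iter_mult by (intro exI[of _ "i + j"] eqv_sum_0) simp
qed

end

locale tri_der = trinomial n l d im for n l d and im :: "'k::{alg_closed_field, field_char_0}" +
  fixes a :: "tvar \<Rightarrow> 'k mpol"
  assumes a_Car: "\<And>v. v \<in> V \<Longrightarrow> a v \<in> Car" and P_dvd_der_P: "P dvd poly_der n d a P"
begin

abbreviation D :: "'k mpol \<Rightarrow> 'k mpol" where "D \<equiv> poly_der n d a"

end

sublocale tri_der \<subseteq> mod_derivation P D
  by unfold_locales (rule poly_der.D_add poly_der.D_mult P_dvd_der_P of_nat_not_eqv_0 | assumption)+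

context tri_der
begin

lemma D_Var: "v \<in> V \<Longrightarrow> D (Var v) = a v"
  by (simp add: poly_der_Var)

lemma D_Var_notin: "v \<notin> V \<Longrightarrow> D (Var v) = 0"
  by (simp add: poly_der_Var)

lemma D_Const_mult: "D (Const k * f) = Const k * D f"
  by (simp add: D_mult)

lemma D_Car: "f \<in> Car \<Longrightarrow> D f \<in> Car"
  unfolding poly_der_def
proof (intro carrier_mpol_ring_sum carrier_mpol_ring_intros(3) a_Car)
  fix v assume "f \<in> Car"
  then show "pdiff v f \<in> Car" using pvars_pdiff[of v f] by (auto simp: carrier_mpol_ring)
qed

lemma iter_D_Car: "f \<in> Car \<Longrightarrow> (D ^^ k) f \<in> Car"
  by (induction k) (auto intro: D_Car)

text \<open>By the Leibniz formula nilpotent elements are closed under sums and products; variables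
  outside \<open>V\<close> are killed since \<open>poly_der\<close> sums over \<open>V\<close>
  only.\<close>

lemma nilpotent_if_vars_nilpotent:
  assumes "\<And>v. v \<in> V \<Longrightarrow> \<exists>k. (D ^^ k) (Var v) \<asymp> 0"
  shows "\<exists>k. (D ^^ k) f \<asymp> 0"
proof (induction f rule: mpol_induct)
  case (Const c)
  then show ?case by (intro exI[of _ 1]) simp
next
  case (Var v)
  show ?case
  proof (cases "v \<in> V")
    case False
    then show ?thesis by (intro exI[of _ 1]) (simp add: D_Var_notin)
  qed (rule assms)
qed (auto intro: nilpotent_add nilpotent_mult)

lemma induced_der_cl: "f \<in> Car \<Longrightarrow> induced_der n l d a (cl f) = cl (D f)"
proof -
  assume f: "f \<in> Car"
  have "cl (D q) = cl (D f)" if "q \<in> cl f" for q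
    using that f cl_mem_iff[OF f, of q] D_cong[of q f] cl_eq_iff_eqv[OF D_Car D_Car, of q f]
    by (auto simp: eqv_def)
  moreover have "f \<in> cl f" using cl_mem_iff[OF f, of f] f by simp
  ultimately show ?thesis unfolding induced_der_def by blast
qed

lemma is_derivation_induced_der: "is_derivation n l d (induced_der n l d a)"
  unfolding is_derivation_def Let_def
proof (intro conjI ballI allI Pi_I)
  fix x assume "x \<in> carrier R"
  then show "induced_der n l d a x \<in> carrier R"
    by (elim R_cases) (auto simp: induced_der_cl intro!: cl_in_R D_Car)
next
  fix x y assume "x \<in> carrier R" "y \<in> carrier R"
  then obtain f g where fg: "f \<in> Car" "x = cl f" "g \<in> Car" "y = cl g" by (elim R_cases)
  have Car: "f + g \<in> Car" "f * g \<in> Car" "D f \<in> Car" "D g \<in> Car" "D f * g \<in> Car" "f * D g \<in> Car"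
    using fg D_Car by auto
  show "induced_der n l d a (x \<oplus>\<^bsub>R\<^esub> y) = induced_der n l d a x \<oplus>\<^bsub>R\<^esub> induced_der n l d a y"
    by (simp add: fg Car cl_add induced_der_cl D_add)
  show "induced_der n l d a (x \<otimes>\<^bsub>R\<^esub> y) =
      induced_der n l d a x \<otimes>\<^bsub>R\<^esub> y \<oplus>\<^bsub>R\<^esub> x \<otimes>\<^bsub>R\<^esub> induced_der n l d a y"
    by (simp add: fg Car cl_add cl_mult induced_der_cl D_mult)
next
  fix k show "induced_der n l d a (cl (Const k)) = \<zero>\<^bsub>R\<^esub>"
    by (simp add: induced_der_cl carrier_mpol_ring_intros zero_R)
qed

end

context trinomial
begin

lemma derivation_lift:
  assumes "is_derivation n l d \<delta>"
  obtains a where "tri_der n l d im a" "\<And>f. f \<in> Car \<Longrightarrow> \<delta> (cl f) = cl (poly_der n d a f)"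
proof -
  have \<delta>: "\<delta> x \<in> carrier R" "\<delta> (x \<oplus>\<^bsub>R\<^esub> y) = \<delta> x \<oplus>\<^bsub>R\<^esub> \<delta> y"
      "\<delta> (x \<otimes>\<^bsub>R\<^esub> y) = (\<delta> x \<otimes>\<^bsub>R\<^esub> y) \<oplus>\<^bsub>R\<^esub> (x \<otimes>\<^bsub>R\<^esub> \<delta> y)" "\<delta> (cl (Const k)) = \<zero>\<^bsub>R\<^esub>"
    if "x \<in> carrier R" "y \<in> carrier R" for x y k
    using assms that unfolding is_derivation_def Let_def by auto
  have "\<exists>g. g \<in> Car \<and> \<delta> (cl (Var v)) = cl g" if "v \<in> V" for v
  proof -
    have "cl (Var v) \<in> carrier R" using that by auto
    from \<delta>(1)[OF this this] show ?thesis by (elim R_cases) auto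
  qed
  then obtain a where a: "\<And>v. v \<in> V \<Longrightarrow> a v \<in> Car \<and> \<delta> (cl (Var v)) = cl (a v)" by metis
  let ?D = "poly_der n d a"
  have D: "?D f \<in> Car \<and> \<delta> (cl f) = cl (?D f)" if "f \<in> Car" for f
  proof -
    have "pvars f \<subseteq> V" using that by (simp add: carrier_mpol_ring)
    have "f \<in> Car \<longrightarrow> ?D f \<in> Car \<and> \<delta> (cl f) = cl (?D f)"
    proof -
      have "f \<in> Car \<and> ?D f \<in> Car \<and> \<delta> (cl f) = cl (?D f)"
      proof (induction f rule: mpol_induct)
        case (Const c)
        then show ?case using \<delta>(4)[of "cl 0" "cl 0" c] by (auto simp: zero_R)
      next
        case (Var v)
        then have "v \<in> V" using \<open>pvars f \<subseteq> V\<close> by auto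
        then show ?case using a[of v] by (auto simp: poly_der_Var)
      next
        case (add f g)
        then show ?case using \<delta>(2)[of "cl f" "cl g"] by (auto simp: cl_add poly_der.D_add)
      next
        case (mult f g)
        then have "?D f * g \<in> Car" "f * ?D g \<in> Car" by auto
        then show ?case using mult \<delta>(3)[of "cl f" "cl g"] by (auto simp: cl_add cl_mult poly_der.D_mult)
      qed
      then show ?thesis by blast
    qed
    then show ?thesis using that by blast
  qed
  have "cl (?D P) = \<delta> (cl P)" using D[OF P_Car] by simp
  also have "cl P = cl (Const 0)" using P_Car cl_eq_iff[of P 0] by auto
  also have "\<delta> (cl (Const 0)) = \<zero>\<^bsub>R\<^esub>" using \<delta>(4)[of "cl 0" "cl 0" 0] by auto
  finally have "P dvd ?D P" using cl_eq_0_iff D[OF P_Car] by blast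
  then have "tri_der n l d im a"
    using a by unfold_locales auto
  then show ?thesis using that D by blast
qed

end

context tri_der
begin

lemma iter_derivation:
  assumes "\<And>f. f \<in> Car \<Longrightarrow> \<delta> (cl f) = cl (D f)" "f \<in> Car"
  shows "(\<delta> ^^ k) (cl f) = cl ((D ^^ k) f)"
  by (induction k) (auto simp: assms iter_D_Car)

lemma is_LND_iff:
  assumes "\<And>f. f \<in> Car \<Longrightarrow> \<delta> (cl f) = cl (D f)" "is_derivation n l d \<delta>"
  shows "is_LND n l d \<delta> \<longleftrightarrow> (\<forall>f. \<exists>k. (D ^^ k) f \<asymp> 0)"
proof
  assume "is_LND n l d \<delta>"
  then have nil: "\<exists>k. (\<delta> ^^ k) (cl f) = \<zero>\<^bsub>R\<^esub>" if "f \<in> Car" for f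
    unfolding is_LND_def using that by auto
  have "\<exists>k. (D ^^ k) (Var v) \<asymp> 0" if "v \<in> V" for v
  proof -
    have v: "Var v \<in> Car" using that by auto
    obtain k where "(\<delta> ^^ k) (cl (Var v)) = \<zero>\<^bsub>R\<^esub>" using nil[OF v] by blast
    then have "(D ^^ k) (Var v) \<asymp> 0"
      using iter_derivation[OF assms(1) v] cl_eq_0_iff[OF iter_D_Car[OF v]] by (simp add: eqv_0)
    then show ?thesis by blast
  qed
  then show "\<forall>f. \<exists>k. (D ^^ k) f \<asymp> 0" using nilpotent_if_vars_nilpotent by blast
next
  assume nil: "\<forall>f. \<exists>k. (D ^^ k) f \<asymp> 0"
  show "is_LND n l d \<delta>"
    unfolding is_LND_def
  proof (intro conjI ballI assms(2))
    fix x assume "x \<in> carrier R"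
    then obtain f where f: "f \<in> Car" "x = cl f" by (elim R_cases)
    obtain k where "(D ^^ k) f \<asymp> 0" using nil by blast
    then show "\<exists>k. (\<delta> ^^ k) x = \<zero>\<^bsub>R\<^esub>"
      using iter_derivation[OF assms(1) f(1)] cl_eq_0_iff[OF iter_D_Car[OF f(1)]] f(2)
      by (intro exI[of _ k]) (simp add: eqv_0)
  qed
qed

lemma der_ker_eq: "der_ker n l d (induced_der n l d a) = {cl f | f. f \<in> Car \<and> D f \<asymp> 0}"
proof (intro equalityI subsetI)
  fix x assume "x \<in> der_ker n l d (induced_der n l d a)"
  then have x: "x \<in> carrier R" "induced_der n l d a x = \<zero>\<^bsub>R\<^esub>" by (auto simp: der_ker_def)
  then obtain f where f: "f \<in> Car" "x = cl f" by (elim R_cases)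
  then show "x \<in> {cl f | f. f \<in> Car \<and> D f \<asymp> 0}"
    using x cl_eq_0_iff[OF D_Car] by (auto simp: induced_der_cl eqv_0)
next
  fix x assume "x \<in> {cl f | f. f \<in> Car \<and> D f \<asymp> 0}"
  then show "x \<in> der_ker n l d (induced_der n l d a)"
    using cl_eq_0_iff[OF D_Car, THEN iffD2] cl_in_R by (auto simp: der_ker_def induced_der_cl eqv_0 simp del: zero_R)
qed

end

section \<open>Computation of kernels\<close>

text \<open>The \<open>S_k\<close> are left out: denominators come from the monomials of the
  trinomial and contain only frozen \<open>T_ij\<close>.\<close>

definition (in chart) fr_vars_set :: "tvar set" where
  "fr_vars_set = {TVar (p i) j | i j. i \<in> {0,1,2} \<and> j \<in> {1..n (p i)} \<and> j \<noteq> c (p i)}"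

lemma (in chart) fr_vars_set_Frozen: "fr_vars_set \<subseteq> Frozen"
  using TVar_in_Frozen by (auto simp: fr_vars_set_def)

locale chart_der = chart n l d im p c + tri_der n l d im a
  for n l d and im :: "'k::{alg_closed_field, field_char_0}" and p c a

text \<open>The candidate for the kernel consists of the polynomials in the frozen variables and \<open>q\<close>.  They are
  parametrized by the polynomials in the frozen variables and \<open>s\<close>, where \<open>s\<close>, one of the selected
  variables, is a placeholder for \<open>q\<close>.\<close>

locale kernel_candidate = chart_der n l d im p c a
  for n l d and im :: "'k::{alg_closed_field, field_char_0}" and p c a +
  fixes s :: tvar and q :: "'k mpol"
  assumes s_selected: "s \<in> {xv 0, xv 1, xv 2}" and q_Car: "q \<in> Car"
begin

definition par :: "'k mpol \<Rightarrow> 'k mpol" where "par = psubst Const (Var(s := q))"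
definition par_dom :: "'k mpol set" where "par_dom = {f. pvars f \<subseteq> insert s Frozen}"

lemma s_notin_Frozen: "s \<notin> Frozen"
  using s_selected by (auto simp: Frozen_def)

lemma par_simps [simp]: "par (f + g) = par f + par g" "par (f * g) = par f * par g" "par (Const k) = Const k"
  "par (Var s) = q" "v \<in> Frozen \<Longrightarrow> par (Var v) = Var v" "par (f - g) = par f - par g"
  using s_notin_Frozen by (auto simp: par_def Const_hom.psubst_simps)

lemma par_Car: "f \<in> par_dom \<Longrightarrow> par f \<in> Car"
  unfolding par_def carrier_mpol_ring par_dom_def
  by (rule pvars_psubst) (use q_Car in \<open>auto simp: Frozen_def carrier_mpol_ring\<close>)

definition par_image :: "'k mpol set" where "par_image = par ` par_dom"

lemma par_dom_add: "f \<in> par_dom \<Longrightarrow> g \<in> par_dom \<Longrightarrow> f + g \<in> par_dom"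
  and par_dom_mult: "f \<in> par_dom \<Longrightarrow> g \<in> par_dom \<Longrightarrow> f * g \<in> par_dom"
  using pvars_add[of f g] pvars_mult[of f g] by (auto simp: par_dom_def)

lemma par_in_par_image: "f \<in> par_dom \<Longrightarrow> par f \<in> par_image"
  unfolding par_image_def by (rule imageI)

lemma par_imageE: "f \<in> par_image \<Longrightarrow> (\<And>g. g \<in> par_dom \<Longrightarrow> f = par g \<Longrightarrow> thesis) \<Longrightarrow> thesis"
  unfolding par_image_def by blast

lemma par_image_add:
  assumes "f \<in> par_image" "g \<in> par_image"
  shows "f + g \<in> par_image"
proof -
  obtain f' g' where "f' \<in> par_dom" "f = par f'" "g' \<in> par_dom" "g = par g'"
    using assms by (metis par_imageE)
  then show ?thesis using par_in_par_image[OF par_dom_add, of f' g'] by simp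
qed

lemma par_image_mult:
  assumes "f \<in> par_image" "g \<in> par_image"
  shows "f * g \<in> par_image"
proof -
  obtain f' g' where "f' \<in> par_dom" "f = par f'" "g' \<in> par_dom" "g = par g'"
    using assms by (metis par_imageE)
  then show ?thesis using par_in_par_image[OF par_dom_mult, of f' g'] by simp
qed

lemma par_image_Const: "Const k \<in> par_image"
  unfolding par_image_def by (rule image_eqI[of _ _ "Const k"]) (auto simp: par_dom_def)

lemma par_image_0: "0 \<in> par_image" and par_image_1: "1 \<in> par_image"
  using par_image_Const[of 0] par_image_Const[of 1] by simp_all

lemma par_image_minus: "f \<in> par_image \<Longrightarrow> - f \<in> par_image"
  using par_image_mult[OF par_image_Const[of "-1"], of f] by (simp add: Const_minus)

lemma par_image_diff: "f \<in> par_image \<Longrightarrow> g \<in> par_image \<Longrightarrow> f - g \<in> par_image"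
  using par_image_add[OF _ par_image_minus] by fastforce

lemma par_image_power: "f \<in> par_image \<Longrightarrow> f ^ k \<in> par_image"
  by (induction k) (auto intro: par_image_1 par_image_mult)

lemma par_image_q: "q \<in> par_image"
  unfolding par_image_def by (rule image_eqI[of _ _ "Var s"]) (auto simp: par_dom_def)

lemma par_image_frozen: "pvars f \<subseteq> Frozen \<Longrightarrow> f \<in> par_image"
proof -
  assume f: "pvars f \<subseteq> Frozen"
  then have "par f = psubst Const Var f"
    unfolding par_def using s_notin_Frozen by (intro psubst_cong) auto
  then show ?thesis unfolding par_image_def using f by (intro image_eqI[of _ _ f]) (auto simp: par_dom_def)
qed

lemmas par_image_intros = par_image_add par_image_mult par_image_Const par_image_0 par_image_1 par_image_minus
  par_image_diff par_image_power par_image_q par_image_frozen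

text \<open>Possible denominators, built from images of parameters one at a time because
  \<open>cancel_denom\<close> removes a single parameter.\<close>

inductive_set denoms :: "tvar set \<Rightarrow> 'k mpol set" for W where
  denoms_1: "1 \<in> denoms W"
| denoms_step: "w \<in> W \<Longrightarrow> M \<in> denoms W \<Longrightarrow> par (Var w) * M \<in> denoms W"

lemma denoms_mult: "M \<in> denoms W \<Longrightarrow> N \<in> denoms W \<Longrightarrow> M * N \<in> denoms W"
  by (induction M rule: denoms.induct) (auto simp: mult.assoc intro: denoms.intros)

lemma denoms_par_image: "M \<in> denoms W \<Longrightarrow> W \<subseteq> insert s Frozen \<Longrightarrow> M \<in> par_image"
proof (induction M rule: denoms.induct)
  case (denoms_step w M)
  then have "par (Var w) \<in> par_image" by (intro par_in_par_image) (auto simp: par_dom_def)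
  then show ?case using denoms_step by (intro par_image_mult)
qed (rule par_image_1)

lemma denoms_Var_power: "w \<in> W \<Longrightarrow> par (Var w) ^ k \<in> denoms W"
  by (induction k) (auto intro: denoms.intros)

lemma denoms_fr:
  assumes "i \<in> {0,1,2}" "fr_vars_set \<subseteq> W"
  shows "fr i \<alpha> \<in> denoms W"
proof -
  have *: "(\<Prod>j\<in>A. Var (TVar (p i) j) ^ (l (p i) j div \<alpha>)) \<in> denoms W"
    if "finite A" "A \<subseteq> {1..n (p i)} - {c (p i)}" for A
    using that
  proof (induction A)
    case (insert j A)
    then have "TVar (p i) j \<in> Frozen" "TVar (p i) j \<in> fr_vars_set"
      using assms(1) by (auto simp: fr_vars_set_def intro!: TVar_in_Frozen)
    then have "Var (TVar (p i) j) ^ (l (p i) j div \<alpha>) \<in> denoms W"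
      using denoms_Var_power[of "TVar (p i) j" W] assms(2) by auto
    moreover have "(\<Prod>j\<in>A. Var (TVar (p i) j) ^ (l (p i) j div \<alpha>)) \<in> denoms W"
      using insert.IH insert.prems by blast
    ultimately show ?case unfolding prod.insert[OF insert.hyps] by (rule denoms_mult)
  qed (auto intro: denoms.intros)
  show ?thesis unfolding fr_def by (rule *) auto
qed

definition par_poly :: "'k mpol poly \<Rightarrow> bool" where "par_poly pp \<longleftrightarrow> (\<forall>i. coeff pp i \<in> par_image)"

lemma par_poly_add: "par_poly pp \<Longrightarrow> par_poly qq \<Longrightarrow> par_poly (pp + qq)"
  by (auto simp: par_poly_def intro: par_image_intros)

lemma par_poly_mult: "par_poly pp \<Longrightarrow> par_poly qq \<Longrightarrow> par_poly (pp * qq)"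
proof -
  assume *: "par_poly pp" "par_poly qq"
  have sum: "(\<Sum>i\<in>A. f i) \<in> par_image" if "\<And>i. i \<in> A \<Longrightarrow> f i \<in> par_image" for A :: "nat set" and f
    using that by (induction A rule: infinite_finite_induct) (auto intro: par_image_intros)
  show ?thesis unfolding par_poly_def coeff_mult
    using * by (intro allI sum par_image_mult) (auto simp: par_poly_def)
qed

lemma par_poly_const: "f \<in> par_image \<Longrightarrow> par_poly [:f:]"
  by (auto simp: par_poly_def coeff_pCons par_image_0 split: nat.split)

lemma par_poly_X: "par_poly [:0, 1:]"
  by (auto simp: par_poly_def coeff_pCons par_image_0 par_image_1 split: nat.split)

lemma par_poly_power: "par_poly pp \<Longrightarrow> par_poly (pp ^ k)"
  by (induction k) (auto intro: par_poly_mult par_poly_const[OF par_image_1, unfolded one_pCons[symmetric]])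

lemma par_poly_diff: "par_poly pp \<Longrightarrow> par_poly qq \<Longrightarrow> par_poly (pp - qq)"
  by (auto simp: par_poly_def intro: par_image_intros)

lemmas par_poly_intros = par_poly_add par_poly_mult par_poly_const par_poly_X par_poly_power par_poly_diff

text \<open>A point with prescribed values of all parameters except \<open>w\<close>, which vanishes, shows that \<open>w\<close> can be
  cancelled.\<close>

lemma param_independent:
  assumes "pvars f \<subseteq> insert s Frozen - {w}" and "par f \<asymp> par (Var w) * k"
    and point: "\<And>t. (\<forall>v. t v \<noteq> 0) \<Longrightarrow> \<exists>t'. eval_at t' P = 0 \<and> eval_at t' (par (Var w)) = 0 \<and>
       (\<forall>v\<in>insert s Frozen - {w}. eval_at t' (par (Var v)) = t v)"
  shows "f = 0"
proof (rule mpol_eq_0_if_vanishing)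
  fix t :: "tvar \<Rightarrow> 'k" assume "\<forall>v. t v \<noteq> 0"
  then obtain t' where t': "eval_at t' P = 0" "eval_at t' (par (Var w)) = 0"
    "\<And>v. v \<in> insert s Frozen - {w} \<Longrightarrow> eval_at t' (par (Var v)) = t v" using point by blast
  obtain r where "par f - par (Var w) * k = P * r" using assms(2) by (auto simp: eqv_def elim: dvdE)
  then have "par f = par (Var w) * k + P * r" by (simp add: algebra_simps)
  then have "eval_at t' (par f) = eval_at t' (par (Var w) * k + P * r)" by simp
  then have "eval_at t' (par f) = 0"
    using t' unfolding eval_at_psubst id_hom.psubst_add id_hom.psubst_mult by simp
  moreover have "eval_at t' (par f) = psubst (\<lambda>c. c) (\<lambda>v. eval_at t' (par (Var v))) f"
    unfolding par_def eval_at_psubst psubst_psubst[OF id_hom.coeff_hom_axioms] by simp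
  moreover have "\<dots> = eval_at t f"
    unfolding eval_at_psubst[of t] using assms(1) t'(3) by (intro psubst_cong) auto
  ultimately show "eval_at t f = 0" by simp
qed

text \<open>Split \<open>f = f0 + w f1\<close> with \<open>f0\<close> free of \<open>w\<close>. The
  image of \<open>f0\<close> is divisible by that of \<open>w\<close>, so \<open>f0\<close> is 0 by
  independence, and the quotient is the image of \<open>f1\<close>.\<close>

lemma cancel_denom:
  assumes w: "w \<in> insert s Frozen" "\<not> par (Var w) \<asymp> 0"
    and indep: "\<And>f k. pvars f \<subseteq> insert s Frozen - {w} \<Longrightarrow> par f \<asymp> par (Var w) * k \<Longrightarrow> f = 0"
    and "f \<in> par_dom" "par (Var w) * g \<asymp> par f"
  shows "\<exists>f'\<in>par_dom. g \<asymp> par f'"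
proof -
  define f0 where "f0 = psubst Const (Var(w := 0)) f"
  have f0: "pvars f0 \<subseteq> insert s Frozen - {w}"
    unfolding f0_def using assms(4) by (intro pvars_psubst) (auto simp: par_dom_def)
  have "Var w dvd psubst Const Var f - f0" unfolding f0_def by (rule dvd_psubst_diff) auto
  then have "Var w dvd f - f0" by simp
  moreover have "pvars (f - f0) \<subseteq> insert s Frozen" using pvars_diff[of f f0] f0 assms(4) by (auto simp: par_dom_def)
  ultimately obtain f1 where f1: "pvars f1 \<subseteq> insert s Frozen" "f - f0 = Var w * f1"
    using dvd_pvars[of "Var w" "insert s Frozen" "f - f0"] w by auto
  have "par f = par f0 + par (Var w) * par f1" using f1(2) by (metis add_diff_cancel_left' diff_add_cancel par_simps(1,2) add.commute)
  then have eq: "par (Var w) * g \<asymp> par f0 + par (Var w) * par f1" using assms(5) by simp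
  have "par f0 \<asymp> par (Var w) * (g - par f1)"
    using eqv_sym[OF eqv_diff[OF eq eqv_refl[of "par (Var w) * par f1"]]] by (simp add: algebra_simps)
  then have "f0 = 0" using indep f0 by blast
  then have "par f0 = 0" using par_simps(3)[of 0] by simp
  then have "par (Var w) * g \<asymp> par (Var w) * par f1" using eq by simp
  then have "g \<asymp> par f1" using eqv_mult_cancel_left[OF w(2)] by blast
  then show ?thesis using f1(1) by (auto simp: par_dom_def)
qed

text \<open>For \<open>f\<close> in the kernel some \<open>M f\<close> is a polynomial in
  \<open>t\<close> over the candidate. It is killed and \<open>t\<close> is not, so it equals its
  constant coefficient, which lies in the candidate; then the factors of \<open>M\<close> are
  cancelled.\<close>

theorem kernel_subset:
  assumes W: "W \<subseteq> insert s Frozen"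
    and killed: "\<And>v. v \<in> Frozen \<Longrightarrow> D (Var v) \<asymp> 0" "D q \<asymp> 0" and t: "\<not> D t \<asymp> 0"
    and gens: "\<And>i. i \<in> {0,1,2} \<Longrightarrow> \<exists>M\<in>denoms W. \<exists>pp. par_poly pp \<and> M * X i \<asymp> poly pp t"
    and indep: "\<And>w f k. w \<in> W \<Longrightarrow> pvars f \<subseteq> insert s Frozen - {w} \<Longrightarrow> par f \<asymp> par (Var w) * k \<Longrightarrow> f = 0"
    and nonzero: "\<And>w. w \<in> W \<Longrightarrow> \<not> par (Var w) \<asymp> 0"
    and f: "f \<in> Car" "D f \<asymp> 0"
  shows "\<exists>g\<in>par_dom. f \<asymp> par g"
proof -
  have par_killed: "D (par g) \<asymp> 0" if "g \<in> par_dom" for g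
  proof (induction g rule: mpol_induct)
    case (Var v)
    then have "v = s \<or> v \<in> Frozen" using that by (auto simp: par_dom_def)
    then show ?case using killed by auto
  qed (auto intro: ker_add ker_mult)
  have par_image_killed: "D g \<asymp> 0" if "g \<in> par_image" for g
    using that by (rule par_imageE) (simp add: par_killed)
  have "\<exists>M\<in>denoms W. \<exists>pp. par_poly pp \<and> M * f \<asymp> poly pp t"
  proof (induction f rule: mpol_induct)
    case (Const k)
    show ?case
      by (rule bexI[OF _ denoms_1], rule exI[of _ "[:Const k:]"]) (simp add: par_poly_const par_image_Const)
  next
    case (Var v)
    then have "v \<in> V" using f(1) by (auto simp: carrier_mpol_ring)
    then consider "v \<in> Frozen" | i where "i \<in> {0,1,2}" "v = xv i" by (auto simp: Frozen_def)
    then show ?case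
    proof cases
      case 1
      then have "Var v \<in> par_image" by (intro par_image_frozen) simp
      then show ?thesis
        by (intro bexI[OF _ denoms_1] exI[of _ "[:Var v:]"]) (simp add: par_poly_const)
    next
      case 2
      then show ?thesis using gens by blast
    qed
  next
    case (add g h)
    then obtain M pp N qq where g: "M \<in> denoms W" "par_poly pp" "M * g \<asymp> poly pp t"
      and h: "N \<in> denoms W" "par_poly qq" "N * h \<asymp> poly qq t" by blast
    have "M * N * (g + h) = N * (M * g) + M * (N * h)" by (simp add: algebra_simps)
    also have "\<dots> \<asymp> N * poly pp t + M * poly qq t" by (intro eqv_add eqv_mult eqv_refl g h)
    also have "\<dots> = poly ([:N:] * pp + [:M:] * qq) t" by simp
    finally have "M * N * (g + h) \<asymp> poly ([:N:] * pp + [:M:] * qq) t" .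
    moreover have "par_poly ([:N:] * pp + [:M:] * qq)"
      by (intro par_poly_intros denoms_par_image[OF _ W] g h)
    ultimately show ?case using denoms_mult[OF g(1) h(1)] by blast
  next
    case (mult g h)
    then obtain M pp N qq where g: "M \<in> denoms W" "par_poly pp" "M * g \<asymp> poly pp t"
      and h: "N \<in> denoms W" "par_poly qq" "N * h \<asymp> poly qq t" by blast
    have "M * N * (g * h) = (M * g) * (N * h)" by (simp add: algebra_simps)
    also have "\<dots> \<asymp> poly pp t * poly qq t" by (intro eqv_mult g h)
    also have "\<dots> = poly (pp * qq) t" by simp
    finally have "M * N * (g * h) \<asymp> poly (pp * qq) t" .
    then show ?case using denoms_mult[OF g(1) h(1)] par_poly_mult[OF g(2) h(2)] by blast
  qed
  then obtain M pp where M: "M \<in> denoms W" "par_poly pp" "M * f \<asymp> poly pp t" by blast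
  have coeffs: "D (coeff pp i) \<asymp> 0" for i
    using M(2) unfolding par_poly_def by (blast intro: par_image_killed)
  have M_par: "M \<in> par_image" by (rule denoms_par_image[OF M(1) W])
  then have "D M \<asymp> 0" by (rule par_image_killed)
  then have "D (poly pp t) \<asymp> 0"
    using ker_mult[OF _ f(2), of M] D_cong[OF M(3)] eqv_0_cong by blast
  then have "poly pp t \<asymp> coeff pp 0" by (rule poly_in_ker_eqv_coeff_0[OF coeffs t])
  then have eq: "M * f \<asymp> coeff pp 0" by (rule eqv_trans[OF M(3)])
  have "coeff pp 0 \<in> par_image" using M(2) by (simp add: par_poly_def)
  then obtain g where "g \<in> par_dom" "coeff pp 0 = par g" by (rule par_imageE)
  with eq have "g \<in> par_dom" "M * f \<asymp> par g" by simp_all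
  with M(1) show ?thesis
  proof (induction M arbitrary: g rule: denoms.induct)
    case denoms_1
    then show ?case by auto
  next
    case (denoms_step w M)
    then have eq: "par (Var w) * (M * f) \<asymp> par g" by (simp add: mult.assoc)
    have "w \<in> insert s Frozen" using denoms_step.hyps W by blast
    then have "\<exists>g'\<in>par_dom. M * f \<asymp> par g'"
    proof (rule cancel_denom)
      show "\<not> par (Var w) \<asymp> 0" by (rule nonzero[OF denoms_step.hyps(1)])
      show "h = 0" if "pvars h \<subseteq> insert s Frozen - {w}" "par h \<asymp> par (Var w) * k" for h k
        by (rule indep[OF denoms_step.hyps(1) that])
    qed (rule denoms_step.prems eq)+
    then obtain g' where "g' \<in> par_dom" "M * f \<asymp> par g'" by blast
    then show ?case by (rule denoms_step.IH)
  qed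
qed

lemma Frozen_cases:
  "v \<in> Frozen \<longleftrightarrow> (\<exists>i j. v = TVar i j \<and> i \<in> {0,1,2} \<and> j \<in> {1..n i} \<and> j \<noteq> c i) \<or> (\<exists>k\<in>{1..d}. v = SVar k)"
proof -
  have "v \<in> {xv 0, xv 1, xv 2} \<longleftrightarrow> (\<exists>i\<in>{0,1,2}. v = TVar (p i) (c (p i)))" by (simp add: xv_def)
  also have "\<dots> \<longleftrightarrow> (\<exists>i\<in>p ` {0,1,2}. v = TVar i (c i))" by (simp only: bex_simps)
  finally have "v \<in> {xv 0, xv 1, xv 2} \<longleftrightarrow> (\<exists>i\<in>{0,1,2}. v = TVar i (c i))" unfolding p_image .
  then show ?thesis unfolding Frozen_def tri_vars_def by auto
qed

theorem der_ker_eq_ker_alg: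
  assumes killed: "\<And>v. v \<in> Frozen \<Longrightarrow> D (Var v) \<asymp> 0" "D q \<asymp> 0"
    and kernel: "\<And>f. f \<in> Car \<Longrightarrow> D f \<asymp> 0 \<Longrightarrow> \<exists>g\<in>par_dom. f \<asymp> par g"
  shows "der_ker n l d (induced_der n l d a) = ker_alg n l d c q"
proof (intro equalityI subsetI)
  fix x assume "x \<in> der_ker n l d (induced_der n l d a)"
  then obtain f where f: "f \<in> Car" "D f \<asymp> 0" "x = cl f" unfolding der_ker_eq by blast
  then obtain g where g: "g \<in> par_dom" "f \<asymp> par g" using kernel by blast
  then have x: "x = cl (par g)" using f cl_eq_iff_eqv par_Car by blast
  have "par g \<in> Car \<and> cl (par g) \<in> ker_alg n l d c q"
  proof (induction g rule: mpol_induct)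
    case (Const k)
    show ?case unfolding ker_alg_def by (auto intro: generate_ring.incl)
  next
    case (Var v)
    then have "v = s \<or> v \<in> Frozen" using g by (auto simp: par_dom_def)
    then show ?case
    proof
      assume "v = s"
      then show ?thesis using q_Car unfolding ker_alg_def by (auto intro: generate_ring.incl)
    next
      assume "v \<in> Frozen"
      then have "v \<in> V" by (simp add: Frozen_def)
      with \<open>v \<in> Frozen\<close> show ?thesis
        unfolding ker_alg_def Frozen_cases by (auto simp: Frozen_cases intro!: generate_ring.incl)
    qed
  next
    case (add g h)
    then show ?case unfolding ker_alg_def by (auto simp: cl_add[symmetric] intro: generate_ring.eng_add)
  next
    case (mult g h)
    then show ?case unfolding ker_alg_def by (auto simp: cl_mult[symmetric] intro: generate_ring.eng_mult)
  qed
  then show "x \<in> ker_alg n l d c q" using x by simp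
next
  fix x assume "x \<in> ker_alg n l d c q"
  then have "\<exists>f. f \<in> Car \<and> D f \<asymp> 0 \<and> x = cl f"
    unfolding ker_alg_def
  proof (induction x rule: generate_ring.induct)
    case one
    then show ?case by (intro exI[of _ 1]) (auto simp: cl_one)
  next
    case (incl h)
    then consider k where "h = cl (Const k)" | "h = cl q" | v where "v \<in> Frozen" "h = cl (Var v)"
      unfolding Frozen_cases by blast
    then show ?case
    proof cases
      case 1
      then show ?thesis by (intro exI[of _ "Const k"]) auto
    next
      case 2
      then show ?thesis using killed q_Car by blast
    next
      case 3
      then show ?thesis using killed by (intro exI[of _ "Var v"]) (auto simp: Frozen_def)
    qed
  next
    case (a_inv h)
    then obtain f where "f \<in> Car" "D f \<asymp> 0" "h = cl f" by blast
    then show ?case by (intro exI[of _ "- f"]) (auto simp: cl_minus D_minus)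
  next
    case (eng_add h1 h2)
    then obtain f g where "f \<in> Car" "D f \<asymp> 0" "h1 = cl f" "g \<in> Car" "D g \<asymp> 0" "h2 = cl g" by blast
    then show ?case by (intro exI[of _ "f + g"]) (auto simp: cl_add intro: ker_add)
  next
    case (eng_mult h1 h2)
    then obtain f g where "f \<in> Car" "D f \<asymp> 0" "h1 = cl f" "g \<in> Car" "D g \<asymp> 0" "h2 = cl g" by blast
    then show ?case by (intro exI[of _ "f * g"]) (auto simp: cl_mult intro: ker_mult)
  qed
  then show "x \<in> der_ker n l d (induced_der n l d a)" unfolding der_ker_eq by blast
qed

end

lemma ex3I: "Q x y z \<Longrightarrow> \<exists>x y z. Q x y z"
  by blast

section \<open>The derivations of types (a)--(d) and their kernels\<close>

text \<open>If \<open>r\<close> is itself a root, it is multiplied by a zero of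
  \<open>1 + w + ... + w^(k-1)\<close>, which is a root of unity different from 1 in characteristic
  zero.\<close>

lemma root_of_minus_1_avoiding:
  fixes r :: "'k::{alg_closed_field, field_char_0}"
  assumes "k \<ge> 2"
  shows "\<exists>z. z ^ k = -1 \<and> z \<noteq> r"
proof (cases "r ^ k = -1")
  case False
  then show ?thesis using nth_root_exists[of k "-1 :: 'k"] assms by auto
next
  case True
  define q :: "'k poly" where "q = (\<Sum>i<k. monom 1 i)"
  have coeff: "coeff q j = (if j < k then 1 else 0)" for j
    by (simp add: q_def coeff_sum)
  have "k - 1 \<le> degree q" using assms coeff by (intro le_degree) auto
  then have "degree q > 0" using assms by linarith
  then obtain w where w: "poly q w = 0" using alg_closed_imp_poly_has_root by blast
  have pq: "poly q w = (\<Sum>i<k. w ^ i)" by (simp add: q_def poly_sum poly_monom)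
  have "w ^ k = 1" using w one_diff_power_eq[of w k] by (simp add: pq)
  moreover have "w \<noteq> 1" using w assms by (auto simp: pq)
  moreover have "r \<noteq> 0" using True assms by (auto simp: zero_power_eq split: if_splits)
  ultimately show ?thesis using True by (intro exI[of _ "r * w"]) (auto simp: power_mult_distrib)
qed

context chart
begin

abbreviation dm :: "nat \<Rightarrow> nat \<Rightarrow> 'k mpol" where "dm i \<equiv> dmon n l c (p i)"

definition avec :: "'k mpol \<Rightarrow> 'k mpol \<Rightarrow> 'k mpol \<Rightarrow> tvar \<Rightarrow> 'k mpol" where
  "avec f0 f1 f2 = (\<lambda>_. 0)(xv 0 := f0, xv 1 := f1, xv 2 := f2)"

lemma avec_simps [simp]:
  "avec f0 f1 f2 (xv 0) = f0" "avec f0 f1 f2 (xv 1) = f1" "avec f0 f1 f2 (xv (Suc 0)) = f1"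
  "avec f0 f1 f2 (xv 2) = f2" "v \<in> Frozen \<Longrightarrow> avec f0 f1 f2 v = 0"
  by (auto simp: avec_def)

lemma in012 [simp]: "(0::nat) \<in> {0,1,2}" "(1::nat) \<in> {0,1,2}" "(2::nat) \<in> {0,1,2}"
  by auto

lemma poly_der_avec_Var:
  "poly_der n d (avec f0 f1 f2) (X 0) = f0" "poly_der n d (avec f0 f1 f2) (X 1) = f1"
  "poly_der n d (avec f0 f1 f2) (X 2) = f2" "v \<in> Frozen \<Longrightarrow> poly_der n d (avec f0 f1 f2) (Var v) = 0"
  using xv_in_V[OF in012(1)] xv_in_V[OF in012(2)] xv_in_V[OF in012(3)] by (simp_all add: poly_der_Var)

lemma poly_der_frozen:
  assumes "\<And>v. v \<in> Frozen \<Longrightarrow> poly_der n d a (Var v) = 0" "pvars q \<subseteq> Frozen"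
  shows "poly_der n d a q = 0"
proof (induction q rule: mpol_induct)
  case (Var v)
  then show ?case using assms by auto
qed (auto simp: poly_der.D_add poly_der.D_mult)

lemma poly_der_tm:
  assumes "\<And>v. v \<in> Frozen \<Longrightarrow> poly_der n d a (Var v) = 0" and i: "i \<in> {0,1,2}"
  shows "poly_der n d a (tm i \<alpha>) = dm i \<alpha> * poly_der n d a (X i)"
  using poly_der_frozen[OF assms(1) fr_vars_Frozen[OF i, of \<alpha>]]
  by (simp add: tm_eq[OF i] dmon_eq[OF i] poly_der.D_mult poly_der.D_power)

lemma tm_Car: "i \<in> {0,1,2} \<Longrightarrow> tm i \<alpha> \<in> Car"
  by (intro tri_mon_Car p_in)

lemma dm_Car: "i \<in> {0,1,2} \<Longrightarrow> dm i \<alpha> \<in> Car"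
  using pvars_pdiff[of "TVar (p i) (c (p i))" "tm i \<alpha>"] tm_Car[of i \<alpha>]
  unfolding dmon_def carrier_mpol_ring by blast

lemma chart_der_avec:
  assumes "f0 \<in> Car" "f1 \<in> Car" "f2 \<in> Car" and "dm 0 1 * f0 + dm 1 1 * f1 + dm 2 1 * f2 = 0"
  shows "chart_der n l d im p c (avec f0 f1 f2)"
proof unfold_locales
  show "avec f0 f1 f2 v \<in> Car" if "v \<in> V" for v
    using assms(1-3) by (auto simp: avec_def)
  have "poly_der n d (avec f0 f1 f2) P = dm 0 1 * f0 + dm 1 1 * f1 + dm 2 1 * f2"
    unfolding P_eq poly_der.D_add
    by (subst (1 2 3) poly_der_tm) (simp_all only: poly_der_avec_Var in012)
  then show "P dvd poly_der n d (avec f0 f1 f2) P" using assms(4) by simp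
qed

lemma der_a_eq: "der_a n l d p c = induced_der n l d (avec (dm 2 1) 0 (- dm 0 1))"
proof -
  have "(\<lambda>_. 0)(xv 0 := f, xv 2 := g) = avec f 0 g" for f g
    by (auto simp: avec_def fun_eq_iff)
  then show ?thesis unfolding der_a_def xv_def[symmetric] by simp
qed

lemma der_b_eq: "der_b n l d p c lam = induced_der n l d (avec (dm 1 (ex 0) * dm 2 1)
    (Const lam * dm 0 (ex 0) * dm 2 1) (- (dm 0 1 * dm 1 (ex 0) + Const lam * dm 0 (ex 0) * dm 1 1)))"
  unfolding der_b_def Let_def avec_def xv_def ex_def ..

lemma der_c_eq: "der_c n l d p c mu = induced_der n l d (avec (Const mu * dm 1 2 * dm 2 1)
    (dm 0 2 * dm 2 1) (- (Const mu * dm 0 1 * dm 1 2 + dm 0 2 * dm 1 1)))"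
  unfolding der_c_def avec_def xv_def ..

lemma der_d_eq: "der_d n l d p c im lam = induced_der n l d (avec
    (dm 1 2 * dm 2 2 * (Const (2 * lam) * tm 1 2 + Const ((1 + lam^2) * im) * tm 2 2))
    (dm 0 2 * dm 2 2 * (Const (- 2 * lam) * tm 0 2 + Const (1 - lam^2) * tm 2 2))
    (dm 0 2 * dm 1 2 * (Const (- ((1 + lam^2) * im)) * tm 0 2 - Const (1 - lam^2) * tm 1 2)))"
  unfolding der_d_def avec_def xv_def ..

lemma tm_2_eqv: "tm 2 1 \<asymp> - (tm 0 1 + tm 1 1)"
proof -
  have "tm 2 1 - - (tm 0 1 + tm 1 1) = P" unfolding P_eq by simp
  then show ?thesis unfolding eqv_def by (simp only: dvd_refl)
qed

definition upd :: "(tvar \<Rightarrow> 'k) \<Rightarrow> 'k \<Rightarrow> 'k \<Rightarrow> 'k \<Rightarrow> tvar \<Rightarrow> 'k" where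
  "upd t x y z = t(xv 0 := x, xv 1 := y, xv 2 := z)"

lemma eval_upd [simp]: "eval_at (upd t x y z) (X 0) = x" "eval_at (upd t x y z) (X 1) = y"
  "eval_at (upd t x y z) (X (Suc 0)) = y" "eval_at (upd t x y z) (X 2) = z"
  by (auto simp: upd_def eval_at_psubst)

lemma eval_upd_fr [simp]: "i \<in> {0,1,2} \<Longrightarrow> eval_at (upd t x y z) (fr i \<alpha>) = eval_at t (fr i \<alpha>)"
  unfolding eval_at_psubst upd_def using fr_vars_Frozen[of i \<alpha>]
  by (intro psubst_cong) (auto simp: Frozen_def)

lemma eval_simps: "eval_at t (f + g) = eval_at t f + eval_at t g" "eval_at t (f - g) = eval_at t f - eval_at t g"
  "eval_at t (f * g) = eval_at t f * eval_at t g" "eval_at t (f ^ k) = eval_at t f ^ k"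
  "eval_at t (Const a) = a" "eval_at t (- f) = - eval_at t f"
  by (simp_all add: eval_at_psubst id_hom.psubst_simps)

lemma eval_upd_tm:
  "eval_at (upd t x y z) (tm 0 \<alpha>) = eval_at t (fr 0 \<alpha>) * x ^ (ex 0 div \<alpha>)"
  "eval_at (upd t x y z) (tm 1 \<alpha>) = eval_at t (fr 1 \<alpha>) * y ^ (ex 1 div \<alpha>)"
  "eval_at (upd t x y z) (tm 2 \<alpha>) = eval_at t (fr 2 \<alpha>) * z ^ (ex 2 div \<alpha>)"
  unfolding tm_eq[OF in012(1)] tm_eq[OF in012(2)] tm_eq[OF in012(3)] eval_simps by (simp_all only: eval_upd eval_upd_fr in012)

lemma eval_upd_P: "eval_at (upd t x y z) P =
    eval_at t (fr 0 1) * x ^ ex 0 + eval_at t (fr 1 1) * y ^ ex 1 + eval_at t (fr 2 1) * z ^ ex 2"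
  unfolding P_eq eval_simps eval_upd_tm by simp

lemma eval_fr_power:
  assumes "\<And>j. j \<in> {1..n (p i)} \<Longrightarrow> \<alpha> dvd l (p i) j"
  shows "eval_at t (fr i 1) = eval_at t (fr i \<alpha>) ^ \<alpha>"
  using fr_power[of i \<alpha>, OF assms] by (simp flip: eval_simps)

end

text \<open>Setting a frozen variable of block \<open>i\<close> to 0 kills \<open>fr i\<close>. What
  is left to check for each type is that the selected coordinates can still be chosen on the
  hypersurface with an arbitrary nonzero value of \<open>q\<close>. The block has at least two
  variables, since it contains a frozen one.\<close>

lemma (in kernel_candidate) fr_var_independent:
  assumes f: "pvars f \<subseteq> insert s Frozen - {w}" "par f \<asymp> par (Var w) * k" and w: "w \<in> fr_vars_set"
    and point: "\<And>t L i. i \<in> {0,1,2} \<Longrightarrow> n (p i) \<ge> 2 \<Longrightarrow>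
        (\<And>k \<alpha>. k \<in> {0,1,2} \<Longrightarrow> k \<noteq> i \<Longrightarrow> eval_at t (fr k \<alpha>) \<noteq> 0) \<Longrightarrow>
        (\<And>\<alpha>. \<alpha> > 0 \<Longrightarrow> (\<And>j. j \<in> {1..n (p i)} \<Longrightarrow> \<alpha> dvd l (p i) j) \<Longrightarrow> eval_at t (fr i \<alpha>) = 0) \<Longrightarrow>
        L \<noteq> 0 \<Longrightarrow> \<exists>x y z. eval_at (upd t x y z) P = 0 \<and> eval_at (upd t x y z) q = L"
  shows "f = 0"
proof (rule param_independent[OF f])
  fix t :: "tvar \<Rightarrow> 'k" assume t: "\<forall>v. t v \<noteq> 0"
  obtain i j where ij: "w = TVar (p i) j" "i \<in> {0,1,2}" "j \<in> {1..n (p i)}" "j \<noteq> c (p i)"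
    using w unfolding fr_vars_set_def by blast
  have wF: "w \<in> Frozen" using w fr_vars_set_Frozen by blast
  have n2: "n (p i) \<ge> 2" using ij(3,4) c_in[OF ij(2)] by auto
  define t1 where "t1 = t(w := 0)"
  have other: "eval_at t1 (fr k \<alpha>) \<noteq> 0" if k: "k \<in> {0,1,2}" "k \<noteq> i" for k \<alpha>
  proof -
    have "w \<notin> pvars (fr k \<alpha>)" using fr_vars[OF k(1), of \<alpha>] k(2) by (auto simp: ij(1) p_eq_iff)
    then have "eval_at t1 (fr k \<alpha>) = eval_at t (fr k \<alpha>)"
      unfolding eval_at_psubst t1_def by (intro psubst_cong) auto
    then show ?thesis using fr_eval_nonzero[of t k \<alpha>] t k(1) by simp
  qed
  have self: "eval_at t1 (fr i \<alpha>) = 0" if "\<alpha> > 0" "\<And>j. j \<in> {1..n (p i)} \<Longrightarrow> \<alpha> dvd l (p i) j" for \<alpha>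
  proof -
    have "l (p i) j \<ge> 1" by (rule l_pos[OF p_in[OF ij(2)] ij(3)])
    then have "l (p i) j div \<alpha> \<noteq> 0" using that(2)[OF ij(3)] that(1) by (auto elim!: dvdE)
    then show ?thesis
      unfolding fr_def eval_at_psubst id_hom.psubst_prod id_hom.psubst_power id_hom.psubst_Var
      using ij by (intro prod_zero bexI[of _ j]) (auto simp: t1_def zero_power)
  qed
  obtain x y z where xyz: "eval_at (upd t1 x y z) P = 0" "eval_at (upd t1 x y z) q = t s"
    using point[OF ij(2) n2 other self, of "t s"] t by blast
  have "eval_at (upd t1 x y z) (Var v) = t1 v" if "v \<in> Frozen" for v
    using that by (auto simp: eval_at_psubst upd_def Frozen_def)
  then have *: "eval_at (upd t1 x y z) (par (Var v)) = (if v = s then t s else t1 v)" if "v \<in> insert s Frozen" for v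
    using that xyz(2) s_notin_Frozen by auto
  have "w \<noteq> s" using wF s_notin_Frozen by blast
  have "eval_at (upd t1 x y z) (par (Var w)) = (if w = s then t s else t1 w)"
    by (rule *) (use wF in blast)
  then have "eval_at (upd t1 x y z) (par (Var w)) = 0"
    using \<open>w \<noteq> s\<close> by (simp add: t1_def del: par_simps)
  moreover have "eval_at (upd t1 x y z) (par (Var v)) = t v" if "v \<in> insert s Frozen - {w}" for v
    using *[of v] that by (auto simp: t1_def simp del: par_simps)
  ultimately show "\<exists>t'. eval_at t' P = 0 \<and> eval_at t' (par (Var w)) = 0 \<and>
      (\<forall>v\<in>insert s Frozen - {w}. eval_at t' (par (Var v)) = t v)"
    using xyz(1) by blast
qed

lemma (in kernel_candidate) s_independent:
  assumes f: "pvars f \<subseteq> insert s Frozen - {s}" "par f \<asymp> par (Var s) * k"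
    and q0: "\<And>t. eval_at (upd t 0 0 0) q = 0"
  shows "f = 0"
proof (rule param_independent[OF f])
  fix t :: "tvar \<Rightarrow> 'k" assume t: "\<forall>v. t v \<noteq> 0"
  have "eval_at (upd t 0 0 0) P = 0"
    unfolding eval_upd_P using ex_pos[OF in012(1)] ex_pos[OF in012(2)] ex_pos[OF in012(3)] by (simp add: zero_power)
  moreover have "eval_at (upd t 0 0 0) (par (Var v)) = t v" if "v \<in> insert s Frozen - {s}" for v
    using that by (auto simp: eval_at_psubst upd_def Frozen_def)
  ultimately show "\<exists>t'. eval_at t' P = 0 \<and> eval_at t' (par (Var s)) = 0 \<and>
      (\<forall>v\<in>insert s Frozen - {s}. eval_at t' (par (Var v)) = t v)"
    using q0[of t] by (intro exI[of _ "upd t 0 0 0"]) simp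
qed

section \<open>Kernel descriptions and the identities behind types (c) and (d)\<close>

context chart
begin

text \<open>The kernel at the level of polynomials. The classification needs it in this form, to
  write a factor of proportionality as a polynomial in \<open>q\<close> and to split off its
  constant term.\<close>

definition ker_param :: "(tvar \<Rightarrow> 'k mpol) \<Rightarrow> tvar \<Rightarrow> 'k mpol \<Rightarrow> bool" where
  "ker_param a s q \<longleftrightarrow> (\<forall>f\<in>Car. poly_der n d a f \<asymp> 0 \<longrightarrow>
     (\<exists>g. pvars g \<subseteq> insert s Frozen \<and> f \<asymp> psubst Const (Var(s := q)) g))"

lemma dm_eq_fr: "i \<in> {0,1,2} \<Longrightarrow> ex i = \<alpha> \<Longrightarrow> dm i \<alpha> = fr i \<alpha>"
  using ex_pos[of i] by (simp add: dmon_eq)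

lemma tm_eq_linear: "i \<in> {0,1,2} \<Longrightarrow> ex i = \<alpha> \<Longrightarrow> tm i \<alpha> = fr i \<alpha> * X i"
  using ex_pos[of i] by (simp add: tm_eq)

lemma tm_power: "(\<And>j. j \<in> {1..n (p i)} \<Longrightarrow> \<alpha> dvd l (p i) j) \<Longrightarrow> tm i 1 = tm i \<alpha> ^ \<alpha>"
  by (rule tri_mon_power[symmetric])

lemma dm_power:
  assumes "\<And>j. j \<in> {1..n (p i)} \<Longrightarrow> \<alpha> dvd l (p i) j"
  shows "dm i 1 = of_nat \<alpha> * tm i \<alpha> ^ (\<alpha> - 1) * dm i \<alpha>"
proof -
  have "tm i 1 = tm i \<alpha> ^ \<alpha>" by (rule tm_power) (rule assms)
  then show ?thesis unfolding dmon_def by (simp add: pdiff.D_power)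
qed

lemma not_eqv_0_if_eval: "eval_at t P = 0 \<Longrightarrow> eval_at t f \<noteq> 0 \<Longrightarrow> \<not> f \<asymp> 0"
  unfolding eqv_0 by (auto simp: eval_simps elim!: dvdE)

lemma Const_mult_eqv_0: "k \<noteq> 0 \<Longrightarrow> Const k * f \<asymp> 0 \<longleftrightarrow> f \<asymp> 0"
  using Const_not_eqv_0 by (simp add: mult_eqv_0_iff)

lemma fr_mult_eqv_0: "fr i \<alpha> * f \<asymp> 0 \<longleftrightarrow> f \<asymp> 0"
  using fr_not_eqv_0 by (simp add: mult_eqv_0_iff)

end

lemma (in kernel_candidate) ker_paramI:
  assumes "\<And>f. f \<in> Car \<Longrightarrow> D f \<asymp> 0 \<Longrightarrow> \<exists>g\<in>par_dom. f \<asymp> par g"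
  shows "ker_param a s q"
  unfolding ker_param_def using assms by (auto simp: par_dom_def par_def)

lemma (in kernel_candidate) der_ker_eq_if_ker_param:
  assumes "\<And>v. v \<in> Frozen \<Longrightarrow> D (Var v) = 0" "D q = 0" "ker_param a s q"
  shows "der_ker n l d (induced_der n l d a) = ker_alg n l d c q"
  by (rule der_ker_eq_ker_alg) (use assms in \<open>auto simp: ker_param_def par_dom_def par_def\<close>)

lemma (in kernel_candidate) gen_frozen_linear:
  assumes "i \<in> {0,1,2}" "fr_vars_set \<subseteq> W" "fr i \<alpha> * X i \<asymp> poly pp t" "par_poly pp"
  shows "\<exists>M\<in>denoms W. \<exists>pp. par_poly pp \<and> M * X i \<asymp> poly pp t"
  using denoms_fr[OF assms(1,2)] assms(3,4) by blast

lemma (in kernel_candidate) gen_q_frozen_linear: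
  assumes "i \<in> {0,1,2}" "fr_vars_set \<subseteq> W" "s \<in> W" "q * (fr i \<alpha> * X i) \<asymp> poly pp t" "par_poly pp"
  shows "\<exists>M\<in>denoms W. \<exists>pp. par_poly pp \<and> M * X i \<asymp> poly pp t"
proof -
  have "par (Var s) * fr i \<alpha> \<in> denoms W" by (rule denoms_step[OF assms(3) denoms_fr[OF assms(1,2)]])
  moreover have "par (Var s) * fr i \<alpha> * X i \<asymp> poly pp t" using assms(4) by (simp add: mult.assoc)
  ultimately show ?thesis using assms(5) by blast
qed

lemma (in kernel_candidate) par_poly_fr: "i \<in> {0,1,2} \<Longrightarrow> par_poly [:fr i \<alpha>:]"
  by (intro par_poly_const par_image_frozen fr_vars_Frozen)

lemma (in kernel_candidate) par_poly_Const: "par_poly [:Const k:]" and par_poly_q: "par_poly [:q:]"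
  by (intro par_poly_const par_image_Const par_image_q)+

lemma (in kernel_candidate) par_fr_var_not_eqv_0: "w \<in> fr_vars_set \<Longrightarrow> \<not> par (Var w) \<asymp> 0"
  using fr_vars_set_Frozen Var_not_eqv_0[of w] by auto

lemma (in kernel_candidate) gen_self: "X i = t \<Longrightarrow> \<exists>M\<in>denoms W. \<exists>pp. par_poly pp \<and> M * X i \<asymp> poly pp t"
  by (rule bexI[OF _ denoms_1], rule exI[of _ "[:0, 1:]"]) (simp add: par_poly_X)

text \<open>Identities modulo \<open>A\<^sup>2 + B\<^sup>2 + G\<^sup>2 = 0\<close>, the condition for \<open>q = A x + B y + G z\<close> to be a tangent
  of the conic \<open>x\<^sup>2 + y\<^sup>2 + z\<^sup>2 = 0\<close>; the linear form \<open>B x - A y\<close> vanishes at the point of contact.\<close>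

lemma tangent_identities:
  fixes A B G x y z :: "'a::comm_ring_1"
  assumes "A ^ 2 + B ^ 2 = - (G ^ 2)"
  shows "B * (d0 * (d1 * d2 * (G * y - B * z))) - A * (d1 * (d0 * d2 * (A * z - G * x))) =
      G * (d0 * (d1 * (d2 * (A * x + B * y + G * z))))"
    and "G * (2 * ((A * x + B * y + G * z) * z)) - ((B * x - A * y) ^ 2 + (A * x + B * y + G * z) ^ 2) =
      G ^ 2 * (x ^ 2 + y ^ 2 + z ^ 2)"
    and "G * (2 * (G * ((A * x + B * y + G * z) * x))) -
      (A * (B * x - A * y) ^ 2 - A * (A * x + B * y + G * z) ^ 2 - 2 * (B * ((A * x + B * y + G * z) * (B * x - A * y)))) =
      A * G ^ 2 * (x ^ 2 + y ^ 2 + z ^ 2)"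
    and "G * (2 * (G * ((A * x + B * y + G * z) * y))) -
      (B * (B * x - A * y) ^ 2 - B * (A * x + B * y + G * z) ^ 2 + 2 * (A * ((A * x + B * y + G * z) * (B * x - A * y)))) =
      B * G ^ 2 * (x ^ 2 + y ^ 2 + z ^ 2)"
proof -
  have S: "A ^ 2 + B ^ 2 + G ^ 2 = 0" using assms by simp
  have *: "f = g" if "f - g = (A ^ 2 + B ^ 2 + G ^ 2) * k" for f g k
    using that unfolding S by simp
  show "B * (d0 * (d1 * d2 * (G * y - B * z))) - A * (d1 * (d0 * d2 * (A * z - G * x))) =
      G * (d0 * (d1 * (d2 * (A * x + B * y + G * z))))"
    by (rule *[of _ _ "- (d0 * d1 * d2 * z)"]) (simp add: algebra_simps power2_eq_square)
  show "G * (2 * ((A * x + B * y + G * z) * z)) - ((B * x - A * y) ^ 2 + (A * x + B * y + G * z) ^ 2) =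
      G ^ 2 * (x ^ 2 + y ^ 2 + z ^ 2)"
    by (rule *[of _ _ "- (x ^ 2 + y ^ 2)"]) (simp add: algebra_simps power2_eq_square)
  show "G * (2 * (G * ((A * x + B * y + G * z) * x))) -
      (A * (B * x - A * y) ^ 2 - A * (A * x + B * y + G * z) ^ 2 - 2 * (B * ((A * x + B * y + G * z) * (B * x - A * y)))) =
      A * G ^ 2 * (x ^ 2 + y ^ 2 + z ^ 2)"
    by (rule *[of _ _ "2 * (A * x + B * y + G * z) * x - A * (x ^ 2 + y ^ 2)"])
      (simp add: algebra_simps power2_eq_square)
  show "G * (2 * (G * ((A * x + B * y + G * z) * y))) -
      (B * (B * x - A * y) ^ 2 - B * (A * x + B * y + G * z) ^ 2 + 2 * (A * ((A * x + B * y + G * z) * (B * x - A * y)))) =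
      B * G ^ 2 * (x ^ 2 + y ^ 2 + z ^ 2)"
    by (rule *[of _ _ "2 * (A * x + B * y + G * z) * y - B * (x ^ 2 + y ^ 2)"])
      (simp add: algebra_simps power2_eq_square)
qed

text \<open>The product of \<open>q = u x + y\<close> and \<open>y - u x\<close> is
  \<open>x^2 + y^2\<close>, hence \<open>- z\<close> on the hypersurface. The difference and the sum
  of the two factors, multiplied by \<open>q\<close>, express \<open>q x\<close> and
  \<open>q y\<close> through \<open>q\<close> and \<open>z\<close>.\<close>

lemma split_square_identities:
  fixes u x y z :: "'a::comm_ring_1"
  assumes "u ^ 2 = -1"
  shows "2 * u * ((u * x + y) * x) - ((u * x + y) ^ 2 + z) = - (x ^ 2 + y ^ 2 + z)"
    and "2 * ((u * x + y) * y) - ((u * x + y) ^ 2 - z) = x ^ 2 + y ^ 2 + z"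
proof -
  have *: "f = g" if "f - g = (u ^ 2 + 1) * k" for f g k
    using that unfolding assms by simp
  show "2 * u * ((u * x + y) * x) - ((u * x + y) ^ 2 + z) = - (x ^ 2 + y ^ 2 + z)"
    by (rule *[of _ _ "x ^ 2"]) (simp add: algebra_simps power2_eq_square)
  show "2 * ((u * x + y) * y) - ((u * x + y) ^ 2 - z) = x ^ 2 + y ^ 2 + z"
    by (rule *[of _ _ "- (x ^ 2)"]) (simp add: algebra_simps power2_eq_square)
qed

context chart
begin

subsection \<open>Type (a)\<close>

lemma chart_der_a: "chart_der n l d im p c (avec (dm 2 1) 0 (- dm 0 1))"
  by (rule chart_der_avec) (auto intro!: carrier_mpol_ring_intros dm_Car)

text \<open>With \<open>t = X 0\<close> only \<open>X 2\<close> has to be expressed, and as its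
  exponent is 1 the trinomial does this with the denominator \<open>fr 2 1\<close>.\<close>

lemma ker_param_a:
  assumes "ex 2 = 1"
  shows "ker_param (avec (dm 2 1) 0 (- dm 0 1)) (xv 1) (X 1)"
proof -
  let ?a = "avec (dm 2 1) 0 (- dm 0 1)"
  interpret chart_der n l d im p c ?a by (rule chart_der_a)
  interpret kernel_candidate n l d im p c ?a "xv 1" "X 1"
    by unfold_locales (use xv_in_V[OF in012(2)] in auto)
  have fr2: "dm 2 1 = fr 2 1" using assms by (intro dm_eq_fr) auto
  show ?thesis
  proof (rule ker_paramI, rule kernel_subset[where W = fr_vars_set and t = "X 0"])
    show "fr_vars_set \<subseteq> insert (xv 1) Frozen" using fr_vars_set_Frozen by blast
    show "poly_der n d ?a (Var v) \<asymp> 0" if "v \<in> Frozen" for v using poly_der_avec_Var(4)[OF that] by simp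
    show "poly_der n d ?a (X 1) \<asymp> 0" unfolding poly_der_avec_Var by simp
    show "\<not> poly_der n d ?a (X 0) \<asymp> 0" unfolding poly_der_avec_Var fr2 by (rule fr_not_eqv_0)
    show "\<exists>M\<in>denoms fr_vars_set. \<exists>pp. par_poly pp \<and> M * X i \<asymp> poly pp (X 0)" if "i \<in> {0,1,2}" for i
    proof -
      consider "i = 0" | "i = 1" | "i = 2" using \<open>i \<in> {0,1,2}\<close> by auto
      then show ?thesis
      proof cases
        case 1
        then show ?thesis by (intro gen_self) simp
      next
        case 2
        show ?thesis unfolding 2
          by (rule bexI[OF _ denoms_1], rule exI[of _ "[:X 1:]"]) (simp add: par_poly_q[simplified])
      next
        case 3
        have "fr 2 1 * X 2 = tm 2 1" using tm_eq_linear[OF in012(3) assms] by simp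
        also have "\<dots> \<asymp> - (tm 0 1 + tm 1 1)" by (rule tm_2_eqv)
        also have "\<dots> = poly ([:Const (-1):] * ([:fr 0 1:] * [:0, 1:] ^ ex 0 + [:fr 1 1:] * [:X 1:] ^ ex 1)) (X 0)"
          by (simp add: tm_eq Const_minus)
        finally show ?thesis unfolding 3
          by (rule gen_frozen_linear[OF in012(3) order.refl])
            (intro par_poly_intros par_poly_fr par_poly_Const par_image_q par_image_Const par_image_frozen fr_vars_Frozen in012)
      qed
    qed
    show "f = 0" if w: "w \<in> fr_vars_set" and f: "pvars f \<subseteq> insert (xv 1) Frozen - {w}" "par f \<asymp> par (Var w) * k" for w f k
    proof (rule fr_var_independent[OF f w])
      fix t L i
      assume i: "i \<in> {0,1,2}" and other: "\<And>k \<alpha>. k \<in> {0,1,2} \<Longrightarrow> k \<noteq> i \<Longrightarrow> eval_at t (fr k \<alpha>) \<noteq> 0"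
        and self: "\<And>\<alpha>. \<alpha> > 0 \<Longrightarrow> (\<And>j. j \<in> {1..n (p i)} \<Longrightarrow> \<alpha> dvd l (p i) j) \<Longrightarrow> eval_at t (fr i \<alpha>) = 0"
        and L: "(L::'k) \<noteq> 0"
      have self1: "eval_at t (fr i 1) = 0" by (rule self) auto
      \<comment> \<open>The value of \<open>X 1\<close> is prescribed. If \<open>fr 2\<close>
        survives and \<open>fr 0\<close> vanishes, the equation is linear in \<open>X 2\<close>; if
        \<open>fr 1\<close> vanishes, 0 will do for the others; if \<open>fr 2\<close> vanishes, a
        root gives \<open>X 0\<close>.\<close>
      consider "i = 0" | "i = 1" | "i = 2" using i by auto
      then show "\<exists>x y z. eval_at (upd t x y z) P = 0 \<and> eval_at (upd t x y z) (X 1) = L"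
      proof cases
        case 1
        then show ?thesis
          using self1 other[of 2 1] assms ex_pos[OF in012(1)]
          by (intro ex3I[of _ 0 L "- (eval_at t (fr 1 1) * L ^ ex 1) / eval_at t (fr 2 1)"])
            (simp add: eval_upd_P)
      next
        case 2
        then show ?thesis
          using self1 ex_pos[OF in012(1)] ex_pos[OF in012(3)]
          by (intro ex3I[of _ 0 L 0]) (simp add: eval_upd_P zero_power)
      next
        case 3
        have "eval_at t (fr 0 1) \<noteq> 0" using other[of 0 1] 3 by simp
        moreover obtain x where "x ^ ex 0 = - (eval_at t (fr 1 1) * L ^ ex 1) / eval_at t (fr 0 1)"
          using nth_root_exists[of "ex 0"] ex_pos[OF in012(1)] by (metis less_le_trans zero_less_one)
        ultimately show ?thesis using self1 3
          by (intro ex3I[of _ x L 0]) (simp add: eval_upd_P)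
      qed
    qed
    show "\<not> par (Var w) \<asymp> 0" if "w \<in> fr_vars_set" for w
      by (rule par_fr_var_not_eqv_0[OF that])
  qed
qed

theorem der_ker_a:
  assumes "cond_a l p c"
  shows "der_ker n l d (der_a n l d p c :: 'k mpol set \<Rightarrow> 'k mpol set) = ker_alg n l d c (Var (TVar (p 1) (c (p 1))))"
proof -
  let ?a = "avec (dm 2 1) 0 (- dm 0 1)"
  have ex2: "ex 2 = 1" using assms by (simp add: cond_a_def ex_def)
  interpret chart_der n l d im p c ?a by (rule chart_der_a)
  interpret kernel_candidate n l d im p c ?a "xv 1" "X 1"
    by unfold_locales (use xv_in_V[OF in012(2)] in auto)
  show ?thesis
    unfolding der_a_eq xv_def[symmetric]
    by (rule der_ker_eq_if_ker_param[OF _ _ ker_param_a[OF ex2]]) (simp_all only: poly_der_avec_Var)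
qed

subsection \<open>Type (b)\<close>

definition avec_b :: "'k \<Rightarrow> tvar \<Rightarrow> 'k mpol" where
  "avec_b lam = avec (dm 1 (ex 0) * dm 2 1) (Const lam * dm 0 (ex 0) * dm 2 1)
     (- (dm 0 1 * dm 1 (ex 0) + Const lam * dm 0 (ex 0) * dm 1 1))"

definition q_b :: "'k \<Rightarrow> 'k mpol" where
  "q_b lam = Const lam * tm 0 (ex 0) - tm 1 (ex 0)"

lemma chart_der_b: "chart_der n l d im p c (avec_b lam)"
  unfolding avec_b_def
  by (rule chart_der_avec) (auto intro!: carrier_mpol_ring_intros dm_Car simp: algebra_simps)

lemma q_b_Car: "q_b lam \<in> Car"
  unfolding q_b_def by (intro carrier_mpol_ring_intros tm_Car in012)

lemma der_q_b: "poly_der n d (avec_b lam) (q_b lam) = 0"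
proof -
  have "poly_der n d (avec_b lam) (tm 0 (ex 0)) = dm 0 (ex 0) * (dm 1 (ex 0) * dm 2 1)"
    "poly_der n d (avec_b lam) (tm 1 (ex 0)) = dm 1 (ex 0) * (Const lam * dm 0 (ex 0) * dm 2 1)"
    unfolding avec_b_def by (subst poly_der_tm; simp only: poly_der_avec_Var in012)+
  then show ?thesis unfolding q_b_def poly_der.D_diff poly_der.D_mult by (simp add: algebra_simps)
qed

text \<open>Here \<open>t = X 1\<close>, and \<open>q\<close> expresses \<open>X 0\<close>. In the
  excluded case the derivation kills \<open>X 2\<close>, while \<open>q\<close> is congruent to
  \<open>fr 2 1 * X 2\<close> with a frozen variable in \<open>fr 2 1\<close>; the candidate would
  miss \<open>X 2\<close>.\<close>

lemma ker_param_b: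
  assumes ex2: "ex 2 = 1" and dvd: "\<And>i j. i \<in> {0,1} \<Longrightarrow> j \<in> {1..n (p i)} \<Longrightarrow> ex 0 dvd l (p i) j"
    and lam: "lam \<noteq> 0" "\<not> (ex 0 = 1 \<and> lam = -1 \<and> n (p 2) \<ge> 2)"
  shows "ker_param (avec_b lam) (xv 0) (q_b lam)"
proof -
  define \<alpha> where "\<alpha> = ex 0"
  define m where "m = ex 1 div \<alpha>"
  have \<alpha>: "\<alpha> > 0" using ex_pos[OF in012(1)] by (simp add: \<alpha>_def)
  have "\<alpha> dvd ex 1" using dvd[of 1 "c (p 1)"] c_in[OF in012(2)] unfolding \<alpha>_def ex_def[of 1] by simp
  then have ex1: "ex 1 = m * \<alpha>" by (simp add: m_def)
  have m: "m > 0" using ex1 ex_pos[OF in012(2)] by (cases m) auto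
  have tm0: "tm 0 \<alpha> = fr 0 \<alpha> * X 0" by (rule tm_eq_linear) (simp_all add: \<alpha>_def)
  have tm1: "tm 1 \<alpha> = fr 1 \<alpha> * X 1 ^ m" unfolding tm_eq[OF in012(2)] m_def ..
  have dm0: "dm 0 \<alpha> = fr 0 \<alpha>" by (rule dm_eq_fr) (simp_all add: \<alpha>_def)
  have dm2: "dm 2 1 = fr 2 1" using ex2 by (intro dm_eq_fr) auto
  have pow0: "tm 0 1 = tm 0 \<alpha> ^ \<alpha>" by (rule tm_power) (use dvd[of 0] in \<open>simp add: \<alpha>_def\<close>)
  have pow1: "tm 1 1 = tm 1 \<alpha> ^ \<alpha>" by (rule tm_power) (use dvd[of 1] in \<open>simp add: \<alpha>_def\<close>)
  interpret chart_der n l d im p c "avec_b lam" by (rule chart_der_b)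
  interpret kernel_candidate n l d im p c "avec_b lam" "xv 0" "q_b lam"
    by unfold_locales (use q_b_Car in auto)
  have q: "q_b lam = Const lam * tm 0 \<alpha> - tm 1 \<alpha>" by (simp add: q_b_def \<alpha>_def)
  show ?thesis
  proof (rule ker_paramI, rule kernel_subset[where W = fr_vars_set and t = "X 1"])
    show "fr_vars_set \<subseteq> insert (xv 0) Frozen" using fr_vars_set_Frozen by blast
    show "poly_der n d (avec_b lam) (Var v) \<asymp> 0" if "v \<in> Frozen" for v
      unfolding avec_b_def using poly_der_avec_Var(4)[OF that] by simp
    show "poly_der n d (avec_b lam) (q_b lam) \<asymp> 0" by (simp add: der_q_b)
    have "poly_der n d (avec_b lam) (X 1) = Const lam * fr 0 \<alpha> * fr 2 1"
      unfolding avec_b_def poly_der_avec_Var using dm0 dm2 by (simp add: \<alpha>_def)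
    then show "\<not> poly_der n d (avec_b lam) (X 1) \<asymp> 0"
      using lam fr_not_eqv_0 by (simp add: mult.assoc Const_mult_eqv_0 fr_mult_eqv_0)
    \<comment> \<open>This is \<open>(q + W) / lam\<close> for \<open>W = tm 1 \<alpha>\<close>, the
      definition of \<open>q\<close> solved for \<open>tm 0 \<alpha>\<close>.\<close>
    let ?x = "[:Const (1 / lam):] * ([:q_b lam:] + [:fr 1 \<alpha>:] * [:0, 1:] ^ m)"
    have x: "poly ?x (X 1) = tm 0 \<alpha>"
    proof -
      have "poly ?x (X 1) = Const (1 / lam) * (q_b lam + tm 1 \<alpha>)" unfolding tm1 by simp
      also have "\<dots> = Const (1 / lam) * (Const lam * tm 0 \<alpha>)" by (simp add: q)
      also have "\<dots> = tm 0 \<alpha>" using lam(1) by (simp flip: mult.assoc Const_mult)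
      finally show ?thesis .
    qed
    have par_x: "par_poly ?x"
      by (intro par_poly_mult par_poly_add par_poly_power par_poly_X par_poly_fr par_poly_Const par_poly_q in012)
    show "\<exists>M\<in>denoms fr_vars_set. \<exists>pp. par_poly pp \<and> M * X i \<asymp> poly pp (X 1)" if "i \<in> {0,1,2}" for i
    proof -
      consider "i = 0" | "i = 1" | "i = 2" using \<open>i \<in> {0,1,2}\<close> by auto
      then show ?thesis
      proof cases
        case 1
        show ?thesis unfolding 1
          by (rule gen_frozen_linear[OF in012(1) order.refl, of \<alpha> ?x, OF _ par_x])
            (simp only: x tm0 eqv_refl)
      next
        case 2
        then show ?thesis by (intro gen_self) simp
      next
        case 3
        let ?z = "[:Const (-1):] * (?x ^ \<alpha> + ([:fr 1 \<alpha>:] * [:0, 1:] ^ m) ^ \<alpha>)"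
        have "fr 2 1 * X 2 = tm 2 1" using tm_eq_linear[OF in012(3) ex2] by simp
        also have "\<dots> \<asymp> - (tm 0 1 + tm 1 1)" by (rule tm_2_eqv)
        also have "\<dots> = Const (-1) * (tm 0 \<alpha> ^ \<alpha> + (fr 1 \<alpha> * X 1 ^ m) ^ \<alpha>)"
          unfolding pow0 pow1 tm1 by (simp add: Const_minus)
        also have "\<dots> = poly ?z (X 1)"
          unfolding poly_mult[of "[:Const (-1):]"] poly_add[of "?x ^ \<alpha>"] poly_power x by simp
        finally show ?thesis unfolding 3
          by (rule gen_frozen_linear[OF in012(3) order.refl])
            (intro par_poly_mult par_poly_add par_poly_power par_poly_X par_poly_fr par_poly_Const par_poly_q in012)
      qed
    qed
    show "f = 0" if w: "w \<in> fr_vars_set" and f: "pvars f \<subseteq> insert (xv 0) Frozen - {w}" "par f \<asymp> par (Var w) * k" for w f k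
    proof (rule fr_var_independent[OF f w])
      fix t L i
      assume i: "i \<in> {0,1,2}" and n2: "n (p i) \<ge> 2"
        and other: "\<And>k \<alpha>. k \<in> {0,1,2} \<Longrightarrow> k \<noteq> i \<Longrightarrow> eval_at t (fr k \<alpha>) \<noteq> 0"
        and self: "\<And>\<alpha>. \<alpha> > 0 \<Longrightarrow> (\<And>j. j \<in> {1..n (p i)} \<Longrightarrow> \<alpha> dvd l (p i) j) \<Longrightarrow> eval_at t (fr i \<alpha>) = 0"
        and L: "(L::'k) \<noteq> 0"
      let ?U = "\<lambda>i \<alpha>. eval_at t (fr i \<alpha>)"
      have self1: "?U i 1 = 0" by (rule self) auto
      have U0: "?U 0 1 = ?U 0 \<alpha> ^ \<alpha>" by (rule eval_fr_power) (use dvd[of 0] in \<open>simp add: \<alpha>_def\<close>)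
      have U1: "?U 1 1 = ?U 1 \<alpha> ^ \<alpha>" by (rule eval_fr_power) (use dvd[of 1] in \<open>simp add: \<alpha>_def\<close>)
      have evq: "eval_at (upd t x y z) (q_b lam) = lam * (?U 0 \<alpha> * x) - ?U 1 \<alpha> * y ^ m" for x y z
        unfolding q eval_simps eval_upd_tm using \<alpha> by (simp add: m_def \<alpha>_def)
      have evP: "eval_at (upd t x y z) P = (?U 0 \<alpha> * x) ^ \<alpha> + (?U 1 \<alpha> * y ^ m) ^ \<alpha> + ?U 2 1 * z" for x y z
        unfolding eval_upd_P U0 U1 ex1 ex2 by (simp add: power_mult_distrib power_mult \<alpha>_def)
      consider "i = 0" | "i = 1" | "i = 2" using i by auto
      then show "\<exists>x y z. eval_at (upd t x y z) P = 0 \<and> eval_at (upd t x y z) (q_b lam) = L"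
      proof cases
        case 1
        have U: "?U 0 \<alpha> = 0" using self[OF \<alpha>] dvd[of 0] 1 by (simp add: \<alpha>_def)
        have V: "?U 1 \<alpha> \<noteq> 0" "?U 2 1 \<noteq> 0" using other[OF in012(2)] other[OF in012(3)] 1 by auto
        obtain y where y: "y ^ m = - L / ?U 1 \<alpha>" using nth_root_exists[OF m] by blast
        then show ?thesis using U V \<alpha>
          by (intro ex3I[of _ 0 y "- ((- L) ^ \<alpha>) / ?U 2 1"])
            (simp add: evP evq zero_power)
      next
        case 2
        have U: "?U 1 \<alpha> = 0" using self[OF \<alpha>] dvd[of 1] 2 by (simp add: \<alpha>_def)
        have V: "?U 0 \<alpha> \<noteq> 0" "?U 2 1 \<noteq> 0" using other[OF in012(1)] other[OF in012(3)] 2 by auto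
        then show ?thesis using U V \<alpha> lam(1)
          by (intro ex3I[of _ "L / (lam * ?U 0 \<alpha>)" 0 "- ((L / lam) ^ \<alpha>) / ?U 2 1"])
            (simp add: evP evq zero_power)
      next
        case 3
        have U: "?U 2 1 = 0" using self1 3 by simp
        have V: "?U 0 \<alpha> \<noteq> 0" "?U 1 \<alpha> \<noteq> 0" using other[OF in012(1)] other[OF in012(2)] 3 by auto
        \<comment> \<open>With \<open>fr 2 = 0\<close> the equation says
          \<open>U^\<alpha> + W^\<alpha> = 0\<close> for the two remaining monomials. Putting
          \<open>U = \<zeta> W\<close>, the value of \<open>q\<close> is
          \<open>(lam \<zeta> - 1) W\<close>, which can be prescribed if \<open>lam \<zeta>\<close>
          is not 1.\<close>
        obtain \<zeta> where \<zeta>: "\<zeta> ^ \<alpha> = -1" "lam * \<zeta> \<noteq> 1"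
        proof (cases "\<alpha> \<ge> 2")
          case True
          then obtain \<zeta> where "\<zeta> ^ \<alpha> = -1" "\<zeta> \<noteq> 1 / lam" using root_of_minus_1_avoiding by blast
          then show ?thesis using that[of \<zeta>] lam(1) by (auto simp: field_simps)
        next
          case False
          then have "\<alpha> = 1" using \<alpha> by simp
          then have "lam \<noteq> -1" using lam(2) n2 3 by (auto simp: \<alpha>_def)
          then show ?thesis using that[of "-1"] \<open>\<alpha> = 1\<close> by (auto simp: minus_equation_iff)
        qed
        define Y where "Y = L / (lam * \<zeta> - 1)"
        obtain y where y: "y ^ m = Y / ?U 1 \<alpha>" using nth_root_exists[OF m] by blast
        have "lam * (\<zeta> * Y) - Y = (lam * \<zeta> - 1) * Y" by (simp add: algebra_simps)
        also have "\<dots> = L" using \<zeta>(2) by (simp add: Y_def)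
        finally have "lam * (\<zeta> * Y) - Y = L" .
        then show ?thesis using U V y \<zeta>(1)
          by (intro ex3I[of _ "\<zeta> * Y / ?U 0 \<alpha>" y 0]) (simp add: evP evq power_mult_distrib)
      qed
    qed
    show "\<not> par (Var w) \<asymp> 0" if "w \<in> fr_vars_set" for w
      by (rule par_fr_var_not_eqv_0[OF that])
  qed
qed

theorem der_ker_b:
  fixes lam :: 'k
  assumes "cond_b n l p c" "lam \<noteq> 0" "\<not> (l (p 0) (c (p 0)) = 1 \<and> lam = -1 \<and> n (p 2) \<ge> 2)"
  shows "der_ker n l d (der_b n l d p c lam) =
           ker_alg n l d c (Const lam * tri_mon n l (p 0) (l (p 0) (c (p 0)))
                            - tri_mon n l (p 1) (l (p 0) (c (p 0))))"
proof -
  interpret chart_der n l d im p c "avec_b lam" by (rule chart_der_b)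
  interpret kernel_candidate n l d im p c "avec_b lam" "xv 0" "q_b lam"
    by unfold_locales (use q_b_Car in auto)
  have "ker_param (avec_b lam) (xv 0) (q_b lam)"
    by (rule ker_param_b) (use assms in \<open>auto simp: cond_b_def ex_def\<close>)
  then show ?thesis
    unfolding der_b_eq avec_b_def[symmetric] ex_def[symmetric] q_b_def[symmetric]
    by (intro der_ker_eq_if_ker_param der_q_b) (simp_all add: avec_b_def poly_der_avec_Var)
qed

subsection \<open>Type (c)\<close>

definition avec_c :: "'k \<Rightarrow> tvar \<Rightarrow> 'k mpol" where
  "avec_c mu = avec (Const mu * dm 1 2 * dm 2 1) (dm 0 2 * dm 2 1)
     (- (Const mu * dm 0 1 * dm 1 2 + dm 0 2 * dm 1 1))"

definition q_c :: "'k \<Rightarrow> 'k mpol" where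
  "q_c mu = Const mu * tm 0 2 + tm 1 2"

lemma chart_der_c: "chart_der n l d im p c (avec_c mu)"
  unfolding avec_c_def
  by (rule chart_der_avec) (auto intro!: carrier_mpol_ring_intros dm_Car simp: algebra_simps)

lemma q_c_Car: "q_c mu \<in> Car"
  unfolding q_c_def by (intro carrier_mpol_ring_intros tm_Car in012)

lemma der_q_c:
  assumes "mu ^ 2 = -1"
  shows "poly_der n d (avec_c mu) (q_c mu) = 0"
proof -
  have "poly_der n d (avec_c mu) (tm 0 2) = dm 0 2 * (Const mu * dm 1 2 * dm 2 1)"
    "poly_der n d (avec_c mu) (tm 1 2) = dm 1 2 * (dm 0 2 * dm 2 1)"
    unfolding avec_c_def by (subst poly_der_tm; simp only: poly_der_avec_Var in012)+
  then have "poly_der n d (avec_c mu) (q_c mu) = (Const (mu ^ 2) + 1) * (dm 0 2 * dm 1 2 * dm 2 1)"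
    unfolding q_c_def poly_der.D_add poly_der.D_mult by (simp add: algebra_simps power2_eq_square Const_mult)
  then show ?thesis using assms by (simp add: Const_minus)
qed

text \<open>The element \<open>t = X 2\<close> is sent to \<open>-2 q\<close> times a frozen
  monomial. The variables \<open>X 0\<close> and \<open>X 1\<close> are polynomial in
  \<open>t\<close> only after multiplication by \<open>q\<close>, so the placeholder
  \<open>xv 0\<close> of \<open>q\<close> is among the denominators.\<close>

lemma ker_param_c:
  assumes ex: "ex 0 = 2" "ex 1 = 2" and even: "\<And>i j. i \<in> {0,1} \<Longrightarrow> j \<in> {1..n (p i)} \<Longrightarrow> 2 dvd l (p i) j"
    and mu: "mu ^ 2 = -1"
  shows "ker_param (avec_c mu) (xv 0) (q_c mu)"
proof -
  have mu0: "mu \<noteq> 0" using mu by auto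
  have tm0: "tm 0 2 = fr 0 2 * X 0" and tm1: "tm 1 2 = fr 1 2 * X 1"
    using ex by (auto intro: tm_eq_linear)
  have tm2: "tm 2 1 = fr 2 1 * X 2 ^ ex 2" using tm_eq[OF in012(3), of 1] by simp
  have dm0: "dm 0 2 = fr 0 2" and dm1: "dm 1 2 = fr 1 2" using ex by (auto intro: dm_eq_fr)
  have pow0: "tm 0 1 = tm 0 2 ^ 2" by (rule tm_power, rule even) auto
  have pow1: "tm 1 1 = tm 1 2 ^ 2" by (rule tm_power, rule even) auto
  have dm01: "dm 0 1 = 2 * tm 0 2 * dm 0 2" and dm11: "dm 1 1 = 2 * tm 1 2 * dm 1 2"
    using dm_power[of 0 2] dm_power[of 1 2] even by simp_all
  interpret chart_der n l d im p c "avec_c mu" by (rule chart_der_c)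
  interpret kernel_candidate n l d im p c "avec_c mu" "xv 0" "q_c mu"
    by unfold_locales (use q_c_Car in auto)
  let ?W = "insert (xv 0) fr_vars_set" and ?q = "q_c mu"
  have mu2: "Const mu ^ 2 = (-1 :: 'k mpol)" using mu by (simp flip: Const_power add: Const_minus)
  have evq: "eval_at (upd t x y z) ?q = mu * (eval_at t (fr 0 2) * x) + eval_at t (fr 1 2) * y" for t x y z
    unfolding q_c_def eval_simps eval_upd_tm using ex by simp
  have evP: "eval_at (upd t x y z) P = (eval_at t (fr 0 2) * x) ^ 2 + (eval_at t (fr 1 2) * y) ^ 2
      + eval_at t (fr 2 1) * z ^ ex 2" for t x y z
  proof -
    have "eval_at t (fr 0 1) = eval_at t (fr 0 2) ^ 2" by (rule eval_fr_power, rule even) auto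
    moreover have "eval_at t (fr 1 1) = eval_at t (fr 1 2) ^ 2" by (rule eval_fr_power, rule even) auto
    ultimately show ?thesis unfolding eval_upd_P using ex by (simp add: power_mult_distrib)
  qed
  have q_not_0: "\<not> ?q \<asymp> 0"
  proof -
    let ?t = "\<lambda>_. 1 :: 'k"
    obtain z where z: "z ^ ex 2 = - (eval_at ?t (fr 1 2) ^ 2) / eval_at ?t (fr 2 1)"
      using nth_root_exists[of "ex 2"] ex_pos[OF in012(3)] by (metis less_le_trans zero_less_one)
    have "eval_at ?t (fr 1 2) \<noteq> 0" "eval_at ?t (fr 2 1) \<noteq> 0" by (rule fr_eval_nonzero; simp)+
    then show ?thesis using z by (intro not_eqv_0_if_eval[of "upd ?t 0 1 z"]) (simp_all add: evP evq)
  qed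
  show ?thesis
  proof (rule ker_paramI, rule kernel_subset[where W = ?W and t = "X 2"])
    show "?W \<subseteq> insert (xv 0) Frozen" using fr_vars_set_Frozen by blast
    show "poly_der n d (avec_c mu) (Var v) \<asymp> 0" if "v \<in> Frozen" for v
      unfolding avec_c_def using poly_der_avec_Var(4)[OF that] by simp
    show "poly_der n d (avec_c mu) ?q \<asymp> 0" by (simp add: der_q_c mu)
    have "poly_der n d (avec_c mu) (X 2) = Const (-2) * (fr 0 2 * (fr 1 2 * ?q))"
      unfolding avec_c_def poly_der_avec_Var dm01 dm11 dm0 dm1 q_c_def
      by (simp add: Const_minus Const_numeral algebra_simps)
    then show "\<not> poly_der n d (avec_c mu) (X 2) \<asymp> 0"
      using q_not_0 by (simp add: Const_mult_eqv_0 fr_mult_eqv_0)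
    show "\<exists>M\<in>denoms ?W. \<exists>pp. par_poly pp \<and> M * X i \<asymp> poly pp (X 2)" if "i \<in> {0,1,2}" for i
    proof -
      have W: "fr_vars_set \<subseteq> ?W" "xv 0 \<in> ?W" by auto
      let ?z = "[:fr 2 1:] * [:0, 1:] ^ ex 2"
      have z: "poly ?z (X 2) = tm 2 1" unfolding tm2 by simp
      consider "i = 0" | "i = 1" | "i = 2" using \<open>i \<in> {0,1,2}\<close> by auto
      then show ?thesis
      proof cases
        case 1
        let ?x = "[:Const (1 / (2 * mu)):] * ([:?q:] ^ 2 + ?z)"
        have "2 * Const mu * (?q * tm 0 2) - (?q ^ 2 + tm 2 1) = - P"
          unfolding P_eq pow0 pow1 q_c_def by (rule split_square_identities(1)[OF mu2])
        then have "2 * Const mu * (?q * tm 0 2) \<asymp> ?q ^ 2 + tm 2 1" unfolding eqv_def by simp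
        then have "Const (1 / (2 * mu)) * (2 * Const mu * (?q * tm 0 2)) \<asymp> Const (1 / (2 * mu)) * (?q ^ 2 + tm 2 1)"
          by (intro eqv_mult eqv_refl)
        moreover have "Const (1 / (2 * mu)) * (2 * Const mu) = (1 :: 'k mpol)"
          using mu0 by (simp flip: Const_mult Const_numeral)
        ultimately have "?q * tm 0 2 \<asymp> Const (1 / (2 * mu)) * (?q ^ 2 + tm 2 1)"
          by (simp flip: mult.assoc)
        also have "\<dots> = poly ?x (X 2)"
          unfolding poly_mult[of "[:Const (1 / (2 * mu)):]"] poly_add[of "[:?q:] ^ 2"] z by simp
        finally show ?thesis unfolding 1 tm0
          by (rule gen_q_frozen_linear[OF in012(1) W])
            (intro par_poly_mult par_poly_add par_poly_power par_poly_X par_poly_fr par_poly_Const par_poly_q in012)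
      next
        case 2
        let ?y = "[:Const (1 / 2):] * ([:?q:] ^ 2 - ?z)"
        have "2 * (?q * tm 1 2) - (?q ^ 2 - tm 2 1) = P"
          unfolding P_eq pow0 pow1 q_c_def by (rule split_square_identities(2)[OF mu2])
        then have "2 * (?q * tm 1 2) \<asymp> ?q ^ 2 - tm 2 1" unfolding eqv_def by simp
        then have "Const (1 / 2) * (2 * (?q * tm 1 2)) \<asymp> Const (1 / 2) * (?q ^ 2 - tm 2 1)"
          by (intro eqv_mult eqv_refl)
        moreover have "Const (1 / 2) * 2 = (1 :: 'k mpol)"
          by (simp flip: Const_mult Const_numeral)
        ultimately have "?q * tm 1 2 \<asymp> Const (1 / 2) * (?q ^ 2 - tm 2 1)"
          by (simp flip: mult.assoc)
        also have "\<dots> = poly ?y (X 2)"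
          unfolding poly_mult[of "[:Const (1 / 2):]"] poly_diff[of "[:?q:] ^ 2"] z by simp
        finally show ?thesis unfolding 2 tm1
          by (rule gen_q_frozen_linear[OF in012(2) W])
            (intro par_poly_mult par_poly_diff par_poly_power par_poly_X par_poly_fr par_poly_Const par_poly_q in012)
      next
        case 3
        then show ?thesis by (intro gen_self) simp
      qed
    qed
    show "f = 0" if w: "w \<in> ?W" and f: "pvars f \<subseteq> insert (xv 0) Frozen - {w}" "par f \<asymp> par (Var w) * k" for w f k
    proof (cases "w = xv 0")
      case True
      then show ?thesis using f s_independent[of f k] by (simp add: evq)
    next
      case False
      then have w: "w \<in> fr_vars_set" using w by blast
      show ?thesis
      proof (rule fr_var_independent[OF f w])
        fix t L i
        assume i: "i \<in> {0,1,2}"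
          and other: "\<And>k \<alpha>. k \<in> {0,1,2} \<Longrightarrow> k \<noteq> i \<Longrightarrow> eval_at t (fr k \<alpha>) \<noteq> 0"
          and self: "\<And>\<alpha>. \<alpha> > 0 \<Longrightarrow> (\<And>j. j \<in> {1..n (p i)} \<Longrightarrow> \<alpha> dvd l (p i) j) \<Longrightarrow> eval_at t (fr i \<alpha>) = 0"
          and L: "(L::'k) \<noteq> 0"
        let ?U = "\<lambda>i \<alpha>. eval_at t (fr i \<alpha>)"
        have root: "\<exists>z. z ^ ex 2 = r" for r :: 'k
          using nth_root_exists[of "ex 2"] ex_pos[OF in012(3)] by (metis less_le_trans zero_less_one)
        consider "i = 0" | "i = 1" | "i = 2" using i by auto
        then show "\<exists>x y z. eval_at (upd t x y z) P = 0 \<and> eval_at (upd t x y z) ?q = L"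
        proof cases
          case 1
          have U: "?U 0 2 = 0" using self[of 2] even[of 0] 1 by simp
          have V: "?U 1 2 \<noteq> 0" "?U 2 1 \<noteq> 0" using other[OF in012(2)] other[OF in012(3)] 1 by auto
          obtain z where "z ^ ex 2 = - (L ^ 2) / ?U 2 1" using root by blast
          then show ?thesis using U V by (intro ex3I[of _ 0 "L / ?U 1 2" z]) (simp add: evP evq)
        next
          case 2
          have U: "?U 1 2 = 0" using self[of 2] even[of 1] 2 by simp
          have V: "?U 0 2 \<noteq> 0" "?U 2 1 \<noteq> 0" using other[OF in012(1)] other[OF in012(3)] 2 by auto
          obtain z where "z ^ ex 2 = - ((L / mu) ^ 2) / ?U 2 1" using root by blast
          then show ?thesis using U V mu0 by (intro ex3I[of _ "L / (mu * ?U 0 2)" 0 z]) (simp add: evP evq)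
        next
          case 3
          have U: "?U 2 1 = 0" using self[of 1] 3 by simp
          have V: "?U 0 2 \<noteq> 0" "?U 1 2 \<noteq> 0" using other[OF in012(1)] other[OF in012(2)] 3 by auto
          \<comment> \<open>On the pair of lines \<open>x^2 + y^2 = 0\<close> the factor
            \<open>y - mu x\<close> is made to vanish; then \<open>mu x\<close> and \<open>y\<close>
            both equal \<open>L / 2\<close>.\<close>
          have "(L / (2 * mu)) ^ 2 + (L / 2) ^ 2 = 0" using mu mu0 by (simp add: power_divide power_mult_distrib)
          then show ?thesis using U V mu0
            by (intro ex3I[of _ "L / (2 * mu * ?U 0 2)" "L / (2 * ?U 1 2)" 0]) (simp add: evP evq)
        qed
      qed
    qed
    show "\<not> par (Var w) \<asymp> 0" if "w \<in> ?W" for w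
      using that par_fr_var_not_eqv_0 q_not_0 by auto
  qed
qed

theorem der_ker_c:
  assumes "cond_c n l p c" "mu \<in> {im, - im}"
  shows "der_ker n l d (der_c n l d p c mu) = ker_alg n l d c (Const mu * tri_mon n l (p 0) 2 + tri_mon n l (p 1) 2)"
proof -
  interpret chart_der n l d im p c "avec_c mu" by (rule chart_der_c)
  interpret kernel_candidate n l d im p c "avec_c mu" "xv 0" "q_c mu"
    by unfold_locales (use q_c_Car in auto)
  have mu: "mu ^ 2 = -1" using assms(2) im by auto
  have "ker_param (avec_c mu) (xv 0) (q_c mu)"
    by (rule ker_param_c[OF _ _ _ mu]) (use assms in \<open>auto simp: cond_c_def ex_def\<close>)
  then show ?thesis
    unfolding der_c_eq avec_c_def[symmetric] q_c_def[symmetric]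
    by (intro der_ker_eq_if_ker_param der_q_c mu) (simp_all add: avec_c_def poly_der_avec_Var)
qed

subsection \<open>Type (d)\<close>

text \<open>Apart from the derivatives, the values are the cross product of
  \<open>(tm 0 2, tm 1 2, tm 2 2)\<close> with the vector \<open>(A, B, G)\<close>; both the sum of
  squares and the scalar product \<open>q_d\<close> are therefore killed.\<close>

definition avec_d :: "'k \<Rightarrow> tvar \<Rightarrow> 'k mpol" where
  "avec_d lam = (let A = Const (1 - lam^2); B = - Const ((1 + lam^2) * im); G = Const (2 * lam) in avec
    (dm 1 2 * dm 2 2 * (G * tm 1 2 - B * tm 2 2))
    (dm 0 2 * dm 2 2 * (A * tm 2 2 - G * tm 0 2))
    (dm 0 2 * dm 1 2 * (B * tm 0 2 - A * tm 1 2)))"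

definition q_d :: "'k \<Rightarrow> 'k mpol" where
  "q_d lam = Const (1 - lam^2) * tm 0 2 - Const ((1 + lam^2) * im) * tm 1 2 + Const (2 * lam) * tm 2 2"

lemma avec_d_eq: "avec_d lam = avec
    (dm 1 2 * dm 2 2 * (Const (2 * lam) * tm 1 2 + Const ((1 + lam^2) * im) * tm 2 2))
    (dm 0 2 * dm 2 2 * (Const (- 2 * lam) * tm 0 2 + Const (1 - lam^2) * tm 2 2))
    (dm 0 2 * dm 1 2 * (Const (- ((1 + lam^2) * im)) * tm 0 2 - Const (1 - lam^2) * tm 1 2))"
proof -
  have "Const (- 2 * lam) = - Const (2 * lam)" by (simp flip: Const_minus)
  moreover have "Const (- ((1 + lam^2) * im)) = - Const ((1 + lam^2) * im)" by (rule Const_minus)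
  ultimately show ?thesis unfolding avec_d_def Let_def by (simp only: minus_mult_left[symmetric] diff_minus_eq_add add.commute[of "- _"] diff_conv_add_uminus[symmetric])
qed

text \<open>\<open>(1 - lam^2)^2 - (1 + lam^2)^2 = - (2 lam)^2\<close>: the rational parametrization
  of the isotropic vectors, where \<open>im\<close> supplies the sign of the second square.\<close>

lemma isotropic: "Const (1 - lam^2) ^ 2 + (- Const ((1 + lam^2) * im)) ^ 2 = - (Const (2 * lam) ^ 2 :: 'k mpol)"
proof -
  have "(1 - lam^2) ^ 2 + ((1 + lam^2) * im) ^ 2 = - ((2 * lam) ^ 2)"
    unfolding power_mult_distrib[of _ im] im by (simp add: algebra_simps power2_eq_square)
  then have "Const ((1 - lam^2) ^ 2 + ((1 + lam^2) * im) ^ 2) = Const (- ((2 * lam) ^ 2))" by simp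
  then show ?thesis by (simp only: Const_add Const_power Const_minus power2_minus)
qed

lemma chart_der_d:
  assumes even: "\<And>i j. i \<in> {0,1,2} \<Longrightarrow> j \<in> {1..n (p i)} \<Longrightarrow> 2 dvd l (p i) j"
  shows "chart_der n l d im p c (avec_d lam)"
  unfolding avec_d_def Let_def
proof (rule chart_der_avec)
  have "dm i 1 = 2 * tm i 2 * dm i 2" if "i \<in> {0,1,2}" for i
    using dm_power[of i 2] even[OF that] by simp
  then have dms: "dm 0 1 = 2 * tm 0 2 * dm 0 2" "dm 1 1 = 2 * tm 1 2 * dm 1 2" "dm 2 1 = 2 * tm 2 2 * dm 2 2"
    by blast+
  show "dm 0 1 * (dm 1 2 * dm 2 2 * (Const (2 * lam) * tm 1 2 - - Const ((1 + lam^2) * im) * tm 2 2)) +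
      dm 1 1 * (dm 0 2 * dm 2 2 * (Const (1 - lam^2) * tm 2 2 - Const (2 * lam) * tm 0 2)) +
      dm 2 1 * (dm 0 2 * dm 1 2 * (- Const ((1 + lam^2) * im) * tm 0 2 - Const (1 - lam^2) * tm 1 2)) = 0"
    unfolding dms by (simp only: algebra_simps) simp
qed (intro carrier_mpol_ring_intros dm_Car tm_Car in012)+

lemma q_d_Car: "q_d lam \<in> Car"
  unfolding q_d_def by (intro carrier_mpol_ring_intros tm_Car in012)

lemma der_d_tm:
  "poly_der n d (avec_d lam) (tm 0 2) = dm 0 2 * (dm 1 2 * dm 2 2 * (Const (2 * lam) * tm 1 2 + Const ((1 + lam^2) * im) * tm 2 2))"
  "poly_der n d (avec_d lam) (tm 1 2) = dm 1 2 * (dm 0 2 * dm 2 2 * (Const (1 - lam^2) * tm 2 2 - Const (2 * lam) * tm 0 2))"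
  "poly_der n d (avec_d lam) (tm 2 2) = dm 2 2 * (dm 0 2 * dm 1 2 * (- Const ((1 + lam^2) * im) * tm 0 2 - Const (1 - lam^2) * tm 1 2))"
  unfolding avec_d_def Let_def by (subst poly_der_tm; simp only: poly_der_avec_Var in012; simp)+

lemma der_q_d: "poly_der n d (avec_d lam) (q_d lam) = 0"
  unfolding q_d_def poly_der.D_add poly_der.D_diff poly_der.D_mult der_d_tm by (simp add: algebra_simps)

lemma eqv_Const_divide: "Const k * f \<asymp> g \<Longrightarrow> k \<noteq> 0 \<Longrightarrow> f \<asymp> Const (1 / k) * g"
proof -
  assume "Const k * f \<asymp> g" "k \<noteq> 0"
  then have "Const (1 / k) * (Const k * f) \<asymp> Const (1 / k) * g" by (intro eqv_mult eqv_refl)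
  moreover have "Const (1 / k) * (Const k * f) = f" using \<open>k \<noteq> 0\<close> by (simp flip: mult.assoc Const_mult)
  ultimately show ?thesis by simp
qed

lemma ker_param_d:
  assumes ex: "ex 0 = 2" "ex 1 = 2" "ex 2 = 2"
    and even: "\<And>i j. i \<in> {0,1,2} \<Longrightarrow> j \<in> {1..n (p i)} \<Longrightarrow> 2 dvd l (p i) j"
    and lam: "lam \<noteq> 0"
  shows "ker_param (avec_d lam) (xv 0) (q_d lam)"
proof -
  let ?A = "Const (1 - lam^2)" and ?B = "- Const ((1 + lam^2) * im)" and ?G = "Const (2 * lam)"
  let ?W = "insert (xv 0) fr_vars_set" and ?q = "q_d lam"
  \<comment> \<open>By the first tangent identity \<open>\<tau>\<close> is sent to \<open>q\<close>
    times a nonzero constant and a frozen monomial, and the other three express the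
    \<open>q * tm i 2\<close> as polynomials in \<open>\<tau>\<close> and \<open>q\<close>.\<close>
  define \<tau> where "\<tau> = ?B * tm 0 2 - ?A * tm 1 2"
  have q: "?q = ?A * tm 0 2 + ?B * tm 1 2 + ?G * tm 2 2" by (simp add: q_d_def)
  have tm: "tm i 2 = fr i 2 * X i" if "i \<in> {0,1,2}" for i
    using that ex by (intro tm_eq_linear) auto
  have dm: "dm i 2 = fr i 2" if "i \<in> {0,1,2}" for i
    using that ex by (intro dm_eq_fr) auto
  have pow: "tm i 1 = tm i 2 ^ 2" if "i \<in> {0,1,2}" for i
    by (rule tm_power, rule even[OF that])
  have P: "P = tm 0 2 ^ 2 + tm 1 2 ^ 2 + tm 2 2 ^ 2"
    unfolding P_eq using pow[OF in012(1)] pow[OF in012(2)] pow[OF in012(3)] by simp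
  interpret chart_der n l d im p c "avec_d lam" by (rule chart_der_d[OF even])
  interpret kernel_candidate n l d im p c "avec_d lam" "xv 0" "q_d lam"
    by unfold_locales (use q_d_Car in auto)
  define b g where "b = - ((1 + lam^2) * im)" and "g = 2 * lam"
  have evq: "eval_at (upd t x y z) ?q = (1 - lam^2) * (eval_at t (fr 0 2) * x) +
      b * (eval_at t (fr 1 2) * y) + g * (eval_at t (fr 2 2) * z)" for t x y z
    unfolding q_d_def eval_simps eval_upd_tm using ex by (simp add: b_def g_def)
  have evP: "eval_at (upd t x y z) P = (eval_at t (fr 0 2) * x) ^ 2 + (eval_at t (fr 1 2) * y) ^ 2
      + (eval_at t (fr 2 2) * z) ^ 2" for t x y z
    unfolding P eval_simps eval_upd_tm using ex by simp
  have im0: "im \<noteq> 0" using im by auto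
  \<comment> \<open>For \<open>e = im\<close> and \<open>e = - im\<close> the sum
    \<open>b + g e\<close> is \<open>- im (1 - lam)^2\<close> and \<open>- im (1 + lam)^2\<close>;
    these cannot both vanish.\<close>
  obtain e where e: "e ^ 2 = -1" "b + g * e \<noteq> 0"
  proof (cases "b + g * im = 0")
    case True
    have "b + g * im = - im * (1 - lam) ^ 2" "b - g * im = - im * (1 + lam) ^ 2"
      unfolding b_def g_def by (simp_all add: algebra_simps power2_eq_square)
    then have "b - g * im \<noteq> 0" using True im0 by (auto simp: eq_neg_iff_add_eq_0)
    then show ?thesis using that[of "- im"] im by simp
  qed (use that[of im] im in auto)
  have q_not_0: "\<not> ?q \<asymp> 0"
  proof -
    let ?t = "\<lambda>_. 1 :: 'k"
    have "eval_at ?t (fr 1 2) \<noteq> 0" "eval_at ?t (fr 2 2) \<noteq> 0" by (rule fr_eval_nonzero; simp)+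
    then show ?thesis using e
      by (intro not_eqv_0_if_eval[of "upd ?t 0 (1 / eval_at ?t (fr 1 2)) (e / eval_at ?t (fr 2 2))"])
        (simp_all add: evP evq)
  qed
  show ?thesis
  proof (rule ker_paramI, rule kernel_subset[where W = ?W and t = \<tau>])
    show "?W \<subseteq> insert (xv 0) Frozen" using fr_vars_set_Frozen by blast
    show "poly_der n d (avec_d lam) (Var v) \<asymp> 0" if "v \<in> Frozen" for v
      unfolding avec_d_def Let_def using poly_der_avec_Var(4)[OF that] by simp
    show "poly_der n d (avec_d lam) ?q \<asymp> 0" by (simp add: der_q_d)
    have "poly_der n d (avec_d lam) \<tau> = ?B * poly_der n d (avec_d lam) (tm 0 2) - ?A * poly_der n d (avec_d lam) (tm 1 2)"
      unfolding \<tau>_def minus_mult_left[symmetric] poly_der.D_diff poly_der.D_minus poly_der.D_mult poly_der_Const by simp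
    also have "\<dots> = ?G * (dm 0 2 * (dm 1 2 * (dm 2 2 * ?q)))"
      unfolding q tangent_identities(1)[OF isotropic[of lam], symmetric] der_d_tm by simp
    finally have "poly_der n d (avec_d lam) \<tau> = ?G * (fr 0 2 * (fr 1 2 * (fr 2 2 * ?q)))"
      unfolding dm[OF in012(1)] dm[OF in012(2)] dm[OF in012(3)] .
    then show "\<not> poly_der n d (avec_d lam) \<tau> \<asymp> 0"
      using q_not_0 lam by (simp add: Const_mult_eqv_0 fr_mult_eqv_0)
    have W: "fr_vars_set \<subseteq> ?W" "xv 0 \<in> ?W" by auto
    have "?G * (2 * (?q * tm 2 2)) - (\<tau> ^ 2 + ?q ^ 2) = ?G ^ 2 * P"
      unfolding P q \<tau>_def by (rule tangent_identities(2)[OF isotropic])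
    then have gen2: "?G * (2 * (?q * tm 2 2)) \<asymp> \<tau> ^ 2 + ?q ^ 2" unfolding eqv_def by simp
    have "?G * (2 * (?G * (?q * tm 0 2))) - (?A * \<tau> ^ 2 - ?A * ?q ^ 2 - 2 * (?B * (?q * \<tau>))) = ?A * ?G ^ 2 * P"
      unfolding P q \<tau>_def by (rule tangent_identities(3)[OF isotropic])
    then have gen0: "?G * (2 * (?G * (?q * tm 0 2))) \<asymp> ?A * \<tau> ^ 2 - ?A * ?q ^ 2 - 2 * (?B * (?q * \<tau>))" unfolding eqv_def by simp
    have "?G * (2 * (?G * (?q * tm 1 2))) - (?B * \<tau> ^ 2 - ?B * ?q ^ 2 + 2 * (?A * (?q * \<tau>))) = ?B * ?G ^ 2 * P"
      unfolding P q \<tau>_def by (rule tangent_identities(4)[OF isotropic])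
    then have gen1: "?G * (2 * (?G * (?q * tm 1 2))) \<asymp> ?B * \<tau> ^ 2 - ?B * ?q ^ 2 + 2 * (?A * (?q * \<tau>))" unfolding eqv_def by simp
    show "\<exists>M\<in>denoms ?W. \<exists>pp. par_poly pp \<and> M * X i \<asymp> poly pp \<tau>" if i: "i \<in> {0,1,2}" for i
    proof -
      have k: "2 * lam * 2 \<noteq> 0" "2 * lam * 2 * (2 * lam) \<noteq> 0" using lam by simp_all
      have two: "(2 :: 'k mpol) = Const 2" by (simp add: Const_numeral)
      let ?cB = "Const (- ((1 + lam^2) * im))"
      have cB: "?B = ?cB" by (simp add: Const_minus)
      consider "i = 0" | "i = 1" | "i = 2" using i by auto
      then have "\<exists>k f. k \<noteq> 0 \<and> par_poly f \<and> Const k * (?q * tm i 2) \<asymp> poly f \<tau>"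
      proof cases
        case 1
        let ?f = "[:?A:] * [:0, 1:] ^ 2 - [:?A:] * [:?q:] ^ 2 - [:Const 2:] * ([:?cB:] * ([:?q:] * [:0, 1:]))"
        have "poly ?f \<tau> = ?A * \<tau> ^ 2 - ?A * ?q ^ 2 - 2 * (?B * (?q * \<tau>))"
          unfolding cB two by simp
        moreover have "?G * (2 * (?G * (?q * tm 0 2))) = Const (2 * lam * 2 * (2 * lam)) * (?q * tm 0 2)"
          unfolding two by (simp only: Const_mult mult_ac)
        moreover have "par_poly ?f"
          by (intro par_poly_mult par_poly_add par_poly_diff par_poly_power par_poly_X par_poly_Const par_poly_q)
        ultimately show ?thesis using gen0 k(2) 1 by metis
      next
        case 2
        let ?f = "[:?cB:] * [:0, 1:] ^ 2 - [:?cB:] * [:?q:] ^ 2 + [:Const 2:] * ([:?A:] * ([:?q:] * [:0, 1:]))"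
        have "poly ?f \<tau> = ?B * \<tau> ^ 2 - ?B * ?q ^ 2 + 2 * (?A * (?q * \<tau>))"
          unfolding cB two by simp
        moreover have "?G * (2 * (?G * (?q * tm 1 2))) = Const (2 * lam * 2 * (2 * lam)) * (?q * tm 1 2)"
          unfolding two by (simp only: Const_mult mult_ac)
        moreover have "par_poly ?f"
          by (intro par_poly_mult par_poly_add par_poly_diff par_poly_power par_poly_X par_poly_Const par_poly_q)
        ultimately show ?thesis using gen1 k(2) 2 by metis
      next
        case 3
        let ?f = "[:0, 1:] ^ 2 + [:?q:] ^ 2"
        have "poly ?f \<tau> = \<tau> ^ 2 + ?q ^ 2" by simp
        moreover have "?G * (2 * (?q * tm 2 2)) = Const (2 * lam * 2) * (?q * tm 2 2)"
          unfolding two by (simp only: Const_mult mult_ac)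
        moreover have "par_poly ?f" by (intro par_poly_add par_poly_power par_poly_X par_poly_q)
        ultimately show ?thesis using gen2 k(1) 3 by metis
      qed
      then obtain k f where kf: "k \<noteq> 0" "par_poly f" "Const k * (?q * tm i 2) \<asymp> poly f \<tau>" by blast
      have "?q * (fr i 2 * X i) \<asymp> poly ([:Const (1 / k):] * f) \<tau>"
        using eqv_Const_divide[OF kf(3,1)] tm[OF i] by simp
      then show ?thesis
        by (rule gen_q_frozen_linear[OF i W]) (intro par_poly_mult par_poly_Const kf)
    qed
    show "f = 0" if w: "w \<in> ?W" and f: "pvars f \<subseteq> insert (xv 0) Frozen - {w}" "par f \<asymp> par (Var w) * k" for w f k
    proof (cases "w = xv 0")
      case True
      then show ?thesis using f s_independent[of f k] by (simp add: evq)
    next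
      case False
      then have w: "w \<in> fr_vars_set" using w by blast
      show ?thesis
      proof (rule fr_var_independent[OF f w])
        fix t L i
        assume i: "i \<in> {0,1,2}"
          and other: "\<And>k \<alpha>. k \<in> {0,1,2} \<Longrightarrow> k \<noteq> i \<Longrightarrow> eval_at t (fr k \<alpha>) \<noteq> 0"
          and self: "\<And>\<alpha>. \<alpha> > 0 \<Longrightarrow> (\<And>j. j \<in> {1..n (p i)} \<Longrightarrow> \<alpha> dvd l (p i) j) \<Longrightarrow> eval_at t (fr i \<alpha>) = 0"
          and L: "(L::'k) \<noteq> 0"
        let ?U = "\<lambda>i. eval_at t (fr i 2)"
        have U: "?U i = 0" by (rule self) (use even[OF i] in auto)
        consider "i = 0" | "i = 1" | "i = 2" using i by auto
        then show "\<exists>x y z. eval_at (upd t x y z) P = 0 \<and> eval_at (upd t x y z) ?q = L"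
        proof cases
          case 1
          have V: "?U 1 \<noteq> 0" "?U 2 \<noteq> 0" using other[OF in012(2)] other[OF in012(3)] 1 by auto
          define r where "r = L / (b + g * e)"
          have "b * r + g * (e * r) = (b + g * e) * r" by (simp add: algebra_simps)
          also have "\<dots> = L" using e by (simp add: r_def)
          finally have "b * r + g * (e * r) = L" .
          then show ?thesis using U V 1 e(1)
            by (intro ex3I[of _ 0 "r / ?U 1" "e * r / ?U 2"]) (simp add: evP evq power_mult_distrib)
        next
          case 2
          have V: "?U 0 \<noteq> 0" "?U 2 \<noteq> 0" using other[OF in012(1)] other[OF in012(3)] 2 by auto
          obtain e' where e': "e' ^ 2 = -1" "(1 - lam^2) + g * e' \<noteq> 0"
          proof (cases "(1 - lam^2) + g * im = 0")
            case True
            have "(1 - lam^2) - g * im \<noteq> 0"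
            proof
              assume "(1 - lam^2) - g * im = 0"
              moreover have "2 * (g * im) = ((1 - lam^2) + g * im) - ((1 - lam^2) - g * im)" by simp
              ultimately have "g * im = 0" using True by simp
              then show False using im0 lam by (simp add: g_def)
            qed
            then show ?thesis using that[of "- im"] im by simp
          qed (use that[of im] im in auto)
          define r where "r = L / ((1 - lam^2) + g * e')"
          have "(1 - lam^2) * r + g * (e' * r) = ((1 - lam^2) + g * e') * r" by (simp add: algebra_simps)
          also have "\<dots> = L" using e' by (simp add: r_def)
          finally have "(1 - lam^2) * r + g * (e' * r) = L" .
          then show ?thesis using U V 2 e'(1)
            by (intro ex3I[of _ "r / ?U 0" 0 "e' * r / ?U 2"]) (simp add: evP evq power_mult_distrib)
        next
          case 3
          have V: "?U 0 \<noteq> 0" "?U 1 \<noteq> 0" using other[OF in012(1)] other[OF in012(2)] 3 by auto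
          define h where "h = L / 2"
          have "(1 - lam^2) * h + b * (im * h) = (1 - lam^2 - (1 + lam^2) * im ^ 2) * h"
            unfolding b_def by (simp add: algebra_simps power2_eq_square)
          also have "\<dots> = 2 * h" unfolding im by simp
          also have "\<dots> = L" by (simp add: h_def)
          finally have "(1 - lam^2) * h + b * (im * h) = L" .
          then show ?thesis using U V 3 im
            by (intro ex3I[of _ "h / ?U 0" "im * h / ?U 1" 0]) (simp add: evP evq power_mult_distrib)
        qed
      qed
    qed
    show "\<not> par (Var w) \<asymp> 0" if "w \<in> ?W" for w
      using that par_fr_var_not_eqv_0 q_not_0 by auto
  qed
qed

theorem der_ker_d:
  assumes "cond_d n l c" "lam \<noteq> 0"
  shows "der_ker n l d (der_d n l d p c im lam) =
     ker_alg n l d c (Const (1 - lam^2) * tri_mon n l (p 0) 2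
                            - Const ((1 + lam^2) * im) * tri_mon n l (p 1) 2
                            + Const (2 * lam) * tri_mon n l (p 2) 2)"
proof -
  have even: "2 dvd l (p i) j" if "i \<in> {0,1,2}" "j \<in> {1..n (p i)}" for i j
    using assms(1) p_in[OF that(1)] that(2) unfolding cond_d_def by blast
  have ex: "ex i = 2" if "i \<in> {0,1,2}" for i
    using assms(1) p_in[OF that] unfolding cond_d_def ex_def by blast
  interpret chart_der n l d im p c "avec_d lam" by (rule chart_der_d[OF even])
  interpret kernel_candidate n l d im p c "avec_d lam" "xv 0" "q_d lam"
    by unfold_locales (use q_d_Car in auto)
  have "ker_param (avec_d lam) (xv 0) (q_d lam)"
    by (rule ker_param_d) (use ex even assms(2) in auto)
  then show ?thesis
    unfolding der_d_eq avec_d_eq[symmetric] q_d_def[symmetric]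
    by (intro der_ker_eq_if_ker_param der_q_d) (simp_all add: avec_d_def Let_def poly_der_avec_Var)
qed

end

section \<open>Gradings\<close>

definition wdeg :: "(tvar \<Rightarrow> int) \<Rightarrow> (tvar \<Rightarrow>\<^sub>0 nat) \<Rightarrow> int" where
  "wdeg A m = (\<Sum>v\<in>Poly_Mapping.keys m. int (Poly_Mapping.lookup m v) * A v)"

lemma wdeg_superset:
  "finite W \<Longrightarrow> Poly_Mapping.keys m \<subseteq> W \<Longrightarrow> wdeg A m = (\<Sum>v\<in>W. int (Poly_Mapping.lookup m v) * A v)"
  unfolding wdeg_def by (intro sum.mono_neutral_left) (auto simp: in_keys_iff)

lemma wdeg_0 [simp]: "wdeg A 0 = 0"
  by (simp add: wdeg_def)

lemma wdeg_add: "wdeg A (m + m') = wdeg A m + wdeg A m'"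
proof -
  let ?W = "Poly_Mapping.keys m \<union> Poly_Mapping.keys m'"
  have "wdeg A k = (\<Sum>v\<in>?W. int (Poly_Mapping.lookup k v) * A v)" if "k \<in> {m, m', m + m'}" for k
    by (rule wdeg_superset) (use that keys_add[of m m'] in auto)
  then show ?thesis by (simp add: lookup_add distrib_right sum.distrib)
qed

lemma wdeg_single [simp]: "wdeg A (Poly_Mapping.single v k) = int k * A v"
  by (simp add: wdeg_def)

definition homog :: "(tvar \<Rightarrow> int) \<Rightarrow> int \<Rightarrow> 'k::comm_ring_1 mpol \<Rightarrow> bool" where
  "homog A k f \<longleftrightarrow> (\<forall>m\<in>Poly_Mapping.keys f. wdeg A m = k)"

lemma homog_0 [simp]: "homog A k 0"
  by (simp add: homog_def)

lemma homog_Const [simp]: "homog A 0 (Const c)"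
  by (auto simp: homog_def Const_def)

lemma homog_1 [simp]: "homog A 0 1"
  using homog_Const[of A 1] by simp

lemma homog_Var [simp]: "homog A (A v) (Var v)"
  by (auto simp: homog_def Var_def)

lemma homog_add: "homog A k f \<Longrightarrow> homog A k g \<Longrightarrow> homog A k (f + g)"
  using keys_add[of f g] by (auto simp: homog_def)

lemma homog_minus: "homog A k f \<Longrightarrow> homog A k (- f)"
  by (simp add: homog_def)

lemma homog_diff: "homog A k f \<Longrightarrow> homog A k g \<Longrightarrow> homog A k (f - g)"
  using homog_add[of A k f "- g"] homog_minus by fastforce

lemma homog_mult: "homog A k f \<Longrightarrow> homog A j g \<Longrightarrow> homog A (k + j) (f * g)"
  using keys_mult[of f g] by (fastforce simp: homog_def wdeg_add)

lemma homog_sum: "(\<And>i. i \<in> S \<Longrightarrow> homog A k (f i)) \<Longrightarrow> homog A k (\<Sum>i\<in>S. f i)"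
  by (induction S rule: infinite_finite_induct) (auto intro: homog_add)

lemma homog_power: "homog A k f \<Longrightarrow> homog A (int j * k) (f ^ j)"
proof (induction j)
  case (Suc j)
  then show ?case using homog_mult[of A k f "int j * k" "f ^ j"] by (simp add: algebra_simps)
qed simp

lemma homog_prod: "(\<And>i. i \<in> S \<Longrightarrow> homog A (k i) (f i)) \<Longrightarrow> homog A (\<Sum>i\<in>S. k i) (\<Prod>i\<in>S. f i)"
  by (induction S rule: infinite_finite_induct) (auto intro: homog_mult)

lemma homog_pdiff: "homog A k f \<Longrightarrow> homog A (k - A v) (pdiff v f)"
  unfolding pdiff_def
proof (rule homog_sum)
  fix m assume f: "homog A k f" and m: "m \<in> Poly_Mapping.keys f"
  show "homog A (k - A v) (Poly_Mapping.single (m - Poly_Mapping.single v 1)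
      (of_nat (Poly_Mapping.lookup m v) * Poly_Mapping.lookup f m))"
  proof (cases "Poly_Mapping.lookup m v = 0")
    case False
    then have "m - Poly_Mapping.single v 1 + Poly_Mapping.single v 1 = m"
      by (intro poly_mapping_eqI) (auto simp: lookup_add lookup_minus lookup_single when_def)
    then have "wdeg A m = wdeg A (m - Poly_Mapping.single v 1) + A v"
      using wdeg_add[of A "m - Poly_Mapping.single v 1" "Poly_Mapping.single v 1"] by simp
    then show ?thesis using f m by (auto simp: homog_def)
  qed simp
qed

lemma homog_poly_der:
  assumes "\<And>v. v \<in> tri_vars n d \<Longrightarrow> homog A (A v + e) (a v)" "homog A k f"
  shows "homog A (k + e) (poly_der n d a f)"
  unfolding poly_der_def
proof (rule homog_sum)
  fix v assume "v \<in> tri_vars n d"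
  then have "homog A (A v + e + (k - A v)) (a v * pdiff v f)"
    using assms by (intro homog_mult homog_pdiff)
  then show "homog A (k + e) (a v * pdiff v f)" by (simp add: algebra_simps)
qed

lemma Var_power_dvd:
  assumes "\<And>m. m \<in> Poly_Mapping.keys f \<Longrightarrow> k \<le> Poly_Mapping.lookup m v"
  shows "Var v ^ k dvd f"
proof -
  have "Var v ^ k dvd Poly_Mapping.single m (Poly_Mapping.lookup f m)" if "m \<in> Poly_Mapping.keys f" for m
  proof -
    have "Poly_Mapping.single v k + (m - Poly_Mapping.single v k) = m"
      using assms[OF that] by (intro poly_mapping_eqI) (auto simp: lookup_add lookup_minus lookup_single when_def)
    then have "Poly_Mapping.single m (Poly_Mapping.lookup f m) =
        Var v ^ k * Poly_Mapping.single (m - Poly_Mapping.single v k) (Poly_Mapping.lookup f m)"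
      by (simp add: Var_power mult_single)
    then show ?thesis by (rule dvdI)
  qed
  then have "Var v ^ k dvd (\<Sum>m\<in>Poly_Mapping.keys f. Poly_Mapping.single m (Poly_Mapping.lookup f m))"
    by (intro dvd_sum)
  then show ?thesis by (simp add: mpol_sum_single)
qed

text \<open>The part of a polynomial supported on the monomials with property \<open>Q\<close>; with
  weight conditions for \<open>Q\<close> it is a homogeneous component.\<close>

definition prest :: "((tvar \<Rightarrow>\<^sub>0 nat) \<Rightarrow> bool) \<Rightarrow> 'k::comm_ring_1 mpol \<Rightarrow> 'k mpol" where
  "prest Q f = (\<Sum>m | m \<in> Poly_Mapping.keys f \<and> Q m. Poly_Mapping.single m (Poly_Mapping.lookup f m))"

lemma lookup_prest: "Poly_Mapping.lookup (prest Q f) m = (if Q m then Poly_Mapping.lookup f m else 0)"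
proof -
  have "Poly_Mapping.lookup (prest Q f) m =
      (\<Sum>k | k \<in> Poly_Mapping.keys f \<and> Q k. if k = m then Poly_Mapping.lookup f k else 0)"
    unfolding prest_def lookup_sum by (intro sum.cong) (auto simp: lookup_single when_def)
  then show ?thesis by (auto simp: in_keys_iff)
qed

lemma prest_add: "prest Q (f + g) = prest Q f + prest Q g"
  by (rule poly_mapping_eqI) (simp add: lookup_prest lookup_add)

lemma keys_prest: "m \<in> Poly_Mapping.keys (prest Q f) \<longleftrightarrow> m \<in> Poly_Mapping.keys f \<and> Q m"
  by (auto simp: in_keys_iff lookup_prest)

lemma prest_id: "(\<And>m. m \<in> Poly_Mapping.keys f \<Longrightarrow> Q m) \<Longrightarrow> prest Q f = f"
  by (rule poly_mapping_eqI) (auto simp: lookup_prest in_keys_iff)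

lemma prest_none: "(\<And>m. m \<in> Poly_Mapping.keys f \<Longrightarrow> \<not> Q m) \<Longrightarrow> prest Q f = 0"
  by (rule poly_mapping_eqI) (auto simp: lookup_prest in_keys_iff)

lemma prest_mult:
  assumes "\<And>m m'. m \<in> Poly_Mapping.keys p \<Longrightarrow> Q (m + m') \<longleftrightarrow> Q' m'"
  shows "prest Q (p * q) = p * prest Q' q"
proof -
  have q: "q = prest Q' q + prest (\<lambda>m. \<not> Q' m) q"
    by (rule poly_mapping_eqI) (simp add: lookup_prest lookup_add)
  have "prest Q (p * prest Q' q) = p * prest Q' q"
    using keys_mult[of p "prest Q' q"] assms by (intro prest_id) (auto simp: keys_prest)
  moreover have "prest Q (p * prest (\<lambda>m. \<not> Q' m) q) = 0"
    using keys_mult[of p "prest (\<lambda>m. \<not> Q' m) q"] assms by (intro prest_none) (auto simp: keys_prest)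
  ultimately show ?thesis by (subst q) (simp add: distrib_left prest_add)
qed

lemma powi_sum:
  assumes "(x::'k::field) \<noteq> 0"
  shows "x powi (\<Sum>i\<in>S. f i) = (\<Prod>i\<in>S. x powi f i)"
  by (induction S rule: infinite_finite_induct) (use assms in \<open>auto simp: power_int_add\<close>)

text \<open>In characteristic zero 2 is not a root of unity, so a one-parameter subgroup separates
  all weights already by its value at 2.\<close>

lemma two_powi_inject: "(2 :: 'k::field_char_0) powi i = 2 powi j \<longleftrightarrow> i = j"
proof -
  have "k = 0" if "(2 :: 'k) powi k = 1" for k
  proof -
    have *: "j = 0" if "(2 :: 'k) ^ j = 1" for j
    proof -
      have "of_nat (2 ^ j) = (of_nat 1 :: 'k)" using that by simp
      then have "(2::nat) ^ j = 1" unfolding of_nat_eq_iff .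
      then show "j = 0" by simp
    qed
    show ?thesis
    proof (cases "k \<ge> 0")
      case True
      then show ?thesis using that *[of "nat k"] by (simp add: power_int_def)
    next
      case False
      then have "inverse ((2 :: 'k) ^ nat (- k)) = 1"
        using that unfolding power_int_def power_inverse by (simp only: if_False)
      then have "(2 :: 'k) ^ nat (- k) = 1" by (metis inverse_1 inverse_inverse_eq)
      then show ?thesis using *[of "nat (- k)"] False by simp
    qed
  qed
  moreover have "(2 :: 'k) powi i = 2 powi j \<longleftrightarrow> (2 :: 'k) powi (i - j) = 1"
    by (simp add: power_int_diff)
  ultimately show ?thesis by (metis right_minus_eq)
qed

section \<open>One-parameter subgroups and the identity component of the torus\<close>

context trinomial
begin

text \<open>The weights for which \<open>s\<close> acting by \<open>s^(A v)\<close> multiplies all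
  three monomials by \<open>s^w\<close>: the one-parameter subgroups of \<open>\<bbbH>\<close>,
  equivalently the integer gradings for which the trinomial is homogeneous.\<close>

definition cochar :: "(tvar \<Rightarrow> int) \<Rightarrow> int \<Rightarrow> bool" where
  "cochar A w \<longleftrightarrow> (\<forall>i\<in>{0,1,2}. (\<Sum>j\<in>{1..n i}. int (l i j) * A (TVar i j)) = w)"

definition curve :: "(tvar \<Rightarrow> int) \<Rightarrow> 'k \<Rightarrow> tvar \<Rightarrow> 'k" where
  "curve A s = (\<lambda>v\<in>V. s powi A v)"

lemma homog_tri_mon: "cochar A w \<Longrightarrow> i \<in> {0,1,2} \<Longrightarrow> homog A w (tri_mon n l i 1)"
proof -
  assume A: "cochar A w" "i \<in> {0,1,2}"
  have "homog A (\<Sum>j\<in>{1..n i}. int (l i j div 1) * A (TVar i j)) (tri_mon n l i 1)"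
    unfolding tri_mon_def by (intro homog_prod homog_power homog_Var)
  moreover have "(\<Sum>j\<in>{1..n i}. int (l i j) * A (TVar i j)) = w" using A unfolding cochar_def by blast
  ultimately show ?thesis by (simp only: div_by_1)
qed

lemma homog_P: "cochar A w \<Longrightarrow> homog A w P"
  unfolding P_def by (intro homog_add homog_tri_mon) auto

lemma monom_at_curve:
  assumes "s \<noteq> 0" "Poly_Mapping.keys m \<subseteq> V"
  shows "monom_at (curve A s) m = s powi wdeg A m"
proof -
  have "monom_at (curve A s) m = (\<Prod>v\<in>Poly_Mapping.keys m. s powi (int (Poly_Mapping.lookup m v) * A v))"
    unfolding monom_at_def
  proof (intro prod.cong refl)
    fix v assume "v \<in> Poly_Mapping.keys m"
    then have "curve A s v = s powi A v" using assms by (auto simp: curve_def)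
    then show "curve A s v ^ Poly_Mapping.lookup m v = s powi (int (Poly_Mapping.lookup m v) * A v)"
      by (simp add: power_int_mult mult.commute[of "int _"] power_int_of_nat)
  qed
  then show ?thesis using assms by (simp add: wdeg_def powi_sum)
qed

lemma lookup_scale_vars: "Poly_Mapping.lookup (scale_vars t f) m = Poly_Mapping.lookup f m * monom_at t m"
proof -
  have "Poly_Mapping.lookup (scale_vars t f) m =
      (\<Sum>k\<in>Poly_Mapping.keys f. if k = m then Poly_Mapping.lookup f k * monom_at t k else 0)"
    unfolding scale_vars_def lookup_sum by (intro sum.cong) (auto simp: lookup_single when_def)
  then show ?thesis by (simp add: in_keys_iff)
qed

lemma lookup_Const_mult: "Poly_Mapping.lookup (Const k * f) m = k * Poly_Mapping.lookup f m"
  by (simp add: Const_def Poly_Mapping.map.rep_eq when_def flip: mult_map_scale_conv_mult)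

lemma scale_vars_homog:
  assumes "homog A w f" "f \<in> Car" "s \<noteq> 0"
  shows "scale_vars (curve A s) f = Const (s powi w) * f"
proof (rule poly_mapping_eqI)
  fix m
  show "Poly_Mapping.lookup (scale_vars (curve A s) f) m = Poly_Mapping.lookup (Const (s powi w) * f) m"
  proof (cases "m \<in> Poly_Mapping.keys f")
    case True
    then have "Poly_Mapping.keys m \<subseteq> V" using assms(2) by (auto simp: carrier_mpol_ring pvars_def)
    then show ?thesis using True assms monom_at_curve[OF assms(3), of m A]
      by (simp add: lookup_scale_vars lookup_Const_mult homog_def)
  qed (simp add: lookup_scale_vars lookup_Const_mult in_keys_iff)
qed

lemma curve_in_big_torus: "s \<noteq> 0 \<Longrightarrow> curve A s \<in> big_torus n d"
  by (auto simp: big_torus_def curve_def)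

lemma curve_in_H: "cochar A w \<Longrightarrow> s \<noteq> 0 \<Longrightarrow> curve A s \<in> torus_H n l d"
  unfolding torus_H_def using curve_in_big_torus scale_vars_homog[OF homog_tri_mon tri_mon_Car] by blast

text \<open>Along a one-parameter subgroup a polynomial becomes a Laurent polynomial in
  \<open>s\<close>. A power of \<open>s\<close> clears the denominators, so there are finitely many
  zeros unless it vanishes identically.\<close>

lemma eval_curve_poly:
  assumes "f \<in> Car"
  shows "\<exists>N p. \<forall>s. s \<noteq> 0 \<longrightarrow> s ^ N * eval_at (curve A s) f = poly p s"
proof (induction f rule: mpol_induct)
  case (Const c)
  show ?case by (intro exI[of _ 0] exI[of _ "[:c:]"]) (simp add: eval_at_psubst)
next
  case (Var v)
  then have "v \<in> V" using assms by (auto simp: carrier_mpol_ring)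
  then have e: "eval_at (curve A s) (Var v) = s powi A v" for s by (simp add: eval_at_psubst curve_def)
  show ?case
  proof (cases "A v \<ge> 0")
    case True
    then show ?thesis unfolding e
      by (intro exI[of _ 0] exI[of _ "Polynomial.monom 1 (nat (A v))"]) (simp add: poly_monom power_int_def)
  next
    case False
    then show ?thesis unfolding e
      by (intro exI[of _ "nat (- A v)"] exI[of _ 1]) (simp add: power_int_def flip: power_mult_distrib)
  qed
next
  case (add f g)
  from add(1) obtain N p where p: "\<forall>s. s \<noteq> 0 \<longrightarrow> s ^ N * eval_at (curve A s) f = poly p s" by (elim exE)
  from add(2) obtain M q where q: "\<forall>s. s \<noteq> 0 \<longrightarrow> s ^ M * eval_at (curve A s) g = poly q s" by (elim exE)
  have "s ^ (N + M) * eval_at (curve A s) (f + g) = poly (Polynomial.monom 1 M * p + Polynomial.monom 1 N * q) s"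
    if "s \<noteq> 0" for s
  proof -
    have "poly (Polynomial.monom 1 M * p + Polynomial.monom 1 N * q) s =
        s ^ M * (s ^ N * eval_at (curve A s) f) + s ^ N * (s ^ M * eval_at (curve A s) g)"
      using p q that by (simp add: poly_monom)
    also have "\<dots> = s ^ (N + M) * (eval_at (curve A s) f + eval_at (curve A s) g)"
      by (simp add: power_add distrib_left mult_ac)
    finally show ?thesis by (simp add: eval_at_psubst id_hom.psubst_add)
  qed
  then show ?case by blast
next
  case (mult f g)
  from mult(1) obtain N p where p: "\<forall>s. s \<noteq> 0 \<longrightarrow> s ^ N * eval_at (curve A s) f = poly p s" by (elim exE)
  from mult(2) obtain M q where q: "\<forall>s. s \<noteq> 0 \<longrightarrow> s ^ M * eval_at (curve A s) g = poly q s" by (elim exE)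
  have "s ^ (N + M) * eval_at (curve A s) (f * g) = poly (p * q) s" if "s \<noteq> 0" for s
  proof -
    have "poly (p * q) s = (s ^ N * eval_at (curve A s) f) * (s ^ M * eval_at (curve A s) g)"
      using p q that by simp
    also have "\<dots> = s ^ (N + M) * (eval_at (curve A s) f * eval_at (curve A s) g)" by (simp add: power_add mult_ac)
    finally show ?thesis by (simp add: eval_at_psubst id_hom.psubst_mult)
  qed
  then show ?case by blast
qed

text \<open>On the image of a one-parameter subgroup the Zariski topology is coarser than the cofinite topology,
  so the image is connected.\<close>

lemma openin_zariski_curve:
  assumes "openin (zariski_torus n d) E"
  shows "(\<forall>s. s \<noteq> 0 \<longrightarrow> curve A s \<notin> E) \<or> finite {s. s \<noteq> (0::'k) \<and> curve A s \<notin> E}"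
proof -
  have "generate_topology_on {{t \<in> big_torus n d. eval_at t q \<noteq> (0::'k)} | q. q \<in> Car} E"
    using assms unfolding zariski_torus_def openin_topology_generated_by_iff .
  then show ?thesis
  proof (induction rule: generate_topology_on.induct)
    case Empty
    then show ?case by simp
  next
    case (Int E F)
    show ?case
    proof (cases "(\<forall>s. s \<noteq> 0 \<longrightarrow> curve A s \<notin> E) \<or> (\<forall>s. s \<noteq> 0 \<longrightarrow> curve A s \<notin> F)")
      case False
      then have "finite ({s. s \<noteq> 0 \<and> curve A s \<notin> E} \<union> {s. s \<noteq> 0 \<and> curve A s \<notin> F})" using Int.IH by blast
      then have "finite {s. s \<noteq> 0 \<and> curve A s \<notin> E \<inter> F}" by (rule rev_finite_subset) auto
      then show ?thesis by blast
    qed auto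
  next
    case (UN K)
    show ?case
    proof (cases "\<forall>E\<in>K. \<forall>s. s \<noteq> 0 \<longrightarrow> curve A s \<notin> E")
      case False
      then obtain E where "E \<in> K" "finite {s. s \<noteq> 0 \<and> curve A s \<notin> E}" using UN.IH by blast
      then have "finite {s. s \<noteq> 0 \<and> curve A s \<notin> \<Union>K}" by (elim rev_finite_subset) auto
      then show ?thesis by blast
    qed auto
  next
    case (Basis E)
    then obtain q where q: "q \<in> Car" "E = {t \<in> big_torus n d. eval_at t q \<noteq> 0}" by blast
    obtain N p where p: "\<And>s. s \<noteq> 0 \<Longrightarrow> s ^ N * eval_at (curve A s) q = poly p s"
      using eval_curve_poly[OF q(1)] by blast
    have iff: "curve A s \<notin> E \<longleftrightarrow> poly p s = 0" if "s \<noteq> 0" for s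
      using p[OF that] that curve_in_big_torus[OF that] by (auto simp: q(2) simp flip: p)
    show ?case
    proof (cases "p = 0")
      case False
      then have "finite {s. poly p s = 0}" by (rule poly_roots_finite)
      then have "finite {s. s \<noteq> 0 \<and> curve A s \<notin> E}" by (rule rev_finite_subset) (use iff in auto)
      then show ?thesis by blast
    qed (use iff in auto)
  qed
qed

lemma topspace_zariski: "topspace (zariski_torus n d) = (big_torus n d :: (tvar \<Rightarrow> 'k) set)"
proof -
  have "(big_torus n d :: (tvar \<Rightarrow> 'k) set) = {t \<in> big_torus n d. eval_at t 1 \<noteq> (0::'k)}"
    by (simp add: eval_at_psubst)
  moreover have "(1 :: 'k mpol) \<in> Car" by auto
  ultimately have "(big_torus n d :: (tvar \<Rightarrow> 'k) set) \<in> {{t \<in> big_torus n d. eval_at t q \<noteq> (0::'k)} | q. q \<in> Car}"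
    by blast
  then show ?thesis unfolding zariski_torus_def topology_generated_by_topspace by blast
qed

lemma curve_in_torus_T:
  assumes "cochar A w"
  shows "curve A 2 \<in> torus_T n l d"
proof -
  let ?C = "curve A ` (- {0})"
  have "connectedin (zariski_torus n d) ?C"
    unfolding connectedin
  proof (intro conjI notI)
    show "?C \<subseteq> topspace (zariski_torus n d)"
      unfolding topspace_zariski using curve_in_big_torus by auto
    assume "\<exists>E F. openin (zariski_torus n d) E \<and> openin (zariski_torus n d) F \<and> ?C \<subseteq> E \<union> F \<and>
       E \<inter> F \<inter> ?C = {} \<and> E \<inter> ?C \<noteq> {} \<and> F \<inter> ?C \<noteq> {}"
    then obtain E F where EF: "openin (zariski_torus n d) E" "openin (zariski_torus n d) F"
      "E \<inter> F \<inter> ?C = {}" "E \<inter> ?C \<noteq> {}" "F \<inter> ?C \<noteq> {}" by blast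
    then have "finite {s. s \<noteq> 0 \<and> curve A s \<notin> E}" "finite {s. s \<noteq> 0 \<and> curve A s \<notin> F}"
      using openin_zariski_curve[of E A] openin_zariski_curve[of F A] by auto
    then have "finite (insert 0 ({s. s \<noteq> 0 \<and> curve A s \<notin> E} \<union> {s. s \<noteq> 0 \<and> curve A s \<notin> F}))" by simp
    moreover have "UNIV \<subseteq> insert 0 ({s. s \<noteq> 0 \<and> curve A s \<notin> E} \<union> {s. s \<noteq> 0 \<and> curve A s \<notin> F})"
      using EF(3) by auto
    ultimately show False using infinite_UNIV_char_0[where 'a = 'k] finite_subset by blast
  qed
  moreover have "?C \<subseteq> torus_H n l d" using curve_in_H[OF assms] by auto
  ultimately have "connectedin (subtopology (zariski_torus n d) (torus_H n l d)) ?C"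
    by (simp add: connectedin_subtopology)
  moreover have "(\<lambda>v\<in>V. 1) \<in> ?C"
    by (rule image_eqI[of _ _ 1]) (auto simp: curve_def)
  moreover have "curve A 2 \<in> ?C" by auto
  ultimately show ?thesis unfolding torus_T_def connected_component_of_def by blast
qed

lemma torus_T_subset: "t \<in> torus_T n l d \<Longrightarrow> t \<in> torus_H n l d" "t \<in> torus_H n l d \<Longrightarrow> v \<in> V \<Longrightarrow> t v \<noteq> (0::'k)"
proof -
  show "t \<in> torus_H n l d" if "t \<in> torus_T n l d"
    using that connected_component_in_topspace[of "subtopology (zariski_torus n d) (torus_H n l d)" _ t]
    unfolding torus_T_def by auto
  show "t v \<noteq> 0" if "t \<in> torus_H n l d" "v \<in> V"
    using that by (auto simp: torus_H_def big_torus_def PiE_def)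
qed

lemma scale_vars_Car: "f \<in> Car \<Longrightarrow> scale_vars t f \<in> Car"
  unfolding scale_vars_psubst carrier_mpol_ring
proof (rule pvars_psubst)
  fix v assume "pvars f \<subseteq> V" "v \<in> pvars f"
  then show "pvars (Const (t v) * Var v) \<subseteq> V" using pvars_mult[of "Const (t v)" "Var v"] by auto
qed

lemma scale_vars_inverse:
  assumes "\<And>v. v \<in> V \<Longrightarrow> t v * t' v = 1" "f \<in> Car"
  shows "scale_vars t (scale_vars t' f) = f"
proof -
  have "scale_vars t (scale_vars t' f) = psubst Const (\<lambda>v. Const (t' v) * (Const (t v) * Var v)) f"
    unfolding scale_vars_psubst psubst_psubst[OF Const_hom.coeff_hom_axioms]
    by (simp add: Const_hom.psubst_mult)
  also have "\<dots> = psubst Const Var f"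
  proof (rule psubst_cong)
    fix v assume "v \<in> pvars f"
    then have "t' v * t v = 1" using assms by (auto simp: carrier_mpol_ring mult.commute)
    then show "Const (t' v) * (Const (t v) * Var v) = Var v" by (simp flip: mult.assoc Const_mult)
  qed
  finally show ?thesis by simp
qed

text \<open>Both the torus element and its inverse multiply \<open>P\<close> by a constant, so
  cosets of the ideal are mapped onto cosets.\<close>

lemma scale_vars_image_cl:
  assumes t: "t \<in> torus_H n l d" and f: "f \<in> Car"
  shows "scale_vars t ` cl f = cl (scale_vars t f)"
proof -
  obtain w where w: "\<And>i. i \<in> {0,1,2} \<Longrightarrow> scale_vars t (tri_mon n l i 1) = Const w * tri_mon n l i 1"
    using t unfolding torus_H_def by blast
  define t' where "t' v = inverse (t v)" for v
  have t': "t v * t' v = 1" "t' v * t v = 1" if "v \<in> V" for v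
    using torus_T_subset(2)[OF t that] by (simp_all add: t'_def)
  have inv: "scale_vars t' (scale_vars t g) = g" if "g \<in> Car" for g
    by (rule scale_vars_inverse) (use t'(2) that in auto)
  have inv': "scale_vars t (scale_vars t' g) = g" if "g \<in> Car" for g
    by (rule scale_vars_inverse) (use t'(1) that in auto)
  have P: "scale_vars t P = Const w * P"
    using w[of 0] w[of 1] w[of 2] unfolding P_def by (simp add: scale_vars_psubst Const_hom.psubst_add distrib_left)
  have P': "P = Const w * scale_vars t' P"
    using inv[OF P_Car] unfolding P
    by (simp add: scale_vars_psubst Const_hom.psubst_mult)
  have dvd: "P dvd scale_vars t g" if "P dvd g" for g
    using that P by (auto simp: scale_vars_psubst Const_hom.psubst_mult elim!: dvdE)
  \<comment> \<open>Otherwise \<open>P\<close> would be 0, being \<open>w\<close> times a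
    polynomial.\<close>
  have "w \<noteq> 0" using P' P_prime by auto
  then have "scale_vars t' P = Const (inverse w) * P"
    by (subst P') (simp flip: mult.assoc Const_mult)
  then have dvd': "P dvd scale_vars t' g" if "P dvd g" for g
    using that by (auto simp: scale_vars_psubst Const_hom.psubst_mult elim!: dvdE)
  show ?thesis
  proof (intro equalityI subsetI)
    fix q assume "q \<in> scale_vars t ` cl f"
    then obtain g where g: "g \<in> Car" "P dvd g - f" "q = scale_vars t g" using cl_mem_iff[OF f] by auto
    then show "q \<in> cl (scale_vars t f)"
      using cl_mem_iff[OF scale_vars_Car[OF f, of t]] scale_vars_Car dvd[OF g(2)]
      by (simp add: scale_vars_psubst Const_hom.psubst_diff)
  next
    fix q assume "q \<in> cl (scale_vars t f)"
    then have q: "q \<in> Car" "P dvd q - scale_vars t f" using cl_mem_iff[OF scale_vars_Car[OF f, of t]] by auto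
    have "scale_vars t' (q - scale_vars t f) = scale_vars t' q - f"
      using inv[OF f] by (simp add: scale_vars_psubst Const_hom.psubst_diff)
    then have "scale_vars t' q \<in> cl f"
      using cl_mem_iff[OF f] scale_vars_Car[OF q(1)] dvd'[OF q(2)] by simp
    then show "q \<in> scale_vars t ` cl f" using inv'[OF q(1)] by force
  qed
qed

lemma Var_in_graded_part:
  assumes "v \<in> V"
  shows "(\<lambda>t :: tvar \<Rightarrow> 'k. t v) \<in> characters n l d" "cl (Var v) \<in> graded_part n l d (\<lambda>t. t v)"
proof -
  show "(\<lambda>t :: tvar \<Rightarrow> 'k. t v) \<in> characters n l d"
    unfolding characters_def
  proof (intro CollectI conjI ballI exI[of _ "Var v"] exI[of _ 0])
    show "t v \<noteq> 0" if "t \<in> torus_T n l d" for t :: "tvar \<Rightarrow> 'k"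
      using torus_T_subset that assms by blast
  qed (use assms in \<open>auto simp: eval_at_psubst\<close>)
  have v: "(Var v :: 'k mpol) \<in> Car" using assms by auto
  show "cl (Var v) \<in> graded_part n l d (\<lambda>t. t v)"
    unfolding graded_part_def
  proof (intro CollectI conjI ballI)
    show "cl (Var v) \<in> carrier R" using v by blast
    fix t :: "tvar \<Rightarrow> 'k" assume "t \<in> torus_T n l d"
    then have "scale_vars t ` cl (Var v) = cl (scale_vars t (Var v))"
      using torus_T_subset scale_vars_image_cl v by blast
    also have "\<dots> = cl (Const (t v)) \<otimes>\<^bsub>R\<^esub> cl (Var v)"
      using v by (simp add: scale_vars_psubst cl_mult carrier_mpol_ring_intros)
    finally show "scale_vars t ` cl (Var v) = cl (Const (t v)) \<otimes>\<^bsub>R\<^esub> cl (Var v)" .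
  qed
qed

text \<open>A homogeneous derivation has a lift all of whose values on the variables are homogeneous polynomials
  for all gradings at once; \<open>\<epsilon> A\<close> is the degree of the derivation for the grading \<open>A\<close>.\<close>

lemma homogeneous_lift:
  assumes lift: "tri_der n l d im a" "\<And>f. f \<in> Car \<Longrightarrow> \<delta> (cl f) = cl (poly_der n d a f)"
    and hom: "T_homogeneous n l d \<delta>"
  obtains a' \<epsilon> where "tri_der n l d im a'" "\<And>f. f \<in> Car \<Longrightarrow> \<delta> (cl f) = cl (poly_der n d a' f)"
    "\<And>A w v. cochar A w \<Longrightarrow> v \<in> V \<Longrightarrow> homog A (A v + \<epsilon> A) (a' v)"
    "\<And>v. v \<in> V \<Longrightarrow> a' v \<asymp> 0 \<Longrightarrow> a' v = 0"
proof -
  interpret a: tri_der n l d im a by fact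
  obtain e where e: "e \<in> characters n l d"
    "\<And>g. g \<in> characters n l d \<Longrightarrow> \<delta> ` graded_part n l d g \<subseteq> graded_part n l d (\<lambda>t. g t * e t)"
    using hom unfolding T_homogeneous_def by blast
  have semi: "scale_vars t (a v) \<asymp> Const (t v * e t) * a v" if v: "v \<in> V" and t: "t \<in> torus_T n l d" for v t
  proof -
    have vC: "(Var v :: 'k mpol) \<in> Car" using v by auto
    have av: "a v \<in> Car" by (rule a.a_Car[OF v])
    have "\<delta> (cl (Var v)) \<in> graded_part n l d (\<lambda>t. t v * e t)"
      using e(2)[OF Var_in_graded_part(1)[OF v]] Var_in_graded_part(2)[OF v] by blast
    then have "cl (a v) \<in> graded_part n l d (\<lambda>t. t v * e t)" using lift(2)[OF vC] a.D_Var[OF v] by simp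
    then have "scale_vars t ` cl (a v) = cl (Const (t v * e t)) \<otimes>\<^bsub>R\<^esub> cl (a v)"
      using t unfolding graded_part_def by blast
    then have "cl (scale_vars t (a v)) = cl (Const (t v * e t) * a v)"
      using scale_vars_image_cl[OF torus_T_subset(1)[OF t] av] av by (simp add: cl_mult carrier_mpol_ring_intros)
    then show ?thesis
      using cl_eq_iff_eqv[OF scale_vars_Car[OF av] carrier_mpol_ring_intros(3)[OF carrier_mpol_ring_intros(6) av]] by blast
  qed
  \<comment> \<open>A class collects the monomials having prescribed weights for all cocharacters
    simultaneously.\<close>
  define dcls where "dcls \<gamma> m \<longleftrightarrow> (\<forall>A w. cochar A w \<longrightarrow> wdeg A m = \<gamma> A)" for \<gamma> :: "(tvar \<Rightarrow> int) \<Rightarrow> int" and m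
  \<comment> \<open>The generator of the ideal is homogeneous for every cocharacter, so
    multiplication by it shifts classes and the ideal contains the class components of its
    elements.\<close>
  have P_class: "P dvd prest (dcls \<gamma>) f" if "P dvd f" for \<gamma> f
  proof -
    obtain q where q: "f = P * q" using \<open>P dvd f\<close> by (elim dvdE)
    define W where "W A = (THE w. cochar A w)" for A
    have W: "W A = w" if "cochar A w" for A w
      unfolding W_def using that by (intro the_equality) (auto simp: cochar_def)
    have "prest (dcls \<gamma>) (P * q) = P * prest (dcls (\<lambda>A. \<gamma> A - W A)) q"
    proof (rule prest_mult)
      fix m m' assume "m \<in> Poly_Mapping.keys P"
      then have "wdeg A m = W A" if "cochar A w" for A w
        using homog_P[OF that] W[OF that] by (auto simp: homog_def)
      then show "dcls \<gamma> (m + m') \<longleftrightarrow> dcls (\<lambda>A. \<gamma> A - W A) m'"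
        unfolding dcls_def wdeg_add by (metis add_diff_cancel_left' add.commute diff_add_cancel)
    qed
    then show ?thesis by (simp add: q)
  qed
  \<comment> \<open>The element \<open>curve A 2\<close> multiplies the component of class
    \<open>\<gamma>\<close> by \<open>2^(\<gamma> A)\<close>, but multiplies \<open>a v\<close>
    modulo \<open>P\<close> by \<open>2^(A v) e\<close>. Comparing components, either these
    constants agree or the component lies in the ideal.\<close>
  have key: "prest (dcls \<gamma>) (a v) \<asymp> 0 \<or> 2 powi \<gamma> A = 2 powi A v * e (curve A 2)"
    if v: "v \<in> V" and A: "cochar A w" for v \<gamma> A w
  proof -
    let ?t = "curve A 2" and ?k = "2 powi A v * e (curve A 2)"
    have "?t v = 2 powi A v" using v by (simp add: curve_def)
    then have "scale_vars ?t (a v) \<asymp> Const ?k * a v" using semi[OF v curve_in_torus_T[OF A]] by simp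
    then have "P dvd prest (dcls \<gamma>) (scale_vars ?t (a v) - Const ?k * a v)" by (intro P_class) (simp add: eqv_def)
    moreover have "prest (dcls \<gamma>) (scale_vars ?t (a v) - Const ?k * a v) = Const (2 powi \<gamma> A - ?k) * prest (dcls \<gamma>) (a v)"
    proof (rule poly_mapping_eqI)
      fix m
      show "Poly_Mapping.lookup (prest (dcls \<gamma>) (scale_vars ?t (a v) - Const ?k * a v)) m =
          Poly_Mapping.lookup (Const (2 powi \<gamma> A - ?k) * prest (dcls \<gamma>) (a v)) m"
      proof (cases "m \<in> Poly_Mapping.keys (a v) \<and> dcls \<gamma> m")
        case True
        then have "Poly_Mapping.keys m \<subseteq> V" using a.a_Car[OF v] by (auto simp: carrier_mpol_ring pvars_def)
        moreover have "wdeg A m = \<gamma> A" using True A by (auto simp: dcls_def)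
        ultimately have "monom_at ?t m = 2 powi \<gamma> A" by (simp add: monom_at_curve)
        then show ?thesis using True
          unfolding lookup_prest lookup_Const_mult lookup_minus lookup_scale_vars by (simp add: algebra_simps)
      qed (auto simp: lookup_prest lookup_Const_mult lookup_minus lookup_scale_vars in_keys_iff)
    qed
    ultimately have "Const (2 powi \<gamma> A - ?k) * prest (dcls \<gamma>) (a v) \<asymp> 0" by (simp add: eqv_0)
    then show ?thesis using Const_not_eqv_0[of "2 powi \<gamma> A - ?k"] by (auto simp: mult_eqv_0_iff)
  qed
  \<comment> \<open>Weights that are not cocharacters get the value 0, so that two monomials lie in
    one class exactly when these functions are equal.\<close>
  define cls_of where "cls_of m = (\<lambda>A. if \<exists>w. cochar A w then wdeg A m else 0)" for m
  have dcls_iff: "dcls (cls_of m) m' \<longleftrightarrow> cls_of m' = cls_of m" for m m'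
    unfolding dcls_def cls_of_def fun_eq_iff by auto
  have decomp: "f = (\<Sum>\<gamma>\<in>cls_of ` Poly_Mapping.keys f. prest (dcls \<gamma>) f)" for f :: "'k mpol"
  proof (rule poly_mapping_eqI)
    fix m
    have "Poly_Mapping.lookup (\<Sum>\<gamma>\<in>cls_of ` Poly_Mapping.keys f. prest (dcls \<gamma>) f) m =
        (\<Sum>\<gamma>\<in>cls_of ` Poly_Mapping.keys f. if \<gamma> = cls_of m then Poly_Mapping.lookup f m else 0)"
      unfolding lookup_sum lookup_prest by (intro sum.cong) (auto simp: dcls_iff)
    then show "Poly_Mapping.lookup f m =
        Poly_Mapping.lookup (\<Sum>\<gamma>\<in>cls_of ` Poly_Mapping.keys f. prest (dcls \<gamma>) f) m"
      by (auto simp: in_keys_iff)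
  qed
  have "\<exists>\<gamma>. \<not> prest (dcls \<gamma>) (a v) \<asymp> 0 \<and> a v \<asymp> prest (dcls \<gamma>) (a v)" if v: "v \<in> V" and nz: "\<not> a v \<asymp> 0" for v
  proof -
    let ?G = "cls_of ` Poly_Mapping.keys (a v)"
    have "\<exists>\<gamma>\<in>?G. \<not> prest (dcls \<gamma>) (a v) \<asymp> 0"
    proof (rule ccontr)
      assume "\<not> ?thesis"
      then have "(\<Sum>\<gamma>\<in>?G. prest (dcls \<gamma>) (a v)) \<asymp> 0" by (intro eqv_sum_0) auto
      then show False using nz decomp[of "a v"] by simp
    qed
    then obtain \<gamma> where \<gamma>: "\<gamma> \<in> ?G" "\<not> prest (dcls \<gamma>) (a v) \<asymp> 0" by blast
    have others: "prest (dcls \<gamma>') (a v) \<asymp> 0" if \<gamma>': "\<gamma>' \<in> ?G" "\<gamma>' \<noteq> \<gamma>" for \<gamma>'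
    proof (rule ccontr)
      assume nz': "\<not> prest (dcls \<gamma>') (a v) \<asymp> 0"
      have "\<gamma>' A = \<gamma> A" for A
      proof (cases "\<exists>w. cochar A w")
        case True
        then obtain w where w: "cochar A w" by blast
        then have "(2::'k) powi \<gamma>' A = 2 powi \<gamma> A" using key[OF v w, of \<gamma>] key[OF v w, of \<gamma>'] \<gamma>(2) nz' by simp
        then show ?thesis by (simp add: two_powi_inject)
      next
        case False
        then show ?thesis using \<gamma>(1) \<gamma>'(1) by (auto simp: cls_of_def)
      qed
      then show False using \<gamma>'(2) by blast
    qed
    have "a v = prest (dcls \<gamma>) (a v) + (\<Sum>\<gamma>'\<in>?G - {\<gamma>}. prest (dcls \<gamma>') (a v))"
      using decomp[of "a v"] \<gamma>(1) sum.remove[of ?G \<gamma> "\<lambda>\<gamma>. prest (dcls \<gamma>) (a v)"] by simp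
    then have "a v - prest (dcls \<gamma>) (a v) = (\<Sum>\<gamma>'\<in>?G - {\<gamma>}. prest (dcls \<gamma>') (a v))" by (simp add: algebra_simps)
    moreover have "(\<Sum>\<gamma>'\<in>?G - {\<gamma>}. prest (dcls \<gamma>') (a v)) \<asymp> 0" by (intro eqv_sum_0 others) auto
    ultimately have "a v \<asymp> prest (dcls \<gamma>) (a v)" by (simp add: eqv_iff_diff[of "a v"])
    then show ?thesis using \<gamma>(2) by blast
  qed
  then obtain G where G: "\<And>v. v \<in> V \<Longrightarrow> \<not> a v \<asymp> 0 \<Longrightarrow> \<not> prest (dcls (G v)) (a v) \<asymp> 0 \<and> a v \<asymp> prest (dcls (G v)) (a v)"
    by metis
  define a' where "a' v = (if a v \<asymp> 0 then 0 else prest (dcls (G v)) (a v))" for v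
  \<comment> \<open>The degree is read off at one variable that is not killed, and
    \<open>key\<close> shows that the others give the same value. If all are killed, every
    \<open>a' v\<close> is 0 and is homogeneous of any degree.\<close>
  define \<epsilon> where "\<epsilon> A = (let v = SOME v. v \<in> V \<and> \<not> a v \<asymp> 0 in G v A - A v)" for A
  have a'_eqv: "a' v \<asymp> a v" if "v \<in> V" for v
    using G[OF that] eqv_sym by (auto simp: a'_def)
  have der_eqv: "poly_der n d a' f \<asymp> poly_der n d a f" for f
    unfolding poly_der_def by (intro eqv_sum eqv_mult a'_eqv eqv_refl)
  have a'_Car: "a' v \<in> Car" if "v \<in> V" for v
  proof -
    have "pvars (prest Q (a v)) \<subseteq> pvars (a v)" for Q by (auto simp: pvars_def keys_prest)
    then show ?thesis using a.a_Car[OF that] by (auto simp: a'_def carrier_mpol_ring)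
  qed
  have lift': "tri_der n l d im a'"
  proof unfold_locales
    show "P dvd poly_der n d a' P"
      using der_eqv[of P] a.P_dvd_der_P by (simp add: eqv_0_cong flip: eqv_0)
  qed (rule a'_Car)
  show ?thesis
  proof (rule that[OF lift', of \<epsilon>])
    fix f assume f: "f \<in> Car"
    interpret a': tri_der n l d im a' by (rule lift')
    show "\<delta> (cl f) = cl (poly_der n d a' f)"
      using lift(2)[OF f] cl_eq_iff_eqv[OF a'.D_Car[OF f] a.D_Car[OF f]] der_eqv[of f] by simp
  next
    fix A w v assume A: "cochar A w" and v: "v \<in> V"
    show "homog A (A v + \<epsilon> A) (a' v)"
    proof (cases "a v \<asymp> 0")
      case False
      define v0 where "v0 = (SOME v. v \<in> V \<and> \<not> a v \<asymp> 0)"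
      have v0: "v0 \<in> V" "\<not> a v0 \<asymp> 0" using someI[of "\<lambda>v. v \<in> V \<and> \<not> a v \<asymp> 0" v] v False by (auto simp: v0_def)
      have E: "(2::'k) powi G u A = 2 powi A u * e (curve A 2)" if "u \<in> V" "\<not> a u \<asymp> 0" for u
        using key[OF that(1) A, of "G u"] G[OF that] by blast
      have "(2::'k) powi (G v A + A v0) = 2 powi (G v0 A + A v)"
        using E[OF v False] E[OF v0] by (simp add: power_int_add)
      then have "G v A = A v + \<epsilon> A" by (simp add: two_powi_inject \<epsilon>_def Let_def flip: v0_def)
      moreover have "wdeg A m = G v A" if "dcls (G v) m" for m using that A unfolding dcls_def by blast
      ultimately show ?thesis using False by (auto simp: a'_def homog_def keys_prest)
    qed (simp add: a'_def)
  next
    show "a' v = 0" if "v \<in> V" "a' v \<asymp> 0" for v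
      using that G by (auto simp: a'_def split: if_splits)
  qed
qed

end

section \<open>Replicas and gradings\<close>

context mod_prime
begin

lemma eqvI1: "f - g = u * (s - s') \<Longrightarrow> s \<asymp> s' \<Longrightarrow> f \<asymp> g"
  unfolding eqv_def by simp

lemma eqvI2: "f - g = u * (s - s') + v * (t - t') \<Longrightarrow> s \<asymp> s' \<Longrightarrow> t \<asymp> t' \<Longrightarrow> f \<asymp> g"
  unfolding eqv_def by (simp add: dvd_add)

lemma eqvI3: "f - g = u * (s - s') + v * (t - t') + w * (r - r') \<Longrightarrow> s \<asymp> s' \<Longrightarrow> t \<asymp> t' \<Longrightarrow> r \<asymp> r' \<Longrightarrow> f \<asymp> g"
  unfolding eqv_def by (simp add: dvd_add)

end

context mod_lnd
begin

lemma deg_eqv_0: "f \<asymp> 0 \<Longrightarrow> deg f = 0"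
  by (simp add: deg_eq_0_iff D_eqv_0)

lemma deg_mult_le: "deg (f * g) \<le> deg f + deg g"
proof (cases "f \<asymp> 0 \<or> g \<asymp> 0")
  case True
  then have "f * g \<asymp> 0" by (simp add: mult_eqv_0_iff)
  then show ?thesis by (simp add: deg_eqv_0)
qed (simp add: deg_mult)

end

lemma exists_permutation:
  assumes "i \<in> {0,1,2}" "k \<in> {0,1,2}" "m \<in> {0,1,2}" "i \<noteq> k" "i \<noteq> m" "k \<noteq> (m::nat)"
  shows "\<exists>q. q permutes {0,1,2} \<and> q 0 = i \<and> q (Suc 0) = k \<and> q 2 = m"
proof (intro exI conjI)
  let ?q = "id(0 := i, Suc 0 := k, 2 := m)"
  have "inj_on ?q {0,1,2}" using assms(4-6) by (simp add: inj_on_def)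
  moreover have "?q ` {0,1,2} = {i,k,m}" by simp
  moreover have "{i,k,m} = {0,1,2}"
    by (rule card_subset_eq) (use assms in \<open>simp_all\<close>)
  ultimately have "bij_betw ?q {0,1,2} {0,1,2}" by (simp add: bij_betw_def)
  then show "?q permutes {0,1,2}" by (rule bij_imp_permutes) auto
qed auto

definition ind :: "tvar \<Rightarrow> int \<Rightarrow> tvar \<Rightarrow> int" where
  "ind u s v = (if v = u then s else 0)"

lemma ind_simps [simp]: "ind u s u = s" "v \<noteq> u \<Longrightarrow> ind u s v = 0"
  by (simp_all add: ind_def)

lemma wdeg_plus: "wdeg (\<lambda>v. A v + B v) m = wdeg A m + wdeg B m"
  by (simp add: wdeg_def distrib_left sum.distrib)

lemma wdeg_ind: "wdeg (ind u s) m = int (Poly_Mapping.lookup m u) * s"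
proof -
  have "wdeg (ind u s) m = (\<Sum>v\<in>Poly_Mapping.keys m. if v = u then int (Poly_Mapping.lookup m u) * s else 0)"
    unfolding wdeg_def by (intro sum.cong) (auto simp: ind_def)
  then show ?thesis by (simp add: in_keys_iff)
qed

section \<open>Cocharacters of small support and the passage to replicas\<close>

context trinomial
begin

lemma sum_ind:
  "(\<Sum>j\<in>{1..n i}. int (l i j) * ind (TVar i0 j0) s (TVar i j)) = (if i = i0 \<and> j0 \<in> {1..n i} then int (l i0 j0) * s else 0)"
proof -
  have "(\<Sum>j\<in>{1..n i}. int (l i j) * ind (TVar i0 j0) s (TVar i j)) =
      (\<Sum>j\<in>{1..n i}. if j = j0 then (if i = i0 then int (l i0 j0) * s else 0) else 0)"
    by (intro sum.cong) (auto simp: ind_def)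
  then show ?thesis by simp
qed

lemma sum_ind_S: "(\<Sum>j\<in>{1..n i}. int (l i j) * ind (SVar k) s (TVar i j)) = 0"
  by (simp add: ind_def)

lemma cochar_S: "cochar (ind (SVar k) s) 0"
  unfolding cochar_def sum_ind_S by simp

lemma cochar_pair:
  assumes "j \<in> {1..n i}" "j' \<in> {1..n i}" "int (l i j) * s + int (l i j') * s' = 0"
  shows "cochar (\<lambda>v. ind (TVar i j) s v + ind (TVar i j') s' v) 0"
  unfolding cochar_def distrib_left sum.distrib sum_ind using assms by auto

lemma cochar_triple:
  assumes "i \<in> {0,1,2}" "k \<in> {0,1,2}" "m \<in> {0,1,2}" "i \<noteq> k" "i \<noteq> m" "k \<noteq> m"
    and "j \<in> {1..n i}" "j' \<in> {1..n k}" "j'' \<in> {1..n m}"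
    and "int (l i j) * s = w" "int (l k j') * s' = w" "int (l m j'') * s'' = w"
  shows "cochar (\<lambda>v. ind (TVar i j) s v + ind (TVar k j') s' v + ind (TVar m j'') s'' v) w"
  unfolding cochar_def distrib_left sum.distrib sum_ind
proof
  fix i' :: nat assume "i' \<in> {0,1,2}"
  then have "i' = i \<or> i' = k \<or> i' = m" using assms(1-6) by auto
  then show "(if i' = i \<and> j \<in> {1..n i'} then int (l i j) * s else 0) +
      (if i' = k \<and> j' \<in> {1..n i'} then int (l k j') * s' else 0) +
      (if i' = m \<and> j'' \<in> {1..n i'} then int (l m j'') * s'' else 0) = w"
    using assms(4-) by auto
qed

definition proj :: "'k mpol \<Rightarrow> 'k mpol" where
  "proj = psubst Const (\<lambda>v. if v \<in> V then Var v else 0)"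

lemma proj_id: "f \<in> Car \<Longrightarrow> proj f = f"
proof -
  assume "f \<in> Car"
  then have "proj f = psubst Const Var f"
    unfolding proj_def carrier_mpol_ring by (intro psubst_cong) auto
  then show ?thesis by simp
qed

lemma proj_Car: "proj f \<in> Car"
  unfolding proj_def carrier_mpol_ring by (rule pvars_psubst) auto

lemma proj_mult: "proj (f * g) = proj f * proj g"
  by (simp add: proj_def Const_hom.psubst_mult)

lemma proj_cong: "f \<asymp> g \<Longrightarrow> proj f \<asymp> proj g"
proof -
  assume "f \<asymp> g"
  then obtain k where "f = g + P * k" unfolding eqv_def by (metis dvdE add.commute diff_add_cancel)
  moreover have "P \<in> Car" by (rule P_Car)
  ultimately have "proj f - proj g = P * proj k"
    using proj_id[of P] by (simp add: proj_def Const_hom.psubst_add Const_hom.psubst_mult)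
  then show ?thesis by (simp add: eqv_def)
qed

lemma eqv_Car_factor:
  assumes "f \<in> Car" "g \<in> Car" "f \<asymp> g * h"
  shows "f \<asymp> g * proj h"
  using proj_cong[OF assms(3)] assms(1,2) by (simp add: proj_id proj_mult)

text \<open>For a local slice \<open>r\<close> of \<open>D\<close> the product
  \<open>D r = h (D' r)\<close> is a nonzero kernel element, so \<open>h\<close> lies in the kernel
  by factorial closedness. Then \<open>D^k = h^k D'^k\<close>, which makes \<open>D'\<close> locally
  nilpotent.\<close>

lemma is_replica_if_multiple:
  assumes D: "tri_der n l d im a" "\<And>f. \<exists>k. (poly_der n d a ^^ k) f \<asymp> 0"
      "\<And>f. f \<in> Car \<Longrightarrow> \<delta> (cl f) = cl (poly_der n d a f)"
    and D': "tri_der n l d im a'"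
    and h: "\<And>v. v \<in> V \<Longrightarrow> a v \<asymp> h * a' v"
    and nz: "v0 \<in> V" "\<not> a v0 \<asymp> 0"
  shows "is_replica n l d \<delta> (induced_der n l d a')"
proof -
  interpret D: tri_der n l d im a by fact
  interpret L: mod_lnd P "poly_der n d a" by unfold_locales (rule D(2))
  interpret D': tri_der n l d im a' by fact
  let ?D = "poly_der n d a" and ?D' = "poly_der n d a'"
  define h' where "h' = proj h"
  have h'_Car: "h' \<in> Car" unfolding h'_def by (rule proj_Car)
  have h': "a v \<asymp> h' * a' v" if "v \<in> V" for v
    using eqv_Car_factor[OF D.a_Car[OF that] D'.a_Car[OF that], of h] h[OF that]
    by (simp add: h'_def mult.commute)
  have eq: "?D f \<asymp> h' * ?D' f" for f
  proof -
    have "?D f \<asymp> (\<Sum>v\<in>V. (h' * a' v) * pdiff v f)" unfolding poly_der_def by (intro eqv_sum eqv_mult h' eqv_refl)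
    then show ?thesis by (simp add: poly_der_def sum_distrib_left mult.assoc)
  qed
  have "\<not> ?D (Var v0) \<asymp> 0" using D.D_Var nz by simp
  then obtain r where r: "\<not> ?D r \<asymp> 0" "?D (?D r) \<asymp> 0" by (rule L.exists_slice)
  have nz': "\<not> h' * ?D' r \<asymp> 0" using r(1) eqv_0_cong[OF eq[of r]] by blast
  have "?D (h' * ?D' r) \<asymp> 0" using eqv_trans[OF eqv_sym[OF D.D_cong[OF eq[of r]]] r(2)] .
  then have hk: "?D h' \<asymp> 0" using L.ker_factor(1) nz' by blast
  have h0: "\<not> h' \<asymp> 0" using nz' eqv_0_mult by blast
  have hk': "?D' h' \<asymp> 0" using eqv_0_cong[OF eq[of h']] hk h0 by (simp add: mult_eqv_0_iff)
  have iter: "(?D ^^ k) f \<asymp> h' ^ k * (?D' ^^ k) f" for k f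
  proof (induction k)
    case (Suc k)
    have "?D ((?D ^^ k) f) \<asymp> ?D (h' ^ k * (?D' ^^ k) f)" by (rule D.D_cong[OF Suc])
    also have "\<dots> \<asymp> h' * ?D' (h' ^ k * (?D' ^^ k) f)" by (rule eq)
    also have "\<dots> \<asymp> h' * (h' ^ k * ?D' ((?D' ^^ k) f))"
      by (intro eqv_mult eqv_refl D'.D_mult_ker D'.ker_power hk')
    finally show ?case by (simp add: mult.assoc)
  qed simp
  have "\<exists>k. (?D' ^^ k) f \<asymp> 0" for f
  proof -
    obtain k where "(?D ^^ k) f \<asymp> 0" using D(2) by blast
    then have "h' ^ k * (?D' ^^ k) f \<asymp> 0" using eqv_0_cong[OF iter[of k f]] by blast
    then show ?thesis using h0 power_eqv_0 by (auto simp: mult_eqv_0_iff)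
  qed
  then have lnd: "is_LND n l d (induced_der n l d a')"
    using D'.is_LND_iff[OF D'.induced_der_cl D'.is_derivation_induced_der] by blast
  show ?thesis
    unfolding is_replica_def
  proof (intro conjI lnd bexI[of _ "cl h'"] ballI)
    show "cl h' \<in> der_ker n l d (induced_der n l d a')" using D'.der_ker_eq h'_Car hk' by blast
    fix x assume "x \<in> carrier R"
    then obtain f where f: "f \<in> Car" "x = cl f" using R_cases by metis
    have D'f: "?D' f \<in> Car" by (rule D'.D_Car[OF f(1)])
    have "\<delta> x = cl (h' * ?D' f)"
      unfolding f(2) D(3)[OF f(1)]
      using eq[of f] cl_eq_iff_eqv[OF D.D_Car[OF f(1)] carrier_mpol_ring_intros(3)[OF h'_Car D'f]] by blast
    then show "\<delta> x = cl h' \<otimes>\<^bsub>R\<^esub> induced_der n l d a' x"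
      unfolding f(2) D'.induced_der_cl[OF f(1)] cl_mult[OF h'_Car D'f] .
  qed
qed

lemma tri_der_S: "tri_der n l d im ((\<lambda>_. 0)(SVar k := 1))"
proof unfold_locales
  fix v show "((\<lambda>_. 0)(SVar k := 1)) v \<in> Car" by (auto intro: carrier_mpol_ring_intros)
next
  have "SVar k \<notin> pvars (tri_mon n l i 1)" for i
  proof -
    have "pvars (tri_mon n l i 1) \<subseteq> range (TVar i)"
      unfolding tri_mon_def by (intro pvars_prod order_trans[OF pvars_power]) auto
    then show ?thesis by auto
  qed
  then have "SVar k \<notin> pvars P" unfolding P_def
    using pvars_add[of "tri_mon n l 0 1 + tri_mon n l 1 1 :: 'k mpol" "tri_mon n l 2 1"]
      pvars_add[of "tri_mon n l 0 1 :: 'k mpol" "tri_mon n l 1 1"] by blast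
  then have "pdiff (SVar k) P = 0" unfolding pvars_def pdiff_def
    by (intro sum.neutral) (auto simp: in_keys_iff)
  then have "poly_der n d ((\<lambda>_. 0)(SVar k := 1)) P = 0"
    unfolding poly_der_def by (intro sum.neutral) auto
  then show "P dvd poly_der n d ((\<lambda>_. 0)(SVar k := 1)) P" by simp
qed

end

section \<open>Which variables a homogeneous locally nilpotent derivation can move\<close>

locale homog_lnd = tri_der n l d im a for n l d and im :: "'k::{alg_closed_field, field_char_0}" and a +
  fixes \<epsilon> :: "(tvar \<Rightarrow> int) \<Rightarrow> int"
  assumes nilp: "\<And>f. \<exists>k. (poly_der n d a ^^ k) f \<asymp> 0"
    and homog_a: "\<And>A w v. cochar A w \<Longrightarrow> v \<in> V \<Longrightarrow> homog A (A v + \<epsilon> A) (a v)"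
    and a_eqv_0: "\<And>v. v \<in> V \<Longrightarrow> a v \<asymp> 0 \<Longrightarrow> a v = 0"

sublocale homog_lnd \<subseteq> mod_lnd P D
  by unfold_locales (rule nilp)

context homog_lnd
begin

lemma keys_a: "m \<in> Poly_Mapping.keys (a v) \<Longrightarrow> v \<in> V \<Longrightarrow> Poly_Mapping.keys m \<subseteq> V"
  using a_Car[of v] by (auto simp: carrier_mpol_ring pvars_def)

lemma not_dvd_if_not_killed: "v \<in> V \<Longrightarrow> a v \<noteq> 0 \<Longrightarrow> \<not> Var v dvd a v"
  using ker_if_dvd_D[of "Var v"] D_Var[of v] a_eqv_0[of v] by (metis dvdE eqv_refl)

lemma exists_monomial_without:
  assumes "v \<in> V" "a v \<noteq> 0"
  obtains m where "m \<in> Poly_Mapping.keys (a v)" "Poly_Mapping.lookup m v = 0"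
proof -
  have "\<exists>m\<in>Poly_Mapping.keys (a v). Poly_Mapping.lookup m v = 0"
  proof (rule ccontr)
    assume "\<not> ?thesis"
    then have "Var v ^ 1 dvd a v" by (intro Var_power_dvd) (simp add: Suc_leI)
    then show False using not_dvd_if_not_killed[OF assms] by simp
  qed
  then show ?thesis using that by blast
qed

lemma wdeg_a: "cochar A w \<Longrightarrow> v \<in> V \<Longrightarrow> m \<in> Poly_Mapping.keys (a v) \<Longrightarrow> wdeg A m = A v + \<epsilon> A"
  using homog_a by (simp add: homog_def)

text \<open>In the grading by the exponent of \<open>S_k\<close>, the image of \<open>S_k\<close>
  has a monomial without \<open>S_k\<close>, for otherwise \<open>S_k\<close> would divide its image
  and be killed. So the derivation has degree -1, and the image of any other variable would have
  negative exponents.\<close>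

lemma S_case:
  assumes k: "SVar k \<in> V" "a (SVar k) \<noteq> 0" and v: "v \<in> V" "v \<noteq> SVar k"
  shows "a v = 0"
proof -
  let ?A = "ind (SVar k) 1"
  obtain m where m: "m \<in> Poly_Mapping.keys (a (SVar k))" "Poly_Mapping.lookup m (SVar k) = 0"
    using exists_monomial_without[OF k] .
  have "\<epsilon> ?A = -1" using wdeg_a[OF cochar_S[of k 1] k(1) m(1)] m(2) by (simp add: wdeg_ind)
  then have "int (Poly_Mapping.lookup m' (SVar k)) = -1" if "m' \<in> Poly_Mapping.keys (a v)" for m'
    using wdeg_a[OF cochar_S[of k 1] v(1) that] v(2) by (simp add: wdeg_ind)
  then have "m' \<notin> Poly_Mapping.keys (a v)" for m' by force
  then show ?thesis by (metis poly_mapping_eqI in_keys_iff lookup_zero)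
qed

text \<open>Give the two variables weights of opposite sign so that the block has weight 0.
  Monomials of the images that avoid the variable moved bound the degree of the derivation by a
  negative number from above and by a positive number from below.\<close>

lemma one_not_killed:
  assumes ij: "i \<in> {0,1,2}" "j \<in> {1..n i}" "j' \<in> {1..n i}" "j \<noteq> j'" and nz: "a (TVar i j) \<noteq> 0"
  shows "a (TVar i j') = 0"
proof (rule ccontr)
  assume nz': "a (TVar i j') \<noteq> 0"
  let ?A = "\<lambda>v. ind (TVar i j) (int (l i j')) v + ind (TVar i j') (- int (l i j)) v"
  have V: "TVar i j \<in> V" "TVar i j' \<in> V" using ij TVar_in_V by blast+
  have A: "cochar ?A 0" by (rule cochar_pair) (use ij in \<open>simp_all\<close>)
  obtain m m' where m: "m \<in> Poly_Mapping.keys (a (TVar i j))" "Poly_Mapping.lookup m (TVar i j) = 0"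
    and m': "m' \<in> Poly_Mapping.keys (a (TVar i j'))" "Poly_Mapping.lookup m' (TVar i j') = 0"
    using exists_monomial_without[OF V(1) nz] exists_monomial_without[OF V(2) nz'] by metis
  have l: "l i j \<ge> 1" "l i j' \<ge> 1" using l_pos ij by blast+
  have "- int (Poly_Mapping.lookup m (TVar i j') * l i j) = int (l i j') + \<epsilon> ?A"
    using wdeg_a[OF A V(1) m(1)] m(2) ij(4) by (simp add: wdeg_plus wdeg_ind)
  moreover have "int (Poly_Mapping.lookup m' (TVar i j) * l i j') = - int (l i j) + \<epsilon> ?A"
    using wdeg_a[OF A V(2) m'(1)] m'(2) ij(4) by (simp add: wdeg_plus wdeg_ind)
  ultimately show False using l by linarith
qed

lemma exists_tuple:
  "\<exists>c. (\<forall>i\<in>{0,1,2}. c i \<in> {1..n i}) \<and> (\<forall>i\<in>{0,1,2}. \<forall>j\<in>{1..n i}. j \<noteq> c i \<longrightarrow> a (TVar i j) = 0)"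
proof -
  have "\<exists>k. i \<in> {0,1,2} \<longrightarrow> k \<in> {1..n i} \<and> (\<forall>j\<in>{1..n i}. j \<noteq> k \<longrightarrow> a (TVar i j) = 0)" for i
  proof (cases "\<exists>k\<in>{1..n i}. a (TVar i k) \<noteq> 0")
    case True
    then obtain k where "k \<in> {1..n i}" "a (TVar i k) \<noteq> 0" by blast
    then show ?thesis using one_not_killed by blast
  next
    case False
    then show ?thesis using n_pos[of i] by (intro exI[of _ 1]) auto
  qed
  then show ?thesis by metis
qed

end

section \<open>Degrees and relations\<close>

lemma gcd_quotients:
  assumes "a \<ge> 1" "\<not> a dvd (b::nat)"
  shows "int (a div gcd a b) \<ge> 2" "coprime (int (b div gcd a b)) (int (a div gcd a b))"
proof -
  have "a div gcd a b \<noteq> 1"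
    using assms by (metis dvd_div_mult_self gcd_dvd1 gcd_dvd2 mult_1)
  moreover have "a div gcd a b \<noteq> 0" using assms(1) by (simp add: div_eq_0_iff gcd_le1_nat not_less)
  ultimately show "int (a div gcd a b) \<ge> 2" by linarith
  show "coprime (int (b div gcd a b)) (int (a div gcd a b))"
    using div_gcd_coprime[of a b] assms(1) by (simp add: coprime_commute)
qed


locale hl = chart n l d im p c + homog_lnd n l d im a \<epsilon>
  for n l d and im :: "'k::{alg_closed_field, field_char_0}" and p c a \<epsilon> +
  assumes others_zero: "\<And>v. v \<in> V \<Longrightarrow> (\<And>i. i \<in> {0,1,2} \<Longrightarrow> v \<noteq> TVar i (c i)) \<Longrightarrow> a v = 0"
begin

abbreviation y :: "nat \<Rightarrow> 'k mpol" where "y i \<equiv> a (xv i)"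
abbreviation dg :: "nat \<Rightarrow> nat" where "dg i \<equiv> deg (X i)"

lemma frozen_zero: "v \<in> Frozen \<Longrightarrow> a v = 0"
proof (rule others_zero)
  assume v: "v \<in> Frozen"
  then show "v \<in> V" by (simp add: Frozen_def)
  fix i :: nat assume "i \<in> {0,1,2}"
  then obtain k where "k \<in> {0,1,2}" "i = p k" using p_image by blast
  then show "v \<noteq> TVar i (c i)" using v by (auto simp: Frozen_def xv_def)
qed

lemma D_frozen_Var: "v \<in> Frozen \<Longrightarrow> D (Var v) = 0"
  using D_Var[of v] frozen_zero[of v] by (simp add: Frozen_def)

lemma D_X: "i \<in> {0,1,2} \<Longrightarrow> D (X i) = y i"
  by (rule D_Var[OF xv_in_V])

lemma D_tm: "i \<in> {0,1,2} \<Longrightarrow> D (tm i \<alpha>) = dm i \<alpha> * y i"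
  using poly_der_tm[of a i \<alpha>] D_frozen_Var D_X by simp

lemma y_Car: "i \<in> {0,1,2} \<Longrightarrow> y i \<in> Car"
  by (rule a_Car[OF xv_in_V])

lemma X_Car: "i \<in> {0,1,2} \<Longrightarrow> X i \<in> Car"
  using xv_in_V by auto

lemma deg_X: "i \<in> {0,1,2} \<Longrightarrow> y i \<noteq> 0 \<Longrightarrow> dg i = Suc (deg (y i))"
  using deg_D[of "X i"] D_X[of i] a_eqv_0[OF xv_in_V, of i] by metis

lemma deg_frozen: "pvars f \<subseteq> Frozen \<Longrightarrow> deg f = 0"
  using poly_der_frozen[of a f] D_frozen_Var by (simp add: deg_eq_0_iff)

lemma deg_Const: "deg (Const k) = 0"
  by (simp add: deg_frozen)

lemma deg_of_nat: "deg (of_nat k) = 0"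
  using deg_Const[of "of_nat k"] by (simp add: Const_of_nat)

lemma of_nat_nz: "k > 0 \<Longrightarrow> \<not> of_nat k \<asymp> 0"
  using of_nat_not_eqv_0 by (simp add: eqv_0)

lemma dm_1: "i \<in> {0,1,2} \<Longrightarrow> dm i 1 = of_nat (ex i) * fr i 1 * X i ^ (ex i - 1)"
  using dmon_eq[of i 1] by (simp only: div_by_1)

lemma tm_1: "i \<in> {0,1,2} \<Longrightarrow> tm i 1 = fr i 1 * X i ^ (ex i - 1) * X i"
proof -
  assume i: "i \<in> {0,1,2}"
  have "X i ^ ex i = X i ^ (ex i - 1) * X i" using power_minus_mult[of "ex i" "X i"] ex_pos[OF i] by simp
  then show ?thesis using tm_eq[OF i, of 1] by (simp only: div_by_1 mult.assoc)
qed

lemma D_P_relation: "dm 0 1 * y 0 + dm 1 1 * y 1 + dm 2 1 * y 2 \<asymp> 0"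
proof -
  have "D (tm 0 1 + tm 1 1 + tm 2 1) \<asymp> 0" unfolding eqv_0 using P_dvd_der_P by (simp only: P_eq[symmetric])
  then show ?thesis by (simp only: poly_der.D_add D_tm[OF in012(1)] D_tm[OF in012(2)] D_tm[OF in012(3)])
qed

lemma mcoprime_blocks: "i \<in> {0,1,2} \<Longrightarrow> k \<in> {0,1,2} \<Longrightarrow> i \<noteq> k \<Longrightarrow>
    mcoprime (fr i \<alpha> * X i ^ r) (fr k \<beta> * X k ^ s)"
  by (intro mcoprime_bmon[of i k] bmon_intros) auto

lemma mcoprime_X: "i \<in> {0,1,2} \<Longrightarrow> k \<in> {0,1,2} \<Longrightarrow> i \<noteq> k \<Longrightarrow> mcoprime (X i) (X k)"
  by (intro mcoprime_bmon[of i k] bmon_intros) auto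

lemma block_not_eqv_0: "\<not> fr i \<alpha> * X i ^ r \<asymp> 0"
  using fr_not_eqv_0 Var_power_not_eqv_0 by (simp add: mult_eqv_0_iff)

text \<open>Let \<open>g_i = fr i 1 * X i ^ (ex i - 1)\<close>. The trinomial and its derivative say
  that \<open>(g_i)\<close> is orthogonal to both \<open>(X i)\<close> and
  \<open>(ex i * y i)\<close>, hence proportional to their cross product. Coprimality of
  \<open>g_1\<close> and \<open>g_2\<close> puts the factor \<open>h\<close> into the ring.\<close>

lemma relations:
  obtains h where "h \<in> Car"
    "of_nat (ex 1) * X 0 * y 1 - of_nat (ex 0) * X 1 * y 0 \<asymp> fr 2 1 * X 2 ^ (ex 2 - 1) * h"
    "of_nat (ex 2) * X 1 * y 2 - of_nat (ex 1) * X 2 * y 1 \<asymp> fr 0 1 * X 0 ^ (ex 0 - 1) * h"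
    "of_nat (ex 0) * X 2 * y 0 - of_nat (ex 2) * X 0 * y 2 \<asymp> fr 1 1 * X 1 ^ (ex 1 - 1) * h"
proof -
  define g where "g i = fr i 1 * X i ^ (ex i - 1)" for i
  define e :: "nat \<Rightarrow> 'k mpol" where "e i = of_nat (ex i)" for i
  define x where "x i = X i" for i
  have DP: "e 0 * g 0 * y 0 + e 1 * g 1 * y 1 + e 2 * g 2 * y 2 \<asymp> 0"
    using D_P_relation unfolding dm_1[OF in012(1)] dm_1[OF in012(2)] dm_1[OF in012(3)]
    unfolding g_def e_def by (simp only: mult.assoc)
  have M: "g 0 * x 0 + g 1 * x 1 + g 2 * x 2 \<asymp> 0"
    unfolding g_def x_def tm_1[OF in012(1), symmetric] tm_1[OF in012(2), symmetric] tm_1[OF in012(3), symmetric]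
    by (simp only: P_eq[symmetric] eqv_0 dvd_refl)
  define R1 where "R1 = e 1 * x 0 * y 1 - e 0 * x 1 * y 0"
  define R2 where "R2 = e 2 * x 1 * y 2 - e 1 * x 2 * y 1"
  define R3 where "R3 = e 0 * x 2 * y 0 - e 2 * x 0 * y 2"
  have 13: "g 1 * R1 \<asymp> g 2 * R3"
    by (rule eqvI2[OF _ DP M, of _ _ "x 0" "- e 0 * y 0"]) (simp add: R1_def R3_def algebra_simps)
  have 12: "g 0 * R1 \<asymp> g 2 * R2"
    by (rule eqvI2[OF _ DP M, of _ _ "- x 1" "e 1 * y 1"]) (simp add: R1_def R2_def algebra_simps)
  have g0: "\<not> g i \<asymp> 0" for i unfolding g_def by (rule block_not_eqv_0)
  have "mcoprime (g 2) (g 1)" unfolding g_def by (rule mcoprime_blocks) simp_all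
  then have "mdvd (g 2) R1" unfolding mcoprime_def using mdvdI[OF 13] by blast
  then obtain h0 where h0: "R1 \<asymp> g 2 * h0" unfolding mdvd_def by blast
  define h where "h = proj h0"
  have Car: "R1 \<in> Car" "g 2 \<in> Car"
    unfolding R1_def g_def e_def x_def Const_of_nat[symmetric]
    by (intro carrier_mpol_ring_intros X_Car y_Car fr_Car in012)+
  have R1: "R1 \<asymp> g 2 * h" unfolding h_def by (rule eqv_Car_factor[OF Car h0])
  have "g 2 * R3 \<asymp> g 2 * (g 1 * h)"
    by (rule eqvI2[OF _ 13 R1, of _ _ "-1" "g 1"]) (simp add: algebra_simps)
  then have R3: "R3 \<asymp> g 1 * h" using eqv_mult_cancel_left[OF g0] by blast
  have "g 2 * R2 \<asymp> g 2 * (g 0 * h)"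
    by (rule eqvI2[OF _ 12 R1, of _ _ "-1" "g 0"]) (simp add: algebra_simps)
  then have R2: "R2 \<asymp> g 0 * h" using eqv_mult_cancel_left[OF g0] by blast
  have "h \<in> Car" unfolding h_def by (rule proj_Car)
  then show ?thesis
    using R1 R2 R3 unfolding R1_def R2_def R3_def g_def e_def x_def by (rule that)
qed

text \<open>If \<open>h\<close> were 0, coprimality of \<open>X 0\<close> and \<open>X 1\<close>
  would make \<open>X 0\<close> divide its own image, so that \<open>X 0\<close> would be
  killed.\<close>

lemma relation_factor_nonzero:
  assumes R1: "of_nat (ex 1) * X 0 * y 1 - of_nat (ex 0) * X 1 * y 0 \<asymp> f * h" and nz: "y 0 \<noteq> 0"
  shows "\<not> h \<asymp> 0"
proof
  assume "h \<asymp> 0"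
  then have "f * h \<asymp> 0" by (rule eqv_0_mult)
  then have R0: "of_nat (ex 1) * X 0 * y 1 - of_nat (ex 0) * X 1 * y 0 \<asymp> 0" by (rule eqv_trans[OF R1])
  have "X 1 * (of_nat (ex 0) * y 0) \<asymp> X 0 * (of_nat (ex 1) * y 1)"
    by (rule eqvI1[OF _ R0, of _ _ "-1"]) (simp add: algebra_simps)
  then have "mdvd (X 0) (of_nat (ex 0) * y 0)"
    using mcoprime_X[OF in012(1,2)] mdvdI unfolding mcoprime_def by (metis zero_neq_one)
  then obtain k where "of_nat (ex 0) * y 0 \<asymp> X 0 * k" unfolding mdvd_def by blast
  then have "Const (of_nat (ex 0)) * y 0 \<asymp> X 0 * k" by (simp add: Const_of_nat)
  then have "y 0 \<asymp> Const (1 / of_nat (ex 0)) * (X 0 * k)" using ex_pos[of 0] by (intro eqv_Const_divide) simp_all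
  then have "D (X 0) \<asymp> X 0 * (Const (1 / of_nat (ex 0)) * k)" by (simp add: D_X mult_ac)
  then have "y 0 \<asymp> 0" using ker_if_dvd_D[of "X 0"] by (simp add: D_X)
  then show False using nz a_eqv_0[OF xv_in_V[OF in012(1)]] by blast
qed

text \<open>The degree of \<open>y i\<close> is one less than that of \<open>X i\<close>, so the
  left side has degree at most \<open>dg i + dg k - 1\<close>; the right side contains
  \<open>X m ^ t\<close>.\<close>

lemma deg_relation:
  assumes R: "of_nat r * X i * y k - of_nat s * X k * y i \<asymp> fr m 1 * X m ^ t * h" "\<not> h \<asymp> 0"
    and ik: "i \<in> {0,1,2}" "k \<in> {0,1,2}" "m \<in> {0,1,2}" and nz: "y i \<noteq> 0" "y k \<noteq> 0"
  shows "t * dg m < dg i + dg k"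
proof -
  have b: "deg (of_nat r * X i * y k) \<le> dg i + deg (y k)" for r i k
    using deg_mult_le[of "of_nat r * X i" "y k"] deg_mult_le[of "of_nat r" "X i"] by (simp add: deg_of_nat)
  have "t * dg m \<le> deg (fr m 1 * X m ^ t * h)"
    using R(2) fr_not_eqv_0[of m 1] Var_power_not_eqv_0[of "xv m" t] Var_not_eqv_0[of "xv m"]
    by (simp add: deg_mult mult_eqv_0_iff deg_power)
  also have "\<dots> = deg (of_nat r * X i * y k - of_nat s * X k * y i)" using deg_cong[OF R(1)] by simp
  also have "\<dots> \<le> dg i + dg k - 1"
    using b[of r i k] b[of s k i] deg_X[OF ik(1) nz(1)] deg_X[OF ik(2) nz(2)] by (intro deg_diff_le) simp_all
  finally show ?thesis using deg_X[OF ik(1) nz(1)] by simp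
qed

text \<open>Dividing by \<open>ex i\<close> and summing over \<open>i\<close>, these bounds say that
  the reciprocals of the three exponents add up to more than 1.\<close>

lemma degree_bounds:
  assumes nz: "\<And>i. i \<in> {0,1,2} \<Longrightarrow> y i \<noteq> 0" and i: "i \<in> {0,1,2}"
  shows "ex i * dg i < dg 0 + dg 1 + dg 2"
proof -
  obtain h where h: "of_nat (ex 1) * X 0 * y 1 - of_nat (ex 0) * X 1 * y 0 \<asymp> fr 2 1 * X 2 ^ (ex 2 - 1) * h"
    "of_nat (ex 2) * X 1 * y 2 - of_nat (ex 1) * X 2 * y 1 \<asymp> fr 0 1 * X 0 ^ (ex 0 - 1) * h"
    "of_nat (ex 0) * X 2 * y 0 - of_nat (ex 2) * X 0 * y 2 \<asymp> fr 1 1 * X 1 ^ (ex 1 - 1) * h"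
    by (rule relations)
  have h0: "\<not> h \<asymp> 0" by (rule relation_factor_nonzero[OF h(1) nz[OF in012(1)]])
  have e: "ex k * dg k = (ex k - 1) * dg k + dg k" if "k \<in> {0,1,2}" for k
    using ex_pos[OF that] by (metis add.commute le_add_diff_inverse2 mult_Suc plus_1_eq_Suc)
  have b2: "(ex 2 - 1) * dg 2 < dg 0 + dg 1"
    by (rule deg_relation[OF h(1) h0 in012(1,2,3) nz[OF in012(1)] nz[OF in012(2)]])
  have b0: "(ex 0 - 1) * dg 0 < dg 1 + dg 2"
    by (rule deg_relation[OF h(2) h0 in012(2,3,1) nz[OF in012(2)] nz[OF in012(3)]])
  have b1: "(ex 1 - 1) * dg 1 < dg 2 + dg 0"
    by (rule deg_relation[OF h(3) h0 in012(3,1,2) nz[OF in012(3)] nz[OF in012(1)]])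
  have c0: "ex 0 * dg 0 < dg 0 + dg 1 + dg 2" using b0 e[OF in012(1)] by linarith
  have c1: "ex 1 * dg 1 < dg 0 + dg 1 + dg 2" using b1 e[OF in012(2)] by linarith
  have c2: "ex 2 * dg 2 < dg 0 + dg 1 + dg 2" using b2 e[OF in012(3)] by linarith
  from i consider "i = 0" | "i = 1" | "i = 2" by blast
  then show ?thesis
  proof cases
    case 1 show ?thesis unfolding 1 by (rule c0)
  next
    case 2 show ?thesis unfolding 2 by (rule c1)
  next
    case 3 show ?thesis unfolding 3 by (rule c2)
  qed
qed

text \<open>Modulo \<open>N\<close> the weight sees only the exponent of \<open>X i\<close>. If
  \<open>X i\<close> did not divide \<open>y k\<close>, a monomial of \<open>y k\<close> without
  \<open>X i\<close> would make the degree of the derivation divisible by \<open>N\<close>, and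
  every monomial of \<open>y i\<close> would contain \<open>X i\<close>, which is impossible for a
  moved variable. So \<open>X i\<close> divides \<open>y k\<close>, which has smaller degree than
  \<open>X k\<close>.\<close>

lemma isolated_degree:
  assumes i: "i \<in> {0,1,2}" "k \<in> {0,1,2}" "i \<noteq> k" "y i \<noteq> 0" "y k \<noteq> 0"
    and A: "cochar A w" "N \<ge> 2" "coprime (A (xv i)) N" "\<And>v. v \<in> V \<Longrightarrow> v \<noteq> xv i \<Longrightarrow> N dvd A v"
  shows "dg i < dg k"
proof -
  let ?L = "\<lambda>m. int (Poly_Mapping.lookup m (xv i))"
  have V: "xv i \<in> V" "xv k \<in> V" "xv k \<noteq> xv i" using xv_in_V i by auto
  have red: "N dvd wdeg A m - ?L m * A (xv i)" if m: "Poly_Mapping.keys m \<subseteq> V" for m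
  proof -
    have "N dvd (\<Sum>v\<in>Poly_Mapping.keys m. int (Poly_Mapping.lookup m v) * (A v - ind (xv i) (A (xv i)) v))"
    proof (intro dvd_sum dvd_mult)
      fix v assume "v \<in> Poly_Mapping.keys m"
      then show "N dvd A v - ind (xv i) (A (xv i)) v" using A(4)[of v] m by (cases "v = xv i") auto
    qed
    also have "\<dots> = wdeg A m - wdeg (ind (xv i) (A (xv i))) m"
      by (simp add: wdeg_def right_diff_distrib sum_subtractf)
    finally show ?thesis by (simp add: wdeg_ind)
  qed
  have "Var (xv i) dvd y k"
  proof (rule ccontr)
    assume nd: "\<not> Var (xv i) dvd y k"
    have "\<exists>m\<in>Poly_Mapping.keys (y k). Poly_Mapping.lookup m (xv i) = 0"
    proof (rule ccontr)
      assume "\<not> ?thesis"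
      then have "Var (xv i) ^ 1 dvd y k" by (intro Var_power_dvd) (simp add: Suc_leI)
      then show False using nd by simp
    qed
    then obtain m where m: "m \<in> Poly_Mapping.keys (y k)" "Poly_Mapping.lookup m (xv i) = 0" by blast
    have "N dvd A (xv k) + \<epsilon> A"
      using red[OF keys_a[OF m(1) V(2)]] wdeg_a[OF A(1) V(2) m(1)] m(2) by simp
    then have eps: "N dvd \<epsilon> A" using A(4)[OF V(2,3)] by (simp add: dvd_add_right_iff)
    have "1 \<le> Poly_Mapping.lookup m' (xv i)" if m': "m' \<in> Poly_Mapping.keys (y i)" for m'
    proof (rule ccontr)
      assume "\<not> ?thesis"
      then have "Poly_Mapping.lookup m' (xv i) = 0" by simp
      then have "N dvd A (xv i) + \<epsilon> A"
        using red[OF keys_a[OF m' V(1)]] wdeg_a[OF A(1) V(1) m'] by simp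
      then have "N dvd A (xv i)" using eps by (simp add: dvd_add_left_iff)
      then have "N dvd 1" using coprime_common_divisor[OF A(3) _ dvd_refl] by blast
      then show False using A(2) zdvd_imp_le by fastforce
    qed
    then have "Var (xv i) ^ 1 dvd y i" by (intro Var_power_dvd)
    then show False using not_dvd_if_not_killed[OF V(1) i(4)] by simp
  qed
  then obtain q where q: "y k = X i * q" by (rule dvdE)
  have "\<not> y k \<asymp> 0" using i(5) a_eqv_0[OF V(2)] by blast
  then have "deg (y k) = dg i + deg q" unfolding q by (simp add: mult_eqv_0_iff deg_mult)
  then show ?thesis using deg_X[OF i(2,5)] by simp
qed

text \<open>When one of these divisibilities fails, there is a grading that isolates the selected
  variable of block \<open>i\<close> as required by \<open>isolated_degree\<close>;
  \<open>not_niso_degree\<close> constructs it.\<close>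

definition niso :: "nat \<Rightarrow> bool" where
  "niso i \<longleftrightarrow> (\<forall>j\<in>{1..n (p i)}. ex i dvd l (p i) j) \<and>
     (\<forall>k\<in>{0,1,2}. \<forall>m\<in>{0,1,2}. \<forall>j\<in>{1..n (p k)}. \<forall>j'\<in>{1..n (p m)}.
        k \<noteq> m \<and> k \<noteq> i \<and> m \<noteq> i \<longrightarrow> ex i dvd lcm (l (p k) j) (l (p m) j'))"

lemma not_niso_degree:
  assumes i: "i \<in> {0,1,2}" "k \<in> {0,1,2}" "i \<noteq> k" "y i \<noteq> 0" "y k \<noteq> 0" and "\<not> niso i"
  shows "dg i < dg k"
proof -
  have "(\<exists>j\<in>{1..n (p i)}. \<not> ex i dvd l (p i) j) \<or> (\<exists>k\<in>{0,1,2}. \<exists>m\<in>{0,1,2}. \<exists>j\<in>{1..n (p k)}. \<exists>j'\<in>{1..n (p m)}.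
        k \<noteq> m \<and> k \<noteq> i \<and> m \<noteq> i \<and> \<not> ex i dvd lcm (l (p k) j) (l (p m) j'))"
    using assms(6) unfolding niso_def by meson
  then show ?thesis
  proof (elim disjE bexE conjE)
    fix j assume j: "j \<in> {1..n (p i)}" "\<not> ex i dvd l (p i) j"
    \<comment> \<open>The weights live on two variables of the same block and give its monomial
      weight 0. The modulus \<open>ex i div g\<close> divides the weight of the second variable and
      is coprime to that of the selected one.\<close>
    define g where "g = gcd (ex i) (l (p i) j)"
    define A where "A = (\<lambda>v. ind (xv i) (int (l (p i) j div g)) v + ind (TVar (p i) j) (- int (ex i div g)) v)"
    have ne: "xv i \<noteq> TVar (p i) j" using j by (auto simp: xv_def ex_def)
    have "int (ex i) * int (l (p i) j div g) = int (l (p i) j) * int (ex i div g)"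
      unfolding of_nat_mult[symmetric] g_def by (metis div_mult_swap gcd_dvd1 gcd_dvd2 mult.commute)
    then have A: "cochar A 0" unfolding A_def xv_def
      by (intro cochar_pair c_in i(1) j(1)) (simp add: ex_def)
    have Ai: "A (xv i) = int (l (p i) j div g)" using ne by (simp add: A_def)
    show ?thesis
    proof (rule isolated_degree[OF i A, of "int (ex i div g)"])
      show "2 \<le> int (ex i div g)" "coprime (A (xv i)) (int (ex i div g))"
        unfolding Ai g_def by (rule gcd_quotients[OF ex_pos[OF i(1)] j(2)])+
      show "int (ex i div g) dvd A v" if "v \<noteq> xv i" for v using that by (simp add: A_def ind_def)
    qed
  next
    fix k' m j j'
    assume km: "k' \<in> {0,1,2}" "m \<in> {0,1,2}" "k' \<noteq> m" "k' \<noteq> i" "m \<noteq> i"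
      and j: "j \<in> {1..n (p k')}" "j' \<in> {1..n (p m)}" "\<not> ex i dvd lcm (l (p k') j) (l (p m) j')"
    \<comment> \<open>The weights live on one variable of each block. All three monomials get weight
      \<open>N * La\<close>, to which the selected variable contributes only
      \<open>La div g\<close>, coprime to \<open>N\<close>.\<close>
    define La where "La = lcm (l (p k') j) (l (p m) j')"
    define g where "g = gcd (ex i) La"
    define N where "N = ex i div g"
    define A where "A = (\<lambda>v. ind (xv i) (int (La div g)) v + ind (TVar (p k') j) (int (N * (La div l (p k') j))) v +
        ind (TVar (p m) j') (int (N * (La div l (p m) j'))) v)"
    have ne: "xv i \<noteq> TVar (p k') j" "xv i \<noteq> TVar (p m) j'" using km by (auto simp: xv_def p_eq_iff)
    have q: "l (p k') j * (La div l (p k') j) = La" "l (p m) j' * (La div l (p m) j') = La"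
      unfolding La_def by simp_all
    have "cochar A (int (N * La))"
      unfolding A_def xv_def
    proof (intro cochar_triple p_in c_in i(1) km(1,2) j(1,2))
      show "int (l (p i) (c (p i))) * int (La div g) = int (N * La)"
        unfolding of_nat_mult[symmetric] N_def g_def ex_def[symmetric]
        by (metis div_mult_swap gcd_dvd1 gcd_dvd2 mult.commute)
      show "int (l (p k') j) * int (N * (La div l (p k') j)) = int (N * La)"
        "int (l (p m) j') * int (N * (La div l (p m) j')) = int (N * La)"
        unfolding of_nat_mult[symmetric] using q by (metis mult.left_commute)+
    qed (use km in \<open>simp_all add: p_eq_iff\<close>)
    note A = this
    have Ai: "A (xv i) = int (La div g)" using ne by (simp add: A_def)
    show ?thesis
    proof (rule isolated_degree[OF i A, of "int N"])
      show "2 \<le> int N" "coprime (A (xv i)) (int N)"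
        unfolding Ai g_def N_def by (rule gcd_quotients[OF ex_pos[OF i(1)]], use j(3) La_def in simp)+
      show "int N dvd A v" if "v \<noteq> xv i" for v using that by (simp add: A_def ind_def)
    qed
  qed
qed

end

text \<open>The exponent 2 is fixed and \<open>e2 = 2\<close> would contradict
  \<open>e1 dvd lcm 2 e2\<close>. The bounds leave pairs consisting of 3 and one of 3, 4, 5, and
  each violates a divisibility.\<close>

lemma platonic_aux:
  fixes e1 e2 d0 d1 d2 :: nat
  assumes e: "e1 \<ge> 3" "e2 \<ge> 2" and d: "2 * d0 < d0 + d1 + d2" "e1 * d1 < d0 + d1 + d2" "e2 * d2 < d0 + d1 + d2"
    and dvd: "2 dvd lcm e1 e2" "e1 dvd lcm 2 e2"
  shows False
proof -
  have mul: "c * x \<le> e * x" if "c \<le> e" for c e x :: nat using that by simp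
  \<comment> \<open>The least common multiple is replaced by the product, which suffices for the
    finitely many remaining pairs.\<close>
  have lcm: "a dvd b * c" if "a dvd lcm b c" for a b c :: nat using that by (meson dvd_trans lcm_least dvd_triv_left dvd_triv_right)
  have "e2 \<noteq> 2" using dvd(2) e(1) by (auto dest: dvd_imp_le)
  then have e2: "e2 \<ge> 3" using e(2) by simp
  have "\<not> (4 \<le> e1 \<and> 4 \<le> e2)" using mul[of 4 e1 d1] mul[of 4 e2 d2] d by linarith
  then consider "e1 = 3" | "e2 = 3" using e(1) e2 by linarith
  then show False
  proof cases
    case 1
    have "\<not> 6 \<le> e2" using mul[of 6 e2 d2] d[unfolded 1] by linarith
    then have "e2 = 3 \<or> e2 = 4 \<or> e2 = 5" using e2 by linarith
    then show False using 1 lcm[OF dvd(1)] lcm[OF dvd(2)] by auto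
  next
    case 2
    have "\<not> 6 \<le> e1" using mul[of 6 e1 d1] d[unfolded 2] by linarith
    then have "e1 = 3 \<or> e1 = 4 \<or> e1 = 5" using e(1) by linarith
    then show False using 2 lcm[OF dvd(1)] lcm[OF dvd(2)] by auto
  qed
qed

text \<open>The degree bounds only leave platonic triples of exponents.\<close>

lemma platonic:
  fixes e0 e1 e2 d0 d1 d2 :: nat
  assumes e: "e0 \<ge> 2" "e1 \<ge> 2" "e2 \<ge> 2"
    and d: "e0 * d0 < d0 + d1 + d2" "e1 * d1 < d0 + d1 + d2" "e2 * d2 < d0 + d1 + d2"
    and dvd: "e0 dvd lcm e1 e2" "e1 dvd lcm e0 e2"
    and last: "e2 dvd lcm e0 e1 \<or> d2 < d0 \<and> d2 < d1"
  shows "e0 = 2 \<and> e1 = 2"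
proof -
  have mul: "c * x \<le> e * x" if "c \<le> e" for c e x :: nat using that by simp
  have lcm: "a dvd b * c" if "a dvd lcm b c" for a b c :: nat using that by (meson dvd_trans lcm_least dvd_triv_left dvd_triv_right)
  have "\<not> (3 \<le> e0 \<and> 3 \<le> e1)"
  proof
    assume 3: "3 \<le> e0 \<and> 3 \<le> e1"
    have "\<not> 3 \<le> e2" using 3 mul[of 3 e0 d0] mul[of 3 e1 d1] mul[of 3 e2 d2] d by linarith
    then have e2: "e2 = 2" using e(3) by simp
    have "\<not> (d2 < d0 \<and> d2 < d1)" using 3 mul[of 3 e0 d0] mul[of 3 e1 d1] d by linarith
    then have two: "2 dvd lcm e0 e1" using last unfolding e2 by blast
    have "\<not> (4 \<le> e0 \<and> 4 \<le> e1)" using mul[of 4 e0 d0] mul[of 4 e1 d1] d[unfolded e2] by linarith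
    then consider "e0 = 3" | "e1 = 3" using 3 by linarith
    then show False
    proof cases
      case 1
      have "\<not> 6 \<le> e1" using mul[of 6 e1 d1] d[unfolded 1 e2] by linarith
      then have "e1 = 3 \<or> e1 = 4 \<or> e1 = 5" using 3 by linarith
      then show False using 1 e2 lcm[OF two] lcm[OF dvd(2)] by auto
    next
      case 2
      have "\<not> 6 \<le> e0" using mul[of 6 e0 d0] d[unfolded 2 e2] by linarith
      then have "e0 = 3 \<or> e0 = 4 \<or> e0 = 5" using 3 by linarith
      then show False using 2 e2 lcm[OF two] lcm[OF dvd(1)] by auto
    qed
  qed
  moreover have "\<not> (e0 = 2 \<and> 3 \<le> e1)"
    using platonic_aux[of e1 e2 d0 d1 d2] e d dvd by auto
  moreover have "\<not> (e1 = 2 \<and> 3 \<le> e0)"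
    using platonic_aux[of e0 e2 d1 d0 d2] e d dvd by (auto simp: add.commute add.left_commute)
  ultimately show ?thesis using e by linarith
qed

section \<open>Exponents when all selected variables move, and type (a)\<close>

context hl
begin

text \<open>A block violating \<open>niso\<close> has the strictly smallest degree, so at most one
  does. Call the two good blocks \<open>i\<close> and \<open>k\<close>; if some exponent is 1 its
  block takes the last place, and otherwise the platonic list applies.\<close>

lemma exponents:
  assumes nz: "\<And>i. i \<in> {0,1,2} \<Longrightarrow> y i \<noteq> 0"
  shows "\<exists>i k m. i \<in> {0,1,2} \<and> k \<in> {0,1,2} \<and> m \<in> {0,1,2} \<and> i \<noteq> k \<and> i \<noteq> m \<and> k \<noteq> m \<and>
    (\<forall>j\<in>{1..n (p i)}. ex i dvd l (p i) j) \<and> (\<forall>j\<in>{1..n (p k)}. ex i dvd l (p k) j) \<and>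
    (ex m = 1 \<or> ex i = 2 \<and> ex k = 2 \<and> ex m \<ge> 2)"
proof -
  have iso: "dg i < dg k" if "i \<in> {0,1,2}" "k \<in> {0,1,2}" "i \<noteq> k" "\<not> niso i" for i k
    using not_niso_degree[OF that(1-3) nz[OF that(1)] nz[OF that(2)] that(4)] .
  have two: "niso i \<or> niso k" if "i \<in> {0,1,2}" "k \<in> {0,1,2}" "i \<noteq> k" for i k
    using iso[OF that] iso[OF that(2,1) that(3)[symmetric]] less_asym by metis
  have "niso 0 \<or> niso 1" "niso 0 \<or> niso 2" "niso 1 \<or> niso 2"
    by (rule two[OF in012(1,2)] two[OF in012(1,3)] two[OF in012(2,3)], simp)+
  then consider "niso 0" "niso 1" | "niso 0" "niso 2" | "niso 1" "niso 2" by argo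
  then obtain i k m where ikm: "i \<in> {0,1,2}" "k \<in> {0,1,2}" "m \<in> {0,1,2}" "i \<noteq> k" "i \<noteq> m" "k \<noteq> m" "niso i" "niso k"
    and S: "dg 0 + dg 1 + dg 2 = dg i + dg k + dg m"
  proof cases
    case 1 then show ?thesis by (intro that[of 0 1 2] in012) simp_all
  next
    case 2 then show ?thesis by (intro that[of 0 2 1] in012) simp_all
  next
    case 3 then show ?thesis by (intro that[of 1 2 0] in012) simp_all
  qed
  define Q where "Q i k m \<longleftrightarrow> (\<forall>j\<in>{1..n (p i)}. ex i dvd l (p i) j) \<and> (\<forall>j\<in>{1..n (p k)}. ex i dvd l (p k) j) \<and>
    (ex m = 1 \<or> ex i = 2 \<and> ex k = 2 \<and> ex m \<ge> 2)" for i k m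
  have fin: ?thesis if "a \<in> {0,1,2}" "b \<in> {0,1,2}" "c \<in> {0,1,2}" "a \<noteq> b" "a \<noteq> c" "b \<noteq> c" "Q a b c" for a b c
    by (rule ex3I[of _ a b c]) (intro conjI that(1-6) that(7)[unfolded Q_def, THEN conjunct1]
        that(7)[unfolded Q_def, THEN conjunct2, THEN conjunct1] that(7)[unfolded Q_def, THEN conjunct2, THEN conjunct2])
  have own: "\<forall>j\<in>{1..n (p i)}. ex i dvd l (p i) j" if "niso i" for i using that unfolding niso_def by (rule conjunct1)
  have oth: "ex i dvd lcm (l (p k) j) (l (p m) j')"
    if "niso i" "k \<in> {0,1,2}" "m \<in> {0,1,2}" "k \<noteq> m" "k \<noteq> i" "m \<noteq> i" "j \<in> {1..n (p k)}" "j' \<in> {1..n (p m)}" for i k m j j'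
    using that(1)[unfolded niso_def, THEN conjunct2, THEN bspec[OF _ that(2)], THEN bspec[OF _ that(3)],
        THEN bspec[OF _ that(7)], THEN bspec[OF _ that(8)]] that(4-6) by argo
  have exs: "ex i dvd lcm (ex k) (ex m)"
    if "niso i" "k \<in> {0,1,2}" "m \<in> {0,1,2}" "k \<noteq> m" "k \<noteq> i" "m \<noteq> i" for i k m
    using oth[OF that c_in[OF that(2)] c_in[OF that(3)]] by (simp only: ex_def)
  have ik: "ex i dvd lcm (ex k) (ex m)" "ex k dvd lcm (ex i) (ex m)"
    using exs[OF ikm(7) ikm(2,3,6) ikm(4)[symmetric] ikm(5)[symmetric]]
      exs[OF ikm(8) ikm(1,3) ikm(5) ikm(4) ikm(6)[symmetric]] .
  have pos: "ex i \<ge> 1" "ex k \<ge> 1" "ex m \<ge> 1" by (rule ex_pos[OF ikm(1)] ex_pos[OF ikm(2)] ex_pos[OF ikm(3)])+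
  consider "ex m = 1" | "ex i = 1" | "ex k = 1" | "ex i \<ge> 2" "ex k \<ge> 2" "ex m \<ge> 2" using pos by linarith
  then show ?thesis
  proof cases
    case 1
    \<comment> \<open>With \<open>ex m = 1\<close> the least common multiples collapse and the two
      exponents divide each other.\<close>
    then have "ex i = ex k" using ik by (simp add: dvd_antisym)
    then have "Q i k m" unfolding Q_def using own[OF ikm(7)] own[OF ikm(8)] 1 by simp
    then show ?thesis by (rule fin[OF ikm(1-6)])
  next
    case 2
    have "ex k dvd l (p m) j" if "j \<in> {1..n (p m)}" for j
      using oth[OF ikm(8) ikm(1,3) ikm(5) ikm(4) ikm(6)[symmetric] c_in[OF ikm(1)] that] 2 by (simp add: ex_def)
    then have "Q k m i" unfolding Q_def using own[OF ikm(8)] 2 by simp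
    then show ?thesis by (rule fin[OF ikm(2,3,1,6) ikm(4)[symmetric] ikm(5)[symmetric]])
  next
    case 3
    have "ex i dvd l (p m) j" if "j \<in> {1..n (p m)}" for j
      using oth[OF ikm(7) ikm(2,3) ikm(6) ikm(4)[symmetric] ikm(5)[symmetric] c_in[OF ikm(2)] that] 3 by (simp add: ex_def)
    then have "Q i m k" unfolding Q_def using own[OF ikm(7)] 3 by simp
    then show ?thesis by (rule fin[OF ikm(1,3,2,5,4) ikm(6)[symmetric]])
  next
    case 4
    have last: "ex m dvd lcm (ex i) (ex k) \<or> dg m < dg i \<and> dg m < dg k"
    proof (cases "niso m")
      case True
      then show ?thesis using exs[OF True ikm(1,2) ikm(4-6)] by blast
    next
      case False
      then show ?thesis using iso[OF ikm(3,1) ikm(5)[symmetric]] iso[OF ikm(3,2) ikm(6)[symmetric]] by metis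
    qed
    have 22: "ex i = 2 \<and> ex k = 2"
      by (rule platonic[OF 4 degree_bounds[OF nz ikm(1), unfolded S] degree_bounds[OF nz ikm(2), unfolded S]
            degree_bounds[OF nz ikm(3), unfolded S] ik last])
    then have "Q i k m" unfolding Q_def using own[OF ikm(7)] own[OF ikm(8)] 4 by simp
    then show ?thesis by (rule fin[OF ikm(1-6)])
  qed
qed

subsection \<open>One killed variable: type (a)\<close>

lemma type_a_multiple:
  assumes "y 1 = 0" "ex 2 = 1"
  shows "\<exists>h. \<forall>v\<in>V. a v \<asymp> h * avec (dm 2 1) 0 (- dm 0 1) v"
proof -
  have rel: "dm 0 1 * y 0 + dm 2 1 * y 2 \<asymp> 0" using D_P_relation assms(1) by simp
  have d2: "dm 2 1 = fr 2 1 * X 2 ^ 0" using dm_1[OF in012(3)] assms(2) by simp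
  have d0: "dm 0 1 = of_nat (ex 0) * (fr 0 1 * X 0 ^ (ex 0 - 1))" using dm_1[OF in012(1)] by (simp add: mult.assoc)
  have "mcoprime (dm 2 1) (fr 0 1 * X 0 ^ (ex 0 - 1))" unfolding d2 by (rule mcoprime_blocks) simp_all
  moreover have "(fr 0 1 * X 0 ^ (ex 0 - 1)) * (of_nat (ex 0) * y 0) \<asymp> dm 2 1 * (- y 2)"
    by (rule eqvI1[OF _ rel, of _ _ 1]) (unfold d0, simp add: algebra_simps)
  ultimately obtain h0 where h0: "of_nat (ex 0) * y 0 \<asymp> dm 2 1 * h0"
    using mdvdI unfolding mcoprime_def mdvd_def by blast
  define h where "h = Const (1 / of_nat (ex 0)) * h0"
  have "Const (of_nat (ex 0)) * y 0 \<asymp> dm 2 1 * h0" using h0 by (simp add: Const_of_nat)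
  then have "y 0 \<asymp> Const (1 / of_nat (ex 0)) * (dm 2 1 * h0)" using ex_pos[of 0] by (intro eqv_Const_divide) simp_all
  then have y0: "y 0 \<asymp> h * dm 2 1" by (simp add: h_def mult_ac)
  have "dm 2 1 * y 2 \<asymp> dm 2 1 * (h * (- dm 0 1))"
    by (rule eqvI2[OF _ rel y0, of _ _ 1 "- dm 0 1"]) (simp add: algebra_simps)
  moreover have "\<not> dm 2 1 \<asymp> 0" unfolding d2 by (rule block_not_eqv_0)
  ultimately have y2: "y 2 \<asymp> h * (- dm 0 1)" using eqv_mult_cancel_left by blast
  have "a v \<asymp> h * avec (dm 2 1) 0 (- dm 0 1) v" if vV: "v \<in> V" for v
  proof -
    consider "v = xv 0" | "v = xv 1" | "v = xv 2" | "v \<in> Frozen" using vV unfolding Frozen_def by blast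
    then show ?thesis
    proof cases
      case 1 then show ?thesis using y0 by simp
    next
      case 2 then show ?thesis using assms(1) by simp
    next
      case 3 then show ?thesis using y2 by simp
    next
      case 4 then show ?thesis by (simp add: frozen_zero)
    qed
  qed
  then show ?thesis by blast
qed

text \<open>By coprimality the derivative of each of the two monomials divides the image of the
  other variable. Two exponents greater than 1 would give \<open>dg 2 < dg 0\<close> and
  \<open>dg 0 < dg 2\<close>.\<close>

lemma type_a_exponents:
  assumes "y 1 = 0" "y 0 \<noteq> 0" "y 2 \<noteq> 0"
  shows "ex 0 = 1 \<or> ex 2 = 1"
proof -
  define g where "g i = fr i 1 * X i ^ (ex i - 1)" for i
  have rel: "of_nat (ex 0) * g 0 * y 0 + of_nat (ex 2) * g 2 * y 2 \<asymp> 0"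
    using D_P_relation assms(1) dm_1[OF in012(1)] dm_1[OF in012(3)] by (simp add: g_def mult.assoc)
  have g0: "\<not> g i \<asymp> 0" for i unfolding g_def by (rule block_not_eqv_0)
  have dgg: "deg (g i) = (ex i - 1) * dg i" if "i \<in> {0,1,2}" for i
    using fr_not_eqv_0[of i 1] Var_power_not_eqv_0[of "xv i"] Var_not_eqv_0[of "xv i"] deg_frozen[OF fr_vars_Frozen[OF that]]
    by (simp add: g_def deg_mult deg_power)
  have bound: "(ex k - 1) * dg k \<le> deg (y i)"
    if ik: "i \<in> {0,1,2}" "k \<in> {0,1,2}" "i \<noteq> k" "y i \<noteq> 0"
      and r: "of_nat (ex i) * g i * y i + of_nat (ex k) * g k * y k \<asymp> 0" for i k
  proof -
    have "mcoprime (g k) (g i)" unfolding g_def by (rule mcoprime_blocks[OF ik(2,1)]) (use ik(3) in simp)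
    moreover have "g i * (of_nat (ex i) * y i) \<asymp> g k * (- of_nat (ex k) * y k)"
      by (rule eqvI1[OF _ r, of _ _ 1]) (simp add: algebra_simps)
    ultimately obtain h where h: "of_nat (ex i) * y i \<asymp> g k * h"
      using mdvdI unfolding mcoprime_def mdvd_def by blast
    have not_y: "\<not> y i \<asymp> 0" using a_eqv_0[OF xv_in_V[OF ik(1)]] ik(4) by blast
    have nz: "\<not> of_nat (ex i) * y i \<asymp> 0"
      using of_nat_nz[of "ex i"] ex_pos[OF ik(1)] not_y by (simp add: mult_eqv_0_iff)
    then have "\<not> g k * h \<asymp> 0" using eqv_0_cong[OF h] by blast
    then have "deg (g k * h) = deg (g k) + deg h" by (simp add: mult_eqv_0_iff deg_mult)
    moreover have "deg (of_nat (ex i) * y i) = deg (y i)"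
      using nz by (simp add: mult_eqv_0_iff deg_mult deg_of_nat)
    ultimately show ?thesis using deg_cong[OF h] dgg[OF ik(2)] by simp
  qed
  have b: "(ex 2 - 1) * dg 2 < dg 0" "(ex 0 - 1) * dg 0 < dg 2"
    using bound[of 0 2] bound[of 2 0] rel assms deg_X[of 0] deg_X[of 2] by (simp_all add: add.commute)
  show ?thesis
  proof (rule ccontr)
    assume "\<not> ?thesis"
    then have le: "1 \<le> ex 0 - 1" "1 \<le> ex 2 - 1" using ex_pos[of 0] ex_pos[of 2] by auto
    show False using mult_le_mono1[OF le(1), of "dg 0"] mult_le_mono1[OF le(2), of "dg 2"] b by linarith
  qed
qed

lemma two_not_killed: "y 0 = 0 \<Longrightarrow> y 1 = 0 \<Longrightarrow> y 2 = 0"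
proof -
  assume "y 0 = 0" "y 1 = 0"
  then have "dm 2 1 * y 2 \<asymp> 0" using D_P_relation by simp
  moreover have "\<not> dm 2 1 \<asymp> 0"
    unfolding dm_1[OF in012(3)] mult.assoc using block_not_eqv_0[of 2 1] of_nat_nz[of "ex 2"] ex_pos[of 2]
    by (simp add: mult_eqv_0_iff)
  ultimately show "y 2 = 0" using a_eqv_0[OF xv_in_V[OF in012(3)]] by (simp add: mult_eqv_0_iff)
qed

end

section \<open>Binary forms\<close>

text \<open>Binary forms over the constants, described by closure rules so that expressions are
  recognized structurally; \<open>bf_hf\<close> supplies coefficients afterwards.\<close>

inductive bf :: "'k::comm_ring_1 mpol \<Rightarrow> 'k mpol \<Rightarrow> nat \<Rightarrow> 'k mpol \<Rightarrow> bool" for U W where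
  bf_Const: "bf U W 0 (Const c)"
| bf_left: "bf U W N F \<Longrightarrow> bf U W (Suc N) (U * F)"
| bf_right: "bf U W N F \<Longrightarrow> bf U W (Suc N) (W * F)"
| bf_add: "bf U W N F \<Longrightarrow> bf U W N G \<Longrightarrow> bf U W N (F + G)"
| bf_0: "bf U W N 0"

lemma bf_1: "bf U W 0 1"
  using bf_Const[of U W 1] by simp

lemma bf_Const_mult: "bf U W N F \<Longrightarrow> bf U W N (Const c * F)"
proof (induction rule: bf.induct)
  case (bf_Const c')
  then show ?case using bf.bf_Const[of U W "c * c'"] by (simp add: Const_mult)
next
  case (bf_left N F)
  then show ?case using bf.bf_left by (simp add: mult.left_commute)
next
  case (bf_right N F)
  then show ?case using bf.bf_right by (simp add: mult.left_commute)
qed (auto simp: distrib_left intro: bf_add bf_0)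

lemma bf_minus: "bf U W N F \<Longrightarrow> bf U W N (- F)"
  using bf_Const_mult[of U W N F "-1"] by (simp add: Const_minus)

lemma bf_mult: "bf U W N F \<Longrightarrow> bf U W M G \<Longrightarrow> bf U W (N + M) (F * G)"
proof (induction rule: bf.induct)
  case (bf_left N F)
  then show ?case using bf.bf_left[of U W "N + M" "F * G"] by (simp add: mult.assoc)
next
  case (bf_right N F)
  then show ?case using bf.bf_right[of U W "N + M" "F * G"] by (simp add: mult.assoc)
qed (auto simp: distrib_right intro: bf_Const_mult bf_add bf_0)

lemma bf_power: "bf U W N F \<Longrightarrow> bf U W (k * N) (F ^ k)"
  by (induction k) (auto intro: bf_1 bf_mult)

lemma bf_sum: "(\<And>i. i \<in> S \<Longrightarrow> bf U W N (F i)) \<Longrightarrow> bf U W N (\<Sum>i\<in>S. F i)"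
  by (induction S rule: infinite_finite_induct) (auto intro: bf_add bf_0)

lemma bf_variables: "bf U W 1 U" "bf U W 1 W"
  using bf_left[OF bf_1[of U W]] bf_right[OF bf_1[of U W]] by simp_all

text \<open>The homogenization of \<open>q\<close> in degree \<open>N\<close>. Roots of
  \<open>q\<close> give linear factors \<open>U - r W\<close>, and a degree smaller than
  \<open>N\<close> gives factors \<open>W\<close>.\<close>

definition hf :: "nat \<Rightarrow> 'k::comm_ring_1 poly \<Rightarrow> 'k mpol \<Rightarrow> 'k mpol \<Rightarrow> 'k mpol" where
  "hf N q U W = (\<Sum>i\<le>N. Const (coeff q i) * U ^ i * W ^ (N - i))"

lemma hf_add: "hf N (q + q') U W = hf N q U W + hf N q' U W"
  by (simp add: hf_def Const_add distrib_right sum.distrib)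

lemma hf_smult: "hf N (Polynomial.smult c q) U W = Const c * hf N q U W"
  by (simp add: hf_def Const_mult sum_distrib_left mult.assoc)

lemma hf_pCons_0: "hf (Suc N) (pCons 0 q) U W = U * hf N q U W"
  unfolding hf_def sum.atMost_Suc_shift by (simp add: sum_distrib_left mult_ac)

lemma hf_Suc: "degree q \<le> N \<Longrightarrow> hf (Suc N) q U W = W * hf N q U W"
proof -
  assume "degree q \<le> N"
  then have "coeff q (Suc N) = 0" by (simp add: coeff_eq_0)
  then have "hf (Suc N) q U W = (\<Sum>i\<le>N. Const (coeff q i) * U ^ i * W ^ (Suc N - i))" by (simp add: hf_def)
  also have "\<dots> = (\<Sum>i\<le>N. W * (Const (coeff q i) * U ^ i * W ^ (N - i)))"
    by (intro sum.cong) (simp_all add: Suc_diff_le mult_ac)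
  finally show ?thesis by (simp add: hf_def sum_distrib_left)
qed

lemma bf_hf: "bf U W N F \<Longrightarrow> \<exists>q. degree q \<le> N \<and> F = hf N q U W"
proof (induction rule: bf.induct)
  case (bf_Const c)
  show ?case by (intro exI[of _ "[:c:]"]) (simp add: hf_def)
next
  case (bf_left N F)
  then obtain q where "degree q \<le> N" "F = hf N q U W" by blast
  then show ?case by (intro exI[of _ "pCons 0 q"]) (auto simp: hf_pCons_0 intro: order_trans[OF degree_pCons_le])
next
  case (bf_right N F)
  then obtain q where "degree q \<le> N" "F = hf N q U W" by blast
  then show ?case by (intro exI[of _ q]) (auto simp: hf_Suc)
next
  case (bf_add N F G)
  then obtain q q' where "degree q \<le> N" "F = hf N q U W" "degree q' \<le> N" "G = hf N q' U W" by blast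
  then show ?case by (intro exI[of _ "q + q'"]) (auto simp: hf_add intro: degree_add_le)
next
  case (bf_0 N)
  show ?case by (intro exI[of _ 0]) (simp add: hf_def)
qed

section \<open>A homogeneous kernel element\<close>

context trinomial
begin

lemma prod_V: "(\<Prod>v\<in>V. F v) = (\<Prod>i\<in>{0,1,2}. \<Prod>j\<in>{1..n i}. F (TVar i j)) * (\<Prod>k\<in>{1..d}. F (SVar k))"
proof -
  have V: "V = (\<lambda>(i, j). TVar i j) ` (SIGMA i:{0,1,2}. {1..n i}) \<union> SVar ` {1..d}"
    by (force simp: tri_vars_def)
  have "(\<Prod>v\<in>V. F v) = (\<Prod>v\<in>(\<lambda>(i, j). TVar i j) ` (SIGMA i:{0,1,2}. {1..n i}). F v) * (\<Prod>v\<in>SVar ` {1..d}. F v)"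
    unfolding V by (intro prod.union_disjoint) auto
  also have "(\<Prod>v\<in>(\<lambda>(i, j). TVar i j) ` (SIGMA i:{0,1,2}. {1..n i}). F v) =
      (\<Prod>(i, j)\<in>(SIGMA i:{0,1,2}. {1..n i}). F (TVar i j))"
    by (subst prod.reindex) (auto simp: inj_on_def case_prod_unfold)
  also have "\<dots> = (\<Prod>i\<in>{0,1,2}. \<Prod>j\<in>{1..n i}. F (TVar i j))" by (rule prod.Sigma[symmetric]) auto
  also have "(\<Prod>v\<in>SVar ` {1..d}. F v) = (\<Prod>k\<in>{1..d}. F (SVar k))"
    by (subst prod.reindex) (auto simp: inj_on_def)
  finally show ?thesis .
qed

lemma single_eq_prod_V:
  fixes k :: 'k
  assumes "Poly_Mapping.keys m \<subseteq> V"
  shows "Poly_Mapping.single m k = Const k * (\<Prod>v\<in>V. Var v ^ Poly_Mapping.lookup m v)"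
proof -
  have "(\<Prod>v\<in>Poly_Mapping.keys m. Var v ^ Poly_Mapping.lookup m v :: 'k mpol) = (\<Prod>v\<in>V. Var v ^ Poly_Mapping.lookup m v)"
    using assms by (intro prod.mono_neutral_left finite_tri_vars) (auto simp: in_keys_iff)
  then show ?thesis by (simp add: single_eq_Const_monom monom_at_def)
qed

definition homogeneous :: "'k mpol \<Rightarrow> bool" where
  "homogeneous g \<longleftrightarrow> (\<forall>A w. cochar A w \<longrightarrow> (\<exists>\<gamma>. homog A \<gamma> g))"

lemma homogeneous_wdeg:
  "homogeneous g \<Longrightarrow> cochar A w \<Longrightarrow> m \<in> Poly_Mapping.keys g \<Longrightarrow> m' \<in> Poly_Mapping.keys g \<Longrightarrow> wdeg A m = wdeg A m'"
  by (metis homogeneous_def homog_def)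

text \<open>The cocharacter with weights \<open>l i j'\<close> and \<open>- l i j\<close> on the two
  variables takes the same value on both monomials.\<close>

lemma homogeneous_ratio:
  assumes g: "homogeneous g" "m \<in> Poly_Mapping.keys g" "m' \<in> Poly_Mapping.keys g"
    and ij: "i \<in> {0,1,2}" "j \<in> {1..n i}" "j' \<in> {1..n i}"
    and z: "Poly_Mapping.lookup m' (TVar i j) = 0"
  shows "Poly_Mapping.lookup m (TVar i j') * l i j = Poly_Mapping.lookup m (TVar i j) * l i j' + Poly_Mapping.lookup m' (TVar i j') * l i j"
proof (cases "j = j'")
  case False
  let ?A = "\<lambda>v. ind (TVar i j) (int (l i j')) v + ind (TVar i j') (- int (l i j)) v"
  have "cochar ?A 0" by (rule cochar_pair[OF ij(2,3)]) simp
  then have "wdeg ?A m = wdeg ?A m'" by (rule homogeneous_wdeg[OF g(1) _ g(2,3)])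
  then have "int (Poly_Mapping.lookup m (TVar i j') * l i j) =
      int (Poly_Mapping.lookup m (TVar i j) * l i j' + Poly_Mapping.lookup m' (TVar i j') * l i j)"
    using z by (simp add: wdeg_plus wdeg_ind)
  then show ?thesis by (simp only: of_nat_eq_iff)
qed (use z in simp)

text \<open>By homogeneity any two monomials of \<open>g\<close> differ, block by block, by a multiple of the exponent vector of
  that block; the monomial \<open>M\<close> collects the minimal exponents.\<close>

lemma homogeneous_factorization:
  fixes c \<alpha> :: "nat \<Rightarrow> nat" and g :: "'k mpol"
  defines "k \<equiv> \<lambda>i m. Poly_Mapping.lookup m (TVar i (c i)) * \<alpha> i div l i (c i)"
  assumes c: "\<And>i. i \<in> {0,1,2} \<Longrightarrow> c i \<in> {1..n i}"
    and g: "g \<in> Car" "homogeneous g"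
    and ref: "\<And>i. i \<in> {0,1,2} \<Longrightarrow> \<exists>m\<in>Poly_Mapping.keys g. Poly_Mapping.lookup m (TVar i (c i)) = 0"
    and \<alpha>: "\<And>i j. i \<in> {0,1,2} \<Longrightarrow> j \<in> {1..n i} \<Longrightarrow> \<alpha> i dvd l i j"
    and div: "\<And>i m. i \<in> {0,1,2} \<Longrightarrow> m \<in> Poly_Mapping.keys g \<Longrightarrow> l i (c i) dvd Poly_Mapping.lookup m (TVar i (c i)) * \<alpha> i"
  shows "\<exists>M. g = M * (\<Sum>m\<in>Poly_Mapping.keys g. Const (Poly_Mapping.lookup g m) * (\<Prod>i\<in>{0,1,2}. tri_mon n l i (\<alpha> i) ^ k i m))"
proof -
  obtain r where r: "\<And>i. i \<in> {0,1,2} \<Longrightarrow> r i \<in> Poly_Mapping.keys g" "\<And>i. i \<in> {0,1,2} \<Longrightarrow> Poly_Mapping.lookup (r i) (TVar i (c i)) = 0"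
    using ref by metis
  have expo: "Poly_Mapping.lookup m (TVar i j) = Poly_Mapping.lookup (r i) (TVar i j) + (l i j div \<alpha> i) * k i m"
    if m: "m \<in> Poly_Mapping.keys g" and i: "i \<in> {0,1,2}" and j: "j \<in> {1..n i}" for m i j
  proof -
    let ?L = "Poly_Mapping.lookup m" and ?e = "l i (c i)"
    have k: "k i m * ?e = ?L (TVar i (c i)) * \<alpha> i" unfolding k_def using div[OF i m] by simp
    obtain q where q: "l i j = \<alpha> i * q" using \<alpha>[OF i j] by (rule dvdE)
    have l0: "l i j \<ge> 1" "?e \<ge> 1" using l_pos[OF i] j c[OF i] by blast+
    then have "\<alpha> i > 0" using q by (cases "\<alpha> i") auto
    then have q': "l i j div \<alpha> i = q" using q by simp
    have "?L (TVar i j) * ?e = ?L (TVar i (c i)) * l i j + Poly_Mapping.lookup (r i) (TVar i j) * ?e"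
      by (rule homogeneous_ratio[OF g(2) m r(1)[OF i] i c[OF i] j r(2)[OF i]])
    also have "?L (TVar i (c i)) * l i j = (q * k i m) * ?e" using k q by (metis mult.assoc mult.commute)
    finally have "?L (TVar i j) * ?e = (Poly_Mapping.lookup (r i) (TVar i j) + q * k i m) * ?e"
      by (simp add: distrib_right)
    then show ?thesis using l0(2) q' by simp
  qed
  have S: "Poly_Mapping.lookup m (SVar s) = Poly_Mapping.lookup (r 0) (SVar s)" if "m \<in> Poly_Mapping.keys g" for m s
    using homogeneous_wdeg[OF g(2) cochar_S[of s 1] that r(1)[of 0]] by (simp add: wdeg_ind)
  define M :: "'k mpol" where "M = (\<Prod>i\<in>{0,1,2}. \<Prod>j\<in>{1..n i}. Var (TVar i j) ^ Poly_Mapping.lookup (r i) (TVar i j)) *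
    (\<Prod>s\<in>{1..d}. Var (SVar s) ^ Poly_Mapping.lookup (r 0) (SVar s))"
  have mono: "(\<Prod>v\<in>V. Var v ^ Poly_Mapping.lookup m v) = M * (\<Prod>i\<in>{0,1,2}. tri_mon n l i (\<alpha> i) ^ k i m)"
    if m: "m \<in> Poly_Mapping.keys g" for m
  proof -
    have "(\<Prod>j\<in>{1..n i}. Var (TVar i j) ^ Poly_Mapping.lookup m (TVar i j) :: 'k mpol) =
        (\<Prod>j\<in>{1..n i}. Var (TVar i j) ^ Poly_Mapping.lookup (r i) (TVar i j)) * tri_mon n l i (\<alpha> i) ^ k i m"
      if i: "i \<in> {0,1,2}" for i
      unfolding tri_mon_def prod_power_distrib prod.distrib[symmetric] power_mult[symmetric] power_add[symmetric]
      by (intro prod.cong refl) (simp only: expo[OF m i])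
    then have "(\<Prod>i\<in>{0,1,2}. \<Prod>j\<in>{1..n i}. Var (TVar i j) ^ Poly_Mapping.lookup m (TVar i j) :: 'k mpol) =
        (\<Prod>i\<in>{0,1,2}. \<Prod>j\<in>{1..n i}. Var (TVar i j) ^ Poly_Mapping.lookup (r i) (TVar i j)) *
        (\<Prod>i\<in>{0,1,2}. tri_mon n l i (\<alpha> i) ^ k i m)"
      unfolding prod.distrib[symmetric] by (intro prod.cong refl) blast
    then show ?thesis unfolding prod_V S[OF m] M_def by (simp only: mult_ac)
  qed
  have keysV: "Poly_Mapping.keys m \<subseteq> V" if "m \<in> Poly_Mapping.keys g" for m
    using g(1) that by (auto simp: carrier_mpol_ring pvars_def)
  have "g = (\<Sum>m\<in>Poly_Mapping.keys g. Poly_Mapping.single m (Poly_Mapping.lookup g m))" by (simp only: mpol_sum_single)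
  also have "\<dots> = (\<Sum>m\<in>Poly_Mapping.keys g. M * (Const (Poly_Mapping.lookup g m) * (\<Prod>i\<in>{0,1,2}. tri_mon n l i (\<alpha> i) ^ k i m)))"
    by (intro sum.cong refl) (simp only: single_eq_prod_V[OF keysV] mono mult.left_commute)
  finally have "g = M * (\<Sum>m\<in>Poly_Mapping.keys g. Const (Poly_Mapping.lookup g m) * (\<Prod>i\<in>{0,1,2}. tri_mon n l i (\<alpha> i) ^ k i m))"
    unfolding sum_distrib_left .
  then show ?thesis by blast
qed

end

section \<open>A homogeneous kernel element when all three selected variables move\<close>

locale hl3 = hl n l d im p c a \<epsilon>
  for n l d and im :: "'k::{alg_closed_field, field_char_0}" and p c a \<epsilon> +
  assumes not_killed: "\<And>i. i \<in> {0,1,2} \<Longrightarrow> y i \<noteq> 0"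

context hl3
begin

lemma not_D_X: "i \<in> {0,1,2} \<Longrightarrow> \<not> D (X i) \<asymp> 0"
  using D_X[of i] not_killed[of i] a_eqv_0[OF xv_in_V, of i] by metis

lemma dg_pos: "i \<in> {0,1,2} \<Longrightarrow> dg i > 0"
  using not_D_X[of i] deg_eq_0_iff[of "X i"] by simp

definition wE :: "tvar \<Rightarrow> int" where
  "wE v = ind (xv 0) (int (ex 1 * ex 2)) v + ind (xv 1) (int (ex 0 * ex 2)) v + ind (xv 2) (int (ex 0 * ex 1)) v"

lemma cochar_wE: "cochar wE (int (ex 0 * ex 1 * ex 2))"
proof -
  have "cochar (\<lambda>v. ind (TVar (p 0) (c (p 0))) (int (ex 1 * ex 2)) v + ind (TVar (p 1) (c (p 1))) (int (ex 0 * ex 2)) v +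
      ind (TVar (p 2) (c (p 2))) (int (ex 0 * ex 1)) v) (int (ex 0 * ex 1 * ex 2))"
    by (rule cochar_triple[OF p_in[OF in012(1)] p_in[OF in012(2)] p_in[OF in012(3)] _ _ _
        c_in[OF in012(1)] c_in[OF in012(2)] c_in[OF in012(3)]])
      (simp_all only: p_eq_iff flip: ex_def, simp_all)
  then show ?thesis unfolding wE_def xv_def .
qed

lemma wdeg_wE: "wdeg wE m = int (Poly_Mapping.lookup m (xv 0) * (ex 1 * ex 2) +
    Poly_Mapping.lookup m (xv 1) * (ex 0 * ex 2) + Poly_Mapping.lookup m (xv 2) * (ex 0 * ex 1))"
  unfolding wE_def wdeg_plus wdeg_ind by simp

lemma wE_xv: "i \<in> {0,1,2} \<Longrightarrow> int (ex i) * wE (xv i) = int (ex 0 * ex 1 * ex 2)"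
  by (elim insertE emptyE) (simp_all add: wE_def)

lemma homog_iter: "cochar A w \<Longrightarrow> homog A k f \<Longrightarrow> homog A (k + int j * \<epsilon> A) ((D ^^ j) f)"
proof (induction j)
  case (Suc j)
  have "homog A (k + int j * \<epsilon> A + \<epsilon> A) (D ((D ^^ j) f))"
    by (rule homog_poly_der[OF homog_a[OF Suc.prems(1)] Suc.IH[OF Suc.prems]])
  then show ?case by (simp add: algebra_simps)
qed simp

lemma weight_0_frozen:
  assumes "f \<in> Car" "homog wE 0 f"
  shows "pvars f \<subseteq> Frozen"
proof
  fix v assume "v \<in> pvars f"
  then obtain m where m: "m \<in> Poly_Mapping.keys f" "v \<in> Poly_Mapping.keys m" by (auto simp: pvars_def)
  have "wdeg wE m = 0" using assms(2) m(1) by (simp add: homog_def)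
  then have "Poly_Mapping.lookup m (xv 0) = 0 \<and> Poly_Mapping.lookup m (xv 1) = 0 \<and> Poly_Mapping.lookup m (xv 2) = 0"
    using ex_pos[OF in012(1)] ex_pos[OF in012(2)] ex_pos[OF in012(3)] unfolding wdeg_wE of_nat_eq_0_iff by auto
  then have "v \<noteq> xv 0 \<and> v \<noteq> xv 1 \<and> v \<noteq> xv 2" using m(2) by (metis in_keys_iff)
  moreover have "v \<in> V" using assms(1) \<open>v \<in> pvars f\<close> by (auto simp: carrier_mpol_ring)
  ultimately show "v \<in> Frozen" by (simp add: Frozen_def)
qed

lemma iter_combination:
  assumes "D u = 0" "D w = 0"
  shows "(D ^^ j) (u * f - w * g) = u * (D ^^ j) f - w * (D ^^ j) g"
  by (induction j) (simp_all add: poly_der.D_diff poly_der.D_mult assms)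

text \<open>At a point of the hypersurface with \<open>X 0 = 0\<close> and \<open>X 1 = 1\<close>
  only the term \<open>- \<alpha> * fr 1 1\<close> remains.\<close>

lemma tm_combination_not_eqv_0:
  assumes \<alpha>: "pvars \<alpha> \<subseteq> Frozen" "\<alpha> \<noteq> 0"
  shows "\<not> \<beta> * tm 0 1 - \<alpha> * tm 1 1 \<asymp> 0"
proof -
  obtain t where t: "\<forall>v. t v \<noteq> 0" "eval_at t \<alpha> \<noteq> 0" using exists_nonzero_point[OF \<alpha>(2)] by blast
  have fr: "eval_at t (fr i 1) \<noteq> 0" if "i \<in> {0,1,2}" for i by (rule fr_eval_nonzero[OF _ that]) (use t(1) in blast)
  obtain z where z: "z ^ ex 2 = - eval_at t (fr 1 1) / eval_at t (fr 2 1)"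
    using nth_root_exists[of "ex 2"] ex_pos[OF in012(3)] by (metis less_le_trans zero_less_one)
  have e0: "(0::'k) ^ ex 0 = 0" using ex_pos[OF in012(1)] by (simp add: zero_power)
  let ?t = "upd t 0 1 z"
  have "eval_at ?t P = 0" using fr[OF in012(3)] by (simp add: eval_upd_P e0 z)
  moreover have "eval_at ?t \<alpha> = eval_at t \<alpha>"
    unfolding eval_at_psubst by (rule psubst_cong) (use \<alpha>(1) in \<open>auto simp: upd_def Frozen_def\<close>)
  then have "eval_at ?t (\<beta> * tm 0 1 - \<alpha> * tm 1 1) \<noteq> 0"
    using t(2) fr[OF in012(2)] by (simp only: eval_simps eval_upd_tm div_by_1 e0) simp
  ultimately show ?thesis by (rule not_eqv_0_if_eval)
qed

text \<open>The last nonzero iterate of some \<open>X i\<close> serves unless all three have weight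
  0. In that case the monomials \<open>tm 0 1\<close> and \<open>tm 1 1\<close> have the same degree
  \<open>k\<close>, and their \<open>k\<close>-th iterates \<open>\<alpha>\<close> and
  \<open>\<beta>\<close> are frozen. The combination \<open>g0\<close> then has smaller degree than
  \<open>k\<close>, and its last nonzero iterate has nonzero weight.\<close>

lemma kernel_element:
  obtains g \<gamma> where "g \<in> Car" "\<not> g \<asymp> 0" "D g \<asymp> 0" "homogeneous g" "homog wE \<gamma> g" "\<gamma> \<noteq> 0"
proof (cases "\<exists>i\<in>{0,1,2}. wE (xv i) + int (dg i) * \<epsilon> wE \<noteq> 0")
  case True
  then obtain i where i: "i \<in> {0,1,2}" "wE (xv i) + int (dg i) * \<epsilon> wE \<noteq> 0" by blast
  show ?thesis
  proof (rule that)
    show "(D ^^ dg i) (X i) \<in> Car" by (rule iter_D_Car[OF X_Car[OF i(1)]])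
    show "\<not> (D ^^ dg i) (X i) \<asymp> 0" by (rule iter_deg_not_eqv_0[OF Var_not_eqv_0])
    show "D ((D ^^ dg i) (X i)) \<asymp> 0" by (rule iter_deg)
    show "homogeneous ((D ^^ dg i) (X i))"
      unfolding homogeneous_def using homog_iter[OF _ homog_Var] by blast
    show "homog wE (wE (xv i) + int (dg i) * \<epsilon> wE) ((D ^^ dg i) (X i))"
      by (rule homog_iter[OF cochar_wE homog_Var])
  qed (rule i(2))
next
  case False
  define W where "W = int (ex 0 * ex 1 * ex 2)"
  have pos: "ex 0 > 0" "ex 1 > 0" "ex 2 > 0" using ex_pos[OF in012(1)] ex_pos[OF in012(2)] ex_pos[OF in012(3)] by auto
  then have W: "W > 0" unfolding W_def by simp
  have rel: "W + int (ex i * dg i) * \<epsilon> wE = 0" if i: "i \<in> {0,1,2}" for i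
  proof -
    have "int (ex i) * (wE (xv i) + int (dg i) * \<epsilon> wE) = 0" using False i by (metis mult_zero_right)
    then show ?thesis using wE_xv[OF i] by (simp only: distrib_left W_def of_nat_mult mult.assoc)
  qed
  then have eps: "\<epsilon> wE \<noteq> 0" using W by (metis add_0_right in012(1) less_irrefl mult_zero_right)
  define k where "k = ex 0 * dg 0"
  have "int k * \<epsilon> wE = int (ex 1 * dg 1) * \<epsilon> wE"
    using rel[OF in012(1)] rel[OF in012(2)] unfolding k_def by linarith
  then have k1: "ex 1 * dg 1 = k" using mult_right_cancel[OF eps] of_nat_eq_iff by metis
  have k0: "k > 0" unfolding k_def using pos dg_pos[OF in012(1)] by simp
  have dtm: "deg (tm i 1) = ex i * dg i" if "i \<in> {0,1,2}" for i
  proof -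
    have "tm i 1 = fr i 1 * X i ^ ex i" using tm_eq[OF that, of 1] by (simp only: div_by_1)
    then show ?thesis
      using fr_not_eqv_0[of i 1] Var_power_not_eqv_0[of "xv i"] Var_not_eqv_0[of "xv i"] deg_frozen[OF fr_vars_Frozen[OF that]]
      by (simp only: deg_mult deg_power not_False_eq_True)
  qed
  define \<alpha> where "\<alpha> = (D ^^ k) (tm 0 1)"
  define \<beta> where "\<beta> = (D ^^ k) (tm 1 1)"
  have hom: "homog A (w + int k * \<epsilon> A) \<alpha>" "homog A (w + int k * \<epsilon> A) \<beta>" if "cochar A w" for A w
    unfolding \<alpha>_def \<beta>_def by (intro homog_iter[OF that] homog_tri_mon[OF that] p_in in012)+
  have Car: "\<alpha> \<in> Car" "\<beta> \<in> Car" unfolding \<alpha>_def \<beta>_def by (intro iter_D_Car tm_Car in012)+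
  have "W + int k * \<epsilon> wE = 0" using rel[OF in012(1)] by (simp only: k_def)
  then have fz: "pvars \<alpha> \<subseteq> Frozen" "pvars \<beta> \<subseteq> Frozen"
    using weight_0_frozen[OF Car(1)] weight_0_frozen[OF Car(2)] hom[OF cochar_wE, folded W_def] by simp_all
  have D0: "D \<alpha> = 0" "D \<beta> = 0" using poly_der_frozen[of a] D_frozen_Var fz by blast+
  have tm0: "\<not> tm 0 1 \<asymp> 0" using tm_1[OF in012(1)] block_not_eqv_0[of 0 1] Var_not_eqv_0 by (metis mult_eqv_0_iff)
  have "\<not> \<alpha> \<asymp> 0" unfolding \<alpha>_def using iter_deg_not_eqv_0[OF tm0] dtm[OF in012(1)] by (simp only: k_def not_False_eq_True)
  then have \<alpha>0: "\<alpha> \<noteq> 0" by auto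
  define g0 where "g0 = \<beta> * tm 0 1 - \<alpha> * tm 1 1"
  have g0: "\<not> g0 \<asymp> 0" unfolding g0_def by (rule tm_combination_not_eqv_0[OF fz(1) \<alpha>0])
  have "(D ^^ k) g0 = 0"
    unfolding g0_def iter_combination[OF D0(2,1)] by (simp only: \<alpha>_def[symmetric] \<beta>_def[symmetric]) (simp add: mult.commute)
  then have "deg g0 \<le> k - 1" unfolding deg_le_iff using k0 by (metis Suc_diff_1 eqv_refl)
  then have j: "deg g0 < k" using k0 by linarith
  have g0_hom: "homog A (w + int k * \<epsilon> A + w) g0" if "cochar A w" for A w
    unfolding g0_def by (intro homog_diff homog_mult hom[OF that] homog_tri_mon[OF that] p_in in012)
  show ?thesis
  proof (rule that)
    have "g0 \<in> Car" unfolding g0_def by (intro carrier_mpol_ring_intros Car tm_Car in012)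
    then show "(D ^^ deg g0) g0 \<in> Car" by (rule iter_D_Car)
    show "\<not> (D ^^ deg g0) g0 \<asymp> 0" by (rule iter_deg_not_eqv_0[OF g0])
    show "D ((D ^^ deg g0) g0) \<asymp> 0" by (rule iter_deg)
    show "homogeneous ((D ^^ deg g0) g0)"
      unfolding homogeneous_def using homog_iter[OF _ g0_hom] by blast
    show "homog wE (W + int k * \<epsilon> wE + W + int (deg g0) * \<epsilon> wE) ((D ^^ deg g0) g0)"
      unfolding W_def by (rule homog_iter[OF cochar_wE g0_hom[OF cochar_wE]])
    have "W + int k * \<epsilon> wE + W + int (deg g0) * \<epsilon> wE = (int (deg g0) - int k) * \<epsilon> wE"
      using \<open>W + int k * \<epsilon> wE = 0\<close> by (simp add: left_diff_distrib)
    then show "W + int k * \<epsilon> wE + W + int (deg g0) * \<epsilon> wE \<noteq> 0" using j eps by simp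
  qed
qed

text \<open>If all monomials of \<open>g\<close> contained \<open>X i\<close>, then
  \<open>X i\<close> would divide a nonzero kernel element and be killed. The weight is positive
  because \<open>wE\<close> is nonnegative and the weight of \<open>g\<close> is nonzero.\<close>

lemma kernel_monomials:
  obtains g \<Gamma> where "g \<in> Car" "\<not> g \<asymp> 0" "D g \<asymp> 0" "homogeneous g" "\<Gamma> > 0"
    "\<forall>m\<in>Poly_Mapping.keys g. Poly_Mapping.lookup m (xv 0) * (ex 1 * ex 2) +
      Poly_Mapping.lookup m (xv 1) * (ex 0 * ex 2) + Poly_Mapping.lookup m (xv 2) * (ex 0 * ex 1) = \<Gamma>"
    "\<forall>i\<in>{0,1,2}. \<exists>m\<in>Poly_Mapping.keys g. Poly_Mapping.lookup m (xv i) = 0"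
proof -
  obtain g \<gamma> where g: "g \<in> Car" "\<not> g \<asymp> 0" "D g \<asymp> 0" "homogeneous g" "homog wE \<gamma> g" "\<gamma> \<noteq> 0"
    by (rule kernel_element)
  have "g \<noteq> 0" using g(2) by auto
  then obtain m0 where m0: "m0 \<in> Poly_Mapping.keys g" by (metis all_not_in_conv keys_eq_empty)
  have wd: "wdeg wE m = \<gamma>" if "m \<in> Poly_Mapping.keys g" for m using g(5) that by (simp add: homog_def)
  have "\<gamma> \<ge> 0" using wd[OF m0] unfolding wdeg_wE by linarith
  have \<Gamma>: "Poly_Mapping.lookup m (xv 0) * (ex 1 * ex 2) + Poly_Mapping.lookup m (xv 1) * (ex 0 * ex 2) +
      Poly_Mapping.lookup m (xv 2) * (ex 0 * ex 1) = nat \<gamma>" if "m \<in> Poly_Mapping.keys g" for m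
    using wd[OF that] unfolding wdeg_wE by linarith
  have ref: "\<exists>m\<in>Poly_Mapping.keys g. Poly_Mapping.lookup m (xv i) = 0" if i: "i \<in> {0,1,2}" for i
  proof (rule ccontr)
    assume "\<not> ?thesis"
    then have "Var (xv i) ^ 1 dvd g" by (intro Var_power_dvd) (simp add: Suc_leI)
    then obtain q where q: "g = X i * q" by (auto elim: dvdE)
    then show False using ker_factor(1)[of "X i" q] g(2,3) not_D_X[OF i] by blast
  qed
  have "nat \<gamma> > 0" using \<open>\<gamma> \<ge> 0\<close> g(6) by simp
  from that[OF g(1-4) this ballI[OF \<Gamma>] ballI[OF ref]] show ?thesis .
qed

text \<open>The common monomial factor is removed by factorial closedness of the kernel; what
  remains is a polynomial in the roots \<open>tm i (\<alpha> i)\<close> of the three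
  monomials.\<close>

lemma kernel_form:
  assumes g: "g \<in> Car" "\<not> g \<asymp> 0" "D g \<asymp> 0" "homogeneous g"
      "\<forall>i\<in>{0,1,2}. \<exists>m\<in>Poly_Mapping.keys g. Poly_Mapping.lookup m (xv i) = 0"
    and \<alpha>: "\<forall>i\<in>{0,1,2}. \<forall>j\<in>{1..n (p i)}. \<alpha> i dvd l (p i) j"
    and div: "\<forall>i\<in>{0,1,2}. \<forall>m\<in>Poly_Mapping.keys g. ex i dvd Poly_Mapping.lookup m (xv i) * \<alpha> i"
  defines "k \<equiv> \<lambda>i m. Poly_Mapping.lookup m (xv i) * \<alpha> i div ex i"
  defines "G \<equiv> \<Sum>m\<in>Poly_Mapping.keys g. Const (Poly_Mapping.lookup g m) *
      (tm 0 (\<alpha> 0) ^ k 0 m * (tm 1 (\<alpha> 1) ^ k 1 m * tm 2 (\<alpha> 2) ^ k 2 m))"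
  shows "D G \<asymp> 0" "\<not> G \<asymp> 0"
proof -
  \<comment> \<open>The factorization is indexed by the original blocks, the form by their roles
    under \<open>p\<close>.\<close>
  define \<alpha>' where "\<alpha>' i = \<alpha> (inv_into UNIV p i)" for i
  have ip: "\<alpha>' (p i) = \<alpha> i" for i
    unfolding \<alpha>'_def using permutes_inverses(2)[OF perm] by simp
  have ball: "(\<And>i. i \<in> {0,1,2} \<Longrightarrow> Q (p i)) \<Longrightarrow> i \<in> {0,1,2} \<Longrightarrow> Q i" for Q i
    using p_image by (metis imageE)
  have "\<exists>M. g = M * (\<Sum>m\<in>Poly_Mapping.keys g. Const (Poly_Mapping.lookup g m) *
      (\<Prod>i\<in>{0,1,2}. tri_mon n l i (\<alpha>' i) ^ (Poly_Mapping.lookup m (TVar i (c i)) * \<alpha>' i div l i (c i))))"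
  proof (rule homogeneous_factorization[OF c_range g(1,4)])
    show "i \<in> {0,1,2} \<Longrightarrow> i \<in> {0,1,2}" for i :: nat .
    show "i \<in> {0,1,2} \<Longrightarrow> \<exists>m\<in>Poly_Mapping.keys g. Poly_Mapping.lookup m (TVar i (c i)) = 0" for i
      by (rule ball[of "\<lambda>i. \<exists>m\<in>Poly_Mapping.keys g. Poly_Mapping.lookup m (TVar i (c i)) = 0"])
        (use bspec[OF g(5)] in \<open>simp_all only: xv_def\<close>)
    show "i \<in> {0,1,2} \<Longrightarrow> j \<in> {1..n i} \<Longrightarrow> \<alpha>' i dvd l i j" for i j
      using ball[of "\<lambda>i. \<forall>j\<in>{1..n i}. \<alpha>' i dvd l i j" i] \<alpha> ip by metis
    show "i \<in> {0,1,2} \<Longrightarrow> m \<in> Poly_Mapping.keys g \<Longrightarrow> l i (c i) dvd Poly_Mapping.lookup m (TVar i (c i)) * \<alpha>' i" for i m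
      using ball[of "\<lambda>i. \<forall>m\<in>Poly_Mapping.keys g. l i (c i) dvd Poly_Mapping.lookup m (TVar i (c i)) * \<alpha>' i" i]
        div ip unfolding ex_def xv_def by metis
  qed
  moreover have "(\<Prod>i\<in>{0,1,2}. F i) = F (p 0) * (F (p 1) * F (p 2))" for F :: "nat \<Rightarrow> 'k mpol"
  proof -
    have "(\<Prod>i\<in>{0,1,2}. F i) = (\<Prod>i\<in>{0,1,2}. F (p i))" by (subst prod.permute[OF perm]) (simp add: comp_def)
    then show ?thesis by simp
  qed
  ultimately have "\<exists>M. g = M * G" unfolding G_def k_def ex_def xv_def by (simp only: ip)
  then obtain M where "g = M * G" by blast
  then show "D G \<asymp> 0" "\<not> G \<asymp> 0" using ker_factor(2)[of M G] g(2,3) eqv_0_mult(2)[of G M] by blast+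
qed

text \<open>Over an algebraically closed field the form splits into \<open>N\<close> linear factors,
  and degrees add. The bound is stated for twice the degree because on the conic only the squares of
  the linear factors are estimated.\<close>

lemma deg_hf:
  assumes lin: "\<And>r. B \<le> 2 * deg (U - Const r * W)" "B \<le> 2 * deg W" and B: "B \<ge> 1"
  shows "q \<noteq> 0 \<Longrightarrow> degree q \<le> N \<Longrightarrow> \<not> hf N q U W \<asymp> 0 \<and> N * B \<le> 2 * deg (hf N q U W)"
proof (induction N arbitrary: q)
  case 0
  then obtain c where c: "q = [:c:]" by (metis degree_eq_zeroE le_zero_eq)
  then have "c \<noteq> 0" using 0 by auto
  then show ?case using Const_not_eqv_0[of c] by (simp add: hf_def c)
next
  case (Suc N)
  have nz: "\<not> f \<asymp> 0" if "B \<le> 2 * deg f" for f using that B deg_eqv_0[of f] by auto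
  have step: "\<not> f * g \<asymp> 0 \<and> Suc N * B \<le> 2 * deg (f * g)"
    if "B \<le> 2 * deg f" "\<not> g \<asymp> 0 \<and> N * B \<le> 2 * deg g" for f g
  proof -
    have "\<not> f \<asymp> 0" by (rule nz[OF that(1)])
    then have "deg (f * g) = deg f + deg g" "\<not> f * g \<asymp> 0" using that(2) by (simp_all add: deg_mult mult_eqv_0_iff)
    then show ?thesis using that by simp
  qed
  show ?case
  proof (cases "degree q \<le> N")
    case True
    show ?thesis unfolding hf_Suc[OF True] by (rule step[OF lin(2) Suc.IH[OF Suc.prems(1) True]])
  next
    case False
    then have dq: "degree q = Suc N" using Suc.prems(2) by simp
    then obtain r where "poly q r = 0" using alg_closed_imp_poly_has_root[of q] by auto
    then obtain q' where q': "q = [:- r, 1:] * q'" by (auto simp: poly_eq_0_iff_dvd elim: dvdE)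
    have q'0: "q' \<noteq> 0" using Suc.prems(1) q' by auto
    have "degree q = Suc (degree q')" unfolding q' using q'0 by (subst degree_mult_eq) auto
    then have dq': "degree q' \<le> N" using dq by simp
    have "q = pCons 0 q' + Polynomial.smult (- r) q'" unfolding q' by (simp add: algebra_simps)
    then have "hf (Suc N) q U W = U * hf N q' U W + Const (- r) * (W * hf N q' U W)"
      by (metis hf_add hf_smult hf_pCons_0 hf_Suc[OF dq'])
    also have "\<dots> = (U - Const r * W) * hf N q' U W" by (simp add: Const_minus algebra_simps)
    finally have "hf (Suc N) q U W = (U - Const r * W) * hf N q' U W" .
    then show ?thesis using step[OF lin(1) Suc.IH[OF q'0 dq']] by metis
  qed
qed

text \<open>Eliminating \<open>tm 2 1\<close> through the trinomial turns the kernel element into a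
  binary form of positive degree in \<open>U\<close> and \<open>W\<close>. If no linear factor were
  killed, each would have positive degree, and so would the form.\<close>

lemma linear_form_killed:
  assumes div: "\<And>i j. i \<in> {0,1} \<Longrightarrow> j \<in> {1..n (p i)} \<Longrightarrow> ex 0 dvd l (p i) j"
    and num: "ex 2 = 1 \<or> ex 0 = 2 \<and> ex 1 = 2 \<and> (\<exists>j\<in>{1..n (p 2)}. odd (l (p 2) j))"
    and nY: "\<not> D (tm 1 (ex 0)) \<asymp> 0"
  shows "\<exists>r. D (tm 0 (ex 0) - Const r * tm 1 (ex 0)) \<asymp> 0"
proof (rule ccontr)
  assume none: "\<not> ?thesis"
  define e where "e = ex 0"
  define U where "U = tm 0 e"
  define W where "W = tm 1 e"
  have e0: "e > 0" using ex_pos[OF in012(1)] by (simp add: e_def)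
  have div0: "e dvd l (p 0) j" if "j \<in> {1..n (p 0)}" for j using div[of 0 j] that by (simp add: e_def)
  have div1: "e dvd l (p 1) j" if "j \<in> {1..n (p 1)}" for j using div[of 1 j] that by (simp add: e_def)
  obtain g \<Gamma> where g: "g \<in> Car" "\<not> g \<asymp> 0" "D g \<asymp> 0" "homogeneous g" and \<Gamma>0: "\<Gamma> > 0" and \<Gamma>1:
    "\<forall>m\<in>Poly_Mapping.keys g. Poly_Mapping.lookup m (xv 0) * (ex 1 * ex 2) +
      Poly_Mapping.lookup m (xv 1) * (ex 0 * ex 2) + Poly_Mapping.lookup m (xv 2) * (ex 0 * ex 1) = \<Gamma>"
    and ref1: "\<forall>i\<in>{0,1,2}. \<exists>m\<in>Poly_Mapping.keys g. Poly_Mapping.lookup m (xv i) = 0"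
    by (rule kernel_monomials)
  note \<Gamma> = \<Gamma>0 bspec[OF \<Gamma>1] and ref = bspec[OF ref1]
  let ?L = "Poly_Mapping.lookup"
  \<comment> \<open>These divisibilities allow \<open>g\<close> to be written in powers of
    \<open>U\<close>, \<open>W\<close> and \<open>tm 2 1\<close>. They follow by comparing weights
    with a monomial of \<open>g\<close> that lacks the variable. With two exponents 2 the weights
    determine \<open>?L m (xv 2)\<close> only up to a factor 2, which an odd exponent in block 2
    removes.\<close>
  have d1: "ex 1 dvd ?L m (xv 1) * e" and d2: "ex 2 dvd ?L m (xv 2)" if m: "m \<in> Poly_Mapping.keys g" for m
  proof -
    obtain m1 where m1: "m1 \<in> Poly_Mapping.keys g" "?L m1 (xv 1) = 0" using ref[OF in012(2)] by blast
    obtain m2 where m2: "m2 \<in> Poly_Mapping.keys g" "?L m2 (xv 2) = 0" using ref[OF in012(3)] by blast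
    show "ex 2 dvd ?L m (xv 2)"
      using num
    proof (elim disjE conjE bexE)
      fix j assume ex: "ex 0 = 2" "ex 1 = 2" and j: "j \<in> {1..n (p 2)}" "odd (l (p 2) j)"
      have "2 * ex 2 * (?L m (xv 0) + ?L m (xv 1)) + 4 * ?L m (xv 2) = 2 * ex 2 * (?L m2 (xv 0) + ?L m2 (xv 1))"
        using \<Gamma>(2)[OF m] \<Gamma>(2)[OF m2(1)] m2(2) ex by (simp add: algebra_simps)
      then have "2 * ex 2 dvd 4 * ?L m (xv 2)" by (metis dvd_add_right_iff dvd_triv_left)
      then have "2 * ex 2 dvd 2 * (?L m (xv 2) * 2)" by (simp add: mult.commute)
      then have two: "ex 2 dvd 2 * ?L m (xv 2)" by (simp add: mult.commute)
      obtain q where q: "l (p 2) j = 2 * q + 1" using j(2) by (rule oddE)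
      have "?L m (TVar (p 2) j) * l (p 2) (c (p 2)) =
          ?L m (TVar (p 2) (c (p 2))) * l (p 2) j + ?L m2 (TVar (p 2) j) * l (p 2) (c (p 2))"
        by (rule homogeneous_ratio[OF g(4) m m2(1) p_in[OF in012(3)] c_in[OF in012(3)] j(1)])
          (use m2(2) in \<open>simp only: xv_def\<close>)
      then have "?L m (TVar (p 2) j) * ex 2 = ?L m (xv 2) * l (p 2) j + ?L m2 (TVar (p 2) j) * ex 2"
        by (simp only: xv_def ex_def)
      then have "ex 2 dvd ?L m (xv 2) * l (p 2) j" by (metis dvd_add_left_iff dvd_triv_right)
      then have "ex 2 dvd (2 * ?L m (xv 2)) * q + ?L m (xv 2)" unfolding q by (simp add: algebra_simps)
      then show ?thesis using two by (simp add: dvd_add_right_iff)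
    qed simp
    show "ex 1 dvd ?L m (xv 1) * e"
      using num
    proof (elim disjE conjE)
      assume ex2: "ex 2 = 1"
      have "ex 1 * (?L m (xv 0) + ?L m (xv 2) * ex 0) + ?L m (xv 1) * e = ex 1 * (?L m1 (xv 0) + ?L m1 (xv 2) * ex 0)"
        using \<Gamma>(2)[OF m] \<Gamma>(2)[OF m1(1)] m1(2) ex2 by (simp add: e_def algebra_simps)
      then show ?thesis by (metis dvd_add_right_iff dvd_triv_left)
    qed (simp add: e_def)
  qed
  define \<alpha> where "\<alpha> i = (if i = 2 then 1 else e)" for i :: nat
  have \<alpha>s: "\<alpha> 0 = e" "\<alpha> 1 = e" "\<alpha> 2 = 1" by (simp_all add: \<alpha>_def)
  define k where "k i m = ?L m (xv i) * \<alpha> i div ex i" for i m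
  define G where "G = (\<Sum>m\<in>Poly_Mapping.keys g. Const (?L g m) * (U ^ k 0 m * (W ^ k 1 m * tm 2 1 ^ k 2 m)))"
  have G: "D G \<asymp> 0" "\<not> G \<asymp> 0"
  proof -
    have \<alpha>d: "\<forall>i\<in>{0,1,2}. \<forall>j\<in>{1..n (p i)}. \<alpha> i dvd l (p i) j"
      using div0 div1 by (simp add: \<alpha>_def)
    have kd: "\<forall>i\<in>{0,1,2}. \<forall>m\<in>Poly_Mapping.keys g. ex i dvd ?L m (xv i) * \<alpha> i"
      using d1 d2 by (simp add: \<alpha>_def e_def)
    show "D G \<asymp> 0" "\<not> G \<asymp> 0"
      using kernel_form[OF g ref1 \<alpha>d kd] unfolding G_def k_def U_def W_def by (simp_all only: \<alpha>s simp_thms)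
  qed
  have Z: "tm 2 1 \<asymp> - (U ^ e + W ^ e)"
    using tm_2_eqv tm_power[of 0 e, OF div0] tm_power[of 1 e, OF div1] by (simp only: U_def W_def)
  define G' where "G' = (\<Sum>m\<in>Poly_Mapping.keys g. Const (?L g m) * (U ^ k 0 m * (W ^ k 1 m * (- (U ^ e + W ^ e)) ^ k 2 m)))"
  have GG': "G \<asymp> G'" unfolding G_def G'_def by (intro eqv_sum eqv_mult eqv_power eqv_refl Z)
  \<comment> \<open>The common \<open>wE\<close>-weight of \<open>U\<close> and \<open>W\<close>, so
    that \<open>\<Gamma>\<close> is \<open>C\<close> times the degree \<open>H\<close> of the binary
    form.\<close>
  define C where "C = (if ex 2 = 1 then ex 1 else 2 * ex 2)"
  have kH: "C * (k 0 m + (k 1 m + k 2 m * e)) = \<Gamma>" if m: "m \<in> Poly_Mapping.keys g" for m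
  proof -
    have k: "k 0 m * ex 0 = ?L m (xv 0) * e" "k 1 m * ex 1 = ?L m (xv 1) * e" "k 2 m * ex 2 = ?L m (xv 2)"
      unfolding k_def \<alpha>s using d1[OF m] d2[OF m] by (simp_all add: e_def)
    have k0: "k 0 m = ?L m (xv 0)" using k(1) e0 by (simp add: e_def)
    show ?thesis
      using num
    proof (elim disjE conjE)
      assume ex2: "ex 2 = 1"
      have "\<Gamma> = ?L m (xv 0) * ex 1 + ?L m (xv 1) * e + ?L m (xv 2) * (e * ex 1)"
        using \<Gamma>(2)[OF m] ex2 by (simp add: e_def)
      also have "\<dots> = k 0 m * ex 1 + k 1 m * ex 1 + k 2 m * (e * ex 1)" using k k0 ex2 by simp
      finally show ?thesis using ex2 by (simp add: C_def algebra_simps)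
    next
      assume ex: "ex 0 = 2" "ex 1 = 2" "\<exists>j\<in>{1..n (p 2)}. odd (l (p 2) j)"
      have k1: "k 1 m = ?L m (xv 1)" using k(2) ex by (simp add: e_def)
      have "\<Gamma> = k 0 m * (2 * ex 2) + k 1 m * (2 * ex 2) + (k 2 m * ex 2) * 4"
        using \<Gamma>(2)[OF m] ex k0 k1 k(3) by simp
      moreover have "C = 2 * ex 2" using ex by (simp add: C_def)
      ultimately show ?thesis using ex by (simp add: e_def algebra_simps)
    qed
  qed
  define H where "H = \<Gamma> div C"
  have C0: "C > 0" using ex_pos[OF in012(2)] ex_pos[OF in012(3)] by (simp add: C_def)
  have H: "k 0 m + (k 1 m + k 2 m * e) = H" if "m \<in> Poly_Mapping.keys g" for m
    unfolding H_def kH[OF that, symmetric] using C0 by simp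
  have "g \<noteq> 0" using g(2) by auto
  then obtain m0 where m0: "m0 \<in> Poly_Mapping.keys g" by (metis all_not_in_conv keys_eq_empty)
  have "C * H = \<Gamma>" using kH[OF m0] H[OF m0] by simp
  then have H0: "H > 0" using \<Gamma>(1) by (metis gr0I mult_0_right)
  have "bf U W H G'"
    unfolding G'_def
  proof (intro bf_sum bf_Const_mult)
    fix m assume m: "m \<in> Poly_Mapping.keys g"
    have pw: "bf U W j (U ^ j)" "bf U W j (W ^ j)" for j
      using bf_power[OF bf_variables(1)[of U W], of j] bf_power[OF bf_variables(2)[of U W], of j] by simp_all
    show "bf U W H (U ^ k 0 m * (W ^ k 1 m * (- (U ^ e + W ^ e)) ^ k 2 m))"
      unfolding H[OF m, symmetric] by (intro bf_mult bf_power bf_minus bf_add pw)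
  qed
  then obtain q where q: "degree q \<le> H" "G' = hf H q U W" using bf_hf by blast
  have "\<not> G' \<asymp> 0" using G(2) eqv_0_cong[OF GG'] by blast
  then have q0: "q \<noteq> 0" unfolding q(2) by (auto simp: hf_def)
  have lin: "2 \<le> 2 * deg (U - Const r * W)" for r
  proof -
    have "deg (U - Const r * W) \<noteq> 0" using none unfolding deg_eq_0_iff U_def W_def e_def by blast
    then show ?thesis by simp
  qed
  have linW: "2 \<le> 2 * deg W" using nY deg_eq_0_iff[of W] unfolding W_def e_def by simp
  have "H * 2 \<le> 2 * deg G'" using deg_hf[OF lin linW _ q0 q(1)] unfolding q(2) by simp
  moreover have "deg G' = 0" using deg_cong[OF GG'] G(1) deg_eq_0_iff[of G] by simp
  ultimately show False using H0 by simp
qed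

text \<open>The form is evaluated on the parametrization of the conic \<open>x\<^sup>2 + y\<^sup>2 + z\<^sup>2 = 0\<close> by \<open>(z : x + i y)\<close>; the squares of
  the linear factors are multiples of the tangents of the conic.\<close>

lemma tangent_killed:
  assumes ex: "ex 0 = 2" "ex 1 = 2" and even: "\<And>i j. i \<in> {0,1,2} \<Longrightarrow> j \<in> {1..n (p i)} \<Longrightarrow> 2 dvd l (p i) j"
  defines "A \<equiv> tm 0 2 + Const im * tm 1 2" and "B \<equiv> tm 0 2 - Const im * tm 1 2"
  shows "D A \<asymp> 0 \<or> (\<exists>r. D (Const (r ^ 2) * A - Const (2 * r) * tm 2 2 - B) \<asymp> 0)"
proof (rule ccontr)
  assume none: "\<not> ?thesis"
  define x where "x = tm 0 2"
  define w where "w = tm 1 2"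
  define z where "z = tm 2 2"
  have conic: "x ^ 2 + w ^ 2 + z ^ 2 \<asymp> 0"
    using P_eq tm_power[of 0 2, OF even[OF in012(1)]] tm_power[of 1 2, OF even[OF in012(2)]]
      tm_power[of 2 2, OF even[OF in012(3)]] unfolding x_def w_def z_def by (metis eqv_0 dvd_refl)
  have im2: "Const im * Const im = (-1 :: 'k mpol)"
  proof -
    have "Const im * Const im = Const (im * im)" by (simp only: Const_mult)
    also have "im * im = -1" using im by (simp only: power2_eq_square)
    finally show ?thesis by (simp only: Const_minus Const_1)
  qed
  have A: "A = x + Const im * w" and B: "B = x - Const im * w" unfolding A_def B_def x_def w_def by simp_all
  have AB: "A * B = x ^ 2 + w ^ 2"
  proof -
    have "A * B = x ^ 2 - (Const im * Const im) * w ^ 2" unfolding A B by (simp add: algebra_simps power2_eq_square)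
    then show ?thesis unfolding im2 by simp
  qed
  obtain g \<Gamma> where g: "g \<in> Car" "\<not> g \<asymp> 0" "D g \<asymp> 0" "homogeneous g" and \<Gamma>0: "\<Gamma> > 0" and \<Gamma>1:
    "\<forall>m\<in>Poly_Mapping.keys g. Poly_Mapping.lookup m (xv 0) * (ex 1 * ex 2) +
      Poly_Mapping.lookup m (xv 1) * (ex 0 * ex 2) + Poly_Mapping.lookup m (xv 2) * (ex 0 * ex 1) = \<Gamma>"
    and ref1: "\<forall>i\<in>{0,1,2}. \<exists>m\<in>Poly_Mapping.keys g. Poly_Mapping.lookup m (xv i) = 0"
    by (rule kernel_monomials)
  note \<Gamma> = \<Gamma>0 bspec[OF \<Gamma>1] and ref = bspec[OF ref1]
  let ?L = "Poly_Mapping.lookup"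
  have d2: "ex 2 dvd ?L m (xv 2) * 2" if m: "m \<in> Poly_Mapping.keys g" for m
  proof -
    obtain m2 where m2: "m2 \<in> Poly_Mapping.keys g" "?L m2 (xv 2) = 0" using ref[OF in012(3)] by blast
    have "2 * ex 2 * (?L m (xv 0) + ?L m (xv 1)) + 4 * ?L m (xv 2) = 2 * ex 2 * (?L m2 (xv 0) + ?L m2 (xv 1))"
      using \<Gamma>(2)[OF m] \<Gamma>(2)[OF m2(1)] m2(2) ex by (simp add: algebra_simps)
    then have "2 * ex 2 dvd 4 * ?L m (xv 2)" by (metis dvd_add_right_iff dvd_triv_left)
    then have "2 * ex 2 dvd 2 * (?L m (xv 2) * 2)" by (simp add: mult.commute)
    then have "ex 2 dvd 2 * ?L m (xv 2)" by (simp add: mult.commute)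
    then show ?thesis by (subst mult.commute)
  qed
  define k where "k i m = ?L m (xv i) * 2 div ex i" for i m
  define G where "G = (\<Sum>m\<in>Poly_Mapping.keys g. Const (?L g m) * (x ^ k 0 m * (w ^ k 1 m * z ^ k 2 m)))"
  have kd: "\<forall>i\<in>{0,1,2}. \<forall>m\<in>Poly_Mapping.keys g. ex i dvd ?L m (xv i) * 2"
    using d2 ex by simp
  have \<alpha>d: "\<forall>i\<in>{0,1,2}. \<forall>j\<in>{1..n (p i)}. 2 dvd l (p i) j" using even by blast
  have G: "D G \<asymp> 0" "\<not> G \<asymp> 0"
    using kernel_form[of g "\<lambda>_. 2", OF g ref1 \<alpha>d kd] unfolding G_def k_def x_def w_def z_def by (simp_all only: simp_thms)
  have kH: "2 * ex 2 * (k 0 m + (k 1 m + k 2 m)) = \<Gamma>" if m: "m \<in> Poly_Mapping.keys g" for m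
  proof -
    have "k 2 m * ex 2 = ?L m (xv 2) * 2" unfolding k_def using d2[OF m] by simp
    moreover have "k 0 m = ?L m (xv 0)" "k 1 m = ?L m (xv 1)" unfolding k_def ex by simp_all
    ultimately show ?thesis using \<Gamma>(2)[OF m] ex by (simp add: algebra_simps)
  qed
  define H where "H = \<Gamma> div (2 * ex 2)"
  have H: "k 0 m + (k 1 m + k 2 m) = H" if "m \<in> Poly_Mapping.keys g" for m
    unfolding H_def kH[OF that, symmetric] using ex_pos[OF in012(3)] by simp
  have "g \<noteq> 0" using g(2) by auto
  then obtain m0 where m0: "m0 \<in> Poly_Mapping.keys g" by (metis all_not_in_conv keys_eq_empty)
  have "2 * ex 2 * H = \<Gamma>" using kH[OF m0] H[OF m0] by simp
  then have H0: "H > 0" using \<Gamma>(1) by (metis gr0I mult_0_right)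
  have half: "Const (1/2) * 2 = (1 :: 'k mpol)" 
  proof -
    have "Const (2 :: 'k) = 2" by (rule Const_numeral)
    then show ?thesis using Const_mult[of "1/2" "2 :: 'k"] by simp
  qed
  \<comment> \<open>On the conic \<open>A B = - z^2\<close>. Writing \<open>x\<close> and
    \<open>w\<close> through \<open>A\<close> and \<open>B\<close> and multiplying by
    \<open>A\<close> gives these two quadratic forms in \<open>z\<close> and
    \<open>A\<close>.\<close>
  define fx where "fx = Const (1/2) * (A ^ 2 - z ^ 2)"
  define fw where "fw = Const (- im / 2) * (A ^ 2 + z ^ 2)"
  have Cim: "Const (- im / 2) = - (Const (1/2) * Const im)" by (simp flip: Const_mult Const_minus)
  have "A * x - fx = Const (1/2) * (x ^ 2 + w ^ 2 + z ^ 2 - 0)"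
  proof -
    have "A * x - fx = (Const (1/2) * 2) * (A * x) - Const (1/2) * (A ^ 2 - z ^ 2)" unfolding half fx_def by simp
    also have "\<dots> = Const (1/2) * (A * B + z ^ 2)" unfolding A B by (simp add: algebra_simps power2_eq_square)
    finally show ?thesis unfolding AB by simp
  qed
  then have Ax: "A * x \<asymp> fx" by (rule eqvI1[OF _ conic])
  have "A * w - fw = (Const (1/2) * Const im) * (x ^ 2 + w ^ 2 + z ^ 2 - 0)"
  proof -
    have "A * w = (Const (1/2) * 2) * (- (Const im * Const im)) * (A * w)" unfolding half im2 by simp
    also have "\<dots> = - (Const (1/2) * Const im) * (A * (2 * Const im * w))" by (simp add: algebra_simps)
    also have "2 * Const im * w = A - B" unfolding A B by simp
    finally have "A * w - fw = Const (1/2) * Const im * (A * B + z ^ 2)"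
      unfolding fw_def Cim by (simp add: algebra_simps power2_eq_square)
    then show ?thesis unfolding AB by simp
  qed
  then have Aw: "A * w \<asymp> fw" by (rule eqvI1[OF _ conic])
  define F where "F = (\<Sum>m\<in>Poly_Mapping.keys g. Const (?L g m) * (fx ^ k 0 m * (fw ^ k 1 m * (A * z) ^ k 2 m)))"
  have "A ^ H * G = (\<Sum>m\<in>Poly_Mapping.keys g. Const (?L g m) * ((A * x) ^ k 0 m * ((A * w) ^ k 1 m * (A * z) ^ k 2 m)))"
    unfolding G_def sum_distrib_left
  proof (intro sum.cong refl)
    fix m assume m: "m \<in> Poly_Mapping.keys g"
    show "A ^ H * (Const (?L g m) * (x ^ k 0 m * (w ^ k 1 m * z ^ k 2 m))) =
        Const (?L g m) * ((A * x) ^ k 0 m * ((A * w) ^ k 1 m * (A * z) ^ k 2 m))"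
      unfolding H[OF m, symmetric] power_add power_mult_distrib by (simp add: mult_ac)
  qed
  also have "\<dots> \<asymp> F" unfolding F_def by (intro eqv_sum eqv_mult eqv_power eqv_refl Ax Aw)
  finally have AF: "A ^ H * G \<asymp> F" .
  have "bf z A (H * 2) F"
    unfolding F_def
  proof (intro bf_sum bf_Const_mult)
    fix m assume m: "m \<in> Poly_Mapping.keys g"
    have sq: "bf z A 2 (z ^ 2)" "bf z A 2 (A ^ 2)" "bf z A 2 (A * z)"
      using bf_power[OF bf_variables(1)[of z A], of 2] bf_power[OF bf_variables(2)[of z A], of 2]
        bf_mult[OF bf_variables(2)[of z A] bf_variables(1)[of z A]] by (simp_all add: numeral_2_eq_2)
    have fs: "bf z A 2 fx" "bf z A 2 fw"
      unfolding fx_def fw_def diff_conv_add_uminus by (intro bf_Const_mult bf_add bf_minus sq)+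
    show "bf z A (H * 2) (fx ^ k 0 m * (fw ^ k 1 m * (A * z) ^ k 2 m))"
      unfolding H[OF m, symmetric] distrib_right by (intro bf_mult bf_power sq fs)
  qed
  then obtain q where q: "degree q \<le> H * 2" "F = hf (H * 2) q z A" using bf_hf by blast
  have DA: "deg A \<noteq> 0" using none deg_eq_0_iff[of A] by blast
  then have A0: "\<not> A \<asymp> 0" using deg_eqv_0[of A] by auto
  then have AG0: "\<not> A ^ H * G \<asymp> 0" using G(2) power_eqv_0[of A H] by (auto simp: mult_eqv_0_iff)
  then have "\<not> F \<asymp> 0" using eqv_0_cong[OF AF] by blast
  then have q0: "q \<noteq> 0" unfolding q(2) by (auto simp: hf_def)
  \<comment> \<open>On the conic the square of \<open>z - r A\<close> is \<open>A\<close> times a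
    tangent. The tangent is not killed by assumption, so it has degree at least 1.\<close>
  have lin: "deg A + 1 \<le> 2 * deg (z - Const r * A)" for r
  proof -
    let ?l = "Const (r ^ 2) * A - Const (2 * r) * z - B"
    have l: "deg ?l \<noteq> 0" using none unfolding deg_eq_0_iff z_def by blast
    then have l0: "\<not> ?l \<asymp> 0" using deg_eqv_0[of ?l] by auto
    have "(z - Const r * A) ^ 2 - A * ?l = A * B + z ^ 2"
      by (simp add: algebra_simps power2_eq_square Const_mult Const_numeral)
    then have "(z - Const r * A) ^ 2 - A * ?l = 1 * (x ^ 2 + w ^ 2 + z ^ 2 - 0)" unfolding AB by simp
    then have sq: "(z - Const r * A) ^ 2 \<asymp> A * ?l" by (rule eqvI1[OF _ conic])
    have "\<not> A * ?l \<asymp> 0" using A0 l0 by (simp add: mult_eqv_0_iff)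
    then have "\<not> (z - Const r * A) \<asymp> 0" using eqv_0_cong[OF sq] by (auto simp: power2_eq_square mult_eqv_0_iff)
    then have "2 * deg (z - Const r * A) = deg A + deg ?l"
      using deg_cong[OF sq] deg_mult[OF A0 l0] deg_power[of "z - Const r * A" 2] by simp
    then show ?thesis using l by simp
  qed
  \<comment> \<open>The \<open>2 H\<close> linear factors force \<open>deg F\<close> to be at least
    \<open>H (deg A + 1)\<close>, but \<open>F\<close> is \<open>A^H\<close> times a kernel element
    and has degree \<open>H deg A\<close>.\<close>
  have "H * 2 * (deg A + 1) \<le> 2 * deg F"
    using deg_hf[OF lin _ _ q0 q(1)] DA unfolding q(2) by simp
  moreover have "deg F = H * deg A"
    using deg_cong[OF AF] deg_mult[of "A ^ H" G] deg_power[OF A0, of H] AG0 G(1) by (simp add: mult_eqv_0_iff deg_eq_0_iff)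
  ultimately show False using H0 by simp
qed

end

section \<open>Recognizing the derivation from a killed linear form\<close>

lemma psubst_const_poly: "psubst (\<lambda>c. [:c:]) (\<lambda>v. [:t v:]) f = [:eval_at t f:]"
  for f :: "'k::comm_ring_1 mpol"
  by (induction f rule: mpol_induct)
    (simp_all add: eval_at_psubst id_hom.psubst_simps poly_const_hom.psubst_simps)

context hl
begin

definition pev :: "(tvar \<Rightarrow> 'k) \<Rightarrow> 'k poly \<Rightarrow> 'k poly \<Rightarrow> 'k poly \<Rightarrow> 'k mpol \<Rightarrow> 'k poly" where
  "pev t x1 x2 x3 = psubst (\<lambda>c. [:c:]) ((\<lambda>v. [:t v:])(xv 0 := x1, xv 1 := x2, xv 2 := x3))"

lemma pev_simps: "pev t x1 x2 x3 (f + g) = pev t x1 x2 x3 f + pev t x1 x2 x3 g"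
  "pev t x1 x2 x3 (f * g) = pev t x1 x2 x3 f * pev t x1 x2 x3 g"
  "pev t x1 x2 x3 (f - g) = pev t x1 x2 x3 f - pev t x1 x2 x3 g"
  "pev t x1 x2 x3 (- f) = - pev t x1 x2 x3 f"
  "pev t x1 x2 x3 (f ^ k) = pev t x1 x2 x3 f ^ k"
  "pev t x1 x2 x3 (Const b) = [:b:]"
  "pev t x1 x2 x3 (X 0) = x1" "pev t x1 x2 x3 (X 1) = x2" "pev t x1 x2 x3 (X 2) = x3"
  by (simp_all add: pev_def poly_const_hom.psubst_simps poly_const_hom.psubst_power poly_const_hom.psubst_diff
      poly_const_hom.psubst_minus)

lemma pev_of_nat: "pev t x1 x2 x3 (of_nat k) = of_nat k"
  using pev_simps(6)[of t x1 x2 x3 "of_nat k"] by (simp only: Const_of_nat of_nat_poly)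

lemma pev_frozen: "pvars f \<subseteq> Frozen \<Longrightarrow> pev t x1 x2 x3 f = [:eval_at t f:]"
proof -
  assume f: "pvars f \<subseteq> Frozen"
  have "pev t x1 x2 x3 f = psubst (\<lambda>c. [:c:]) (\<lambda>v. [:t v:]) f"
    unfolding pev_def by (rule psubst_cong) (use f in \<open>auto simp: Frozen_def\<close>)
  then show ?thesis by (simp only: psubst_const_poly)
qed

lemma pev_fr: "i \<in> {0,1,2} \<Longrightarrow> pev t x1 x2 x3 (fr i \<alpha>) = [:eval_at t (fr i \<alpha>):]"
  by (rule pev_frozen[OF fr_vars_Frozen])

lemma pev_tm: "pev t x1 x2 x3 (tm 0 \<alpha>) = [:eval_at t (fr 0 \<alpha>):] * x1 ^ (ex 0 div \<alpha>)"
  "pev t x1 x2 x3 (tm 1 \<alpha>) = [:eval_at t (fr 1 \<alpha>):] * x2 ^ (ex 1 div \<alpha>)"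
  "pev t x1 x2 x3 (tm 2 \<alpha>) = [:eval_at t (fr 2 \<alpha>):] * x3 ^ (ex 2 div \<alpha>)"
  by (simp_all only: tm_eq[OF in012(1)] tm_eq[OF in012(2)] tm_eq[OF in012(3)] pev_simps pev_fr in012)

lemma pev_P: "pev t x1 x2 x3 P = [:eval_at t (fr 0 1):] * x1 ^ ex 0 + [:eval_at t (fr 1 1):] * x2 ^ ex 1 + [:eval_at t (fr 2 1):] * x3 ^ ex 2"
  unfolding P_eq pev_simps pev_tm by (simp only: div_by_1)

text \<open>Along the curve \<open>q\<close> vanishes, while \<open>P\<close> vanishes to a higher
  order at 0 than \<open>b\<close>. Cancelling the common factor \<open>N\<close> and setting the
  parameter to 0 gives \<open>g = 0\<close> at \<open>t\<close>. A curve instead of a point is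
  needed because \<open>b\<close> itself may vanish at the point.\<close>

lemma zero_if_curves:
  assumes g: "pvars g \<subseteq> Frozen" "g * b \<asymp> q * k"
    and curve: "\<And>t. \<forall>v. t v \<noteq> 0 \<Longrightarrow> \<exists>x1 x2 x3 N c c'. N \<noteq> 0 \<and> pev t x1 x2 x3 q = 0 \<and>
      pev t x1 x2 x3 P = N * pCons 0 c \<and> pev t x1 x2 x3 b = N * c' \<and> poly c' 0 \<noteq> 0"
  shows "g = 0"
proof (rule ccontr)
  assume "g \<noteq> 0"
  then obtain t where t: "\<forall>v. t v \<noteq> 0" "eval_at t g \<noteq> 0" using exists_nonzero_point by blast
  obtain x1 x2 x3 N c c' where N: "N \<noteq> 0" "pev t x1 x2 x3 q = 0" "pev t x1 x2 x3 P = N * pCons 0 c"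
    "pev t x1 x2 x3 b = N * c'" "poly c' 0 \<noteq> 0" using curve[OF t(1)] by blast
  obtain r where "g * b - q * k = P * r" using g(2) unfolding eqv_def by (rule dvdE)
  then have "pev t x1 x2 x3 (g * b - q * k) = pev t x1 x2 x3 (P * r)" by (rule arg_cong)
  then have "N * ([:eval_at t g:] * c') = N * (pCons 0 c * pev t x1 x2 x3 r)"
    unfolding pev_simps pev_frozen[OF g(1)] N by (simp add: mult_ac)
  then have "[:eval_at t g:] * c' = pCons 0 c * pev t x1 x2 x3 r" unfolding mult_left_cancel[OF N(1)] .
  then have "poly ([:eval_at t g:] * c') 0 = poly (pCons 0 c * pev t x1 x2 x3 r) 0" by (rule arg_cong)
  then show False using t(2) N(5) by simp
qed

lemma D_avec_relation:
  assumes "tri_der n l d im (avec f0 f1 f2)"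
  shows "dm 0 1 * f0 + dm 1 1 * f1 + dm 2 1 * f2 \<asymp> 0"
proof -
  interpret A: tri_der n l d im "avec f0 f1 f2" by fact
  have fz: "poly_der n d (avec f0 f1 f2) (Var v) = 0" if "v \<in> Frozen" for v
    by (rule poly_der_avec_Var(4)[OF that])
  have "poly_der n d (avec f0 f1 f2) (tm 0 1 + tm 1 1 + tm 2 1) \<asymp> 0"
    unfolding eqv_0 using A.P_dvd_der_P by (simp only: P_eq[symmetric])
  then show ?thesis
    by (simp only: poly_der.D_add poly_der_tm[OF fz in012(1)] poly_der_tm[OF fz in012(2)] poly_der_tm[OF fz in012(3)] poly_der_avec_Var)
qed

end

context hl3
begin

text \<open>Two derivations with a common non-frozen kernel element are proportional.  The proportionality factor \<open>h\<close>
  lies in the kernel, hence is a polynomial in \<open>q\<close>, and its constant term vanishes.\<close>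

lemma multiple_if_proportional:
  fixes f0 f1 f2 :: "'k mpol"
  defines "a' \<equiv> avec f0 f1 f2"
  assumes der: "tri_der n l d im a'" and q: "q \<in> Car" "D q \<asymp> 0" and h: "h \<in> Car" "\<not> h \<asymp> 0" and K: "K \<noteq> 0"
    and rel0: "Const K * (q * y 0) \<asymp> h * f0" and rel1: "Const K * (q * y 1) \<asymp> h * f1"
    and kp: "ker_param a' s q" and s: "s \<notin> Frozen"
    and w: "w \<in> V" and indep: "\<And>g k. pvars g \<subseteq> Frozen \<Longrightarrow> g * a' w \<asymp> q * k \<Longrightarrow> g = 0"
  shows "\<exists>h. \<forall>v\<in>V. a v \<asymp> h * a' v"
proof -
  interpret A: tri_der n l d im a' by fact
  let ?D' = "poly_der n d a'"
  have dm2: "\<not> dm 2 1 \<asymp> 0"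
    unfolding dm_1[OF in012(3)] mult.assoc using block_not_eqv_0[of 2 1] of_nat_nz[of "ex 2"] ex_pos[of 2]
    by (simp add: mult_eqv_0_iff)
  \<comment> \<open>Both derivations annihilate \<open>P\<close> modulo the ideal, so the
    proportionality on two variables determines it on the third.\<close>
  have "dm 2 1 * (Const K * (q * y 2)) - dm 2 1 * (h * f2) =
      (Const K * q) * (dm 0 1 * y 0 + dm 1 1 * y 1 + dm 2 1 * y 2 - 0) +
      (- h) * (dm 0 1 * f0 + dm 1 1 * f1 + dm 2 1 * f2 - 0) +
      (-1) * (dm 0 1 * (Const K * (q * y 0)) + dm 1 1 * (Const K * (q * y 1)) - (dm 0 1 * (h * f0) + dm 1 1 * (h * f1)))"
    by (simp add: algebra_simps)
  then have "dm 2 1 * (Const K * (q * y 2)) \<asymp> dm 2 1 * (h * f2)"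
    by (rule eqvI3[OF _ D_P_relation D_avec_relation[OF der[unfolded a'_def]]])
      (intro eqv_add eqv_mult eqv_refl rel0 rel1)
  then have rel2: "Const K * (q * y 2) \<asymp> h * f2" using eqv_mult_cancel_left[OF dm2] by blast
  have rel: "Const K * (q * a v) \<asymp> h * a' v" if vV: "v \<in> V" for v
  proof -
    consider "v = xv 0" | "v = xv 1" | "v = xv 2" | "v \<in> Frozen" using vV unfolding Frozen_def by blast
    then show ?thesis
      by cases (use rel0 rel1 rel2 in \<open>simp_all add: a'_def frozen_zero\<close>)
  qed
  have der_rel: "Const K * (q * D f) \<asymp> h * ?D' f" for f
  proof -
    have "(\<Sum>v\<in>V. (Const K * (q * a v)) * pdiff v f) \<asymp> (\<Sum>v\<in>V. (h * a' v) * pdiff v f)"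
      by (intro eqv_sum eqv_mult rel eqv_refl)
    then show ?thesis by (simp add: poly_der_def sum_distrib_left mult.assoc)
  qed
  have a'w: "\<not> a' w \<asymp> 0"
  proof
    assume "a' w \<asymp> 0"
    then have "1 * a' w \<asymp> q * 0" by simp
    then show False using indep[of 1 0] by simp
  qed
  have q0: "\<not> q \<asymp> 0"
  proof
    assume "q \<asymp> 0"
    then have "Const K * (q * a w) \<asymp> 0" by (simp add: mult_eqv_0_iff)
    then have "h * a' w \<asymp> 0" using eqv_0_cong[OF rel[OF w]] by blast
    then show False using h(2) a'w by (simp add: mult_eqv_0_iff)
  qed
  have K0: "\<not> Const K \<asymp> 0" by (rule Const_not_eqv_0[OF K])
  \<comment> \<open>For a local slice \<open>r\<close> the element \<open>h (D' r)\<close> is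
    congruent to a nonzero kernel element, so its factor \<open>h\<close> is killed as well.\<close>
  obtain r where r: "\<not> D r \<asymp> 0" "D (D r) \<asymp> 0" by (rule exists_slice[OF not_D_X[OF in012(1)]])
  have "D (Const K * (q * D r)) \<asymp> 0"
    by (intro ker_mult q(2) r(2)) simp
  then have 1: "D (h * ?D' r) \<asymp> 0" using eqv_0_cong[OF D_cong[OF der_rel]] by blast
  have "\<not> Const K * (q * D r) \<asymp> 0" using K0 q0 r(1) by (simp add: mult_eqv_0_iff)
  then have 2: "\<not> h * ?D' r \<asymp> 0" using eqv_0_cong[OF der_rel] by blast
  have Dh: "D h \<asymp> 0" by (rule ker_factor(1)[OF 1 2])
  then have "Const K * (q * D h) \<asymp> 0" by (simp add: mult_eqv_0_iff)
  then have "h * ?D' h \<asymp> 0" using eqv_0_cong[OF der_rel] by blast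
  then have "?D' h \<asymp> 0" using h(2) by (simp add: mult_eqv_0_iff)
  then obtain g where g: "pvars g \<subseteq> insert s Frozen" "h \<asymp> psubst Const (Var(s := q)) g"
    using kp h(1) unfolding ker_param_def by blast
  \<comment> \<open>The part of \<open>h\<close> that is constant in \<open>q\<close>; independence
    shows that it vanishes, so that \<open>q\<close> can be cancelled.\<close>
  define g0 where "g0 = psubst Const (Var(s := 0)) g"
  have g0F: "pvars g0 \<subseteq> Frozen"
    unfolding g0_def by (rule pvars_psubst) (use g(1) in auto)
  have "q dvd psubst Const (Var(s := q)) g - psubst Const (Var(s := 0)) g"
    by (rule dvd_psubst_diff) auto
  then obtain h1 where "psubst Const (Var(s := q)) g - g0 = q * h1" unfolding g0_def by (rule dvdE)
  then have h1: "h \<asymp> g0 + q * h1" using g(2) by (simp add: algebra_simps)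
  have "g0 * a' w \<asymp> q * (Const K * a w - h1 * a' w)"
    by (rule eqvI2[OF _ rel[OF w] h1, of _ _ "-1" "- a' w"]) (simp add: algebra_simps)
  then have "g0 = 0" by (rule indep[OF g0F])
  then have hq: "h \<asymp> q * h1" using h1 by simp
  have "a v \<asymp> (Const (1 / K) * h1) * a' v" if "v \<in> V" for v
  proof -
    have "q * (Const K * a v) \<asymp> q * (h1 * a' v)"
      by (rule eqvI2[OF _ rel[OF that] hq, of _ _ 1 "a' v"]) (simp add: algebra_simps)
    then have "Const K * a v \<asymp> h1 * a' v" using eqv_mult_cancel_left[OF q0] by blast
    then show ?thesis using eqv_Const_divide[OF _ K] by (simp add: mult.assoc)
  qed
  then show ?thesis by blast
qed

lemma dm_not_eqv_0:
  assumes "i \<in> {0,1,2}" "\<alpha> \<ge> 1" "\<alpha> \<le> ex i"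
  shows "\<not> dm i \<alpha> \<asymp> 0"
proof -
  have "ex i div \<alpha> > 0" using assms by (simp add: div_greater_zero_iff)
  then show ?thesis
    unfolding dmon_eq[OF assms(1)] mult.assoc using of_nat_nz[of "ex i div \<alpha>"] block_not_eqv_0 by (simp add: mult_eqv_0_iff)
qed

lemma tm_not_killed:
  assumes "i \<in> {0,1,2}" "\<alpha> \<ge> 1" "\<alpha> \<le> ex i"
  shows "\<not> D (tm i \<alpha>) \<asymp> 0"
  using dm_not_eqv_0[OF assms] not_D_X[OF assms(1)] D_tm[OF assms(1)] D_X[OF assms(1)] by (simp add: mult_eqv_0_iff)

text \<open>A linear form \<open>U - r W\<close> is killed, and \<open>r\<close> is nonzero as
  \<open>U\<close> is moved. Rescaling by \<open>lam = 1 / r\<close> gives \<open>q_b\<close>, after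
  which the values on the selected variables follow by linear algebra.\<close>

lemma case_b:
  assumes ex2: "ex 2 = 1" and div: "\<And>i j. i \<in> {0,1} \<Longrightarrow> j \<in> {1..n (p i)} \<Longrightarrow> ex 0 dvd l (p i) j"
  shows "\<exists>lam. lam \<noteq> 0 \<and> (\<exists>h. \<forall>v\<in>V. a v \<asymp> h * avec_b lam v)"
proof -
  define e where "e = ex 0"
  have e1: "e \<ge> 1" using ex_pos[OF in012(1)] by (simp add: e_def)
  have "e dvd ex 1" using div[of 1 "c (p 1)"] c_in[OF in012(2)] by (simp add: e_def ex_def)
  then obtain F where F: "ex 1 = e * F" by (rule dvdE)
  have F0: "F \<ge> 1" using F ex_pos[OF in012(2)] by (cases F) auto
  have le: "e \<le> ex 1" using F F0 by simp
  have dF: "ex 1 div e = F" using F e1 by simp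
  have nU: "\<not> D (tm 0 e) \<asymp> 0" by (rule tm_not_killed[OF in012(1) e1]) (simp add: e_def)
  have nW: "\<not> D (tm 1 e) \<asymp> 0" by (rule tm_not_killed[OF in012(2) e1 le])
  obtain r where r: "D (tm 0 e - Const r * tm 1 e) \<asymp> 0"
    using linear_form_killed[OF div] ex2 nW unfolding e_def by blast
  have r0: "r \<noteq> 0" using r nU by auto
  define lam where "lam = 1 / r"
  have lam0: "lam \<noteq> 0" using r0 by (simp add: lam_def)
  have "q_b lam = Const lam * (tm 0 e - Const r * tm 1 e)"
  proof -
    have "Const lam * Const r = (1 :: 'k mpol)" using r0 by (simp add: lam_def flip: Const_mult)
    then have "Const lam * (Const r * tm 1 e) = tm 1 e" by (simp flip: mult.assoc)
    then show ?thesis unfolding q_b_def e_def by (simp add: right_diff_distrib)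
  qed
  then have q: "D (q_b lam) \<asymp> 0" using r by (simp add: D_Const_mult mult_eqv_0_iff)
  \<comment> \<open>In the excluded case \<open>q_b\<close> is congruent to \<open>tm 2 1\<close>,
    but \<open>X 2\<close> is moved.\<close>
  have excl: "\<not> (ex 0 = 1 \<and> lam = -1 \<and> n (p 2) \<ge> 2)"
  proof
    assume A: "ex 0 = 1 \<and> lam = -1 \<and> n (p 2) \<ge> 2"
    then have "q_b lam = - (tm 0 1 + tm 1 1)" unfolding q_b_def by (simp add: Const_minus)
    then have "tm 2 1 \<asymp> q_b lam" using tm_2_eqv by simp
    then have "D (tm 2 1) \<asymp> 0" using eqv_0_cong[OF D_cong] q by blast
    then show False using tm_not_killed[OF in012(3), of 1] ex2 by simp
  qed
  obtain h where h: "h \<in> Car"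
    "of_nat (ex 1) * X 0 * y 1 - of_nat (ex 0) * X 1 * y 0 \<asymp> fr 2 1 * X 2 ^ (ex 2 - 1) * h"
    by (rule relations)
  have h0: "\<not> h \<asymp> 0" by (rule relation_factor_nonzero[OF h(2) not_killed[OF in012(1)]])
  define u where "u = fr 0 e"
  define g where "g = fr 1 e * X 1 ^ (F - 1)"
  define w where "w = fr 2 1"
  define N0 where "N0 = (of_nat e :: 'k mpol)"
  define NF where "NF = (of_nat F :: 'k mpol)"
  have dm0: "dm 0 e = u" and tm0: "tm 0 e = u * X 0"
    unfolding u_def by (rule dm_eq_fr[OF in012(1)] tm_eq_linear[OF in012(1)], simp add: e_def)+
  have dm1: "dm 1 e = NF * g" unfolding dmon_eq[OF in012(2)] dF NF_def g_def by (simp only: mult.assoc)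
  have tm1: "tm 1 e = g * X 1"
    unfolding tm_eq[OF in012(2)] dF g_def mult.assoc using power_minus_mult[of F "X 1"] F0 by simp
  have dm2: "dm 2 1 = w" unfolding w_def by (rule dm_eq_fr[OF in012(3) ex2])
  have S: "Const lam * u * y 0 - NF * g * y 1 \<asymp> 0"
    using q unfolding q_b_def e_def[symmetric] poly_der.D_diff D_Const_mult D_tm[OF in012(1)] D_tm[OF in012(2)] dm0 dm1
    by (simp only: mult.assoc)
  have R: "NF * N0 * X 0 * y 1 - N0 * X 1 * y 0 \<asymp> w * h"
    using h(2) unfolding F ex2 w_def N0_def NF_def e_def[symmetric] by (simp add: mult_ac)
  have qe: "q_b lam = Const lam * u * X 0 - g * X 1" unfolding q_b_def e_def[symmetric] tm0 tm1 by (simp add: mult.assoc)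
  have K: "Const (of_nat (ex 1)) = NF * N0" unfolding F N0_def NF_def Const_of_nat by simp
  have K0: "(of_nat (ex 1) :: 'k) \<noteq> 0" using ex_pos[OF in012(2)] by simp
  \<comment> \<open>Cramer's rule for the system \<open>S\<close>, \<open>R\<close> in the unknowns
    \<open>y 0\<close> and \<open>y 1\<close>, whose determinant is \<open>ex 1\<close> times
    \<open>q_b\<close>.\<close>
  have rel0: "Const (of_nat (ex 1)) * (q_b lam * y 0) \<asymp> h * (dm 1 (ex 0) * dm 2 1)"
    unfolding K qe e_def[symmetric] dm1 dm2
    by (rule eqvI2[OF _ S R, of _ _ "NF * N0 * X 0" "NF * g"]) (simp add: algebra_simps)
  have rel1: "Const (of_nat (ex 1)) * (q_b lam * y 1) \<asymp> h * (Const lam * dm 0 (ex 0) * dm 2 1)"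
    unfolding K qe e_def[symmetric] dm0 dm2
    by (rule eqvI2[OF _ S R, of _ _ "N0 * X 1" "Const lam * u"]) (simp add: algebra_simps)
  have "\<exists>h. \<forall>v\<in>V. a v \<asymp> h * avec_b lam v"
    unfolding avec_b_def
  proof (rule multiple_if_proportional[OF _ q_b_Car[of lam] q h(1) h0 K0 rel0 rel1])
    show "tri_der n l d im (avec (dm 1 (ex 0) * dm 2 1) (Const lam * dm 0 (ex 0) * dm 2 1)
        (- (dm 0 1 * dm 1 (ex 0) + Const lam * dm 0 (ex 0) * dm 1 1)))"
      using chart_der_b[of lam] unfolding avec_b_def chart_der_def by blast
    show "ker_param (avec (dm 1 (ex 0) * dm 2 1) (Const lam * dm 0 (ex 0) * dm 2 1)
        (- (dm 0 1 * dm 1 (ex 0) + Const lam * dm 0 (ex 0) * dm 1 1))) (xv 0) (q_b lam)"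
      using ker_param_b[OF ex2 div lam0 excl] unfolding avec_b_def by blast
    show "xv 0 \<notin> Frozen" by simp
    show "xv 1 \<in> V" by (rule xv_in_V[OF in012(2)])
    fix g0 k
    assume g0: "pvars g0 \<subseteq> Frozen" "g0 * avec (dm 1 (ex 0) * dm 2 1) (Const lam * dm 0 (ex 0) * dm 2 1)
        (- (dm 0 1 * dm 1 (ex 0) + Const lam * dm 0 (ex 0) * dm 1 1)) (xv 1) \<asymp> q_b lam * k"
    show "g0 = 0"
    proof (rule zero_if_curves[OF g0])
      fix t :: "tvar \<Rightarrow> 'k" assume t: "\<forall>v. t v \<noteq> 0"
      have fr: "eval_at t (fr i \<alpha>) \<noteq> 0" if "i \<in> {0,1,2}" for i \<alpha> by (rule fr_eval_nonzero[OF spec[OF t] that])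
      have z: "(0 :: 'k poly) ^ ex 0 = 0" "(0 :: 'k poly) ^ ex 1 = 0" "(0 :: 'k poly) ^ ex 2 = 0"
        using ex_pos[OF in012(1)] ex_pos[OF in012(2)] ex_pos[OF in012(3)] by (simp_all add: zero_power)
      \<comment> \<open>The constant curve suffices: the value of the type (b) derivation on
        \<open>X 1\<close> is a frozen monomial and does not vanish.\<close>
      have "pev t 0 0 0 (q_b lam) = 0" unfolding qe pev_simps by simp
      moreover have "pev t 0 0 0 P = 1 * pCons 0 0" unfolding pev_P z by simp
      moreover have "pev t 0 0 0 (Const lam * u * w) = 1 * [:lam * eval_at t (fr 0 e) * eval_at t (fr 2 1):]"
        unfolding u_def w_def pev_simps pev_fr[OF in012(1)] pev_fr[OF in012(3)] by simp
      moreover have "poly [:lam * eval_at t (fr 0 e) * eval_at t (fr 2 1):] 0 \<noteq> 0"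
        using lam0 fr[OF in012(1)] fr[OF in012(3)] by simp
      ultimately show "\<exists>x1 x2 x3 N c c'. N \<noteq> 0 \<and> pev t x1 x2 x3 (q_b lam) = 0 \<and> pev t x1 x2 x3 P = N * pCons 0 c \<and>
          pev t x1 x2 x3 (avec (dm 1 (ex 0) * dm 2 1) (Const lam * dm 0 (ex 0) * dm 2 1)
            (- (dm 0 1 * dm 1 (ex 0) + Const lam * dm 0 (ex 0) * dm 1 1)) (xv 1)) = N * c' \<and> poly c' 0 \<noteq> 0"
        unfolding avec_simps e_def[symmetric] dm0 dm2 by (metis one_neq_zero)
    qed
  qed
  then show ?thesis using lam0 by blast
qed

text \<open>The killed form and the first relation are linear in \<open>y 0\<close> and
  \<open>y 1\<close>, with determinant a constant times \<open>q_c\<close>; \<open>mu^2 = -1\<close>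
  enters in the second component.\<close>

lemma case_c_multiple:
  assumes ex: "ex 0 = 2" "ex 1 = 2" and even: "\<And>i j. i \<in> {0,1} \<Longrightarrow> j \<in> {1..n (p i)} \<Longrightarrow> 2 dvd l (p i) j"
    and mu: "mu ^ 2 = -1" and q: "D (q_c mu) \<asymp> 0"
  shows "\<exists>h. \<forall>v\<in>V. a v \<asymp> h * avec_c mu v"
proof -
  obtain h where h: "h \<in> Car"
    "of_nat (ex 1) * X 0 * y 1 - of_nat (ex 0) * X 1 * y 0 \<asymp> fr 2 1 * X 2 ^ (ex 2 - 1) * h"
    by (rule relations)
  have h0: "\<not> h \<asymp> 0" by (rule relation_factor_nonzero[OF h(2) not_killed[OF in012(1)]])
  define u where "u = fr 0 2"
  define v where "v = fr 1 2"
  define w where "w = fr 2 1 * X 2 ^ (ex 2 - 1)"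
  define N where "N = (of_nat (ex 2) :: 'k mpol)"
  define m where "m = (Const mu :: 'k mpol)"
  have m2: "m * m \<asymp> -1"
  proof -
    have "m * m = Const (mu * mu)" unfolding m_def by (simp only: Const_mult)
    also have "mu * mu = -1" using mu by (simp only: power2_eq_square)
    finally show ?thesis by (simp add: Const_minus)
  qed
  have mu0: "mu \<noteq> 0" using mu by auto
  have dm: "dm 0 2 = u" "dm 1 2 = v" "tm 0 2 = u * X 0" "tm 1 2 = v * X 1"
    unfolding u_def v_def
    by (rule dm_eq_fr[OF in012(1) ex(1)] dm_eq_fr[OF in012(2) ex(2)] tm_eq_linear[OF in012(1) ex(1)] tm_eq_linear[OF in012(2) ex(2)])+
  have dm2: "dm 2 1 = N * w" unfolding dm_1[OF in012(3)] N_def w_def by (simp only: mult.assoc)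
  have S: "m * u * y 0 + v * y 1 \<asymp> 0"
    using q unfolding q_c_def m_def poly_der.D_add D_Const_mult D_tm[OF in012(1)] D_tm[OF in012(2)] unfolding dm
    by (simp only: mult.assoc)
  have R: "2 * X 0 * y 1 - 2 * X 1 * y 0 \<asymp> w * h" using h(2) unfolding ex w_def by simp
  have qe: "q_c mu = m * u * X 0 + v * X 1" unfolding q_c_def dm m_def by (simp only: mult.assoc)
  define K where "K = - 2 * of_nat (ex 2) * mu"
  have K: "Const K = - (2 * N * m)"
    unfolding K_def N_def m_def by (simp add: Const_mult Const_minus Const_numeral Const_of_nat)
  have K0: "K \<noteq> 0" unfolding K_def using mu0 ex_pos[OF in012(3)] by simp
  have rel0: "Const K * (q_c mu * y 0) \<asymp> h * (Const mu * dm 1 2 * dm 2 1)"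
    unfolding K qe dm dm2 m_def[symmetric]
    by (rule eqvI2[OF _ S R, of _ _ "- (2 * N * m * X 0)" "N * m * v"]) (simp add: algebra_simps)
  have rel1: "Const K * (q_c mu * y 1) \<asymp> h * (dm 0 2 * dm 2 1)"
    unfolding K qe dm dm2
    by (rule eqvI3[OF _ S R m2, of _ _ "- (2 * N * m * X 1)" "N * u" "2 * N * u * (X 1 * y 0 - X 0 * y 1)"])
      (simp add: algebra_simps)
  show ?thesis
    unfolding avec_c_def
  proof (rule multiple_if_proportional[OF _ q_c_Car[of mu] q h(1) h0 K0 rel0 rel1])
    show "tri_der n l d im (avec (Const mu * dm 1 2 * dm 2 1) (dm 0 2 * dm 2 1)
        (- (Const mu * dm 0 1 * dm 1 2 + dm 0 2 * dm 1 1)))"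
      using chart_der_c[of mu] unfolding avec_c_def chart_der_def by blast
    show "ker_param (avec (Const mu * dm 1 2 * dm 2 1) (dm 0 2 * dm 2 1)
        (- (Const mu * dm 0 1 * dm 1 2 + dm 0 2 * dm 1 1))) (xv 0) (q_c mu)"
      using ker_param_c[OF ex even mu] unfolding avec_c_def by blast
    show "xv 0 \<notin> Frozen" by simp
    show "xv 1 \<in> V" by (rule xv_in_V[OF in012(2)])
    fix g0 k
    assume g0: "pvars g0 \<subseteq> Frozen" "g0 * avec (Const mu * dm 1 2 * dm 2 1) (dm 0 2 * dm 2 1)
        (- (Const mu * dm 0 1 * dm 1 2 + dm 0 2 * dm 1 1)) (xv 1) \<asymp> q_c mu * k"
    show "g0 = 0"
    proof (rule zero_if_curves[OF g0])
      fix t :: "tvar \<Rightarrow> 'k" assume t: "\<forall>v. t v \<noteq> 0"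
      have fr: "eval_at t (fr i \<alpha>) \<noteq> 0" if "i \<in> {0,1,2}" for i \<alpha> by (rule fr_eval_nonzero[OF spec[OF t] that])
      \<comment> \<open>The curve moves along \<open>X 2\<close> with \<open>X 0 = X 1 = 0\<close>.
        There \<open>P\<close> has order \<open>ex 2\<close>, and the derivation of type (c) has a
        component of order \<open>ex 2 - 1\<close>.\<close>
      let ?z = "[:0, 1:] :: 'k poly" and ?f = "eval_at t (fr 2 1)"
      let ?N = "?z ^ (ex 2 - 1)"
      have N0: "?N \<noteq> 0" by simp
      have z: "(0 :: 'k poly) ^ ex 0 = 0" "(0 :: 'k poly) ^ ex 1 = 0" unfolding ex by simp_all
      have zp: "?z ^ ex 2 = ?N * ?z" using power_minus_mult[of "ex 2" ?z] ex_pos[OF in012(3)] by simp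
      have "pev t 0 0 ?z (q_c mu) = 0" unfolding qe pev_simps by simp
      moreover have "pev t 0 0 ?z P = ?N * pCons 0 [:?f:]" unfolding pev_P z zp by simp
      moreover have "pev t 0 0 ?z (u * (N * w)) = ?N * [:eval_at t (fr 0 2) * of_nat (ex 2) * ?f:]"
        unfolding u_def N_def w_def pev_simps pev_fr[OF in012(1)] pev_fr[OF in012(3)] pev_of_nat of_nat_poly
        by (simp add: mult_ac)
      moreover have "poly [:eval_at t (fr 0 2) * of_nat (ex 2) * ?f:] 0 \<noteq> 0"
        using fr[OF in012(1)] fr[OF in012(3)] ex_pos[OF in012(3)] by simp
      ultimately show "\<exists>x1 x2 x3 N c c'. N \<noteq> 0 \<and> pev t x1 x2 x3 (q_c mu) = 0 \<and> pev t x1 x2 x3 P = N * pCons 0 c \<and>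
          pev t x1 x2 x3 (avec (Const mu * dm 1 2 * dm 2 1) (dm 0 2 * dm 2 1)
            (- (Const mu * dm 0 1 * dm 1 2 + dm 0 2 * dm 1 1)) (xv 1)) = N * c' \<and> poly c' 0 \<noteq> 0"
        unfolding avec_simps dm dm2 using N0 by metis
    qed
  qed
qed

lemma im_squared_cases: "mu ^ 2 = -1 \<Longrightarrow> mu \<in> {im, - im}"
proof -
  assume "mu ^ 2 = -1"
  then have "(mu - im) * (mu + im) = 0" using im by (simp add: algebra_simps power2_eq_square)
  then show ?thesis by (auto simp: eq_neg_iff_add_eq_0)
qed

text \<open>The killed form \<open>L = tm 0 2 - r * tm 1 2\<close> must divide the sum of squares.
  If \<open>r^2\<close> were not -1, the relation for \<open>y 0\<close> and \<open>y 1\<close>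
  would give \<open>(ex 2 - 1) * dg 2 < dg 1\<close>, while the trinomial gives
  \<open>2 * dg 1 \<le> ex 2 * dg 2\<close>; these conflict for \<open>ex 2 \<ge> 2\<close>.\<close>

lemma case_c_odd:
  assumes ex: "ex 0 = 2" "ex 1 = 2" "ex 2 \<ge> 2" and even: "\<And>i j. i \<in> {0,1} \<Longrightarrow> j \<in> {1..n (p i)} \<Longrightarrow> 2 dvd l (p i) j"
    and odd: "\<exists>j\<in>{1..n (p 2)}. odd (l (p 2) j)"
  shows "\<exists>mu. mu ^ 2 = -1 \<and> (\<exists>h. \<forall>v\<in>V. a v \<asymp> h * avec_c mu v)"
proof -
  have nW: "\<not> D (tm 1 2) \<asymp> 0" by (rule tm_not_killed[OF in012(2)]) (simp_all only: ex le_refl one_le_numeral)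
  have div: "ex 0 dvd l (p i) j" if "i \<in> {0,1}" "j \<in> {1..n (p i)}" for i j using even[OF that] ex by simp
  obtain r where r: "D (tm 0 2 - Const r * tm 1 2) \<asymp> 0"
    using linear_form_killed[OF div] ex odd nW by metis
  define u where "u = fr 0 2"
  define v where "v = fr 1 2"
  define L where "L = tm 0 2 - Const r * tm 1 2"
  have dm: "dm 0 2 = u" "dm 1 2 = v" "tm 0 2 = u * X 0" "tm 1 2 = v * X 1"
    unfolding u_def v_def
    by (rule dm_eq_fr[OF in012(1) ex(1)] dm_eq_fr[OF in012(2) ex(2)] tm_eq_linear[OF in012(1) ex(1)] tm_eq_linear[OF in012(2) ex(2)])+
  have r2: "r ^ 2 = -1"
  proof (rule ccontr)
    assume "r ^ 2 \<noteq> -1"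
    then have r1: "r ^ 2 + 1 \<noteq> 0" by (simp add: eq_neg_iff_add_eq_0)
    obtain h where h: "h \<in> Car"
      "of_nat (ex 1) * X 0 * y 1 - of_nat (ex 0) * X 1 * y 0 \<asymp> fr 2 1 * X 2 ^ (ex 2 - 1) * h"
      by (rule relations)
    have h0: "\<not> h \<asymp> 0" by (rule relation_factor_nonzero[OF h(2) not_killed[OF in012(1)]])
    have R: "2 * X 0 * y 1 - 2 * X 1 * y 0 \<asymp> fr 2 1 * X 2 ^ (ex 2 - 1) * h" using h(2) unfolding ex by simp
    have S: "u * y 0 - Const r * (v * y 1) \<asymp> 0"
      using r unfolding poly_der.D_diff D_Const_mult D_tm[OF in012(1)] D_tm[OF in012(2)] unfolding dm .
    have "u * (v * (fr 2 1 * X 2 ^ (ex 2 - 1) * h)) \<asymp> 2 * (L * (v * y 1))"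
      by (rule eqvI2[OF _ S R, of _ _ "-2 * v * X 1" "- u * v"]) (unfold L_def dm, simp add: algebra_simps)
    then have eq: "deg (u * (v * (fr 2 1 * X 2 ^ (ex 2 - 1) * h))) = deg (2 * (L * (v * y 1)))" by (rule deg_cong)
    have "(ex 2 - 1) * dg 2 \<le> deg (u * (v * (fr 2 1 * X 2 ^ (ex 2 - 1) * h)))"
      using h0 fr_not_eqv_0 Var_power_not_eqv_0[of "xv 2" "ex 2 - 1"] Var_not_eqv_0[of "xv 2"]
      unfolding u_def v_def by (simp add: deg_mult mult_eqv_0_iff deg_power)
    also have "\<dots> \<le> deg (2 :: 'k mpol) + (deg L + (deg v + deg (y 1)))"
      unfolding eq using deg_mult_le[of 2 "L * (v * y 1)"] deg_mult_le[of L "v * y 1"] deg_mult_le[of v "y 1"] by linarith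
    also have "\<dots> = deg (y 1)"
      using r deg_of_nat[of 2] deg_frozen[OF fr_vars_Frozen[OF in012(2)], of 2] unfolding L_def v_def
      by (simp add: deg_eq_0_iff)
    finally have b1: "(ex 2 - 1) * dg 2 < dg 1" using deg_X[OF in012(2) not_killed[OF in012(2)]] by simp
    have v0: "\<not> v \<asymp> 0" unfolding v_def by (rule fr_not_eqv_0)
    have dW: "deg (tm 1 2) = dg 1"
      unfolding dm using v0 Var_not_eqv_0[of "xv 1"] deg_frozen[OF fr_vars_Frozen[OF in012(2)], of 2]
      by (simp add: deg_mult v_def)
    have W0: "\<not> tm 1 2 \<asymp> 0" unfolding dm using v0 Var_not_eqv_0 by (simp add: mult_eqv_0_iff)
    have pow: "tm 0 1 = tm 0 2 ^ 2" "tm 1 1 = tm 1 2 ^ 2"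
      by (rule tm_power, rule even, simp, assumption)+
    have "tm 0 2 ^ 2 + tm 1 2 ^ 2 = Const (r ^ 2 + 1) * tm 1 2 ^ 2 + L * (L + Const (2 * r) * tm 1 2)"
      unfolding L_def by (simp add: power2_eq_square Const_add Const_mult Const_numeral algebra_simps)
    then have sum: "tm 0 1 + tm 1 1 = Const (r ^ 2 + 1) * tm 1 2 ^ 2 + L * (L + Const (2 * r) * tm 1 2)"
      unfolding pow .
    have z: "Const (r ^ 2 + 1) * tm 1 2 ^ 2 \<asymp> - tm 2 1 - L * (L + Const (2 * r) * tm 1 2)"
      by (rule eqvI1[OF _ tm_2_eqv, of _ _ 1]) (unfold sum, simp add: algebra_simps)
    have "2 * dg 1 = deg (Const (r ^ 2 + 1) * tm 1 2 ^ 2)"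
      using W0 Const_not_eqv_0[OF r1] power_eqv_0[of "tm 1 2" 2] dW deg_Const
      by (subst deg_mult) (auto simp: deg_power)
    also have "\<dots> = deg (- tm 2 1 - L * (L + Const (2 * r) * tm 1 2))" by (rule deg_cong[OF z])
    also have "\<dots> \<le> max (deg (tm 2 1)) (dg 1)"
    proof (rule deg_diff_le)
      show "deg (- tm 2 1) \<le> max (deg (tm 2 1)) (dg 1)" by (simp add: deg_minus)
      have L0: "deg L = 0" using r by (simp add: L_def deg_eq_0_iff)
      have "deg (L + Const (2 * r) * tm 1 2) \<le> dg 1"
        using L0 deg_mult_le[of "Const (2 * r)" "tm 1 2"] dW deg_Const by (intro deg_add_le) auto
      then show "deg (L * (L + Const (2 * r) * tm 1 2)) \<le> max (deg (tm 2 1)) (dg 1)"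
        using deg_mult_le[of L "L + Const (2 * r) * tm 1 2"] L0 by simp
    qed
    finally have "2 * dg 1 \<le> max (deg (tm 2 1)) (dg 1)" .
    moreover have "deg (tm 2 1) = ex 2 * dg 2"
    proof -
      have "tm 2 1 = fr 2 1 * X 2 ^ ex 2" using tm_eq[OF in012(3), of 1] by (simp only: div_by_1)
      then show ?thesis
        using fr_not_eqv_0[of 2 1] Var_power_not_eqv_0[of "xv 2"] Var_not_eqv_0[of "xv 2"] deg_frozen[OF fr_vars_Frozen[OF in012(3)]]
        by (simp only: deg_mult deg_power not_False_eq_True)
    qed
    \<comment> \<open>The alternative \<open>2 * dg 1 \<le> dg 1\<close> in the maximum is
      impossible because \<open>dg 1\<close> is positive.\<close>
    ultimately have b2: "2 * dg 1 \<le> ex 2 * dg 2" using dg_pos[OF in012(2)] by simp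
    obtain k where k: "ex 2 = k + 2" using ex(3) by (metis add.commute le_Suc_ex)
    show False using b1 b2 unfolding k by (simp add: algebra_simps)
  qed
  have "q_c r = Const r * L"
  proof -
    have "Const r * (Const r * tm 1 2) = Const (r * r) * tm 1 2" by (simp only: Const_mult mult.assoc)
    also have "r * r = -1" using r2 by (simp only: power2_eq_square)
    finally show ?thesis unfolding q_c_def L_def by (simp add: right_diff_distrib Const_minus)
  qed
  then have "D (q_c r) \<asymp> 0" using r by (simp add: L_def D_Const_mult mult_eqv_0_iff)
  then show ?thesis using case_c_multiple[OF ex(1,2) even r2] r2 by blast
qed

text \<open>A tangent of the conic is killed. If it is \<open>A\<close> or \<open>B\<close>, its
  third coordinate is 0 and type (c) results. Otherwise it is \<open>q_d r\<close> up to sign, and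
  degrees force the third exponent to be 2.\<close>

lemma case_even:
  assumes ex: "ex 0 = 2" "ex 1 = 2" and even: "\<And>i j. i \<in> {0,1,2} \<Longrightarrow> j \<in> {1..n (p i)} \<Longrightarrow> 2 dvd l (p i) j"
  shows "(\<exists>mu. mu ^ 2 = -1 \<and> (\<exists>h. \<forall>v\<in>V. a v \<asymp> h * avec_c mu v)) \<or>
    ex 2 = 2 \<and> (\<exists>lam. lam \<noteq> 0 \<and> (\<exists>h. \<forall>v\<in>V. a v \<asymp> h * avec_d lam v))"
proof -
  have even01: "2 dvd l (p i) j" if "i \<in> {0,1}" "j \<in> {1..n (p i)}" for i j using even that by blast
  have caseC: ?thesis if "mu ^ 2 = -1" "D (q_c mu) \<asymp> 0" for mu
    by (intro disjI1 exI[of _ mu] conjI that(1) case_c_multiple[OF ex _ that]) (rule even01)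
  define U where "U = tm 0 2"
  define W where "W = tm 1 2"
  define Z where "Z = tm 2 2"
  define I' where "I' = (Const im :: 'k mpol)"
  define A where "A = U + I' * W"
  define B where "B = U - I' * W"
  have I2: "I' * I' = -1"
  proof -
    have "I' * I' = Const (im * im)" unfolding I'_def by (simp only: Const_mult)
    also have "im * im = -1" using im by (simp only: power2_eq_square)
    finally show ?thesis by (simp only: Const_minus Const_1)
  qed
  have qc: "q_c im = I' * B" "q_c (- im) = - (I' * A)"
  proof -
    have "I' * (I' * W) = - W" using I2 by (simp flip: mult.assoc)
    then show "q_c im = I' * B" "q_c (- im) = - (I' * A)"
      unfolding q_c_def A_def B_def U_def W_def I'_def by (simp_all add: Const_minus distrib_left right_diff_distrib)
  qed
  have ims: "im ^ 2 = -1" "(- im) ^ 2 = -1" using im by simp_all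
  show ?thesis
  proof (cases "D A \<asymp> 0 \<or> D B \<asymp> 0")
    case True
    then have "D (q_c im) \<asymp> 0 \<or> D (q_c (- im)) \<asymp> 0"
      unfolding qc I'_def poly_der.D_minus D_Const_mult by (auto simp: mult_eqv_0_iff)
    then show ?thesis using caseC[OF ims(1)] caseC[OF ims(2)] by blast
  next
    case False
    then obtain r where r: "D (Const (r ^ 2) * A - Const (2 * r) * Z - B) \<asymp> 0"
      using tangent_killed[OF ex even] unfolding A_def B_def U_def W_def Z_def I'_def by blast
    have r0: "r \<noteq> 0"
    proof
      assume "r = 0"
      then have "D (- B) \<asymp> 0" using r by simp
      then show False using False by (simp add: poly_der.D_minus)
    qed
    define al where "al = (Const (1 - r ^ 2) :: 'k mpol)"
    define be where "be = (- Const ((1 + r ^ 2) * im) :: 'k mpol)"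
    define ga where "ga = (Const (2 * r) :: 'k mpol)"
    have qd: "q_d r = al * U + be * W + ga * Z" by (simp add: q_d_def al_def be_def ga_def U_def W_def Z_def)
    have qd': "q_d r = - (Const (r ^ 2) * A - Const (2 * r) * Z - B)"
      unfolding qd al_def be_def ga_def A_def B_def I'_def by (simp add: Const_add Const_diff Const_mult algebra_simps)
    have q: "D (q_d r) \<asymp> 0" unfolding qd' poly_der.D_minus using r by simp
    obtain N where N: "ex 2 = 2 * N" using even[OF in012(3) c_in[OF in012(3)]] by (auto simp: ex_def elim: dvdE)
    have N1: "N \<ge> 1" using N ex_pos[OF in012(3)] by (cases N) auto
    obtain h where h: "h \<in> Car"
      "of_nat (ex 1) * X 0 * y 1 - of_nat (ex 0) * X 1 * y 0 \<asymp> fr 2 1 * X 2 ^ (ex 2 - 1) * h"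
      "of_nat (ex 2) * X 1 * y 2 - of_nat (ex 1) * X 2 * y 1 \<asymp> fr 0 1 * X 0 ^ (ex 0 - 1) * h"
      "of_nat (ex 0) * X 2 * y 0 - of_nat (ex 2) * X 0 * y 2 \<asymp> fr 1 1 * X 1 ^ (ex 1 - 1) * h"
      by (rule relations)
    have h0: "\<not> h \<asymp> 0" by (rule relation_factor_nonzero[OF h(2) not_killed[OF in012(1)]])
    define u where "u = fr 0 2"
    define v where "v = fr 1 2"
    define w where "w = fr 2 2"
    define s where "s = X 2 ^ (N - 1)"
    define n' where "n' = (of_nat N :: 'k mpol)"
    have frp: "fr 0 1 = u * u" "fr 1 1 = v * v" "fr 2 1 = w * w"
      using fr_power[of 0 2, OF even[OF in012(1)]] fr_power[of 1 2, OF even[OF in012(2)]] fr_power[of 2 2, OF even[OF in012(3)]]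
      unfolding u_def v_def w_def by (simp_all only: power2_eq_square)
    have dm: "dm 0 2 = u" "dm 1 2 = v" "U = u * X 0" "W = v * X 1"
      unfolding u_def v_def U_def W_def
      by (rule dm_eq_fr[OF in012(1) ex(1)] dm_eq_fr[OF in012(2) ex(2)] tm_eq_linear[OF in012(1) ex(1)] tm_eq_linear[OF in012(2) ex(2)])+
    have N2: "ex 2 div 2 = N" using N by simp
    have dm2: "dm 2 2 = n' * w * s" unfolding dmon_eq[OF in012(3)] N2 n'_def w_def s_def ..
    have sX: "X 2 ^ N = s * X 2" unfolding s_def using power_minus_mult[of N "X 2"] N1 by simp
    have Ze: "Z = w * s * X 2" unfolding Z_def tm_eq[OF in012(3)] N2 sX w_def by (simp only: mult.assoc)
    have "ex 2 - 1 = (N - 1) + N" using N N1 by linarith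
    then have "X 2 ^ (ex 2 - 1) = X 2 ^ (N - 1) * X 2 ^ N" by (simp only: power_add)
    then have sX2: "X 2 ^ (ex 2 - 1) = s * (s * X 2)" unfolding sX s_def .
    have R1: "2 * X 0 * y 1 - 2 * X 1 * y 0 \<asymp> w * w * (s * (s * X 2)) * h"
      using h(2) unfolding ex frp sX2 by simp
    have R2: "2 * n' * X 1 * y 2 - 2 * X 2 * y 1 \<asymp> u * u * X 0 * h"
      using h(3) unfolding ex frp N n'_def by simp
    have R3: "2 * X 2 * y 0 - 2 * n' * X 0 * y 2 \<asymp> v * v * X 1 * h"
      using h(4) unfolding ex frp N n'_def by simp
    define ka where "ka = u * v * w * s"
    define DU where "DU = u * y 0"
    define DW where "DW = v * y 1"
    define DZ where "DZ = n' * w * s * y 2"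
    have DD: "D U = DU" "D W = DW" "D Z = DZ"
      unfolding DU_def DW_def DZ_def U_def W_def Z_def D_tm[OF in012(1)] D_tm[OF in012(2)] D_tm[OF in012(3)] dm dm2 by (rule refl)+
    have E1: "2 * (U * DW - W * DU) \<asymp> ka * Z * h"
      by (rule eqvI1[OF _ R1, of _ _ "u * v"]) (simp add: dm Ze DU_def DW_def ka_def algebra_simps)
    have E2: "2 * (W * DZ - Z * DW) \<asymp> ka * U * h"
      by (rule eqvI1[OF _ R2, of _ _ "v * w * s"]) (simp add: dm Ze DZ_def DW_def ka_def algebra_simps)
    have E3: "2 * (Z * DU - U * DZ) \<asymp> ka * W * h"
      by (rule eqvI1[OF _ R3, of _ _ "u * w * s"]) (simp add: dm Ze DZ_def DU_def ka_def algebra_simps)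
    have S: "al * DU + be * DW + ga * DZ \<asymp> 0"
      using q unfolding qd al_def be_def ga_def poly_der.D_add D_Const_mult DD Const_minus[symmetric] .
    have qDU: "2 * (q_d r * DU) \<asymp> ka * h * (ga * W - be * Z)"
      unfolding qd by (rule eqvI3[OF _ S E1 E3, of _ _ "2 * U" "- be" ga]) (simp add: algebra_simps)
    have qDW: "2 * (q_d r * DW) \<asymp> ka * h * (al * Z - ga * U)"
      unfolding qd by (rule eqvI3[OF _ S E1 E2, of _ _ "2 * W" al "- ga"]) (simp add: algebra_simps)
    have eN: "N = 1"
    proof (rule ccontr)
      assume "N \<noteq> 1"
      then have N_ge: "N \<ge> 2" using N1 by simp
      \<comment> \<open>The square of \<open>t\<close> is \<open>- A * q_d r\<close> on the conic,
        so \<open>deg A = 2 * deg t\<close>. The relation for \<open>D A\<close> gives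
        \<open>(N - 1) * dg 2 < deg t\<close>, and \<open>Const r * A = t + Z\<close> gives
        \<open>2 * deg t \<le> N * dg 2\<close>; together they exclude
        \<open>N \<ge> 2\<close>.\<close>
      define t where "t = Const r * A - Z"
      have alb: "I' * al - be = 2 * I'"
      proof -
        have "I' * al - be = Const (im * (1 - r ^ 2) + (1 + r ^ 2) * im)" unfolding I'_def al_def be_def
          by (simp add: Const_mult Const_add Const_diff)
        also have "im * (1 - r ^ 2) + (1 + r ^ 2) * im = 2 * im" by (simp add: algebra_simps)
        finally show ?thesis by (simp add: I'_def Const_mult Const_numeral)
      qed
      have ga2: "ga = 2 * Const r" by (simp add: ga_def Const_mult Const_numeral)
      have comb: "(ga * W - be * Z) + I' * (al * Z - ga * U) = - (2 * I') * t"
      proof -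
        have "(ga * W - be * Z) + I' * (al * Z - ga * U) = ga * W - I' * ga * U + (I' * al - be) * Z" by (simp add: algebra_simps)
        also have "\<dots> = - (I' * I') * ga * W - I' * ga * U + 2 * I' * Z" unfolding alb I2 by simp
        also have "\<dots> = - (2 * I') * t" unfolding t_def A_def ga2 by (simp add: algebra_simps)
        finally show ?thesis .
      qed
      have DA: "D A = DU + I' * DW" unfolding A_def I'_def poly_der.D_add D_Const_mult DD ..
      have "2 * (q_d r * D A) - ka * h * (- (2 * I') * t) =
          1 * (2 * (q_d r * DU) - ka * h * (ga * W - be * Z)) + I' * (2 * (q_d r * DW) - ka * h * (al * Z - ga * U))"
        unfolding DA comb[symmetric] by (simp add: algebra_simps)
      then have qDA: "2 * (q_d r * D A) \<asymp> ka * h * (- (2 * I') * t)" by (rule eqvI2[OF _ qDU qDW])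
      have conic: "U ^ 2 + W ^ 2 + Z ^ 2 \<asymp> 0"
        using P_eq tm_power[of 0 2, OF even[OF in012(1)]] tm_power[of 1 2, OF even[OF in012(2)]]
          tm_power[of 2 2, OF even[OF in012(3)]] unfolding U_def W_def Z_def by (metis eqv_0 dvd_refl)
      have AB: "A * B = U ^ 2 + W ^ 2"
      proof -
        have "A * B = U ^ 2 - (I' * I') * W ^ 2" unfolding A_def B_def by (simp add: algebra_simps power2_eq_square)
        then show ?thesis unfolding I2 by simp
      qed
      have "t ^ 2 - - (A * q_d r) = A * B + Z ^ 2"
        unfolding t_def qd' by (simp add: algebra_simps power2_eq_square Const_mult Const_numeral)
      then have "t ^ 2 - - (A * q_d r) = 1 * (U ^ 2 + W ^ 2 + Z ^ 2 - 0)" unfolding AB by simp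
      then have tt: "t ^ 2 \<asymp> - (A * q_d r)" by (rule eqvI1[OF _ conic])
      have t0: "\<not> t \<asymp> 0"
      proof -
        have im0: "im \<noteq> 0" using im by auto
        have fr: "eval_at (\<lambda>_. 1) (fr i \<alpha>) = (1 :: 'k)" for i \<alpha>
          unfolding fr_def by (simp add: eval_at_psubst id_hom.psubst_prod id_hom.psubst_power)
        let ?t = "upd (\<lambda>_. 1) 1 (- im) 0"
        have z: "(0::'k) ^ ex 2 = 0" "(0::'k) ^ (ex 2 div 2) = 0" using N N1 by (simp_all add: zero_power)
        have "eval_at ?t P = 0" unfolding eval_upd_P fr z ex using im by simp
        moreover have "eval_at ?t t = r * 2"
          unfolding t_def A_def U_def W_def Z_def I'_def eval_simps eval_upd_tm fr z ex
          using im by (simp add: power2_eq_square)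
        ultimately show ?thesis using not_eqv_0_if_eval[of ?t t] r0 by simp
      qed
      then have "\<not> t ^ 2 \<asymp> 0" using power_eqv_0 by blast
      then have Aq0: "\<not> A \<asymp> 0" "\<not> q_d r \<asymp> 0" using eqv_0_cong[OF tt] by (auto simp: mult_eqv_0_iff)
      have q0: "deg (q_d r) = 0" using q by (simp add: deg_eq_0_iff)
      have dA: "deg A = 2 * deg t"
        using deg_cong[OF tt] deg_power[OF t0, of 2] deg_mult[OF Aq0] q0 by (simp add: deg_minus)
      have dA0: "deg A > 0" using False deg_eq_0_iff[of A] by blast
      have DA0: "\<not> D A \<asymp> 0" using False by blast
      have dZ: "deg Z = N * dg 2"
        unfolding Z_def tm_eq[OF in012(3)] N2
        using fr_not_eqv_0[of 2 2] Var_power_not_eqv_0[of "xv 2" N] Var_not_eqv_0[of "xv 2"] deg_frozen[OF fr_vars_Frozen[OF in012(3)]]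
        by (simp only: deg_mult deg_power not_False_eq_True)
      have "deg Z \<le> deg A"
      proof -
        have "Z = Const r * A - t" by (simp add: t_def)
        moreover have "deg (Const r * A - t) \<le> deg A"
          using deg_mult_le[of "Const r" A] deg_Const dA by (intro deg_diff_le) auto
        ultimately show ?thesis by simp
      qed
      have "ka \<asymp> 0 \<Longrightarrow> False"
        unfolding ka_def u_def v_def w_def s_def using fr_not_eqv_0 Var_power_not_eqv_0 by (auto simp: mult_eqv_0_iff)
      then have ka0: "\<not> ka \<asymp> 0" by blast
      have dka: "(N - 1) * dg 2 \<le> deg ka"
        unfolding ka_def u_def v_def w_def s_def
        using fr_not_eqv_0 Var_power_not_eqv_0[of "xv 2" "N - 1"] Var_not_eqv_0[of "xv 2"]
        by (simp add: deg_mult mult_eqv_0_iff deg_power)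
      have I0: "\<not> - (2 * I') \<asymp> 0"
      proof -
        have "- (2 * I') = Const (- (2 * im))" by (simp add: I'_def Const_minus Const_mult Const_numeral)
        moreover have "im \<noteq> 0" using im by auto
        then have "- (2 * im) \<noteq> 0" by simp
        then have "\<not> Const (- (2 * im)) \<asymp> 0" by (rule Const_not_eqv_0)
        ultimately show ?thesis by metis
      qed
      have "(N - 1) * dg 2 + deg t \<le> deg (ka * h * (- (2 * I') * t))"
        using ka0 h0 I0 t0 dka by (simp add: deg_mult deg_minus mult_eqv_0_iff)
      also have "\<dots> = deg (2 * (q_d r * D A))" using deg_cong[OF qDA] by simp
      also have "\<dots> \<le> deg (D A)"
        using deg_mult_le[of 2 "q_d r * D A"] deg_mult_le[of "q_d r" "D A"] deg_of_nat[of 2] q0 by simp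
      finally have b1: "(N - 1) * dg 2 + deg t < 2 * deg t" using deg_D[OF DA0] dA by simp
      have b2: "2 * deg t \<le> N * dg 2"
      proof (rule ccontr)
        assume "\<not> ?thesis"
        then have lt: "deg Z \<le> 2 * deg t - 1" using dZ by simp
        have "deg (Const r * A) \<le> 2 * deg t - 1"
        proof -
          have "Const r * A = t + Z" by (simp add: t_def)
          moreover have "deg (t + Z) \<le> 2 * deg t - 1" using lt dA dA0 by (intro deg_add_le) auto
          ultimately show ?thesis by simp
        qed
        moreover have "deg (Const r * A) = deg A"
          using deg_mult[OF Const_not_eqv_0[OF r0] Aq0(1)] deg_Const by simp
        ultimately show False using dA dA0 by simp
      qed
      obtain k where k: "N = k + 2" using N_ge by (metis add.commute le_Suc_ex)
      have "(k + 1) * dg 2 < deg t" using b1 unfolding k by simp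
      moreover have "2 * deg t \<le> (k + 2) * dg 2" using b2 unfolding k .
      ultimately show False by (simp add: algebra_simps)
    qed
    have s1: "s = 1" unfolding s_def eN by simp
    have n1: "n' = 1" unfolding n'_def eN by simp
    have ex2: "ex 2 = 2" using N eN by simp
    have cancel: "f \<asymp> g" if "fr i 2 * f \<asymp> fr i 2 * g" for i f g using eqv_mult_cancel_left[OF fr_not_eqv_0] that by blast
    have K2: "Const (2 :: 'k) = 2" by (rule Const_numeral)
    have dm2': "dm 2 2 = w" unfolding dm2 s1 n1 by simp
    have rel0: "Const 2 * (q_d r * y 0) \<asymp> h * (dm 1 2 * dm 2 2 * (ga * tm 1 2 - be * tm 2 2))"
    proof (rule cancel[of 0])
      show "fr 0 2 * (Const 2 * (q_d r * y 0)) \<asymp> fr 0 2 * (h * (dm 1 2 * dm 2 2 * (ga * tm 1 2 - be * tm 2 2)))"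
        by (rule eqvI1[OF _ qDU, of _ _ 1])
          (unfold K2 dm dm2' DU_def ka_def s1 u_def[symmetric] U_def[symmetric] W_def[symmetric] Z_def[symmetric], simp add: algebra_simps)
    qed
    have rel1: "Const 2 * (q_d r * y 1) \<asymp> h * (dm 0 2 * dm 2 2 * (al * tm 2 2 - ga * tm 0 2))"
    proof (rule cancel[of 1])
      show "fr 1 2 * (Const 2 * (q_d r * y 1)) \<asymp> fr 1 2 * (h * (dm 0 2 * dm 2 2 * (al * tm 2 2 - ga * tm 0 2)))"
        unfolding v_def[symmetric]
        by (rule eqvI1[OF _ qDW, of _ _ 1])
          (unfold K2 dm dm2' DW_def ka_def s1 U_def[symmetric] W_def[symmetric] Z_def[symmetric], simp add: algebra_simps)
    qed
    have av: "avec_d r = avec (dm 1 2 * dm 2 2 * (ga * tm 1 2 - be * tm 2 2)) (dm 0 2 * dm 2 2 * (al * tm 2 2 - ga * tm 0 2))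
        (dm 0 2 * dm 1 2 * (be * tm 0 2 - al * tm 1 2))"
      unfolding avec_d_def Let_def al_def be_def ga_def ..
    have "\<exists>h. \<forall>v\<in>V. a v \<asymp> h * avec_d r v"
      unfolding av
    proof (rule multiple_if_proportional[OF _ q_d_Car[of r] q h(1) h0 _ rel0 rel1])
      show "tri_der n l d im (avec (dm 1 2 * dm 2 2 * (ga * tm 1 2 - be * tm 2 2)) (dm 0 2 * dm 2 2 * (al * tm 2 2 - ga * tm 0 2))
          (dm 0 2 * dm 1 2 * (be * tm 0 2 - al * tm 1 2)))"
        using chart_der_d[OF even, of r] unfolding av chart_der_def by blast
      show "(2 :: 'k) \<noteq> 0" by simp
      show "ker_param (avec (dm 1 2 * dm 2 2 * (ga * tm 1 2 - be * tm 2 2)) (dm 0 2 * dm 2 2 * (al * tm 2 2 - ga * tm 0 2))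
          (dm 0 2 * dm 1 2 * (be * tm 0 2 - al * tm 1 2))) (xv 0) (q_d r)"
        using ker_param_d[OF ex ex2 even r0] unfolding av by blast
      show "xv 0 \<notin> Frozen" by simp
      show "xv 2 \<in> V" by (rule xv_in_V[OF in012(3)])
      fix g0 k
      assume g0: "pvars g0 \<subseteq> Frozen" "g0 * avec (dm 1 2 * dm 2 2 * (ga * tm 1 2 - be * tm 2 2)) (dm 0 2 * dm 2 2 * (al * tm 2 2 - ga * tm 0 2))
          (dm 0 2 * dm 1 2 * (be * tm 0 2 - al * tm 1 2)) (xv 2) \<asymp> q_d r * k"
      show "g0 = 0"
      proof (rule zero_if_curves[OF g0])
        fix t :: "tvar \<Rightarrow> 'k" assume t: "\<forall>v. t v \<noteq> 0"
        have fr: "eval_at t (fr i \<alpha>) \<noteq> 0" if "i \<in> {0,1,2}" for i \<alpha> by (rule fr_eval_nonzero[OF spec[OF t] that])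
        define a1 where "a1 = 1 - r ^ 2"
        define b1 where "b1 = - ((1 + r ^ 2) * im)"
        define u1 where "u1 = eval_at t (fr 0 2)"
        define v1 where "v1 = eval_at t (fr 1 2)"
        have ab: "a1 ^ 2 + b1 ^ 2 = - (4 * r ^ 2)"
        proof -
          have "b1 ^ 2 = (1 + r ^ 2) ^ 2 * im ^ 2" by (simp add: b1_def power_mult_distrib)
          then have b: "b1 ^ 2 = - ((1 + r ^ 2) ^ 2)" unfolding im by simp
          show ?thesis unfolding b a1_def by (simp add: power2_eq_square algebra_simps)
        qed
        have fr0: "eval_at t (fr 0 1) = u1 ^ 2"
          unfolding u1_def by (rule eval_fr_power, rule even[OF in012(1)])
        have fr1: "eval_at t (fr 1 1) = v1 ^ 2"
          unfolding v1_def by (rule eval_fr_power, rule even[OF in012(2)])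
        \<comment> \<open>The line on which \<open>q_d r\<close> vanishes in the plane
          \<open>X 2 = 0\<close>. Since \<open>a1^2 + b1^2 = -4 r^2\<close> is nonzero,
          \<open>P\<close> has order 2 along it and the third component of the derivation has order
          1.\<close>
        let ?x = "[:0, b1 * v1:]" and ?y = "[:0, - (a1 * u1):]" and ?N = "[:0, 1:] :: 'k poly"
        have N0: "?N \<noteq> 0" by simp
        have AL: "al = Const a1" "be = Const b1" unfolding al_def be_def a1_def b1_def by (simp_all only: Const_minus)
        have two: "2 div 2 = (1::nat)" by simp
        have z: "(0 :: 'k poly) ^ ex 2 = 0" "(0 :: 'k poly) ^ (ex 2 div 2) = 0" unfolding ex2 by simp_all
        have "pev t ?x ?y 0 (q_d r) = 0"
          unfolding qd AL U_def W_def Z_def pev_simps pev_tm z ex two u1_def[symmetric] v1_def[symmetric] by simp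
        moreover have "pev t ?x ?y 0 P = ?N * pCons 0 [:- (4 * r ^ 2) * (u1 ^ 2 * v1 ^ 2):]"
        proof -
          have "pev t ?x ?y 0 P = ?N * pCons 0 [:(a1 ^ 2 + b1 ^ 2) * (u1 ^ 2 * v1 ^ 2):]"
            unfolding pev_P fr0 fr1 ex z by (simp add: power2_eq_square algebra_simps)
          then show ?thesis unfolding ab .
        qed
        moreover have "pev t ?x ?y 0 (u * v * (be * tm 0 2 - al * tm 1 2)) = ?N * [:- (4 * r ^ 2) * (u1 * v1 * (u1 * v1)):]"
        proof -
          have "pev t ?x ?y 0 (u * v * (be * tm 0 2 - al * tm 1 2)) = ?N * [:(a1 ^ 2 + b1 ^ 2) * (u1 * v1 * (u1 * v1)):]"
            unfolding u_def v_def AL pev_simps pev_tm ex two pev_fr[OF in012(1)] pev_fr[OF in012(2)] u1_def[symmetric] v1_def[symmetric]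
            by (simp add: power2_eq_square algebra_simps)
          then show ?thesis unfolding ab .
        qed
        moreover have "poly [:- (4 * r ^ 2) * (u1 * v1 * (u1 * v1)):] 0 \<noteq> 0"
          using r0 fr[OF in012(1)] fr[OF in012(2)] by (simp add: u1_def v1_def)
        ultimately show "\<exists>x1 x2 x3 N c c'. N \<noteq> 0 \<and> pev t x1 x2 x3 (q_d r) = 0 \<and> pev t x1 x2 x3 P = N * pCons 0 c \<and>
            pev t x1 x2 x3 (avec (dm 1 2 * dm 2 2 * (ga * tm 1 2 - be * tm 2 2)) (dm 0 2 * dm 2 2 * (al * tm 2 2 - ga * tm 0 2))
              (dm 0 2 * dm 1 2 * (be * tm 0 2 - al * tm 1 2)) (xv 2)) = N * c' \<and> poly c' 0 \<noteq> 0"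
          unfolding avec_simps dm using N0 by metis
      qed
    qed
    then show ?thesis using ex2 r0 by blast
  qed
qed

end

section \<open>The classification\<close>

context hl
begin

lemma is_replica_of_multiple:
  assumes "\<forall>f\<in>Car. \<delta> (cl f) = cl (D f)" "chart_der n l d im p c a'"
    and "\<exists>h. \<forall>v\<in>V. a v \<asymp> h * a' v" and "i \<in> {0,1,2}" "y i \<noteq> 0"
  shows "is_replica n l d \<delta> (induced_der n l d a')"
proof -
  obtain h where h: "\<forall>v\<in>V. a v \<asymp> h * a' v" using assms(3) by blast
  interpret A: chart_der n l d im p c a' by (rule assms(2))
  show ?thesis
  proof (rule is_replica_if_multiple)
    show "tri_der n l d im a" "tri_der n l d im a'" by (rule tri_der_axioms A.tri_der_axioms)+
    show "\<exists>k. (poly_der n d a ^^ k) f \<asymp> 0" for f by (rule nilp)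
    show "\<delta> (cl f) = cl (poly_der n d a f)" if "f \<in> Car" for f using assms(1) that by blast
    show "a v \<asymp> h * a' v" if "v \<in> V" for v using h that by blast
    show "xv i \<in> V" by (rule xv_in_V[OF assms(4)])
    then show "\<not> y i \<asymp> 0" using a_eqv_0 assms(5) by blast
  qed
qed

lemma type_a_replica:
  assumes \<delta>: "\<forall>f\<in>Car. \<delta> (cl f) = cl (D f)" and "y 1 = 0" "y 0 \<noteq> 0" "ex 2 = 1"
  shows "cond_a l p c \<and> is_replica n l d \<delta> (der_a n l d p c)"
proof
  show "cond_a l p c" using assms(4) by (simp only: cond_a_def ex_def)
  show "is_replica n l d \<delta> (der_a n l d p c)"
    unfolding der_a_eq
    by (rule is_replica_of_multiple[OF \<delta> chart_der_a type_a_multiple[OF assms(2,4)] in012(1) assms(3)])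
qed

end

context hl3
begin

lemma three_replica:
  assumes \<delta>: "\<forall>f\<in>Car. \<delta> (cl f) = cl (D f)"
    and div: "\<forall>i\<in>{0,1}. \<forall>j\<in>{1..n (p i)}. ex 0 dvd l (p i) j"
    and num: "ex 2 = 1 \<or> ex 0 = 2 \<and> ex 1 = 2 \<and> ex 2 \<ge> 2"
  shows "(\<exists>lam. cond_b n l p c \<and> lam \<noteq> 0 \<and> is_replica n l d \<delta> (der_b n l d p c lam)) \<or>
    (\<exists>mu. cond_c n l p c \<and> mu \<in> {im, - im} \<and> is_replica n l d \<delta> (der_c n l d p c mu)) \<or>
    (\<exists>lam. cond_d n l c \<and> lam \<noteq> 0 \<and> is_replica n l d \<delta> (der_d n l d p c im lam))"
proof -
  note rep = is_replica_of_multiple[OF \<delta> _ _ in012(1) not_killed[OF in012(1)]]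
  have div': "ex 0 dvd l (p i) j" if "i \<in> {0,1}" "j \<in> {1..n (p i)}" for i j using div that by blast
  show ?thesis
  proof (cases "ex 2 = 1")
    case True
    obtain lam where lam: "lam \<noteq> 0" "\<exists>h. \<forall>v\<in>V. a v \<asymp> h * avec_b lam v"
    proof -
      have "\<exists>lam. lam \<noteq> 0 \<and> (\<exists>h. \<forall>v\<in>V. a v \<asymp> h * avec_b lam v)"
        by (rule case_b[OF True]) (rule div')
      then show thesis using that by blast
    qed
    have "is_replica n l d \<delta> (induced_der n l d (avec_b lam))" by (rule rep[OF chart_der_b lam(2)])
    then have "is_replica n l d \<delta> (der_b n l d p c lam)" by (simp only: der_b_eq avec_b_def)
    moreover have "cond_b n l p c" using True div unfolding cond_b_def ex_def by blast
    ultimately show ?thesis using lam(1) by blast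
  next
    case False
    then have ex: "ex 0 = 2" "ex 1 = 2" "ex 2 \<ge> 2" using num by blast+
    have even: "2 dvd l (p i) j" if "i \<in> {0,1}" "j \<in> {1..n (p i)}" for i j using div'[OF that] ex by simp
    have type_c: ?thesis if mu: "mu ^ 2 = -1" "\<exists>h. \<forall>v\<in>V. a v \<asymp> h * avec_c mu v" for mu
    proof -
      have "is_replica n l d \<delta> (induced_der n l d (avec_c mu))" by (rule rep[OF chart_der_c mu(2)])
      then have "is_replica n l d \<delta> (der_c n l d p c mu)" by (simp only: der_c_eq avec_c_def)
      moreover have "cond_c n l p c" using ex even unfolding cond_c_def ex_def by blast
      ultimately show ?thesis using im_squared_cases[OF mu(1)] by blast
    qed
    show ?thesis
    proof (cases "\<exists>j\<in>{1..n (p 2)}. odd (l (p 2) j)")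
      case True
      have "\<exists>mu. mu ^ 2 = -1 \<and> (\<exists>h. \<forall>v\<in>V. a v \<asymp> h * avec_c mu v)"
        by (rule case_c_odd[OF ex _ True]) (rule even)
      then obtain mu where "mu ^ 2 = -1" "\<exists>h. \<forall>v\<in>V. a v \<asymp> h * avec_c mu v" by metis
      then show ?thesis by (rule type_c)
    next
      case False
      then have even2: "2 dvd l (p i) j" if i: "i \<in> {0,1,2}" and j: "j \<in> {1..n (p i)}" for i j
      proof (cases "i = 2")
        case True then show ?thesis using j \<open>\<not> (\<exists>j\<in>{1..n (p 2)}. odd (l (p 2) j))\<close> by blast
      next
        case False then show ?thesis using i j even by blast
      qed
      have "(\<exists>mu. mu ^ 2 = -1 \<and> (\<exists>h. \<forall>v\<in>V. a v \<asymp> h * avec_c mu v)) \<or>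
          ex 2 = 2 \<and> (\<exists>lam. lam \<noteq> 0 \<and> (\<exists>h. \<forall>v\<in>V. a v \<asymp> h * avec_d lam v))"
        by (rule case_even[OF ex(1,2)]) (rule even2)
      then show ?thesis
      proof
        assume "\<exists>mu. mu ^ 2 = -1 \<and> (\<exists>h. \<forall>v\<in>V. a v \<asymp> h * avec_c mu v)"
        then obtain mu where "mu ^ 2 = -1" "\<exists>h. \<forall>v\<in>V. a v \<asymp> h * avec_c mu v" by metis
        then show ?thesis by (rule type_c)
      next
        assume "ex 2 = 2 \<and> (\<exists>lam. lam \<noteq> 0 \<and> (\<exists>h. \<forall>v\<in>V. a v \<asymp> h * avec_d lam v))"
        then obtain lam where 2: "ex 2 = 2" "lam \<noteq> 0" "\<exists>h. \<forall>v\<in>V. a v \<asymp> h * avec_d lam v" by metis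
        have "is_replica n l d \<delta> (induced_der n l d (avec_d lam))" by (rule rep[OF _ 2(3)], rule chart_der_d, rule even2)
        then have "is_replica n l d \<delta> (der_d n l d p c im lam)" by (simp only: der_d_eq avec_d_eq)
        moreover have "cond_d n l c"
          unfolding cond_d_def
        proof (intro conjI ballI)
          fix i :: nat assume "i \<in> {0,1,2}"
          then obtain i' where i': "i = p i'" "i' \<in> {0,1,2}" using p_image by blast
          have "ex i' = 2" using i'(2) ex(1,2) 2(1) by auto
          then show "l i (c i) = 2" unfolding i'(1) ex_def .
          fix j assume "j \<in> {1..n i}"
          then show "even (l i j)" unfolding i'(1) by (rule even2[OF i'(2)])
        qed
        ultimately show ?thesis using 2(2) by blast
      qed
    qed
  qed
qed

end

context trinomial
begin

text \<open>Either some \<open>S_k\<close> moves and nothing else does, or one variable per block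
  may move. In the second case the blocks are reordered so that the exponent 1, if there is one,
  stands in the last place.\<close>

lemma classification:
  assumes lnd: "is_LND n l d \<delta>" and hom: "T_homogeneous n l d \<delta>" and nz: "x \<in> carrier R" "\<delta> x \<noteq> \<zero>\<^bsub>R\<^esub>"
  shows "(\<exists>k\<in>{1..d}. is_replica n l d \<delta> (der_S n l d k)) \<or>
        (\<exists>p c. p permutes {0,1,2} \<and> (\<forall>i\<in>{0,1,2}. c i \<in> {1..n i}) \<and>
          (cond_a l p c \<and> is_replica n l d \<delta> (der_a n l d p c) \<or>
           (\<exists>lam. cond_b n l p c \<and> lam \<noteq> 0 \<and> is_replica n l d \<delta> (der_b n l d p c lam)) \<or>
           (\<exists>mu. cond_c n l p c \<and> mu \<in> {im, - im} \<and> is_replica n l d \<delta> (der_c n l d p c mu)) \<or>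
           (\<exists>lam. cond_d n l c \<and> lam \<noteq> 0 \<and> is_replica n l d \<delta> (der_d n l d p c im lam))))"
proof -
  have der: "is_derivation n l d \<delta>" using lnd unfolding is_LND_def by blast
  obtain a0 where a0: "tri_der n l d im a0" "\<And>f. f \<in> Car \<Longrightarrow> \<delta> (cl f) = cl (poly_der n d a0 f)"
    using derivation_lift[OF der] by metis
  obtain a \<epsilon> where a: "tri_der n l d im a" "\<And>f. f \<in> Car \<Longrightarrow> \<delta> (cl f) = cl (poly_der n d a f)"
    "\<And>A w v. cochar A w \<Longrightarrow> v \<in> V \<Longrightarrow> homog A (A v + \<epsilon> A) (a v)"
    "\<And>v. v \<in> V \<Longrightarrow> a v \<asymp> 0 \<Longrightarrow> a v = 0"
    using homogeneous_lift[OF a0 hom] by metis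
  interpret A: tri_der n l d im a by (rule a(1))
  have nilp: "\<exists>k. (poly_der n d a ^^ k) f \<asymp> 0" for f
    using A.is_LND_iff[OF a(2) der] lnd by blast
  have \<delta>: "\<forall>f\<in>Car. \<delta> (cl f) = cl (poly_der n d a f)" using a(2) by blast
  interpret L: homog_lnd n l d im a \<epsilon>
    by unfold_locales (rule nilp a(3) a(4); assumption?)+
  have ex_nz: "\<exists>v\<in>V. a v \<noteq> 0"
  proof (rule ccontr)
    assume "\<not> ?thesis"
    then have "poly_der n d a f = 0" for f unfolding poly_der_def by (intro sum.neutral) simp
    then show False using nz a(2) by (auto elim!: R_cases simp: zero_R)
  qed
  show ?thesis
  proof (cases "\<exists>k. SVar k \<in> V \<and> a (SVar k) \<noteq> 0")
    case True
    then obtain k where k: "SVar k \<in> V" "a (SVar k) \<noteq> 0" by blast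
    have "is_replica n l d \<delta> (der_S n l d k)"
      unfolding der_S_def
    proof (rule is_replica_if_multiple)
      show "tri_der n l d im a" by (rule a(1))
      show "tri_der n l d im ((\<lambda>_. 0)(SVar k := 1))" by (rule tri_der_S)
      show "\<exists>k. (poly_der n d a ^^ k) f \<asymp> 0" for f by (rule nilp)
      show "\<delta> (cl f) = cl (poly_der n d a f)" if "f \<in> Car" for f by (rule a(2)[OF that])
      show "a v \<asymp> a (SVar k) * ((\<lambda>_. 0)(SVar k := 1)) v" if "v \<in> V" for v
        using L.S_case[OF k that] by (cases "v = SVar k") simp_all
      show "SVar k \<in> V" by (rule k(1))
      show "\<not> a (SVar k) \<asymp> 0" using a(4)[OF k(1)] k(2) by blast
    qed
    moreover have "k \<in> {1..d}" using k(1) SVar_in_V by blast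
    ultimately show ?thesis by blast
  next
    case False
    obtain c where c: "\<forall>i\<in>{0,1,2}. c i \<in> {1..n i}" "\<forall>i\<in>{0,1,2}. \<forall>j\<in>{1..n i}. j \<noteq> c i \<longrightarrow> a (TVar i j) = 0"
      using L.exists_tuple by blast
    have others: "a v = 0" if v: "v \<in> V" "\<And>i. i \<in> {0,1,2} \<Longrightarrow> v \<noteq> TVar i (c i)" for v
    proof (cases v)
      case (TVar i j)
      then have "i \<in> {0,1,2}" "j \<in> {1..n i}" using v(1) TVar_in_V by blast+
      then show ?thesis using c(2) v(2)[of i] TVar by blast
    next
      case (SVar k)
      then show ?thesis using False v(1) by blast
    qed
    have hl: "hl n l d im q c a \<epsilon>" if "q permutes {0,1,2}" for q
      by unfold_locales (use that c(1) others in blast)+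
    define z where "z i = a (TVar i (c i))" for i
    have fin: ?thesis if "q permutes {0,1,2}" "cond_a l q c \<and> is_replica n l d \<delta> (der_a n l d q c) \<or>
           (\<exists>lam. cond_b n l q c \<and> lam \<noteq> 0 \<and> is_replica n l d \<delta> (der_b n l d q c lam)) \<or>
           (\<exists>mu. cond_c n l q c \<and> mu \<in> {im, - im} \<and> is_replica n l d \<delta> (der_c n l d q c mu)) \<or>
           (\<exists>lam. cond_d n l c \<and> lam \<noteq> 0 \<and> is_replica n l d \<delta> (der_d n l d q c im lam))" for q
      by (intro disjI2 exI[of _ q] exI[of _ c] conjI that c(1))
    have type_a: ?thesis
      if ikm: "i \<in> {0,1,2}" "k \<in> {0,1,2}" "m \<in> {0,1,2}" "i \<noteq> k" "i \<noteq> m" "k \<noteq> m" and "z k = 0" "z i \<noteq> 0" "l m (c m) = 1" for i k m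
    proof -
      obtain q where q: "q permutes {0,1,2}" "q 0 = i" "q (Suc 0) = k" "q 2 = m"
        using exists_permutation[OF ikm] by blast
      interpret H: hl n l d im q c a \<epsilon> by (rule hl[OF q(1)])
      have "a (H.xv 1) = 0" "a (H.xv 0) \<noteq> 0" "H.ex 2 = 1"
        using that(7-9) q(2-4) by (simp_all add: H.xv_def H.ex_def z_def)
      from H.type_a_replica[OF \<delta> this] show ?thesis by (intro fin[OF q(1)] disjI1)
    qed
    have two: ?thesis
      if ikm: "i \<in> {0,1,2}" "k \<in> {0,1,2}" "m \<in> {0,1,2}" "i \<noteq> k" "i \<noteq> m" "k \<noteq> m" and zs: "z k = 0" "z i \<noteq> 0" for i k m
    proof -
      \<comment> \<open>A derivation moving a single selected variable would contradict the
        derivative of the trinomial, so exactly two are moved.\<close>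
      have zm: "z m \<noteq> 0"
      proof
        assume "z m = 0"
        obtain q where q: "q permutes {0,1,2}" "q 0 = k" "q (Suc 0) = m" "q 2 = i"
          using exists_permutation[OF ikm(2,3,1) ikm(6) ikm(4)[symmetric] ikm(5)[symmetric]] by blast
        interpret H: hl n l d im q c a \<epsilon> by (rule hl[OF q(1)])
        have "a (H.xv 0) = 0" "a (H.xv 1) = 0" using \<open>z m = 0\<close> zs(1) q(2-3) by (simp_all add: H.xv_def z_def)
        then have "a (H.xv 2) = 0" by (rule H.two_not_killed)
        then show False using zs(2) q(4) by (simp add: H.xv_def z_def)
      qed
      obtain q where q: "q permutes {0,1,2}" "q 0 = i" "q (Suc 0) = k" "q 2 = m"
        using exists_permutation[OF ikm] by blast
      interpret H: hl n l d im q c a \<epsilon> by (rule hl[OF q(1)])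
      have "a (H.xv 1) = 0" "a (H.xv 0) \<noteq> 0" "a (H.xv 2) \<noteq> 0"
        using zs zm q(2-4) by (simp_all add: H.xv_def z_def)
      then have "H.ex 0 = 1 \<or> H.ex 2 = 1" by (rule H.type_a_exponents)
      then consider "l i (c i) = 1" | "l m (c m) = 1" using q(2,4) by (auto simp: H.ex_def)
      then show ?thesis
      proof cases
        case 1
        then show ?thesis using type_a[OF ikm(3,2,1) ikm(6)[symmetric] ikm(5)[symmetric] ikm(4)[symmetric] zs(1) zm] by blast
      next
        case 2
        then show ?thesis using type_a[OF ikm zs] by blast
      qed
    qed
    obtain v where v: "v \<in> V" "a v \<noteq> 0" using ex_nz by blast
    then obtain i where i: "i \<in> {0,1,2}" "z i \<noteq> 0" using others[OF v(1)] unfolding z_def by blast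
    show ?thesis
    proof (cases "\<exists>k\<in>{0,1,2}. z k = 0")
      case True
      then obtain k where k: "k \<in> {0,1,2}" "z k = 0" by blast
      have "\<exists>m\<in>{0,1,2}. m \<noteq> i \<and> m \<noteq> k"
        using i(1) k(1) by (elim insertE emptyE) simp_all
      then obtain m where m: "m \<in> {0,1,2}" "m \<noteq> i" "m \<noteq> k" by blast
      have ik: "i \<noteq> k" using i(2) k(2) by blast
      show ?thesis by (rule two[OF i(1) k(1) m(1) ik m(2)[symmetric] m(3)[symmetric] k(2) i(2)])
    next
      case False
      then have znz: "z k \<noteq> 0" if "k \<in> {0,1,2}" for k using that by blast
      \<comment> \<open>The identity chart only serves to find the roles of the blocks; a second
        chart then puts the blocks into these roles.\<close>
      interpret H: hl n l d im id c a \<epsilon> by (rule hl[OF permutes_id])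
      have "a (H.xv k) \<noteq> 0" if "k \<in> {0,1,2}" for k using znz[OF that] by (simp add: H.xv_def z_def)
      from H.exponents[OF this] obtain i k m where ikm: "i \<in> {0,1,2}" "k \<in> {0,1,2}" "m \<in> {0,1,2}" "i \<noteq> k" "i \<noteq> m" "k \<noteq> m"
        and E: "\<forall>j\<in>{1..n (id i)}. H.ex i dvd l (id i) j" "\<forall>j\<in>{1..n (id k)}. H.ex i dvd l (id k) j"
        "H.ex m = 1 \<or> H.ex i = 2 \<and> H.ex k = 2 \<and> H.ex m \<ge> 2" by metis
      obtain q where q: "q permutes {0,1,2}" "q 0 = i" "q (Suc 0) = k" "q 2 = m"
        using exists_permutation[OF ikm] by blast
      interpret Q: hl n l d im q c a \<epsilon> by (rule hl[OF q(1)])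
      interpret Q: hl3 n l d im q c a \<epsilon>
      proof unfold_locales
        fix k :: nat assume "k \<in> {0,1,2}"
        then show "a (Q.xv k) \<noteq> 0" using znz[OF Q.p_in] by (simp add: Q.xv_def z_def)
      qed
      have exs: "Q.ex 0 = H.ex i" "Q.ex 1 = H.ex k" "Q.ex 2 = H.ex m" using q(2-4) by (simp_all add: Q.ex_def H.ex_def)
      have "\<forall>i\<in>{0,1}. \<forall>j\<in>{1..n (q i)}. Q.ex 0 dvd l (q i) j"
        unfolding exs using E(1,2) q(2,3) by simp
      moreover have "Q.ex 2 = 1 \<or> Q.ex 0 = 2 \<and> Q.ex 1 = 2 \<and> Q.ex 2 \<ge> 2" unfolding exs by (rule E(3))
      ultimately show ?thesis by (intro fin[OF q(1)] disjI2[OF Q.three_replica[OF \<delta>]])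
    qed
  qed
qed

end

text \<open>The zero derivation is set aside because there may be no derivation of any listed type
  of which it could be a replica. In type (b) with exponent 1 and \<open>lam = -1\<close> the
  derivation also kills the selected variable of block \<open>p 2\<close>, which for
  \<open>n (p 2) \<ge> 2\<close> is not in the algebra on the right-hand side. The
  \<open>S_k\<close> are among the generators in \<open>ker_alg\<close>.\<close>

theorem theorem4p4:
  fixes n :: "nat \<Rightarrow> nat" and l :: "nat \<Rightarrow> nat \<Rightarrow> nat" and d :: nat
    and im :: "'k::{alg_closed_field, field_char_0}"
  assumes n_pos: "\<forall>i\<in>{0,1,2}. n i \<ge> 1"
    and l_pos: "\<forall>i\<in>{0,1,2}. \<forall>j\<in>{1..n i}. l i j \<ge> 1"
    and im: "im ^ 2 = -1"
  shows
    "(\<forall>\<delta> :: 'k mpol set \<Rightarrow> 'k mpol set.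
        is_LND n l d \<delta> \<and> T_homogeneous n l d \<delta> \<and>
        (\<exists>x\<in>carrier (tri_alg n l d). \<delta> x \<noteq> \<zero>\<^bsub>tri_alg n l d\<^esub>) \<longrightarrow>
        (\<exists>k\<in>{1..d}. is_replica n l d \<delta> (der_S n l d k)) \<or>
        (\<exists>p c. p permutes {0,1,2} \<and> (\<forall>i\<in>{0,1,2}. c i \<in> {1..n i}) \<and>
          (cond_a l p c \<and> is_replica n l d \<delta> (der_a n l d p c) \<or>
           (\<exists>lam. cond_b n l p c \<and> lam \<noteq> 0 \<and> is_replica n l d \<delta> (der_b n l d p c lam)) \<or>
           (\<exists>mu. cond_c n l p c \<and> mu \<in> {im, - im} \<and> is_replica n l d \<delta> (der_c n l d p c mu)) \<or>
           (\<exists>lam. cond_d n l c \<and> lam \<noteq> 0 \<and> is_replica n l d \<delta> (der_d n l d p c im lam)))))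
     \<and>
     (\<forall>p c. p permutes {0,1,2} \<and> (\<forall>i\<in>{0,1,2}. c i \<in> {1..n i}) \<longrightarrow>
        (cond_a l p c \<longrightarrow>
           der_ker n l d (der_a n l d p c :: 'k mpol set \<Rightarrow> 'k mpol set) =
           ker_alg n l d c (Var (TVar (p 1) (c (p 1))))) \<and>
        (\<forall>lam::'k. cond_b n l p c \<and> lam \<noteq> 0 \<and>
             \<not> (l (p 0) (c (p 0)) = 1 \<and> lam = -1 \<and> n (p 2) \<ge> 2) \<longrightarrow>
           der_ker n l d (der_b n l d p c lam) =
           ker_alg n l d c (Const lam * tri_mon n l (p 0) (l (p 0) (c (p 0)))
                            - tri_mon n l (p 1) (l (p 0) (c (p 0))))) \<and>
        (\<forall>mu::'k. cond_c n l p c \<and> mu \<in> {im, - im} \<longrightarrow>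
           der_ker n l d (der_c n l d p c mu) =
           ker_alg n l d c (Const mu * tri_mon n l (p 0) 2 + tri_mon n l (p 1) 2)) \<and>
        (\<forall>lam::'k. cond_d n l c \<and> lam \<noteq> 0 \<longrightarrow>
           der_ker n l d (der_d n l d p c im lam) =
           ker_alg n l d c (Const (1 - lam^2) * tri_mon n l (p 0) 2
                            - Const ((1 + lam^2) * im) * tri_mon n l (p 1) 2
                            + Const (2 * lam) * tri_mon n l (p 2) 2)))"
proof -
  interpret trinomial n l d im
    by unfold_locales (use n_pos l_pos im in blast)+
  have chart: "chart n l im p c" if "p permutes {0,1,2} \<and> (\<forall>i\<in>{0,1,2}. c i \<in> {1..n i})" for p c
    by unfold_locales (use that in blast)+
  show ?thesis
  proof (intro conjI allI impI)
    fix \<delta> :: "'k mpol set \<Rightarrow> 'k mpol set"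
    assume "is_LND n l d \<delta> \<and> T_homogeneous n l d \<delta> \<and> (\<exists>x\<in>carrier (tri_alg n l d). \<delta> x \<noteq> \<zero>\<^bsub>tri_alg n l d\<^esub>)"
    then show "(\<exists>k\<in>{1..d}. is_replica n l d \<delta> (der_S n l d k)) \<or>
        (\<exists>p c. p permutes {0,1,2} \<and> (\<forall>i\<in>{0,1,2}. c i \<in> {1..n i}) \<and>
          (cond_a l p c \<and> is_replica n l d \<delta> (der_a n l d p c) \<or>
           (\<exists>lam. cond_b n l p c \<and> lam \<noteq> 0 \<and> is_replica n l d \<delta> (der_b n l d p c lam)) \<or>
           (\<exists>mu. cond_c n l p c \<and> mu \<in> {im, - im} \<and> is_replica n l d \<delta> (der_c n l d p c mu)) \<or>
           (\<exists>lam. cond_d n l c \<and> lam \<noteq> 0 \<and> is_replica n l d \<delta> (der_d n l d p c im lam))))"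
      using classification by (elim conjE bexE)
  next
    fix p c :: "nat \<Rightarrow> nat"
    assume pc: "p permutes {0,1,2} \<and> (\<forall>i\<in>{0,1,2}. c i \<in> {1..n i})"
    interpret C: chart n l d im p c by (rule chart[OF pc])
    show "der_ker n l d (der_a n l d p c :: 'k mpol set \<Rightarrow> 'k mpol set) =
        ker_alg n l d c (Var (TVar (p 1) (c (p 1))))" if "cond_a l p c"
      by (rule C.der_ker_a[OF that])
    show "der_ker n l d (der_b n l d p c lam) =
        ker_alg n l d c (Const lam * tri_mon n l (p 0) (l (p 0) (c (p 0))) - tri_mon n l (p 1) (l (p 0) (c (p 0))))"
      if "cond_b n l p c \<and> lam \<noteq> 0 \<and> \<not> (l (p 0) (c (p 0)) = 1 \<and> lam = -1 \<and> n (p 2) \<ge> 2)" for lam :: 'k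
      using that by (intro C.der_ker_b) blast+
    show "der_ker n l d (der_c n l d p c mu) = ker_alg n l d c (Const mu * tri_mon n l (p 0) 2 + tri_mon n l (p 1) 2)"
      if "cond_c n l p c \<and> mu \<in> {im, - im}" for mu :: 'k
      using that by (intro C.der_ker_c) blast+
    show "der_ker n l d (der_d n l d p c im lam) =
        ker_alg n l d c (Const (1 - lam^2) * tri_mon n l (p 0) 2 - Const ((1 + lam^2) * im) * tri_mon n l (p 1) 2
          + Const (2 * lam) * tri_mon n l (p 2) 2)"
      if "cond_d n l c \<and> lam \<noteq> 0" for lam :: 'k
      using that by (intro C.der_ker_d) blast+
  qed
qed

end
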